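(* For each $\beta\in[0,\infty)$, the map that sends a $\mathrm{KMS}_\beta$ state $\psi$ of $(\mathcal T(\mathbb N^\times\ltimes\mathbb Z),\sigma)$ to the measure $\nu_\psi$ on $\mathbb T$ representing the restriction of $\psi$ to $C^*(U)$, i.e. $\int_{\mathbb T}f\,d\nu_\psi=\psi(f(U))$ for $f\in C(\mathbb T)$, is an affine homeomorphism of the simplex of $\mathrm{KMS}_\beta$ states of $(\mathcal T(\mathbb N^\times\ltimes\mathbb Z),\sigma)$ onto the $\beta$-subconformal probability measures $\nu$ on $\mathbb T$. The inverse map $\nu\mapsto\psi_{\beta,\nu}$ is given by $$\psi_{\beta,\nu}(V_b\,f(U)\,V_c^* )=\delta_{b,c}\,b^{-\beta}\int_{\mathbb T}f\,d\nu,\qquad b,c\in\mathbb N^\times,\ f\in C(\mathbb T).$$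
   Context: $\mathbb N^\times$ is the multiplicative monoid of positive integers. $\mathbb N^\times\ltimes\mathbb Z$ is the monoid with operation $(a,m)(b,n)=(ab,bm+n)$ on $\mathbb N^\times\times\mathbb Z$. $\mathcal T(\mathbb N^\times\ltimes\mathbb Z)$ is the C*-algebra on $\ell^2(\mathbb N^\times\ltimes\mathbb Z)$ generated by $T_{(a,m)}\varepsilon_{(b,n)}=\varepsilon_{(ab,bm+n)}$; $U=T_{(1,1)}$ (a unitary with $C^*(U)\cong C(\mathbb T)$ via functional calculus) and $V_a=T_{(a,0)}$ (isometries). The elements $V_aU^kV_b^*$ have dense linear span, and $\sigma$ is the dynamics $\sigma_t(V_aU^kV_b^* )=(a/b)^{it}V_aU^kV_b^*$. A state $\phi$ is $\mathrm{KMS}_\beta$ if $\phi(xy)=\phi(y\sigma_{i\beta}(x))$ for all $\sigma$-analytic $x$ and all $y$; for $\beta=0$ one also requires $\sigma$-invariance. States and measures carry the weak* topology. A measure $\nu$ on $\mathbb T$ is $\beta$-subconformal if $\sum_{d\mid n}\mu(d)d^{-\beta}\int_{\mathbb T}f(z^d)\,d\nu(z)\ge0$ for all $f\in C(\mathbb T)_+$ and all $n\in\mathbb N^\times$, where $\mu$ is the Möbius function. *)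

theory Defs
  imports
    "HOL-Probability.Probability"
    "HOL-Computational_Algebra.Squarefree"
    "HOL-Algebra.Lattice"
begin

section \<open>The Hilbert space of square-summable functions\<close>

typedef 'a ell2 = "{f :: 'a \<Rightarrow> complex. (\<lambda>x. (cmod (f x))\<^sup>2) summable_on UNIV}"
  by (rule exI[of _ "\<lambda>_. 0"]) simp

setup_lifting type_definition_ell2

lemma square_summable_product:
  fixes f g :: "'a \<Rightarrow> complex"
  assumes "(\<lambda>x. (cmod (f x))\<^sup>2) summable_on A" "(\<lambda>x. (cmod (g x))\<^sup>2) summable_on A"
  shows "(\<lambda>x. f x * cnj (g x)) summable_on A"
proof -
  have "(\<lambda>x. norm (f x * cnj (g x))) summable_on A"
  proof (rule abs_summable_product)
    show "(\<lambda>x. norm (f x * f x)) summable_on A"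
      using assms(1) by (simp add: norm_mult power2_eq_square)
    show "(\<lambda>x. norm (cnj (g x) * cnj (g x))) summable_on A"
      using assms(2) by (simp add: norm_mult power2_eq_square)
  qed
  then show ?thesis by (rule abs_summable_summable)
qed

lemma square_summable_add:
  fixes f g :: "'a \<Rightarrow> complex"
  assumes "(\<lambda>x. (cmod (f x))\<^sup>2) summable_on A" "(\<lambda>x. (cmod (g x))\<^sup>2) summable_on A"
  shows "(\<lambda>x. (cmod (f x + g x))\<^sup>2) summable_on A"
proof (rule summable_on_comparison_test)
  show "(\<lambda>x. 2 * (cmod (f x))\<^sup>2 + 2 * (cmod (g x))\<^sup>2) summable_on A"
    using assms by (intro summable_on_add summable_on_cmult_right)
  fix x
  have "(cmod (f x + g x))\<^sup>2 \<le> (cmod (f x) + cmod (g x))\<^sup>2"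
    by (rule power_mono[OF norm_triangle_ineq]) simp
  also have "\<dots> \<le> 2 * (cmod (f x))\<^sup>2 + 2 * (cmod (g x))\<^sup>2"
    using sum_squares_bound[of "cmod (f x)" "cmod (g x)"] by (simp add: power2_sum)
  finally show "(cmod (f x + g x))\<^sup>2 \<le> 2 * (cmod (f x))\<^sup>2 + 2 * (cmod (g x))\<^sup>2" .
qed simp

lemma square_summable_mult:
  fixes f :: "'a \<Rightarrow> complex"
  assumes "(\<lambda>x. (cmod (f x))\<^sup>2) summable_on A"
  shows "(\<lambda>x. (cmod (c * f x))\<^sup>2) summable_on A"
  using summable_on_cmult_right[OF assms, of "(cmod c)\<^sup>2"] by (simp add: norm_mult power_mult_distrib)

lift_definition cscale :: "complex \<Rightarrow> 'a ell2 \<Rightarrow> 'a ell2" is "\<lambda>c f x. c * f x"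
  by (simp add: square_summable_mult)

text \<open>The complex inner product, linear in the first variable.\<close>

lift_definition cinner :: "'a ell2 \<Rightarrow> 'a ell2 \<Rightarrow> complex"
  is "\<lambda>f g. \<Sum>\<^sub>\<infinity>x. f x * cnj (g x)" .

lemma cinner_self: "cinner \<xi> \<xi> = of_real (\<Sum>\<^sub>\<infinity>t. (cmod (Rep_ell2 \<xi> t))\<^sup>2)"
proof -
  have "(\<lambda>t. (cmod (Rep_ell2 \<xi> t))\<^sup>2) summable_on UNIV" using Rep_ell2[of \<xi>] by simp
  then have "((\<lambda>t. complex_of_real ((cmod (Rep_ell2 \<xi> t))\<^sup>2)) has_sum
      of_real (\<Sum>\<^sub>\<infinity>t. (cmod (Rep_ell2 \<xi> t))\<^sup>2)) UNIV"
    by (intro has_sum_of_real has_sum_infsum)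
  then show ?thesis
    by (simp only: cinner.rep_eq complex_norm_square infsumI)
qed

instantiation ell2 :: (type) real_inner
begin

lift_definition zero_ell2 :: "'a ell2" is "\<lambda>_. 0" by simp
lift_definition plus_ell2 :: "'a ell2 \<Rightarrow> 'a ell2 \<Rightarrow> 'a ell2" is "\<lambda>f g x. f x + g x"
  by (simp add: square_summable_add)
lift_definition uminus_ell2 :: "'a ell2 \<Rightarrow> 'a ell2" is "\<lambda>f x. - f x" by simp
lift_definition minus_ell2 :: "'a ell2 \<Rightarrow> 'a ell2 \<Rightarrow> 'a ell2" is "\<lambda>f g x. f x - g x"
  subgoal for f g
    using square_summable_add[of f UNIV "\<lambda>x. - g x"] by simp
  done
lift_definition scaleR_ell2 :: "real \<Rightarrow> 'a ell2 \<Rightarrow> 'a ell2" is "\<lambda>r f x. complex_of_real r * f x"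
  by (simp only: mem_Collect_eq square_summable_mult)
definition inner_ell2 :: "'a ell2 \<Rightarrow> 'a ell2 \<Rightarrow> real" where
  "inner_ell2 \<xi> \<eta> = Re (cinner \<xi> \<eta>)"
definition norm_ell2 :: "'a ell2 \<Rightarrow> real" where
  "norm_ell2 \<xi> = sqrt (inner \<xi> \<xi>)"
definition sgn_ell2 :: "'a ell2 \<Rightarrow> 'a ell2" where
  "sgn_ell2 \<xi> = scaleR (inverse (norm \<xi>)) \<xi>"
definition dist_ell2 :: "'a ell2 \<Rightarrow> 'a ell2 \<Rightarrow> real" where
  "dist_ell2 \<xi> \<eta> = norm (\<xi> - \<eta>)"
definition uniformity_ell2 :: "('a ell2 \<times> 'a ell2) filter" where
  "uniformity_ell2 = (INF e\<in>{0<..}. principal {(\<xi>, \<eta>). dist \<xi> \<eta> < e})"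
definition open_ell2 :: "'a ell2 set \<Rightarrow> bool" where
  "open_ell2 S = (\<forall>\<xi>\<in>S. \<forall>\<^sub>F (\<xi>', \<eta>) in uniformity. \<xi>' = \<xi> \<longrightarrow> \<eta> \<in> S)"

instance
proof
  fix x y z :: "'a ell2" and r s :: real
  show "x + y + z = x + (y + z)" by transfer (simp add: add.assoc)
  show "x + y = y + x" by transfer (simp add: add.commute)
  show "0 + x = x" by transfer simp
  show "- x + x = 0" by transfer simp
  show "x - y = x + - y" by transfer simp
  show "r *\<^sub>R (x + y) = r *\<^sub>R x + r *\<^sub>R y" by transfer (simp add: algebra_simps)
  show "(r + s) *\<^sub>R x = r *\<^sub>R x + s *\<^sub>R x" by transfer (simp add: algebra_simps)
  show "r *\<^sub>R s *\<^sub>R x = (r * s) *\<^sub>R x" by transfer (simp add: algebra_simps)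
  show "1 *\<^sub>R x = x" by transfer simp
  show "sgn x = inverse (norm x) *\<^sub>R x" by (rule sgn_ell2_def)
  show "dist x y = norm (x - y)" by (rule dist_ell2_def)
  show "norm x = sqrt (inner x x)" by (rule norm_ell2_def)
  show "uniformity = (INF e\<in>{0<..}. principal {(\<xi>, \<eta>). dist (\<xi> :: 'a ell2) \<eta> < e})"
    by (rule uniformity_ell2_def)
  show "open U = (\<forall>\<xi>\<in>U. \<forall>\<^sub>F (\<xi>', \<eta>) in uniformity. \<xi>' = \<xi> \<longrightarrow> \<eta> \<in> U)" for U :: "'a ell2 set"
    by (rule open_ell2_def)
  have "cinner y x = cnj (cinner x y)"
    by (simp only: cinner.rep_eq infsum_cnj[symmetric] complex_cnj_mult complex_cnj_cnj mult.commute)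
  then show "inner x y = inner y x" by (simp add: inner_ell2_def)
  have "cinner (x + y) z = cinner x z + cinner y z"
    by transfer (simp add: distrib_right infsum_add square_summable_product)
  then show "inner (x + y) z = inner x z + inner y z" by (simp add: inner_ell2_def)
  have "cinner (r *\<^sub>R x) y = of_real r * cinner x y"
    by transfer (simp add: mult.assoc infsum_cmult_right square_summable_product)
  then show "inner (r *\<^sub>R x) y = r * inner x y" by (simp add: inner_ell2_def)
  have eq: "cinner x x = of_real (\<Sum>\<^sub>\<infinity>t. (cmod (Rep_ell2 x t))\<^sup>2)"
    by (rule cinner_self)
  then show "0 \<le> inner x x" by (simp add: inner_ell2_def infsum_nonneg)
  show "inner x x = 0 \<longleftrightarrow> x = 0"
  proof
    assume "inner x x = 0"
    then have 0: "(\<Sum>\<^sub>\<infinity>t. (cmod (Rep_ell2 x t))\<^sup>2) = 0" by (simp add: inner_ell2_def eq)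
    have "(\<lambda>t. (cmod (Rep_ell2 x t))\<^sup>2) summable_on UNIV" using Rep_ell2[of x] by simp
    then have "(cmod (Rep_ell2 x t))\<^sup>2 = 0" for t
      using nonneg_infsum_le_0D[of "\<lambda>t. (cmod (Rep_ell2 x t))\<^sup>2" UNIV t] 0 by simp
    then have "Rep_ell2 x = (\<lambda>_. 0)" by auto
    then show "x = 0" by (simp add: zero_ell2.rep_eq Rep_ell2_inject[symmetric])
  next
    assume "x = 0"
    then show "inner x x = 0" by (simp add: inner_ell2_def cinner.rep_eq zero_ell2.rep_eq)
  qed
qed

end

lemma norm_ell2_square: "(norm \<xi>)\<^sup>2 = (\<Sum>\<^sub>\<infinity>t. (cmod (Rep_ell2 \<xi> t))\<^sup>2)"
  by (simp add: power2_norm_eq_inner inner_ell2_def cinner_self)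

lift_definition basis_vec :: "'a \<Rightarrow> 'a ell2" is "\<lambda>s t. if t = s then 1 else 0"
  subgoal for s
  proof -
    have "(\<lambda>t. (cmod (if t = s then 1 else 0))\<^sup>2) summable_on {s}" by simp
    then have "(\<lambda>t. (cmod (if t = s then 1 else 0))\<^sup>2) summable_on UNIV"
      by (rule summable_on_cong_neutral[THEN iffD1, rotated -1]) auto
    then show ?thesis by simp
  qed
  done

section \<open>Operators, C*-algebras and states\<close>

text \<open>Operators are elements of the library type of bounded real-linear maps, with composition
  \<open>o\<^sub>L\<close> and the operator norm. An operator having an adjoint for the complex inner product is
  automatically complex-linear.\<close>

lift_definition cmult :: "complex \<Rightarrow> 'a ell2 \<Rightarrow>\<^sub>L 'a ell2" is cscale
proof (rule bounded_linear_intro)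
  fix c r and x y :: "'a ell2"
  show "cscale c (x + y) = cscale c x + cscale c y" by transfer (simp add: distrib_left)
  show "cscale c (r *\<^sub>R x) = r *\<^sub>R cscale c x" by transfer (simp add: mult.left_commute)
  have "(norm (cscale c x))\<^sup>2 = (cmod c)\<^sup>2 * (norm x)\<^sup>2"
    unfolding norm_ell2_square
    by (simp add: cscale.rep_eq norm_mult power_mult_distrib infsum_cmult_right')
  then have "(norm (cscale c x))\<^sup>2 = (norm x * cmod c)\<^sup>2" by (simp add: power_mult_distrib)
  then show "norm (cscale c x) \<le> norm x * cmod c"
    by (simp add: power2_eq_iff_nonneg)
qed

definition adj :: "('a ell2 \<Rightarrow>\<^sub>L 'a ell2) \<Rightarrow> ('a ell2 \<Rightarrow>\<^sub>L 'a ell2)" where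
  "adj x = (THE y. \<forall>\<xi> \<eta>. cinner (blinfun_apply x \<xi>) \<eta> = cinner \<xi> (blinfun_apply y \<eta>))"

definition cstar_subalgebra :: "('a ell2 \<Rightarrow>\<^sub>L 'a ell2) set \<Rightarrow> bool" where
  "cstar_subalgebra A \<longleftrightarrow> closed A \<and> 0 \<in> A \<and>
     (\<forall>x\<in>A. \<forall>y\<in>A. x + y \<in> A \<and> x o\<^sub>L y \<in> A) \<and>
     (\<forall>x\<in>A. adj x \<in> A \<and> (\<forall>c. cmult c o\<^sub>L x \<in> A))"

text \<open>A state of \<open>A\<close> is represented by the function that agrees with it on \<open>A\<close> and vanishes
  outside \<open>A\<close>, so that equality of such functions is equality of states.\<close>

definition is_state :: "('a ell2 \<Rightarrow>\<^sub>L 'a ell2) set \<Rightarrow> (('a ell2 \<Rightarrow>\<^sub>L 'a ell2) \<Rightarrow> complex) \<Rightarrow> bool" where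
  "is_state A \<phi> \<longleftrightarrow>
     (\<forall>x. x \<notin> A \<longrightarrow> \<phi> x = 0) \<and>
     (\<forall>x\<in>A. \<forall>y\<in>A. \<phi> (x + y) = \<phi> x + \<phi> y) \<and>
     (\<forall>x\<in>A. \<forall>c. \<phi> (cmult c o\<^sub>L x) = c * \<phi> x) \<and>
     (\<forall>x\<in>A. \<phi> (adj x o\<^sub>L x) \<in> \<real>\<^sub>\<ge>\<^sub>0) \<and>
     \<phi> id_blinfun = 1"

text \<open>A *-automorphism of a C*-algebra is automatically isometric; the last clause is the
  isometry property.\<close>

definition star_automorphism ::
    "('a ell2 \<Rightarrow>\<^sub>L 'a ell2) set \<Rightarrow> (('a ell2 \<Rightarrow>\<^sub>L 'a ell2) \<Rightarrow> ('a ell2 \<Rightarrow>\<^sub>L 'a ell2)) \<Rightarrow> bool" where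
  "star_automorphism A \<alpha> \<longleftrightarrow> bij_betw \<alpha> A A \<and>
     (\<forall>x\<in>A. \<forall>y\<in>A. \<alpha> (x + y) = \<alpha> x + \<alpha> y \<and> \<alpha> (x o\<^sub>L y) = \<alpha> x o\<^sub>L \<alpha> y) \<and>
     (\<forall>x\<in>A. \<forall>c. \<alpha> (cmult c o\<^sub>L x) = cmult c o\<^sub>L \<alpha> x) \<and>
     (\<forall>x\<in>A. \<alpha> (adj x) = adj (\<alpha> x)) \<and>
     (\<forall>x\<in>A. norm (\<alpha> x) = norm x)"

abbreviation circle :: "complex set" where
  "circle \<equiv> sphere 0 1"

text \<open>Continuous functions on the circle are represented by functions on the complex plane, of
  which only the values on the circle matter.\<close>

definition circle_star_hom :: "((complex \<Rightarrow> complex) \<Rightarrow> ('a ell2 \<Rightarrow>\<^sub>L 'a ell2)) \<Rightarrow> bool" where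
  "circle_star_hom \<Phi> \<longleftrightarrow>
     (\<forall>f g. continuous_on circle f \<and> continuous_on circle g \<longrightarrow>
        \<Phi> (\<lambda>z. f z + g z) = \<Phi> f + \<Phi> g \<and>
        \<Phi> (\<lambda>z. f z * g z) = \<Phi> f o\<^sub>L \<Phi> g \<and>
        ((\<forall>z\<in>circle. f z = g z) \<longrightarrow> \<Phi> f = \<Phi> g)) \<and>
     (\<forall>f c. continuous_on circle f \<longrightarrow> \<Phi> (\<lambda>z. c * f z) = cmult c o\<^sub>L \<Phi> f) \<and>
     (\<forall>f \<xi> \<eta>. continuous_on circle f \<longrightarrow>
        cinner (\<Phi> f \<xi>) \<eta> = cinner \<xi> (\<Phi> (\<lambda>z. cnj (f z)) \<eta>)) \<and>
     \<Phi> (\<lambda>_. 1) = id_blinfun"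

text \<open>The continuous functional calculus \<open>f(u)\<close> of a unitary \<open>u\<close>: the value at \<open>f\<close> of the unique
  unital *-homomorphism on the continuous functions on the circle that sends the coordinate
  function to \<open>u\<close>.\<close>

definition fun_calc :: "('a ell2 \<Rightarrow>\<^sub>L 'a ell2) \<Rightarrow> (complex \<Rightarrow> complex) \<Rightarrow> ('a ell2 \<Rightarrow>\<^sub>L 'a ell2)" where
  "fun_calc u f = (THE x. \<exists>\<Phi>. circle_star_hom \<Phi> \<and> \<Phi> (\<lambda>z. z) = u \<and> x = \<Phi> f)"

section \<open>The Toeplitz algebra and its dynamics\<close>

typedef affine_monoid = "{(a :: nat, m :: int). 0 < a}"
  by (rule exI[of _ "(1, 0)"]) simp

setup_lifting type_definition_affine_monoid

instantiation affine_monoid :: monoid_mult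
begin

lift_definition one_affine_monoid :: affine_monoid is "(1, 0)" by simp
lift_definition times_affine_monoid :: "affine_monoid \<Rightarrow> affine_monoid \<Rightarrow> affine_monoid"
  is "\<lambda>(a, m) (b, n). (a * b, int b * m + n)" by auto

instance
  by standard (transfer; auto simp: algebra_simps)+

end

lemma affine_monoid_left_cancel:
  fixes s t u :: affine_monoid
  assumes "s * t = s * u"
  shows "t = u"
  using assms by transfer auto

definition aff :: "nat \<Rightarrow> int \<Rightarrow> affine_monoid" where
  "aff a m = Abs_affine_monoid (a, m)"

lemma aff_mult: "0 < a \<Longrightarrow> 0 < b \<Longrightarrow> aff a m * aff b n = aff (a * b) (int b * m + n)"
  by (simp add: aff_def times_affine_monoid.abs_eq eq_onp_def)

text \<open>For injective \<open>p\<close>, \<open>push p\<close> moves the coefficient at \<open>s\<close> to \<open>p s\<close>; see \<open>T_op_basis_vec\<close>.\<close>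

lift_definition push :: "('a \<Rightarrow> 'a) \<Rightarrow> 'a ell2 \<Rightarrow> 'a ell2"
  is "\<lambda>p f t. if t \<in> range p then f (inv p t) else 0"
  subgoal premises prems for p f
  proof -
    from prems have "(\<lambda>x. (cmod (f x))\<^sup>2) summable_on (inv p ` range p)"
      using summable_on_subset_banach[OF _ subset_UNIV] by blast
    then have "((\<lambda>x. (cmod (f x))\<^sup>2) \<circ> inv p) summable_on (range p)"
      using summable_on_reindex[OF inj_on_inv_into[OF subset_refl]] by blast
    then have "(\<lambda>t. (cmod (if t \<in> range p then f (inv p t) else 0))\<^sup>2) summable_on UNIV"
      by (rule summable_on_cong_neutral[THEN iffD1, rotated -1]) simp_all
    then show ?thesis by simp
  qed
  done

lemma norm_push: "norm (push p \<xi>) \<le> norm \<xi>"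
proof -
  let ?f = "\<lambda>x. (cmod (Rep_ell2 \<xi> x))\<^sup>2"
  have "(norm (push p \<xi>))\<^sup>2 = infsum (?f \<circ> inv p) (range p)"
    unfolding norm_ell2_square push.rep_eq by (rule infsum_cong_neutral) simp_all
  also have "\<dots> = infsum ?f (inv p ` range p)"
    using infsum_reindex[OF inj_on_inv_into[where f = p and A = UNIV, OF subset_refl], of ?f] by simp
  also have "\<dots> \<le> infsum ?f UNIV"
  proof (rule infsum_mono_neutral)
    show "?f summable_on UNIV" using Rep_ell2[of \<xi>] by simp
    then show "?f summable_on (inv p ` range p)"
      by (rule summable_on_subset_banach) simp
  qed simp_all
  also have "\<dots> = (norm \<xi>)\<^sup>2" by (simp add: norm_ell2_square)
  finally show ?thesis by (rule power2_le_imp_le) simp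
qed

lift_definition push_op :: "('a \<Rightarrow> 'a) \<Rightarrow> 'a ell2 \<Rightarrow>\<^sub>L 'a ell2" is push
proof (rule bounded_linear_intro[where K = 1])
  fix p :: "'a \<Rightarrow> 'a" and r and x y :: "'a ell2"
  show "push p (x + y) = push p x + push p y"
    by (simp add: Rep_ell2_inject[symmetric] push.rep_eq plus_ell2.rep_eq fun_eq_iff)
  show "push p (r *\<^sub>R x) = r *\<^sub>R push p x"
    by (simp add: Rep_ell2_inject[symmetric] push.rep_eq scaleR_ell2.rep_eq fun_eq_iff)
  show "norm (push p x) \<le> norm x * 1" by (simp add: norm_push)
qed

definition T_op :: "affine_monoid \<Rightarrow> affine_monoid ell2 \<Rightarrow>\<^sub>L affine_monoid ell2" where
  "T_op s = push_op ((*) s)"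

lemma T_op_basis_vec: "T_op s (basis_vec t) = basis_vec (s * t)"
proof -
  have inj: "inj ((*) s)" by (auto intro: injI affine_monoid_left_cancel)
  have "Rep_ell2 (T_op s (basis_vec t)) u = Rep_ell2 (basis_vec (s * t)) u" for u
  proof (cases "u \<in> range ((*) s)")
    case True
    then obtain v where v: "u = s * v" by blast
    then show ?thesis
      using inv_f_f[OF inj, of v] inj_eq[OF inj, of v t]
      by (simp add: T_op_def push_op.rep_eq push.rep_eq basis_vec.rep_eq)
  next
    case False
    then have "u \<noteq> s * t" by blast
    with False show ?thesis
      by (simp add: T_op_def push_op.rep_eq push.rep_eq basis_vec.rep_eq)
  qed
  then have "Rep_ell2 (T_op s (basis_vec t)) = Rep_ell2 (basis_vec (s * t))" by (rule ext)
  then show ?thesis by (simp only: Rep_ell2_inject)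
qed

type_synonym operator = "affine_monoid ell2 \<Rightarrow>\<^sub>L affine_monoid ell2"

definition toeplitz :: "operator set" where
  "toeplitz = cstar_subalgebra hull (range T_op)"

definition U_op :: operator where
  "U_op = T_op (aff 1 1)"

definition U_pow :: "int \<Rightarrow> operator" where
  "U_pow k = (if 0 \<le> k then ((o\<^sub>L) U_op ^^ nat k) id_blinfun
              else ((o\<^sub>L) (adj U_op) ^^ nat (- k)) id_blinfun)"

definition V_op :: "nat \<Rightarrow> operator" where
  "V_op a = T_op (aff a 0)"

text \<open>The prescribed values of \<open>\<sigma>\<^sub>t\<close> on the spanning elements determine it as an automorphism;
  the value is meaningful for arguments in \<open>toeplitz\<close>.\<close>

definition dyn :: "real \<Rightarrow> operator \<Rightarrow> operator" where
  "dyn t x = (THE y. \<exists>\<alpha>. star_automorphism toeplitz \<alpha> \<and>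
     (\<forall>a b k. 0 < a \<longrightarrow> 0 < b \<longrightarrow>
        \<alpha> (V_op a o\<^sub>L U_pow k o\<^sub>L adj (V_op b)) =
          cmult ((of_nat a / of_nat b) powr (\<i> * of_real t)) o\<^sub>L
            (V_op a o\<^sub>L U_pow k o\<^sub>L adj (V_op b))) \<and>
     y = \<alpha> x)"

text \<open>\<open>entire_extension x F\<close>: the operator \<open>x\<close> is \<open>\<sigma>\<close>-analytic and \<open>F\<close> is the
  (necessarily unique) entire function with \<open>F z = \<sigma>\<^sub>z(x)\<close>. Holomorphy is real differentiability
  with complex-linear derivative.\<close>

definition entire_extension :: "operator \<Rightarrow> (complex \<Rightarrow> operator) \<Rightarrow> bool" where
  "entire_extension x F \<longleftrightarrow>
     (\<forall>t. F (of_real t) = dyn t x) \<and>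
     (\<forall>z. F z \<in> toeplitz \<and> (\<exists>D. (F has_derivative (\<lambda>h. cmult h o\<^sub>L D)) (at z)))"

definition KMS_states :: "real \<Rightarrow> (operator \<Rightarrow> complex) set" where
  "KMS_states \<beta> = {\<phi>. is_state toeplitz \<phi> \<and>
     (\<forall>x\<in>toeplitz. \<forall>F. entire_extension x F \<longrightarrow>
        (\<forall>y\<in>toeplitz. \<phi> (x o\<^sub>L y) = \<phi> (y o\<^sub>L F (\<i> * of_real \<beta>)))) \<and>
     (\<beta> = 0 \<longrightarrow> (\<forall>t. \<forall>x\<in>toeplitz. \<phi> (dyn t x) = \<phi> x))}"

section \<open>Measures on the circle\<close>

definition circle_prob :: "complex measure set" where
  "circle_prob = {\<nu>. sets \<nu> = sets (restrict_space borel circle) \<and> prob_space \<nu>}"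

definition moebius_mu :: "nat \<Rightarrow> real" where
  "moebius_mu n = (if squarefree n then (-1) ^ card (prime_factors n) else 0)"

definition subconformal :: "real \<Rightarrow> complex measure \<Rightarrow> bool" where
  "subconformal \<beta> \<nu> \<longleftrightarrow>
     (\<forall>f :: complex \<Rightarrow> real. continuous_on circle f \<and> (\<forall>z\<in>circle. 0 \<le> f z) \<longrightarrow>
        (\<forall>n>0. 0 \<le> (\<Sum>d | d dvd n. moebius_mu d * real d powr (- \<beta>) * (\<integral>z. f (z ^ d) \<partial>\<nu>))))"

definition subconformal_probs :: "real \<Rightarrow> complex measure set" where
  "subconformal_probs \<beta> = {\<nu> \<in> circle_prob. subconformal \<beta> \<nu>}"

definition state_measure :: "(operator \<Rightarrow> complex) \<Rightarrow> complex measure" where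
  "state_measure \<psi> = (THE \<nu>. \<nu> \<in> circle_prob \<and>
     (\<forall>f. continuous_on circle f \<longrightarrow> (\<integral>z. f z \<partial>\<nu>) = \<psi> (fun_calc U_op f)))"

section \<open>Weak* topologies and simplices\<close>

text \<open>The initial topology on \<open>X\<close> for the evaluations \<open>x \<mapsto> e x i\<close> with \<open>i \<in> I\<close>.\<close>

definition weak_topology :: "'x set \<Rightarrow> 'i set \<Rightarrow> ('x \<Rightarrow> 'i \<Rightarrow> complex) \<Rightarrow> 'x topology" where
  "weak_topology X I e =
     pullback_topology X (\<lambda>x. restrict (e x) I) (product_topology (\<lambda>_. euclidean) I)"

definition state_topology :: "(operator \<Rightarrow> complex) set \<Rightarrow> (operator \<Rightarrow> complex) topology" where
  "state_topology K = weak_topology K toeplitz (\<lambda>\<phi>. \<phi>)"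

definition measure_topology :: "complex measure set \<Rightarrow> complex measure topology" where
  "measure_topology M = weak_topology M {f. continuous_on circle f} (\<lambda>\<nu> f. \<integral>z. f z \<partial>\<nu>)"

definition cone_over :: "('i \<Rightarrow> complex) set \<Rightarrow> ('i \<Rightarrow> complex) set" where
  "cone_over K = {(\<lambda>i. complex_of_real t * \<phi> i) | t \<phi>. 0 \<le> t \<and> \<phi> \<in> K}"

text \<open>A Choquet simplex is a compact convex set (here of functionals, lying in a hyperplane that
  misses the origin) such that the cone it generates is a lattice in its own order.\<close>

definition choquet_simplex :: "('i \<Rightarrow> complex) topology \<Rightarrow> bool" where
  "choquet_simplex X \<longleftrightarrow> compact_space X \<and>
     (\<forall>\<phi>\<in>topspace X. \<forall>\<psi>\<in>topspace X. \<forall>t\<in>{0..1}.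
        (\<lambda>i. complex_of_real (1 - t) * \<phi> i + complex_of_real t * \<psi> i) \<in> topspace X) \<and>
     Lattice.lattice \<lparr>carrier = cone_over (topspace X), eq = (=),
       le = (\<lambda>\<phi> \<psi>. (\<lambda>i. \<psi> i - \<phi> i) \<in> cone_over (topspace X))\<rparr>"

end

theory Submission
  imports Defs "HOL-Complex_Analysis.Complex_Analysis"
begin

text \<open>The representation on \<open>\<ell>\<^sup>2(\<nat>\<^sup>\<times> \<ltimes> \<int>)\<close> splits into fibres \<open>\<ell>\<^sup>2(\<int>)\<close> over \<open>n \<ge> 1\<close>, on which \<open>U\<close> acts as
  the \<open>n\<close>-th power of the shift, that is, as multiplication by \<open>z\<^sup>n\<close> on the circle, while \<open>V\<^sub>a\<close> maps the
  fibre over \<open>n\<close> identically onto the fibre over \<open>a n\<close>.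

  On the spanning elements the KMS condition says that \<open>\<phi>(V\<^sub>a U\<^sup>k V\<^sub>b\<^sup>*)\<close> vanishes for \<open>a \<noteq> b\<close> and equals
  \<open>a\<^bsup>-\<beta>\<^esup> \<phi>(U\<^sup>k)\<close> for \<open>a = b\<close> (\<open>KMS_states_iff\<close>). A KMS state is therefore determined by its moments \<open>\<phi>(U\<^sup>k)\<close>.
  These are positive-definite, so by Herglotz's theorem (\<open>herglotz\<close>) they are the moments of a measure on
  the circle, and a measure is determined by its integrals of continuous functions. Herglotz's theorem,
  applied to vector states, also yields the functional calculus of \<open>U\<close>.

  The measure is subconformal because the projection \<open>\<Sum>\<^bsub>d dvd n\<^esub> \<mu>(d) V\<^sub>d V\<^sub>d\<^sup>*\<close> onto the fibres of level coprime
  to \<open>n\<close> commutes with \<open>f(U)\<close> (\<open>state_measure_subconformal\<close>).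

  For the converse, compress the algebra to its diagonal, an algebra of functions of \<open>(n, z)\<close>, in which
  \<open>V\<^sub>b U\<^sup>k V\<^sub>b\<^sup>*\<close> becomes the function that is \<open>z\<^bsup>kn/b\<^esup>\<close> if \<open>b\<close> divides \<open>n\<close> and \<open>0\<close> otherwise. KMS states
  correspond to positive functionals on this algebra with \<open>L(V\<^sub>b h V\<^sub>b\<^sup>*) = b\<^bsup>-\<beta>\<^esup> L(h)\<close>. Given a subconformal
  measure \<open>\<nu>\<close>, Moebius inversion suggests placing over \<open>n\<close> the signed measure
  \<open>n\<^bsup>-\<beta>\<^esup> \<Sum>\<^bsub>d dvd M/n\<^esub> \<mu>(d) d\<^bsup>-\<beta>\<^esup> \<integral> f(z\<^sup>d) d\<nu>\<close>, where \<open>M\<close> is highly divisible. Subconformality makes it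
  positive, and the sum over \<open>n dvd M\<close> has exactly the prescribed values on functions of level dividing \<open>M\<close>;
  letting \<open>M = N!\<close> grow gives the functional (\<open>scaling_functional_of_measure\<close>).

  Continuity in both directions follows since states are uniformly bounded and their values on the span
  are finite combinations of moments. The lattice property of the simplex is visible on the diagonal: it
  is a vector lattice, and by the Riesz decomposition the supremum of two scaling functionals, taken among
  all positive functionals, scales as well, because everything below \<open>V\<^sub>b h V\<^sub>b\<^sup>*\<close> has the form \<open>V\<^sub>b g V\<^sub>b\<^sup>*\<close>
  with \<open>g \<le> h\<close> (\<open>scaling_functional_sup\<close>).\<close>

section \<open>Geometry of the Hilbert space\<close>

lemma summable_ell2: "(\<lambda>t. (cmod (Rep_ell2 \<xi> t))\<^sup>2) summable_on UNIV"
  using Rep_ell2[of \<xi>] by simp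

lemma ell2_eqI: "(\<And>t. Rep_ell2 \<xi> t = Rep_ell2 \<eta> t) \<Longrightarrow> \<xi> = \<eta>"
  by (metis Rep_ell2_inject ext)

lemmas ell2_rep = plus_ell2.rep_eq minus_ell2.rep_eq uminus_ell2.rep_eq zero_ell2.rep_eq
  scaleR_ell2.rep_eq cscale.rep_eq basis_vec.rep_eq

lemma cinner_add_left: "cinner (\<xi> + \<eta>) \<zeta> = cinner \<xi> \<zeta> + cinner \<eta> \<zeta>"
  by transfer (simp add: distrib_right infsum_add square_summable_product)

lemma cinner_cscale_left: "cinner (cscale c \<xi>) \<zeta> = c * cinner \<xi> \<zeta>"
  by transfer (simp add: mult.assoc infsum_cmult_right square_summable_product)

lemma cinner_commute: "cinner \<eta> \<xi> = cnj (cinner \<xi> \<eta>)"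
  by (simp only: cinner.rep_eq infsum_cnj[symmetric] complex_cnj_mult complex_cnj_cnj mult.commute)

lemma cinner_add_right: "cinner \<zeta> (\<xi> + \<eta>) = cinner \<zeta> \<xi> + cinner \<zeta> \<eta>"
  by (metis cinner_add_left cinner_commute complex_cnj_add)

lemma cinner_cscale_right: "cinner \<zeta> (cscale c \<xi>) = cnj c * cinner \<zeta> \<xi>"
  by (metis cinner_cscale_left cinner_commute complex_cnj_mult)

lemma cscale_minus_one: "cscale (- 1) \<xi> = - \<xi>"
  by (rule ell2_eqI) (simp add: ell2_rep)

lemma cscale_of_real: "cscale (of_real r) \<xi> = r *\<^sub>R \<xi>"
  by (rule ell2_eqI) (simp add: ell2_rep)

lemma cinner_minus_left: "cinner (- \<xi>) \<eta> = - cinner \<xi> \<eta>"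
  using cinner_cscale_left[of "-1" \<xi> \<eta>] by (simp add: cscale_minus_one)

lemma cinner_minus_right: "cinner \<eta> (- \<xi>) = - cinner \<eta> \<xi>"
  using cinner_cscale_right[of \<eta> "-1" \<xi>] by (simp add: cscale_minus_one)

lemma cinner_diff_left: "cinner (\<xi> - \<eta>) \<zeta> = cinner \<xi> \<zeta> - cinner \<eta> \<zeta>"
  using cinner_add_left[of \<xi> "- \<eta>" \<zeta>] by (simp add: cinner_minus_left)

lemma cinner_diff_right: "cinner \<zeta> (\<xi> - \<eta>) = cinner \<zeta> \<xi> - cinner \<zeta> \<eta>"
  using cinner_add_right[of \<zeta> \<xi> "- \<eta>"] by (simp add: cinner_minus_right)

lemma cinner_zero [simp]: "cinner 0 \<xi> = 0" "cinner \<xi> 0 = 0"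
  using cinner_diff_left[of \<xi> \<xi> \<xi>] cinner_diff_right[of \<xi> \<xi> \<xi>] 
    cinner_diff_left[of 0 0 \<xi>] cinner_diff_right[of \<xi> 0 0] by auto

lemma cinner_sum_left: "cinner (\<Sum>i\<in>I. f i) \<zeta> = (\<Sum>i\<in>I. cinner (f i) \<zeta>)"
  by (induction I rule: infinite_finite_induct) (simp_all add: cinner_add_left)

lemma cinner_sum_right: "cinner \<zeta> (\<Sum>i\<in>I. f i) = (\<Sum>i\<in>I. cinner \<zeta> (f i))"
  by (induction I rule: infinite_finite_induct) (simp_all add: cinner_add_right)

lemma cinner_self_norm: "cinner \<xi> \<xi> = of_real ((norm \<xi>)\<^sup>2)"
  by (simp add: cinner_self norm_ell2_square)

lemma cinner_basis_vec: "cinner \<xi> (basis_vec t) = Rep_ell2 \<xi> t"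
proof -
  have "cinner \<xi> (basis_vec t) = (\<Sum>\<^sub>\<infinity>x\<in>{t}. Rep_ell2 \<xi> x)"
    unfolding cinner.rep_eq basis_vec.rep_eq by (rule infsum_cong_neutral) auto
  then show ?thesis by simp
qed

lemma norm_cscale: "norm (cscale c \<xi>) = cmod c * norm \<xi>"
proof -
  have "(norm (cscale c \<xi>))\<^sup>2 = (cmod c * norm \<xi>)\<^sup>2"
    unfolding norm_ell2_square power_mult_distrib
    by (simp add: cscale.rep_eq norm_mult power_mult_distrib infsum_cmult_right')
  then show ?thesis by (simp add: power2_eq_iff_nonneg)
qed

lemma cnj_sgn_mult: "cnj (sgn c) * c = of_real (cmod c)"
proof (cases "c = 0")
  case False
  have "cnj (sgn c) * c = of_real ((cmod c)\<^sup>2) / of_real (cmod c)"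
    by (subst complex_norm_square) (simp add: sgn_eq mult.commute)
  then show ?thesis using False by (simp add: power2_eq_square)
qed simp

lemma cmod_cinner_le: "cmod (cinner \<xi> \<eta>) \<le> norm \<xi> * norm \<eta>"
proof (cases "cinner \<xi> \<eta> = 0")
  case False
  let ?c = "cinner \<xi> \<eta>"
  let ?u = "cnj (sgn ?c)"
  have u: "cmod ?u = 1" using False by (simp add: norm_sgn)
  have "?u * ?c = of_real (cmod ?c)"
    by (rule cnj_sgn_mult)
  then have "cmod ?c = Re (cinner (cscale ?u \<xi>) \<eta>)"
    by (simp add: cinner_cscale_left)
  also have "\<dots> = inner (cscale ?u \<xi>) \<eta>" by (simp add: inner_ell2_def)
  also have "\<dots> \<le> norm (cscale ?u \<xi>) * norm \<eta>" by (rule norm_cauchy_schwarz)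
  finally show ?thesis using u by (simp only: norm_cscale mult_1)
qed simp

lemma cmod_Rep_le_norm: "cmod (Rep_ell2 \<xi> t) \<le> norm \<xi>"
proof -
  have "(\<Sum>\<^sub>\<infinity>x\<in>{t}. (cmod (Rep_ell2 \<xi> x))\<^sup>2) \<le> (\<Sum>\<^sub>\<infinity>x. (cmod (Rep_ell2 \<xi> x))\<^sup>2)"
    by (rule infsum_mono_neutral) (auto simp: summable_ell2)
  then have "(cmod (Rep_ell2 \<xi> t))\<^sup>2 \<le> (norm \<xi>)\<^sup>2" by (simp add: norm_ell2_square)
  then show ?thesis by (rule power2_le_imp_le) simp
qed

text \<open>Coordinatewise limits of a Cauchy sequence are square summable because the Cauchy estimate
  survives on every finite set of coordinates.\<close>

instance ell2 :: (type) banach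
proof
  fix X :: "nat \<Rightarrow> 'a ell2"
  assume X: "Cauchy X"
  have "Cauchy (\<lambda>n. Rep_ell2 (X n) t)" for t
  proof (rule CauchyI)
    fix e :: real assume "0 < e"
    then obtain M where M: "\<And>m n. M \<le> m \<Longrightarrow> M \<le> n \<Longrightarrow> norm (X m - X n) < e"
      using CauchyD[OF X] by blast
    then show "\<exists>M. \<forall>m\<ge>M. \<forall>n\<ge>M. norm (Rep_ell2 (X m) t - Rep_ell2 (X n) t) < e"
      using le_less_trans[OF cmod_Rep_le_norm[of "X m - X n" t for m n]]
      by (intro exI[of _ M]) (simp add: ell2_rep)
  qed
  then obtain f where f: "\<And>t. (\<lambda>n. Rep_ell2 (X n) t) \<longlonglongrightarrow> f t"
    unfolding Cauchy_convergent_iff convergent_def by metis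
  have fin: "(\<Sum>t\<in>F. (cmod (Rep_ell2 (X n) t - f t))\<^sup>2) \<le> e\<^sup>2"
    if M: "\<forall>m\<ge>M. \<forall>n\<ge>M. norm (X m - X n) < e" and n: "M \<le> n" and F: "finite F"
    for e M n F
  proof (rule LIMSEQ_le_const2)
    show "(\<lambda>m. \<Sum>t\<in>F. (cmod (Rep_ell2 (X n) t - Rep_ell2 (X m) t))\<^sup>2)
        \<longlonglongrightarrow> (\<Sum>t\<in>F. (cmod (Rep_ell2 (X n) t - f t))\<^sup>2)"
      by (intro tendsto_intros f)
    have "(\<Sum>t\<in>F. (cmod (Rep_ell2 (X n) t - Rep_ell2 (X m) t))\<^sup>2) \<le> e\<^sup>2" if "M \<le> m" for m
    proof -
      have "(\<Sum>t\<in>F. (cmod (Rep_ell2 (X n) t - Rep_ell2 (X m) t))\<^sup>2) \<le> (norm (X n - X m))\<^sup>2"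
        unfolding norm_ell2_square using summable_ell2[of "X n - X m"] F
        by (simp only: ell2_rep) (rule finite_sum_le_infsum, auto)
      also have "norm (X n - X m) < e" using M n that by blast
      then have "(norm (X n - X m))\<^sup>2 \<le> e\<^sup>2" by (intro power_mono) auto
      finally show ?thesis .
    qed
    then show "\<exists>N. \<forall>m\<ge>N. (\<Sum>t\<in>F. (cmod (Rep_ell2 (X n) t - Rep_ell2 (X m) t))\<^sup>2) \<le> e\<^sup>2"
      by blast
  qed
  have sum: "(\<lambda>t. (cmod (Rep_ell2 (X n) t - f t))\<^sup>2) summable_on UNIV"
    if M: "\<forall>m\<ge>M. \<forall>n\<ge>M. norm (X m - X n) < e" and n: "M \<le> n" for e M n
    by (rule nonneg_bdd_above_summable_on) (auto intro!: bdd_aboveI[of _ "e\<^sup>2"] fin[OF M n])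
  obtain M1 where M1: "\<forall>m\<ge>M1. \<forall>n\<ge>M1. norm (X m - X n) < 1"
    using CauchyD[OF X, of 1] by auto
  have "(\<lambda>t. (cmod (Rep_ell2 (X M1) t + - (Rep_ell2 (X M1) t - f t)))\<^sup>2) summable_on UNIV"
    using sum[OF M1, of M1] by (intro square_summable_add summable_ell2) (simp add: norm_minus_commute)
  then have "f \<in> {f. (\<lambda>x. (cmod (f x))\<^sup>2) summable_on UNIV}" by simp
  then obtain \<xi> where \<xi>: "Rep_ell2 \<xi> = f" using Abs_ell2_inverse by blast
  have "X \<longlonglongrightarrow> \<xi>"
  proof (rule LIMSEQ_I)
    fix r :: real assume "0 < r"
    then obtain M where M: "\<forall>m\<ge>M. \<forall>n\<ge>M. norm (X m - X n) < r / 2"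
      using CauchyD[OF X, of "r / 2"] by auto
    have "norm (X n - \<xi>) < r" if n: "M \<le> n" for n
    proof -
      have "(\<Sum>\<^sub>\<infinity>t. (cmod (Rep_ell2 (X n) t - f t))\<^sup>2) \<le> (r / 2)\<^sup>2"
      proof (rule infsum_le_finite_sums)
        show "(\<lambda>t. (cmod (Rep_ell2 (X n) t - f t))\<^sup>2) summable_on UNIV" by (rule sum[OF M n])
        fix F :: "'a set" assume "finite F"
        then show "(\<Sum>t\<in>F. (cmod (Rep_ell2 (X n) t - f t))\<^sup>2) \<le> (r / 2)\<^sup>2" by (rule fin[OF M n])
      qed
      then have "(norm (X n - \<xi>))\<^sup>2 \<le> (r / 2)\<^sup>2" by (simp add: norm_ell2_square minus_ell2.rep_eq \<xi>)
      then have "norm (X n - \<xi>) \<le> r / 2" using \<open>0 < r\<close> by (auto elim!: power2_le_imp_le)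
      then show ?thesis using \<open>0 < r\<close> by simp
    qed
    then show "\<exists>no. \<forall>n\<ge>no. norm (X n - \<xi>) < r" by blast
  qed
  then show "convergent X" by (rule convergentI)
qed

section \<open>Adjoints\<close>

text \<open>Adjointability is carried along as a property, because \<open>adj\<close> is a definite description and denotes the adjoint only for operators that have one.\<close>

definition is_adjoint :: "('a ell2 \<Rightarrow>\<^sub>L 'a ell2) \<Rightarrow> ('a ell2 \<Rightarrow>\<^sub>L 'a ell2) \<Rightarrow> bool" where
  "is_adjoint x y \<longleftrightarrow> (\<forall>\<xi> \<eta>. cinner (blinfun_apply x \<xi>) \<eta> = cinner \<xi> (blinfun_apply y \<eta>))"

definition adjointable :: "('a ell2 \<Rightarrow>\<^sub>L 'a ell2) set" where
  "adjointable = {x. \<exists>y. is_adjoint x y}"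

lemma cinner_left_eqD:
  assumes "\<And>\<xi>. cinner \<xi> \<eta> = cinner \<xi> \<zeta>"
  shows "\<eta> = \<zeta>"
proof -
  have "cinner (\<eta> - \<zeta>) (\<eta> - \<zeta>) = 0" using assms by (simp add: cinner_diff_right)
  then show ?thesis by (simp only: cinner_self_norm) simp
qed

lemma is_adjoint_unique:
  assumes "is_adjoint x y" "is_adjoint x z"
  shows "y = z"
proof (rule blinfun_eqI, rule cinner_left_eqD)
  fix \<eta> \<xi> show "cinner \<xi> (blinfun_apply y \<eta>) = cinner \<xi> (blinfun_apply z \<eta>)"
    using assms unfolding is_adjoint_def by metis
qed

lemma adj_eqI: "is_adjoint x y \<Longrightarrow> adj x = y"
  unfolding adj_def is_adjoint_def[symmetric] using is_adjoint_unique by blast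

lemma is_adjoint_adj: "x \<in> adjointable \<Longrightarrow> is_adjoint x (adj x)"
  unfolding adjointable_def using adj_eqI by blast

lemma cinner_adj: "x \<in> adjointable \<Longrightarrow> cinner (blinfun_apply x \<xi>) \<eta> = cinner \<xi> (blinfun_apply (adj x) \<eta>)"
  using is_adjoint_adj is_adjoint_def by blast

lemma is_adjoint_sym: "is_adjoint x y \<Longrightarrow> is_adjoint y x"
  unfolding is_adjoint_def by (metis cinner_commute)

lemma adj_adjointable: "x \<in> adjointable \<Longrightarrow> adj x \<in> adjointable"
  using is_adjoint_adj is_adjoint_sym adjointable_def by blast

lemma adj_adj: "x \<in> adjointable \<Longrightarrow> adj (adj x) = x"
  using is_adjoint_adj is_adjoint_sym adj_eqI by blast

lemma is_adjoint_add: "is_adjoint x y \<Longrightarrow> is_adjoint x' y' \<Longrightarrow> is_adjoint (x + x') (y + y')"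
  by (simp add: is_adjoint_def blinfun.add_left cinner_add_left cinner_add_right)

lemma is_adjoint_diff: "is_adjoint x y \<Longrightarrow> is_adjoint x' y' \<Longrightarrow> is_adjoint (x - x') (y - y')"
  by (simp add: is_adjoint_def blinfun.diff_left cinner_diff_left cinner_diff_right)

lemma is_adjoint_compose: "is_adjoint x y \<Longrightarrow> is_adjoint x' y' \<Longrightarrow> is_adjoint (x o\<^sub>L x') (y' o\<^sub>L y)"
  by (simp add: is_adjoint_def)

lemma is_adjoint_cmult: "is_adjoint (cmult c) (cmult (cnj c))"
  by (simp add: is_adjoint_def cmult.rep_eq cinner_cscale_left cinner_cscale_right)

lemma is_adjoint_id: "is_adjoint id_blinfun id_blinfun"
  by (simp add: is_adjoint_def)

lemma is_adjoint_zero: "is_adjoint 0 0"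
  by (simp add: is_adjoint_def)

lemma adjointable_cscale:
  assumes "x \<in> adjointable" shows "blinfun_apply x (cscale c \<xi>) = cscale c (blinfun_apply x \<xi>)"
proof (rule cinner_left_eqD)
  fix \<eta>
  have "is_adjoint (adj x) x" using assms is_adjoint_adj is_adjoint_sym by blast
  then show "cinner \<eta> (blinfun_apply x (cscale c \<xi>)) = cinner \<eta> (cscale c (blinfun_apply x \<xi>))"
    unfolding is_adjoint_def by (metis cinner_cscale_right)
qed

lemma compose_cmult: "x \<in> adjointable \<Longrightarrow> x o\<^sub>L cmult c = cmult c o\<^sub>L x"
  by (rule blinfun_eqI) (simp add: cmult.rep_eq adjointable_cscale)

lemma norm_is_adjoint_le:
  assumes "is_adjoint x y" shows "norm y \<le> norm x"
proof (rule norm_blinfun_bound)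
  fix \<eta>
  let ?v = "blinfun_apply y \<eta>"
  have "(norm ?v)\<^sup>2 = cmod (cinner ?v ?v)" by (simp add: cinner_self_norm norm_power)
  also have "\<dots> = cmod (cinner (blinfun_apply x ?v) \<eta>)" using assms by (simp add: is_adjoint_def)
  also have "\<dots> \<le> norm (blinfun_apply x ?v) * norm \<eta>" by (rule cmod_cinner_le)
  also have "\<dots> \<le> norm x * norm ?v * norm \<eta>" by (intro mult_right_mono norm_blinfun) auto
  finally have "norm ?v * norm ?v \<le> norm ?v * (norm x * norm \<eta>)"
    by (simp add: power2_eq_square mult_ac)
  then show "norm ?v \<le> norm x * norm \<eta>"
    by (cases "norm ?v = 0") (auto simp: mult_le_cancel_left)
qed simp

lemma norm_is_adjoint: "is_adjoint x y \<Longrightarrow> norm y = norm x"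
  using norm_is_adjoint_le is_adjoint_sym by (metis order_antisym)

lemma norm_adj: "x \<in> adjointable \<Longrightarrow> norm (adj x) = norm x"
  using is_adjoint_adj norm_is_adjoint by blast

lemma adjointableI: "is_adjoint x y \<Longrightarrow> x \<in> adjointable"
  unfolding adjointable_def by blast

lemma adjointable_intros:
  "x \<in> adjointable \<Longrightarrow> y \<in> adjointable \<Longrightarrow> x + y \<in> adjointable"
  "x \<in> adjointable \<Longrightarrow> y \<in> adjointable \<Longrightarrow> x - y \<in> adjointable"
  "x \<in> adjointable \<Longrightarrow> y \<in> adjointable \<Longrightarrow> x o\<^sub>L y \<in> adjointable"
  "cmult c \<in> adjointable" "id_blinfun \<in> adjointable" "0 \<in> adjointable"
  by (rule adjointableI, (rule is_adjoint_add is_adjoint_diff is_adjoint_compose is_adjoint_cmult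
      is_adjoint_id is_adjoint_zero; rule is_adjoint_adj; assumption)
    | rule adjointableI, rule is_adjoint_cmult is_adjoint_id is_adjoint_zero)+

lemma adj_add: "x \<in> adjointable \<Longrightarrow> y \<in> adjointable \<Longrightarrow> adj (x + y) = adj x + adj y"
  by (intro adj_eqI is_adjoint_add is_adjoint_adj)

lemma adj_diff: "x \<in> adjointable \<Longrightarrow> y \<in> adjointable \<Longrightarrow> adj (x - y) = adj x - adj y"
  by (intro adj_eqI is_adjoint_diff is_adjoint_adj)

lemma adj_compose: "x \<in> adjointable \<Longrightarrow> y \<in> adjointable \<Longrightarrow> adj (x o\<^sub>L y) = adj y o\<^sub>L adj x"
  by (intro adj_eqI is_adjoint_compose is_adjoint_adj)

lemma adj_cmult: "x \<in> adjointable \<Longrightarrow> adj (cmult c o\<^sub>L x) = cmult (cnj c) o\<^sub>L adj x"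
  by (subst compose_cmult[symmetric, OF adj_adjointable], assumption)
    (intro adj_eqI is_adjoint_compose is_adjoint_adj is_adjoint_cmult)

lemma adj_id: "adj id_blinfun = id_blinfun"
  by (intro adj_eqI is_adjoint_id)

text \<open>Taking adjoints is isometric, so along a norm convergent sequence the adjoints form a Cauchy sequence, and the defining identity passes to the limits.\<close>

lemma closed_adjointable: "closed (adjointable :: ('a ell2 \<Rightarrow>\<^sub>L 'a ell2) set)"
  unfolding closed_sequential_limits
proof (intro allI impI, elim conjE)
  fix X and x :: "'a ell2 \<Rightarrow>\<^sub>L 'a ell2"
  assume X: "\<forall>n. X n \<in> adjointable" and lim: "X \<longlonglongrightarrow> x"
  have "Cauchy (\<lambda>n. adj (X n))"
  proof (rule CauchyI)
    fix e :: real assume "0 < e"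
    then obtain M where M: "\<And>m n. M \<le> m \<Longrightarrow> M \<le> n \<Longrightarrow> norm (X m - X n) < e"
      using CauchyD[OF LIMSEQ_imp_Cauchy[OF lim]] by blast
    have "norm (adj (X m) - adj (X n)) = norm (X m - X n)" for m n
      using X by (simp add: adj_diff[symmetric] norm_adj adjointable_intros)
    with M show "\<exists>M. \<forall>m\<ge>M. \<forall>n\<ge>M. norm (adj (X m) - adj (X n)) < e" by auto
  qed
  then obtain y where y: "(\<lambda>n. adj (X n)) \<longlonglongrightarrow> y" using Cauchy_convergent_iff convergent_def by blast
  have cont: "((\<lambda>n. cinner (f n) \<eta>) \<longlongrightarrow> cinner g \<eta>) sequentially" if "f \<longlonglongrightarrow> g"
    for f and g \<eta> :: "'a ell2"
  proof -
    have "(\<lambda>n. cinner (f n - g) \<eta>) \<longlonglongrightarrow> 0"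
    proof (rule Lim_null_comparison)
      show "\<forall>\<^sub>F n in sequentially. norm (cinner (f n - g) \<eta>) \<le> norm (f n - g) * norm \<eta>"
        by (simp add: cmod_cinner_le)
      show "(\<lambda>n. norm (f n - g) * norm \<eta>) \<longlonglongrightarrow> 0"
        using tendsto_norm_zero[OF LIM_zero[OF that]] by (auto intro: tendsto_mult_left_zero)
    qed
    then show ?thesis by (simp add: cinner_diff_left LIM_zero_iff)
  qed
  have "is_adjoint x y"
    unfolding is_adjoint_def
  proof (intro allI)
    fix \<xi> \<eta>
    have "(\<lambda>n. cinner (blinfun_apply (X n) \<xi>) \<eta>) \<longlonglongrightarrow> cinner (blinfun_apply x \<xi>) \<eta>"
      by (intro cont tendsto_intros lim)
    moreover have "(\<lambda>n. cnj (cinner (blinfun_apply (adj (X n)) \<eta>) \<xi>)) \<longlonglongrightarrow> cnj (cinner (blinfun_apply y \<eta>) \<xi>)"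
      by (intro tendsto_cnj cont tendsto_intros y)
    moreover have "cinner (blinfun_apply (X n) \<xi>) \<eta> = cnj (cinner (blinfun_apply (adj (X n)) \<eta>) \<xi>)" for n
      using X cinner_adj[of "X n" \<xi> \<eta>] cinner_commute[of \<xi> "blinfun_apply (adj (X n)) \<eta>"] by simp
    ultimately show "cinner (blinfun_apply x \<xi>) \<eta> = cinner \<xi> (blinfun_apply y \<eta>)"
      using LIMSEQ_unique cinner_commute[of \<xi> "blinfun_apply y \<eta>"] by simp
  qed
  then show "x \<in> adjointable" unfolding adjointable_def by blast
qed

lemma norm_adj_apply:
  assumes "x \<in> adjointable" shows "cinner (blinfun_apply (adj x o\<^sub>L x) \<xi>) \<xi> = of_real ((norm (blinfun_apply x \<xi>))\<^sup>2)"
  using assms cinner_adj[OF adj_adjointable[OF assms]] by (simp add: adj_adj cinner_self_norm)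

text \<open>The operators \<open>\<xi> \<mapsto> w \<cdot> (\<xi> \<circ> q)\<close> for injective \<open>q\<close> and \<open>\<bar>w\<bar> \<le> 1\<close>; they comprise the adjoints of
  the shifts \<open>push_op p\<close> (take \<open>q = p\<close>, \<open>w = 1\<close>) and the diagonal operators (take \<open>q = id\<close>).\<close>

lift_definition weighted_pull :: "('a \<Rightarrow> complex) \<Rightarrow> ('a \<Rightarrow> 'a) \<Rightarrow> 'a ell2 \<Rightarrow> 'a ell2"
  is "\<lambda>w q f t. if inj q \<and> (\<forall>t. cmod (w t) \<le> 1) then w t * f (q t) else 0"
  subgoal premises prems for w q f
  proof (cases "inj q \<and> (\<forall>t. cmod (w t) \<le> 1)")
    case True
    have "(\<lambda>x. (cmod (f x))\<^sup>2) summable_on (range q)"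
      using prems summable_on_subset_banach[OF _ subset_UNIV] by blast
    then have "(\<lambda>t. (cmod (f (q t)))\<^sup>2) summable_on UNIV"
      using True by (simp add: summable_on_reindex o_def)
    then have "(\<lambda>t. (cmod (w t * f (q t)))\<^sup>2) summable_on UNIV"
    proof (rule summable_on_comparison_test)
      fix t show "(cmod (w t * f (q t)))\<^sup>2 \<le> (cmod (f (q t)))\<^sup>2"
        using True mult_right_mono[of "cmod (w t)" 1 "cmod (f (q t))"]
        by (intro power_mono) (auto simp: norm_mult)
    qed simp
    with True show ?thesis by simp
  next
    case False then show ?thesis by (simp only: if_False) simp
  qed
  done

lemma norm_weighted_pull: "norm (weighted_pull w q \<xi>) \<le> norm \<xi>"
proof (cases "inj q \<and> (\<forall>t. cmod (w t) \<le> 1)")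
  case True
  let ?f = "\<lambda>x. (cmod (Rep_ell2 \<xi> x))\<^sup>2"
  have s: "?f summable_on (range q)"
    using summable_ell2 summable_on_subset_banach[OF _ subset_UNIV] by blast
  have "(norm (weighted_pull w q \<xi>))\<^sup>2 \<le> (\<Sum>\<^sub>\<infinity>t. ?f (q t))"
    unfolding norm_ell2_square
  proof (rule infsum_mono)
    show "(\<lambda>t. ?f (q t)) summable_on UNIV"
      using True s by (simp add: summable_on_reindex o_def)
    fix t show "(cmod (Rep_ell2 (weighted_pull w q \<xi>) t))\<^sup>2 \<le> ?f (q t)"
      using True mult_right_mono[of "cmod (w t)" 1 "cmod (Rep_ell2 \<xi> (q t))"]
      by (intro power_mono) (auto simp: norm_mult weighted_pull.rep_eq)
  qed (rule summable_ell2)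
  also have "\<dots> = infsum ?f (range q)" using True infsum_reindex[of q UNIV ?f] by (simp add: o_def)
  also have "\<dots> \<le> infsum ?f UNIV"
    by (rule infsum_mono_neutral) (auto intro: s summable_ell2)
  also have "\<dots> = (norm \<xi>)\<^sup>2" by (simp add: norm_ell2_square)
  finally show ?thesis by (rule power2_le_imp_le) simp
next
  case False
  then have "weighted_pull w q \<xi> = 0" by (intro ell2_eqI) (auto simp: weighted_pull.rep_eq ell2_rep)
  then show ?thesis by simp
qed

lift_definition weighted_pull_op :: "('a \<Rightarrow> complex) \<Rightarrow> ('a \<Rightarrow> 'a) \<Rightarrow> 'a ell2 \<Rightarrow>\<^sub>L 'a ell2" is weighted_pull
proof (rule bounded_linear_intro[where K = 1])
  fix w :: "'a \<Rightarrow> complex" and q :: "'a \<Rightarrow> 'a" and r and x y :: "'a ell2"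
  show "weighted_pull w q (x + y) = weighted_pull w q x + weighted_pull w q y"
    by (rule ell2_eqI) (simp add: weighted_pull.rep_eq ell2_rep distrib_left)
  show "weighted_pull w q (r *\<^sub>R x) = r *\<^sub>R weighted_pull w q x"
    by (rule ell2_eqI) (simp add: weighted_pull.rep_eq ell2_rep)
  show "norm (weighted_pull w q x) \<le> norm x * 1" by (simp add: norm_weighted_pull)
qed

lemma Rep_weighted_pull_op:
  "inj q \<Longrightarrow> (\<And>t. cmod (w t) \<le> 1) \<Longrightarrow>
     Rep_ell2 (blinfun_apply (weighted_pull_op w q) \<xi>) t = w t * Rep_ell2 \<xi> (q t)"
  by (simp add: weighted_pull_op.rep_eq weighted_pull.rep_eq)

lemma is_adjoint_push_op:
  assumes "inj p" shows "is_adjoint (push_op p) (weighted_pull_op (\<lambda>_. 1) p)"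
  unfolding is_adjoint_def
proof (intro allI)
  fix \<xi> \<eta>
  have "cinner (blinfun_apply (push_op p) \<xi>) \<eta> =
      (\<Sum>\<^sub>\<infinity>t\<in>range p. Rep_ell2 \<xi> (inv p t) * cnj (Rep_ell2 \<eta> t))"
    unfolding cinner.rep_eq push_op.rep_eq push.rep_eq by (rule infsum_cong_neutral) auto
  also have "\<dots> = (\<Sum>\<^sub>\<infinity>s. Rep_ell2 \<xi> s * cnj (Rep_ell2 \<eta> (p s)))"
    using assms by (subst infsum_reindex) (auto simp: o_def)
  also have "\<dots> = cinner \<xi> (blinfun_apply (weighted_pull_op (\<lambda>_. 1) p) \<eta>)"
    unfolding cinner.rep_eq using assms by (simp add: Rep_weighted_pull_op)
  finally show "cinner (blinfun_apply (push_op p) \<xi>) \<eta> = cinner \<xi> (blinfun_apply (weighted_pull_op (\<lambda>_. 1) p) \<eta>)" .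
qed

lemma is_adjoint_diagonal:
  assumes "\<And>t. cmod (w t) \<le> 1"
  shows "is_adjoint (weighted_pull_op w id) (weighted_pull_op (\<lambda>t. cnj (w t)) id)"
  unfolding is_adjoint_def cinner.rep_eq using assms
  by (simp add: Rep_weighted_pull_op mult_ac)

section \<open>The spanning monomials of the Toeplitz algebra\<close>

text \<open>In the coordinates \<open>\<xi>(m, j)\<close> the fibre over \<open>m\<close> is a copy of \<open>\<ell>\<^sup>2(\<int>)\<close>: \<open>U\<close> shifts it by \<open>m\<close>, while \<open>V\<^sub>a\<close> identifies it with the fibre over \<open>a m\<close>. All identities between the generators are read off from these formulas.\<close>

abbreviation coord :: "affine_monoid ell2 \<Rightarrow> nat \<Rightarrow> int \<Rightarrow> complex" where
  "coord \<xi> m j \<equiv> Rep_ell2 \<xi> (aff m j)"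

lemma aff_eq_iff: "0 < a \<Longrightarrow> 0 < b \<Longrightarrow> aff a m = aff b n \<longleftrightarrow> a = b \<and> m = n"
  unfolding aff_def by (subst Abs_affine_monoid_inject) auto

lemma aff_cases:
  obtains m j where "0 < m" "t = aff m j"
proof -
  obtain m j where mj: "Rep_affine_monoid t = (m, j)" by (cases "Rep_affine_monoid t") auto
  then have "0 < m" using Rep_affine_monoid[of t] by auto
  moreover have "t = aff m j" using mj Rep_affine_monoid_inverse[of t] by (simp add: aff_def)
  ultimately show ?thesis using that by blast
qed

lemma coord_eqI: "(\<And>m j. 0 < m \<Longrightarrow> coord \<xi> m j = coord \<eta> m j) \<Longrightarrow> \<xi> = \<eta>"
  by (rule ell2_eqI) (metis aff_cases)

lemma compose_assoc: "(x o\<^sub>L y) o\<^sub>L z = x o\<^sub>L (y o\<^sub>L z)"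
  by (rule blinfun_eqI) simp

lemma operator_eqI:
  assumes "\<And>\<xi> m j. 0 < m \<Longrightarrow> coord (blinfun_apply x \<xi>) m j = coord (blinfun_apply y \<xi>) m j"
  shows "x = (y :: operator)"
  using assms by (intro blinfun_eqI coord_eqI)

lemma inj_left_mult: "inj ((*) (s :: affine_monoid))"
  by (auto intro: injI affine_monoid_left_cancel)

lemma coord_T_op:
  assumes a: "0 < a" and m: "0 < m"
  shows "coord (blinfun_apply (T_op (aff a k)) \<xi>) m j =
    (if a dvd m then coord \<xi> (m div a) (j - k * int (m div a)) else 0)"
proof (cases "a dvd m")
  case True
  then obtain q where q: "m = a * q" by blast
  with m have "0 < q" by simp
  have eq: "aff m j = aff a k * aff q (j - k * int q)"
    using a \<open>0 < q\<close> by (simp add: aff_mult q)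
  have "inv ((*) (aff a k)) (aff m j) = aff q (j - k * int q)"
    unfolding eq by (rule inv_f_f[OF inj_left_mult])
  moreover have "aff m j \<in> range ((*) (aff a k))" using eq by blast
  ultimately show ?thesis using a q by (simp add: T_op_def push_op.rep_eq push.rep_eq)
next
  case False
  have "aff m j \<notin> range ((*) (aff a k))"
  proof
    assume "aff m j \<in> range ((*) (aff a k))"
    then obtain t where "aff m j = aff a k * t" by blast
    moreover obtain q i where "0 < q" "t = aff q i" by (rule aff_cases)
    ultimately have "m = a * q" using a m by (simp add: aff_mult aff_eq_iff)
    with False show False by simp
  qed
  with False show ?thesis by (simp add: T_op_def push_op.rep_eq push.rep_eq)
qed

lemma is_adjoint_T_op: "is_adjoint (T_op s) (weighted_pull_op (\<lambda>_. 1) ((*) s))"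
  unfolding T_op_def by (rule is_adjoint_push_op[OF inj_left_mult])

lemma T_op_adjointable: "T_op s \<in> adjointable"
  using is_adjoint_T_op adjointable_def by blast

lemma coord_adj_T_op:
  assumes "0 < a" "0 < m"
  shows "coord (blinfun_apply (adj (T_op (aff a k))) \<xi>) m j = coord \<xi> (a * m) (j + k * int m)"
  using assms by (simp add: adj_eqI[OF is_adjoint_T_op] Rep_weighted_pull_op inj_left_mult aff_mult add_ac mult_ac)

lemma T_op_one: "T_op (aff 1 0) = id_blinfun"
  by (rule operator_eqI) (simp add: coord_T_op)

lemma U_op_comp: "U_op o\<^sub>L T_op (aff 1 k) = T_op (aff 1 (k + 1))"
  by (rule operator_eqI) (simp add: U_op_def coord_T_op algebra_simps)

lemma adj_U_op: "adj U_op = T_op (aff 1 (- 1))"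
  by (rule operator_eqI) (simp add: U_op_def coord_T_op coord_adj_T_op)

lemma adj_U_op_comp: "adj U_op o\<^sub>L T_op (aff 1 k) = T_op (aff 1 (k - 1))"
  by (rule operator_eqI) (simp add: adj_U_op coord_T_op algebra_simps)

lemma U_pow_eq: "U_pow k = T_op (aff 1 k)"
proof -
  have "((o\<^sub>L) U_op ^^ n) id_blinfun = T_op (aff 1 (int n))" for n
    by (induction n) (simp_all add: T_op_one[simplified] U_op_comp[simplified] add.commute)
  moreover have "((o\<^sub>L) (adj U_op) ^^ n) id_blinfun = T_op (aff 1 (- int n))" for n
    by (induction n) (simp_all add: T_op_one[simplified] adj_U_op_comp[simplified] minus_diff_commute)
  ultimately show ?thesis by (simp add: U_pow_def)
qed

text \<open>The spanning elements \<open>V\<^sub>a U\<^sup>k V\<^sub>b\<^sup>*\<close>.\<close>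

definition mon :: "nat \<Rightarrow> int \<Rightarrow> nat \<Rightarrow> operator" where
  "mon a k b = V_op a o\<^sub>L U_pow k o\<^sub>L adj (V_op b)"

lemma coord_mon:
  assumes "0 < a" "0 < b" "0 < m"
  shows "coord (blinfun_apply (mon a k b) \<xi>) m j =
    (if a dvd m then coord \<xi> (b * (m div a)) (j - k * int (m div a)) else 0)"
proof (cases "a dvd m")
  case True
  then have "0 < m div a" using assms by (auto elim: dvdE)
  with True assms show ?thesis by (simp add: mon_def V_op_def U_pow_eq coord_T_op coord_adj_T_op)
qed (use assms in \<open>simp add: mon_def V_op_def coord_T_op\<close>)

lemma mon_adjointable: "mon a k b \<in> adjointable"
  unfolding mon_def V_op_def U_pow_eq
  by (intro adjointable_intros T_op_adjointable adj_adjointable)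

lemma T_op_eq_mon: "0 < a \<Longrightarrow> T_op (aff a k) = mon a k 1"
  by (rule operator_eqI) (simp add: coord_T_op coord_mon)

lemma V_op_eq_mon: "0 < a \<Longrightarrow> V_op a = mon a 0 1"
  unfolding V_op_def by (rule T_op_eq_mon)

lemma U_pow_eq_mon: "U_pow k = mon 1 k 1"
  unfolding U_pow_eq by (rule T_op_eq_mon) simp

lemma mon_one: "mon 1 0 1 = id_blinfun"
  using T_op_eq_mon[of 1 0] T_op_one by simp

lemma adj_mon:
  assumes "0 < a" "0 < b" shows "adj (mon a k b) = mon b (- k) a"
proof -
  have "adj (T_op (aff 1 k)) = T_op (aff 1 (- k))"
    by (rule operator_eqI) (simp add: coord_T_op coord_adj_T_op)
  then show ?thesis
    by (simp add: mon_def U_pow_eq V_op_def adj_compose adj_adj T_op_adjointable adjointable_intros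
        adj_adjointable compose_assoc)
qed

text \<open>Writing \<open>g\<close> for the greatest common divisor of \<open>b\<close> and \<open>c\<close>, the product rests on
  \<open>V\<^sub>b\<^sup>* V\<^sub>c = V\<^bsub>c/g\<^esub> V\<^bsub>b/g\<^esub>\<^sup>*\<close> and on the commutation \<open>U V\<^sub>c = V\<^sub>c U\<^sup>c\<close>.\<close>

lemma mon_comp:
  assumes a: "0 < a" and b: "0 < b" and c: "0 < c" and d: "0 < d"
  shows "mon a k b o\<^sub>L mon c l d =
    mon (a * (c div gcd b c)) (k * int (c div gcd b c) + l * int (b div gcd b c)) (d * (b div gcd b c))"
proof -
  define g where "g = gcd b c"
  obtain b' c' where b': "b = b' * g" and c': "c = c' * g" and cop: "coprime b' c'"
    using gcd_coprime_exists[of b c] b unfolding g_def by auto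
  have g: "0 < g" and pos: "0 < b'" "0 < c'" using b c b' c' by (auto intro: Nat.gr0I)
  have div: "b div g = b'" "c div g = c'" using g b' c' by simp_all
  show ?thesis
    unfolding g_def[symmetric] div
  proof (rule operator_eqI)
    fix \<xi> m j assume m: "0 < (m::nat)"
    show "coord (blinfun_apply (mon a k b o\<^sub>L mon c l d) \<xi>) m j =
      coord (blinfun_apply (mon (a * c') (k * int c' + l * int b') (d * b')) \<xi>) m j"
    proof (cases "a dvd m")
      case True
      then obtain q where q: "m = a * q" by blast
      then have q0: "0 < q" using m by simp
      have dvd: "c dvd b * q \<longleftrightarrow> c' dvd q"
      proof -
        have "c dvd b * q \<longleftrightarrow> g * c' dvd g * (b' * q)" using b' c' by (simp add: mult_ac)
        also have "\<dots> \<longleftrightarrow> c' dvd q"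
          using g cop by (simp add: coprime_dvd_mult_right_iff coprime_commute)
        finally show ?thesis .
      qed
      show ?thesis
      proof (cases "c' dvd q")
        case True
        then obtain r where r: "q = c' * r" by blast
        have e: "b * q div c = b' * r"
        proof -
          have "b * q = c * (b' * r)" using b' c' r by simp
          then show ?thesis using c by simp
        qed
        have md: "m div a = q" "m div (a * c') = r" "a * c' dvd m" using q r a pos by auto
        have iq: "int q = int c' * int r" using r by simp
        have cd: "c dvd b * q" using True dvd by blast
        show ?thesis
          using a b c d m pos q0 iq \<open>a dvd m\<close> by (simp add: coord_mon md e cd algebra_simps)
      next
        case False
        then have "\<not> a * c' dvd m" using q a by simp
        moreover have "m div a = q" using q a by simp
        ultimately show ?thesis using False dvd a b c d m pos q0 q by (simp add: coord_mon)
      qed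
    next
      case False
      then have "\<not> a * c' dvd m" using dvd_mult_left by blast
      with False show ?thesis using a b c d m pos by (simp add: coord_mon)
    qed
  qed
qed

inductive_set toep_span :: "operator set" where
  mon: "0 < a \<Longrightarrow> 0 < b \<Longrightarrow> mon a k b \<in> toep_span"
| add: "x \<in> toep_span \<Longrightarrow> y \<in> toep_span \<Longrightarrow> x + y \<in> toep_span"
| cmult: "x \<in> toep_span \<Longrightarrow> cmult c o\<^sub>L x \<in> toep_span"

lemma cmult_zero: "cmult 0 = 0"
  by (rule blinfun_eqI, rule ell2_eqI) (simp add: cmult.rep_eq ell2_rep)

lemma cmult_one: "cmult 1 = id_blinfun"
  by (rule blinfun_eqI, rule ell2_eqI) (simp add: cmult.rep_eq ell2_rep)

lemma cmult_mult: "cmult c o\<^sub>L cmult d = cmult (c * d)"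
  by (rule blinfun_eqI, rule ell2_eqI) (simp add: cmult.rep_eq ell2_rep)

lemma cmult_add: "cmult (c + d) = cmult c + cmult d"
  by (rule blinfun_eqI, rule ell2_eqI) (simp add: cmult.rep_eq ell2_rep blinfun.add_left algebra_simps)

lemma cmult_of_real: "cmult (of_real r) o\<^sub>L x = r *\<^sub>R x"
  by (rule blinfun_eqI) (simp add: cmult.rep_eq cscale_of_real blinfun.scaleR_left)

lemma cmult_minus_one: "cmult (- 1) o\<^sub>L x = - x"
  using cmult_of_real[of "-1" x] by simp

lemma norm_cmult_compose_le: "norm (cmult c o\<^sub>L x) \<le> cmod c * norm x"
proof (rule norm_blinfun_bound)
  fix \<xi> show "norm (blinfun_apply (cmult c o\<^sub>L x) \<xi>) \<le> cmod c * norm x * norm \<xi>"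
    by (simp add: cmult.rep_eq norm_cscale mult_left_mono norm_blinfun mult.assoc)
qed simp

lemmas compose_linear =
  bounded_bilinear.add_left[OF bounded_bilinear_blinfun_compose]
  bounded_bilinear.add_right[OF bounded_bilinear_blinfun_compose]
  bounded_bilinear.diff_left[OF bounded_bilinear_blinfun_compose]
  bounded_bilinear.diff_right[OF bounded_bilinear_blinfun_compose]
  bounded_bilinear.minus_left[OF bounded_bilinear_blinfun_compose]
  bounded_bilinear.minus_right[OF bounded_bilinear_blinfun_compose]
  bounded_bilinear.zero_left[OF bounded_bilinear_blinfun_compose]
  bounded_bilinear.zero_right[OF bounded_bilinear_blinfun_compose]

lemma toep_span_adjointable: "x \<in> toep_span \<Longrightarrow> x \<in> adjointable"
  by (induction rule: toep_span.induct) (auto intro: mon_adjointable adjointable_intros)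

lemma toep_span_zero: "0 \<in> toep_span"
  using toep_span.cmult[OF toep_span.mon[of 1 1 0], of 0] by (simp add: cmult_zero compose_linear)

lemma toep_span_comp:
  assumes "x \<in> toep_span" "y \<in> toep_span" shows "x o\<^sub>L y \<in> toep_span"
  using assms
proof (induction arbitrary: y rule: toep_span.induct)
  case (mon a b k)
  from mon(3) show ?case
  proof (induction rule: toep_span.induct)
    case (mon c d l)
    have "0 < c div gcd b c" "0 < b div gcd b c"
      using \<open>0 < b\<close> \<open>0 < c\<close> by (simp_all add: div_greater_zero_iff dvd_imp_le)
    with mon \<open>0 < a\<close> \<open>0 < b\<close> show ?case by (simp add: mon_comp toep_span.mon)
  next
    case (cmult x c)
    have "mon a k b o\<^sub>L (cmult c o\<^sub>L x) = cmult c o\<^sub>L (mon a k b o\<^sub>L x)"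
      by (metis compose_assoc compose_cmult mon_adjointable)
    with cmult show ?case by (simp add: toep_span.cmult)
  qed (simp add: compose_linear toep_span.add)
qed (simp_all add: compose_linear toep_span.add toep_span.cmult compose_assoc)

lemma toep_span_adj: "x \<in> toep_span \<Longrightarrow> adj x \<in> toep_span"
proof (induction rule: toep_span.induct)
  case (cmult x c)
  then show ?case by (simp add: adj_cmult toep_span_adjointable toep_span.cmult)
qed (simp_all add: adj_mon adj_add toep_span_adjointable toep_span.intros)

lemma cstar_subalgebra_closure_toep_span: "cstar_subalgebra (closure toep_span)"
proof -
  have adjble: "x \<in> adjointable" if "x \<in> closure toep_span" for x
    using that closure_minimal[OF _ closed_adjointable] toep_span_adjointable by blast
  have add: "x + y \<in> closure toep_span" and comp: "x o\<^sub>L y \<in> closure toep_span"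
    if xy: "x \<in> closure toep_span" "y \<in> closure toep_span" for x y
  proof -
    obtain f g where f: "\<And>n. f n \<in> toep_span" "f \<longlonglongrightarrow> x" and g: "\<And>n. g n \<in> toep_span" "g \<longlonglongrightarrow> y"
      using closure_sequential[THEN iffD1, OF xy(1)] closure_sequential[THEN iffD1, OF xy(2)] by auto
    show "x + y \<in> closure toep_span"
      unfolding closure_sequential using f g
      by (intro exI[of _ "\<lambda>n. f n + g n"]) (auto intro: tendsto_add toep_span.add)
    show "x o\<^sub>L y \<in> closure toep_span"
      unfolding closure_sequential using f g
      by (intro exI[of _ "\<lambda>n. f n o\<^sub>L g n"])
        (auto intro: bounded_bilinear.tendsto[OF bounded_bilinear_blinfun_compose] toep_span_comp)
  qed
  have adj: "adj x \<in> closure toep_span" if x: "x \<in> closure toep_span" for x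
    unfolding closure_approachable
  proof (intro allI impI)
    fix e :: real assume "0 < e"
    then obtain y where y: "y \<in> toep_span" "dist y x < e" using x closure_approachable by blast
    have "dist (adj y) (adj x) = dist y x"
      using adjble[OF x] toep_span_adjointable[OF y(1)]
      by (simp add: dist_norm adj_diff[symmetric] norm_adj adjointable_intros)
    with y show "\<exists>y\<in>toep_span. dist y (adj x) < e" using toep_span_adj by force
  qed
  have cmult: "cmult c o\<^sub>L x \<in> closure toep_span" if x: "x \<in> closure toep_span" for x c
  proof -
    obtain f where f: "\<And>n. f n \<in> toep_span" "f \<longlonglongrightarrow> x" using x unfolding closure_sequential by blast
    then show ?thesis unfolding closure_sequential
      by (intro exI[of _ "\<lambda>n. cmult c o\<^sub>L f n"])
        (auto intro: bounded_bilinear.tendsto[OF bounded_bilinear_blinfun_compose] toep_span.cmult)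
  qed
  have "0 \<in> closure toep_span" using toep_span_zero closure_subset by blast
  then show ?thesis unfolding cstar_subalgebra_def
    using add comp adj cmult by simp
qed

lemma cstar_subalgebra_toeplitz: "cstar_subalgebra toeplitz"
  unfolding toeplitz_def
proof (rule hull_in)
  fix T :: "operator set set" assume "Ball T cstar_subalgebra"
  then show "cstar_subalgebra (\<Inter> T)"
    unfolding cstar_subalgebra_def by (auto intro: closed_Inter)
qed

text \<open>The monomials are closed under products and adjoints, and they contain the generators; since the algebraic operations are continuous on adjointable operators, the closure of their span is a C*-algebra.\<close>

theorem toeplitz_eq_closure: "toeplitz = closure toep_span"
proof
  have "range T_op \<subseteq> toep_span"
  proof safe
    fix s obtain a k where "0 < a" "s = aff a k" by (rule aff_cases)
    then show "T_op s \<in> toep_span" by (simp add: T_op_eq_mon toep_span.mon)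
  qed
  then show "toeplitz \<subseteq> closure toep_span"
    unfolding toeplitz_def using closure_subset
    by (intro hull_minimal cstar_subalgebra_closure_toep_span) blast
  have T: "T_op s \<in> toeplitz" for s using hull_subset[of "range T_op" cstar_subalgebra] unfolding toeplitz_def by auto
  have C: "x o\<^sub>L y \<in> toeplitz" if "x \<in> toeplitz" "y \<in> toeplitz" for x y
    using cstar_subalgebra_toeplitz that by (simp add: cstar_subalgebra_def)
  have D: "adj x \<in> toeplitz" if "x \<in> toeplitz" for x
    using cstar_subalgebra_toeplitz that by (simp add: cstar_subalgebra_def)
  have "x \<in> toeplitz" if "x \<in> toep_span" for x
    using that
  proof (induction rule: toep_span.induct)
    case (mon a b k)
    show ?case unfolding mon_def V_op_def U_pow_eq by (intro C D T)
  qed (use cstar_subalgebra_toeplitz in \<open>auto simp: cstar_subalgebra_def\<close>)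
  then show "closure toep_span \<subseteq> toeplitz"
    using cstar_subalgebra_toeplitz unfolding cstar_subalgebra_def by (intro closure_minimal) auto
qed

lemma toep_span_toeplitz: "x \<in> toep_span \<Longrightarrow> x \<in> toeplitz"
  unfolding toeplitz_eq_closure using closure_subset by blast

lemma mon_toeplitz: "0 < a \<Longrightarrow> 0 < b \<Longrightarrow> mon a k b \<in> toeplitz"
  by (intro toep_span_toeplitz toep_span.mon)

lemma toeplitz_adjointable: "x \<in> toeplitz \<Longrightarrow> x \<in> adjointable"
  unfolding toeplitz_eq_closure
  using closure_minimal[OF _ closed_adjointable] toep_span_adjointable by blast

lemma closed_toeplitz: "closed toeplitz"
  using cstar_subalgebra_toeplitz unfolding cstar_subalgebra_def by blast

lemma toeplitz_approx:
  assumes "x \<in> toeplitz" "0 < e" obtains y where "y \<in> toep_span" "norm (x - y) < e"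
  using assms unfolding toeplitz_eq_closure closure_approachable dist_norm
  by (metis norm_minus_commute)

lemma id_toeplitz: "id_blinfun \<in> toeplitz"
  using mon_toeplitz[of 1 1 0] mon_one by simp

lemma toeplitz_add: "x \<in> toeplitz \<Longrightarrow> y \<in> toeplitz \<Longrightarrow> x + y \<in> toeplitz"
  and toeplitz_comp: "x \<in> toeplitz \<Longrightarrow> y \<in> toeplitz \<Longrightarrow> x o\<^sub>L y \<in> toeplitz"
  and toeplitz_adj: "x \<in> toeplitz \<Longrightarrow> adj x \<in> toeplitz"
  and toeplitz_cmult: "x \<in> toeplitz \<Longrightarrow> cmult c o\<^sub>L x \<in> toeplitz"
  and toeplitz_zero: "0 \<in> toeplitz"
  using cstar_subalgebra_toeplitz by (simp_all add: cstar_subalgebra_def)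

lemma toeplitz_scaleR: "x \<in> toeplitz \<Longrightarrow> r *\<^sub>R x \<in> toeplitz"
  using toeplitz_cmult[of x "of_real r"] by (simp add: cmult_of_real)

lemma toeplitz_minus: "x \<in> toeplitz \<Longrightarrow> - x \<in> toeplitz"
  using toeplitz_cmult[of x "-1"] by (simp add: cmult_minus_one)

lemma toeplitz_diff: "x \<in> toeplitz \<Longrightarrow> y \<in> toeplitz \<Longrightarrow> x - y \<in> toeplitz"
  using toeplitz_add[of x "- y"] toeplitz_minus[of y] by simp

lemmas toeplitz_intros = toeplitz_add toeplitz_comp toeplitz_adj toeplitz_cmult toeplitz_zero
  toeplitz_scaleR toeplitz_minus toeplitz_diff id_toeplitz mon_toeplitz

section \<open>Trigonometric polynomials\<close>

text \<open>A trigonometric polynomial is paired with its value at \<open>U\<close>, so that no choice of coefficients is needed. Only the values on the circle matter, whence the last rule: \<open>z\<^sup>k z\<^sup>l\<close> and \<open>z\<^bsup>k+l\<^esup>\<close> differ at \<open>0\<close> for \<open>k = -l\<close>.\<close>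

inductive trig :: "(complex \<Rightarrow> complex) \<Rightarrow> operator \<Rightarrow> bool" where
  mono: "trig (\<lambda>z. z powi k) (U_pow k)"
| add: "trig p P \<Longrightarrow> trig q Q \<Longrightarrow> trig (\<lambda>z. p z + q z) (P + Q)"
| cmult: "trig p P \<Longrightarrow> trig (\<lambda>z. c * p z) (cmult c o\<^sub>L P)"
| cong: "trig p P \<Longrightarrow> (\<And>z. z \<in> circle \<Longrightarrow> p z = q z) \<Longrightarrow> trig q P"

lemma circle_nonzero: "z \<in> circle \<Longrightarrow> z \<noteq> 0"
  by auto

lemma cnj_circle: "z \<in> circle \<Longrightarrow> cnj z = inverse z"
  using complex_norm_square[of z] by (simp add: inverse_unique)

lemma cnj_powi_circle: "z \<in> circle \<Longrightarrow> cnj (z powi k) = z powi (- k)"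
  by (simp only: complex_cnj_power_int cnj_circle power_int_minus power_int_inverse)

lemma continuous_on_powi_circle [continuous_intros]: "continuous_on circle (\<lambda>z::complex. z powi k)"
  by (auto intro!: continuous_intros)

lemma trig_continuous: "trig p P \<Longrightarrow> continuous_on circle p"
proof (induction rule: trig.induct)
  case (cong p P q)
  then show ?case using continuous_on_cong by metis
qed (auto intro!: continuous_intros)

lemma trig_toep_span: "trig p P \<Longrightarrow> P \<in> toep_span"
  by (induction rule: trig.induct) (auto simp: U_pow_eq_mon intro: toep_span.intros)

lemmas trig_adjointable = toep_span_adjointable[OF trig_toep_span]

lemma U_pow_comp: "U_pow k o\<^sub>L U_pow l = U_pow (k + l)"
  by (rule operator_eqI) (simp add: U_pow_eq coord_T_op[where a=1, simplified] algebra_simps)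

lemma adj_U_pow: "adj (U_pow k) = U_pow (- k)"
  by (simp add: U_pow_eq_mon adj_mon)

lemma U_pow_adjointable: "U_pow k \<in> adjointable"
  by (simp add: U_pow_eq T_op_adjointable)

lemma blinfun_compose_id_right: "x o\<^sub>L id_blinfun = x" and blinfun_compose_id_left: "id_blinfun o\<^sub>L x = x"
  by (rule blinfun_eqI, simp)+

lemma U_pow_0: "U_pow 0 = id_blinfun" by (simp add: U_pow_def)

lemma trig_const: "trig (\<lambda>_. c) (cmult c)"
  using trig.cmult[OF trig.mono[of 0], of c] by (simp add: U_pow_0 blinfun_compose_id_right)

lemma trig_mult:
  assumes "trig p P" "trig q Q" shows "trig (\<lambda>z. p z * q z) (P o\<^sub>L Q)"
  using assms
proof (induction arbitrary: q Q rule: trig.induct)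
  case (mono k)
  then show ?case
  proof (induction rule: trig.induct)
    case (mono l)
    show ?case unfolding U_pow_comp
      by (rule trig.cong[OF trig.mono]) (auto simp: power_int_add circle_nonzero)
  next
    case (add p P q Q)
    then show ?case using trig.add by (fastforce simp: compose_linear distrib_left)
  next
    case (cmult p P c)
    have "U_pow k o\<^sub>L (cmult c o\<^sub>L P) = cmult c o\<^sub>L (U_pow k o\<^sub>L P)"
      by (metis compose_assoc compose_cmult U_pow_adjointable)
    with trig.cmult[OF cmult.IH, of c] show ?case by (simp add: mult_ac)
  next
    case (cong p P q)
    then show ?case using trig.cong[OF cong.IH] by simp
  qed
next
  case (add p P p' P')
  then show ?case using trig.add[OF add.IH(1)[OF add.prems] add.IH(2)[OF add.prems]]
    by (simp add: compose_linear distrib_right)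
next
  case (cmult p P c)
  then show ?case using trig.cmult[OF cmult.IH[OF cmult.prems], of c] by (simp add: compose_assoc mult_ac)
next
  case (cong p P p')
  then show ?case using trig.cong[OF cong.IH[OF cong.prems]] by simp
qed

lemma trig_cnj: "trig p P \<Longrightarrow> trig (\<lambda>z. cnj (p z)) (adj P)"
proof (induction rule: trig.induct)
  case (mono k)
  show ?case unfolding adj_U_pow by (rule trig.cong[OF trig.mono]) (simp only: cnj_powi_circle)
next
  case (add p P q Q)
  then show ?case using trig.add[OF add.IH] by (simp add: adj_add trig_adjointable)
next
  case (cmult p P c)
  then show ?case using trig.cmult[OF cmult.IH, of "cnj c"] by (simp add: adj_cmult trig_adjointable)
next
  case (cong p P q)
  then show ?case using trig.cong[OF cong.IH] by simp
qed

lemma trig_real_polynomial: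
  fixes q :: "complex \<Rightarrow> real"
  assumes "real_polynomial_function q" shows "\<exists>P. trig (\<lambda>z. complex_of_real (q z)) P"
  using assms
proof (induction rule: real_polynomial_function.induct)
  case (linear f)
  interpret bounded_linear f by fact
  have f: "f z = Re z * f 1 + Im z * f \<i>" for z
  proof -
    have "f z = f (Re z *\<^sub>R 1 + Im z *\<^sub>R \<i>)" by (simp add: scaleR_conv_of_real complex_eq[symmetric] mult.commute)
    then show ?thesis by (simp only: add scaleR real_scaleR_def)
  qed
  let ?a = "of_real (f 1) / 2 + of_real (f \<i>) / (2 * \<i>)" and ?b = "of_real (f 1) / 2 - of_real (f \<i>) / (2 * \<i>)"
  have "trig (\<lambda>z. complex_of_real (f z)) ((cmult ?a o\<^sub>L U_pow 1) + (cmult ?b o\<^sub>L U_pow (-1)))"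
  proof (rule trig.cong[OF trig.add[OF trig.cmult[OF trig.mono] trig.cmult[OF trig.mono]]])
    fix z :: complex assume z: "z \<in> circle"
    have "?a * z powi 1 + ?b * z powi - 1 = ?a * z + ?b * cnj z"
      using z by (simp add: power_int_minus cnj_circle)
    also have "\<dots> = of_real (f z)"
      unfolding f[of z] by (simp add: complex_eq_iff field_simps)
    finally show "?a * z powi 1 + ?b * z powi - 1 = of_real (f z)" .
  qed
  then show ?case by blast
next
  case (const c)
  then show ?case using trig_const by blast
next
  case (add f g)
  then obtain P Q where "trig (\<lambda>z. complex_of_real (f z)) P" "trig (\<lambda>z. complex_of_real (g z)) Q" by blast
  from trig.add[OF this] show ?case by auto
next
  case (mult f g)
  then obtain P Q where "trig (\<lambda>z. complex_of_real (f z)) P" "trig (\<lambda>z. complex_of_real (g z)) Q" by blast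
  from trig_mult[OF this] show ?case by auto
qed

text \<open>Stone-Weierstrass gives real polynomials in \<open>Re z\<close> and \<open>Im z\<close>, which are trigonometric because \<open>cnj z = z\<^bsup>-1\<^esup>\<close> on the circle.\<close>

lemma trig_dense:
  assumes f: "continuous_on circle f" and "0 < e"
  obtains p P where "trig p P" "\<And>z. z \<in> circle \<Longrightarrow> cmod (f z - p z) < e"
proof -
  have "compact circle" by simp
  then obtain g where g: "polynomial_function g" "\<And>z. z \<in> circle \<Longrightarrow> norm (f z - g z) < e"
    using Stone_Weierstrass_polynomial_function[OF _ f \<open>0 < e\<close>] by auto
  have "real_polynomial_function (\<lambda>z. Re (g z))" "real_polynomial_function (\<lambda>z. Im (g z))"
    using g(1) bounded_linear_Re bounded_linear_Im unfolding polynomial_function_def o_def by blast+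
  then obtain P Q where "trig (\<lambda>z. of_real (Re (g z))) P" "trig (\<lambda>z. of_real (Im (g z))) Q"
    using trig_real_polynomial by blast
  then have "trig (\<lambda>z. of_real (Re (g z)) + \<i> * of_real (Im (g z))) (P + (cmult \<i> o\<^sub>L Q))"
    by (intro trig.add trig.cmult)
  then have "trig g (P + (cmult \<i> o\<^sub>L Q))" by (simp add: complex_eq[symmetric])
  with g that show ?thesis by blast
qed

section \<open>Measures on the circle and their moments\<close>

lemma circle_prob_space: "\<nu> \<in> circle_prob \<Longrightarrow> space \<nu> = circle"
  unfolding circle_prob_def using sets_eq_imp_space_eq[of \<nu> "restrict_space borel circle"]
  by (simp add: space_restrict_space)

lemma circle_continuous_measurable:
  fixes f :: "complex \<Rightarrow> 'b::{banach, second_countable_topology}"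
  assumes "\<nu> \<in> circle_prob" "continuous_on circle f" shows "f \<in> borel_measurable \<nu>"
proof -
  have "f \<in> borel_measurable (restrict_space borel circle)"
    using assms(2) by (intro borel_measurable_continuous_on_restrict)
  moreover have "sets \<nu> = sets (restrict_space borel circle)" using assms(1) by (simp add: circle_prob_def)
  ultimately show ?thesis by (simp cong: measurable_cong_sets)
qed

lemma circle_continuous_bounded:
  fixes f :: "complex \<Rightarrow> 'b::real_normed_vector"
  assumes "continuous_on circle f" obtains B where "\<And>z. z \<in> circle \<Longrightarrow> norm (f z) \<le> B"
proof -
  have "compact (f ` circle)" using assms by (intro compact_continuous_image) auto
  then show ?thesis using that compact_imp_bounded bounded_iff by (metis imageI)
qed

lemma circle_integrable:
  fixes f :: "complex \<Rightarrow> 'b::{banach, second_countable_topology}"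
  assumes "\<nu> \<in> circle_prob" "continuous_on circle f" shows "integrable \<nu> f"
proof -
  interpret prob_space \<nu> using assms(1) by (simp add: circle_prob_def)
  obtain B where B: "\<And>z. z \<in> circle \<Longrightarrow> norm (f z) \<le> B" using circle_continuous_bounded[OF assms(2)] by blast
  show ?thesis
    by (rule integrable_const_bound[of _ B])
      (use B circle_prob_space[OF assms(1)] circle_continuous_measurable[OF assms] in \<open>auto intro!: AE_I2\<close>)
qed

lemma circle_integral_bound:
  fixes f :: "complex \<Rightarrow> 'b::{banach, second_countable_topology}"
  assumes \<nu>: "\<nu> \<in> circle_prob" and f: "continuous_on circle f" and B: "\<And>z. z \<in> circle \<Longrightarrow> norm (f z) \<le> B"
  shows "norm (\<integral>z. f z \<partial>\<nu>) \<le> B"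
proof -
  interpret prob_space \<nu> using \<nu> by (simp add: circle_prob_def)
  have "norm (\<integral>z. f z \<partial>\<nu>) \<le> (\<integral>z. norm (f z) \<partial>\<nu>)" by (rule integral_norm_bound)
  also have "\<dots> \<le> (\<integral>z. B \<partial>\<nu>)"
    using circle_integrable[OF \<nu>] f B circle_prob_space[OF \<nu>]
    by (intro integral_mono) (auto intro: continuous_intros)
  finally show ?thesis by (simp add: prob_space)
qed

lemma circle_integral_diff_bound:
  fixes f g :: "complex \<Rightarrow> 'b::{banach, second_countable_topology}"
  assumes \<nu>: "\<nu> \<in> circle_prob" and f: "continuous_on circle f" and g: "continuous_on circle g"
    and B: "\<And>z. z \<in> circle \<Longrightarrow> norm (f z - g z) \<le> B"
  shows "norm ((\<integral>z. f z \<partial>\<nu>) - (\<integral>z. g z \<partial>\<nu>)) \<le> B"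
proof -
  have "norm (\<integral>z. f z - g z \<partial>\<nu>) \<le> B"
    using f g by (intro circle_integral_bound[OF \<nu> _ B] continuous_intros)
  then show ?thesis using circle_integrable[OF \<nu> f] circle_integrable[OF \<nu> g] by simp
qed

text \<open>Closed sets generate the Borel sets and are stable under intersection, and the indicator of a
  closed set is a bounded pointwise limit of continuous functions.  Formulating the uniqueness of
  the representing measure for a convex combination yields the affinity of the
  correspondence between states and measures at the same time.\<close>

lemma circle_measure_combination:
  assumes \<nu>: "\<nu> \<in> circle_prob" "\<nu>1 \<in> circle_prob" "\<nu>2 \<in> circle_prob"
    and eq: "\<And>f :: complex \<Rightarrow> complex. continuous_on circle f \<Longrightarrow>
      (\<integral>z. f z \<partial>\<nu>) = of_real (1 - t) * (\<integral>z. f z \<partial>\<nu>1) + of_real t * (\<integral>z. f z \<partial>\<nu>2)"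
    and E: "E \<in> sets (restrict_space borel circle)"
  shows "measure \<nu> E = (1 - t) * measure \<nu>1 E + t * measure \<nu>2 E"
proof -
  have sets: "sets m = sets (restrict_space borel circle)" if "m \<in> circle_prob" for m
    using that by (simp add: circle_prob_def)
  have real_eq: "(\<integral>z. f z \<partial>\<nu>) = (1 - t) * (\<integral>z. f z \<partial>\<nu>1) + t * (\<integral>z. f z \<partial>\<nu>2)"
    if "continuous_on circle f" for f :: "complex \<Rightarrow> real"
  proof -
    have "continuous_on circle (\<lambda>z. complex_of_real (f z))" using that by (intro continuous_intros)
    from eq[OF this] have "complex_of_real (\<integral>z. f z \<partial>\<nu>) =
        of_real ((1 - t) * (\<integral>z. f z \<partial>\<nu>1) + t * (\<integral>z. f z \<partial>\<nu>2))"
      by simp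
    then show ?thesis by (simp only: of_real_eq_iff)
  qed
  have meas: "circle \<inter> A \<in> sets m" if "m \<in> circle_prob" "A \<in> sets borel" for m A
    using that sets[OF that(1)] by (auto simp: sets_restrict_space)
  let ?P = "\<lambda>A. measure \<nu> (circle \<inter> A) = (1 - t) * measure \<nu>1 (circle \<inter> A) + t * measure \<nu>2 (circle \<inter> A)"
  have closed: "?P C" if C: "closed C" for C
  proof (cases "circle \<inter> C = {}")
    case False
    let ?C = "circle \<inter> C"
    have clC: "closed ?C" using C by (intro closed_Int) auto
    define g where "g n z = max 0 (1 - real n * infdist z ?C)" for n z
    have g01: "0 \<le> g n z" "g n z \<le> 1" for n z by (auto simp: g_def infdist_nonneg)
    have cont: "continuous_on circle (g n)" for n unfolding g_def by (intro continuous_intros)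
    have lim: "(\<lambda>n. g n z) \<longlonglongrightarrow> indicat_real ?C z" for z
    proof (cases "z \<in> ?C")
      case True
      then show ?thesis by (simp add: g_def)
    next
      case F: False
      then have pos: "0 < infdist z ?C"
        using in_closed_iff_infdist_zero[OF clC False, of z] infdist_nonneg[of z ?C] by linarith
      obtain N where N: "1 / infdist z ?C < real N" using reals_Archimedean2 by blast
      have "g n z = 0" if "N \<le> n" for n
      proof -
        have "1 < real N * infdist z ?C" using N pos by (simp add: field_simps)
        also have "\<dots> \<le> real n * infdist z ?C" using that pos by (intro mult_right_mono) auto
        finally show ?thesis by (simp add: g_def)
      qed
      then have "\<forall>\<^sub>F n in sequentially. g n z = 0" using eventually_sequentially by blast
      then have "(\<lambda>n. g n z) \<longlonglongrightarrow> 0" by (rule tendsto_eventually)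
      with F show ?thesis by simp
    qed
    have int: "(\<lambda>n. \<integral>z. g n z \<partial>m) \<longlonglongrightarrow> measure m ?C" if m: "m \<in> circle_prob" for m
    proof -
      interpret prob_space m using m by (simp add: circle_prob_def)
      have "(\<lambda>n. \<integral>z. g n z \<partial>m) \<longlonglongrightarrow> (\<integral>z. indicat_real ?C z \<partial>m)"
        using g01 lim meas[OF m, of C] C circle_continuous_measurable[OF m cont]
        by (intro integral_dominated_convergence[where w = "\<lambda>_. 1"]) auto
      then show ?thesis using meas[OF m, of C] C by simp
    qed
    have "(\<lambda>n. \<integral>z. g n z \<partial>\<nu>) \<longlonglongrightarrow> (1 - t) * measure \<nu>1 ?C + t * measure \<nu>2 ?C"
      unfolding real_eq[OF cont] by (intro tendsto_intros int \<nu>)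
    with int[OF \<nu>(1)] show ?thesis using LIMSEQ_unique by blast
  qed simp
  have "?P A" if "A \<in> sets borel" for A
  proof -
    have borel: "sets (borel :: complex measure) = sigma_sets UNIV {C. closed C}"
      unfolding borel_eq_closed by (rule sets_measure_of) simp
    have "Int_stable {C :: complex set. closed C}" "{C :: complex set. closed C} \<subseteq> Pow UNIV"
      "A \<in> sigma_sets UNIV {C. closed C}"
      using that borel by (auto simp: Int_stable_def)
    then show ?thesis
    proof (induction rule: sigma_sets_induct_disjoint)
      case (basic A) then show ?case using closed by simp
    next
      case (compl A)
      then have A: "A \<in> sets borel" by (simp add: borel)
      have c: "measure m (circle \<inter> (UNIV - A)) = 1 - measure m (circle \<inter> A)" if m: "m \<in> circle_prob" for m
      proof -
        interpret prob_space m using m by (simp add: circle_prob_def)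
        have "circle \<inter> (UNIV - A) = space m - circle \<inter> A" using circle_prob_space[OF m] by auto
        then show ?thesis using prob_compl[OF meas[OF m A]] by simp
      qed
      show ?case unfolding c[OF \<nu>(1)] c[OF \<nu>(2)] c[OF \<nu>(3)] compl(2) by (simp add: algebra_simps)
    next
      case (union A)
      then have A: "A i \<in> sets borel" for i by (auto simp: borel)
      have c: "(\<lambda>i. measure m (circle \<inter> A i)) sums measure m (circle \<inter> \<Union> (range A))" if m: "m \<in> circle_prob" for m
      proof -
        interpret prob_space m using m by (simp add: circle_prob_def)
        have "(\<lambda>i. measure m (circle \<inter> A i)) sums measure m (\<Union>i. circle \<inter> A i)"
          using meas[OF m A] union(1) by (intro finite_measure_UNION) (auto simp: disjoint_family_on_def)
        moreover have "(\<Union>i. circle \<inter> A i) = circle \<inter> \<Union> (range A)" by blast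
        ultimately show ?thesis by simp
      qed
      have "(\<lambda>i. measure \<nu> (circle \<inter> A i)) sums ((1 - t) * measure \<nu>1 (circle \<inter> \<Union> (range A)) + t * measure \<nu>2 (circle \<inter> \<Union> (range A)))"
        unfolding union(3) by (intro sums_add sums_mult c \<nu>)
      with c[OF \<nu>(1)] show ?case using sums_unique2 by blast
    qed simp
  qed
  moreover obtain A where "A \<in> sets borel" "E = circle \<inter> A" using E by (auto simp: sets_restrict_space)
  ultimately show ?thesis by blast
qed

lemma circle_measure_eqI:
  assumes \<nu>: "\<nu> \<in> circle_prob" "\<nu>' \<in> circle_prob"
    and eq: "\<And>f :: complex \<Rightarrow> complex. continuous_on circle f \<Longrightarrow> (\<integral>z. f z \<partial>\<nu>) = (\<integral>z. f z \<partial>\<nu>')"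
  shows "\<nu> = \<nu>'"
proof (rule measure_eqI)
  interpret a: prob_space \<nu> using \<nu> by (simp add: circle_prob_def)
  interpret b: prob_space \<nu>' using \<nu> by (simp add: circle_prob_def)
  show "sets \<nu> = sets \<nu>'" using \<nu> by (simp add: circle_prob_def)
  fix A assume "A \<in> sets \<nu>"
  then have "A \<in> sets (restrict_space borel circle)" using \<nu> by (simp add: circle_prob_def)
  then have "measure \<nu> A = measure \<nu>' A"
    using circle_measure_combination[OF \<nu>(1,2,2), of 0 A] eq by simp
  then show "emeasure \<nu> A = emeasure \<nu>' A" by (simp add: a.emeasure_eq_measure b.emeasure_eq_measure)
qed

section \<open>Positive-definite sequences are moment sequences\<close>

lemma sum_roots_of_unity:
  assumes "\<bar>m\<bar> < int M"
  shows "(\<Sum>r<M. cis (2 * pi * real r / real M) powi m) = (if m = 0 then of_nat M else 0)"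
proof (cases "m = 0")
  case False
  have M: "0 < M" using assms by auto
  let ?x = "cis (2 * pi * real_of_int m / real M)"
  have pow: "cis (2 * pi * real r / real M) powi m = ?x ^ r" for r
    by (simp add: Complex.DeMoivre cis_power_int mult_ac)
  have "?x \<noteq> 1"
  proof
    assume "?x = 1"
    then have "exp (\<i> * complex_of_real (2 * pi * real_of_int m / real M)) = 1" by (simp add: cis_conv_exp)
    then obtain n :: int where "2 * pi * real_of_int m / real M = real_of_int (2 * n) * pi"
      by (auto simp: exp_eq_1)
    then have "real_of_int m = real_of_int n * real M" using M by (simp add: field_simps)
    then have "real_of_int m = real_of_int (n * int M)" by simp
    then have eq: "m = n * int M" by (simp only: of_int_eq_iff)
    with False have "1 \<le> \<bar>n\<bar>" by auto
    then have "int M \<le> \<bar>m\<bar>" using eq mult_right_mono[of 1 "\<bar>n\<bar>" "int M"] by (simp add: abs_mult)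
    with assms show False by simp
  qed
  moreover have "?x ^ M = 1"
  proof -
    have "?x ^ M = cis (2 * pi * real_of_int m)" using M by (simp add: Complex.DeMoivre)
    also have "\<dots> = 1" by (rule cis_multiple_2pi) simp
    finally show ?thesis .
  qed
  ultimately have "(\<Sum>r<M. ?x ^ r) = 0" by (simp add: geometric_sum)
  with False show ?thesis by (simp add: pow)
qed simp

lemma card_diagonal:
  assumes "\<bar>k\<bar> \<le> int N"
  shows "(\<Sum>i<N. \<Sum>j<N. if int i - int j = k then 1 else (0::complex)) = of_nat (N - nat \<bar>k\<bar>)"
proof -
  have "(\<Sum>j<N. if int i - int j = k then 1 else (0::complex)) =
      (if i \<in> {nat k ..< N - nat (- k)} then 1 else 0)" if "i < N" for i
  proof (cases "i \<in> {nat k ..< N - nat (- k)}")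
    case True
    then have "nat (int i - k) < N" "0 \<le> int i - k" by auto
    moreover have "(int i - int j = k) = (j = nat (int i - k))" for j using calculation(2) by auto
    ultimately show ?thesis using True by simp
  next
    case False
    then have "int i - int j \<noteq> k" if "j < N" for j using that \<open>i < N\<close> by auto
    then show ?thesis using False by (simp add: sum.neutral)
  qed
  then have "(\<Sum>i<N. \<Sum>j<N. if int i - int j = k then 1 else (0::complex)) =
      (\<Sum>i<N. if i \<in> {nat k ..< N - nat (- k)} then 1 else 0)"
    by (intro sum.cong) auto
  also have "\<dots> = of_nat (card ({..<N} \<inter> {nat k ..< N - nat (- k)}))"
    using sum.inter_restrict[of "{..<N}" "\<lambda>_. 1::complex" "{nat k ..< N - nat (- k)}"] by simp
  also have "{..<N} \<inter> {nat k ..< N - nat (- k)} = {nat k ..< N - nat (- k)}" by auto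
  also have "card \<dots> = N - nat \<bar>k\<bar>" using assms by auto
  finally show ?thesis .
qed

lemma fejer_weight_limit: "(\<lambda>n. real (Suc n - nat \<bar>k\<bar>) / real (Suc n)) \<longlonglongrightarrow> 1"
  proof (rule Lim_transform_eventually)
    show "(\<lambda>n. 1 - real (nat \<bar>k\<bar>) / real (Suc n)) \<longlonglongrightarrow> 1"
      using tendsto_diff[OF tendsto_const LIMSEQ_Suc[OF lim_const_over_n[of "real (nat \<bar>k\<bar>)"]], of 1]
      by simp
    show "\<forall>\<^sub>F n in sequentially. 1 - real (nat \<bar>k\<bar>) / real (Suc n) = real (Suc n - nat \<bar>k\<bar>) / real (Suc n)"
      using eventually_ge_at_top[of "nat \<bar>k\<bar>"]
      by eventually_elim (simp add: of_nat_diff field_simps)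
  qed

text \<open>The Fejer means of a positive-definite sequence are nonnegative on the circle.  Sampling the
  \<open>N\<close>-th mean at the \<open>2N\<close>-th roots of unity gives a discrete probability measure whose \<open>k\<close>-th moment
  is exactly \<open>(1 - \<bar>k\<bar>/N) c k\<close> for \<open>\<bar>k\<bar> \<le> N\<close>; the representing measure is a weak limit point.\<close>

theorem herglotz:
  fixes c :: "int \<Rightarrow> complex"
  assumes c0: "c 0 = 1"
    and pos: "\<And>N w. w \<in> circle \<Longrightarrow>
      (\<Sum>i<N. \<Sum>j<N. c (int i - int j) * w powi (int j - int i)) \<in> \<real>\<^sub>\<ge>\<^sub>0"
  obtains \<nu> where "\<nu> \<in> circle_prob" "\<And>k. (\<integral>z. z powi k \<partial>\<nu>) = c k"
proof -
  define S where "S N w = (\<Sum>i<N. \<Sum>j<N. c (int i - int j) * w powi (int j - int i))" for N w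
  define \<theta> where "\<theta> n r = 2 * pi * real r / real (2 * Suc n)" for n r
  define q where "q n r = Re (S (Suc n) (cis (\<theta> n r))) / (real (Suc n) * real (2 * Suc n))" for n r
  define A where "A n = {..<2 * Suc n}" for n
  have S: "S N (cis t) \<in> \<real>\<^sub>\<ge>\<^sub>0" for N t unfolding S_def by (rule pos) simp
  have q0: "0 \<le> q n r" for n r
    using S[of "Suc n" "\<theta> n r"] unfolding q_def by (auto elim!: nonneg_Reals_cases simp del: of_nat_Suc)
  have qS: "complex_of_real (q n r) = S (Suc n) (cis (\<theta> n r)) / (of_nat (Suc n) * of_nat (2 * Suc n))" for n r
  proof -
    have "complex_of_real (Re (S (Suc n) (cis (\<theta> n r)))) = S (Suc n) (cis (\<theta> n r))"
      using S[of "Suc n" "\<theta> n r"] by (auto elim!: nonneg_Reals_cases)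
    then show ?thesis unfolding q_def by simp
  qed
  have moment: "(\<Sum>r\<in>A n. q n r *\<^sub>R (cis (\<theta> n r) powi k)) =
      of_real (real (Suc n - nat \<bar>k\<bar>) / real (Suc n)) * c k" if k: "\<bar>k\<bar> \<le> int (Suc n)" for n k
  proof -
    define N where "N = Suc n"
    define M where "M = 2 * Suc n"
    have NM: "0 < N" "M = 2 * N" "A n = {..<M}" "\<bar>k\<bar> \<le> int N" using k by (simp_all add: N_def M_def A_def)
    have qS': "complex_of_real (q n r) = S N (cis (\<theta> n r)) / (of_nat N * of_nat M)" for r
      unfolding N_def M_def by (rule qS)
    have \<theta>': "\<theta> n r = 2 * pi * real r / real M" for r unfolding M_def \<theta>_def ..
    have "(\<Sum>r\<in>A n. q n r *\<^sub>R (cis (\<theta> n r) powi k)) =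
        (\<Sum>r<M. \<Sum>i<N. \<Sum>j<N. c (int i - int j) * (cis (\<theta> n r) powi (int j - int i) * cis (\<theta> n r) powi k))
          / (of_nat N * of_nat M)"
      unfolding scaleR_conv_of_real qS' S_def NM(3)
      by (simp add: sum_distrib_right sum_distrib_left sum_divide_distrib mult_ac)
    also have "(\<Sum>r<M. \<Sum>i<N. \<Sum>j<N. c (int i - int j) * (cis (\<theta> n r) powi (int j - int i) * cis (\<theta> n r) powi k))
        = (\<Sum>i<N. \<Sum>j<N. \<Sum>r<M. c (int i - int j) * cis (\<theta> n r) powi (int j - int i + k))"
      by (subst sum.swap, subst (2) sum.swap) (simp add: power_int_add)
    also have "\<dots> = (\<Sum>i<N. \<Sum>j<N. c k * (of_nat M * (if int i - int j = k then 1 else 0)))"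
    proof (intro sum.cong refl)
      fix i j assume "i \<in> {..<N}" "j \<in> {..<N}"
      then have "\<bar>int j - int i + k\<bar> < int M" using NM by auto
      from sum_roots_of_unity[OF this]
      show "(\<Sum>r<M. c (int i - int j) * cis (\<theta> n r) powi (int j - int i + k)) =
          c k * (of_nat M * (if int i - int j = k then 1 else 0))"
        unfolding \<theta>' sum_distrib_left[symmetric] by (cases "int i - int j = k") auto
    qed
    also have "\<dots> = c k * (of_nat M * of_nat (N - nat \<bar>k\<bar>))"
      unfolding sum_distrib_left[symmetric] card_diagonal[OF NM(4)] ..
    also have "\<dots> / (of_nat N * of_nat M) = of_real (real (N - nat \<bar>k\<bar>) / real N) * c k"
      using NM(1,2) by (simp add: field_simps)
    finally show ?thesis unfolding N_def .
  qed
  define \<mu> where "\<mu> n = distr (point_measure (A n) (\<lambda>r. ennreal (q n r))) borel (\<theta> n)" for n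
  have fin: "finite (A n)" for n by (simp add: A_def)
  have total: "(\<Sum>r\<in>A n. q n r) = 1" for n
  proof -
    have "complex_of_real (\<Sum>r\<in>A n. q n r) = 1" using moment[of 0 n] c0 by (simp add: scaleR_conv_of_real)
    then show ?thesis by (simp only: of_real_eq_1_iff)
  qed
  have ps: "prob_space (point_measure (A n) (\<lambda>r. ennreal (q n r)))" for n
    using q0 fin by (intro prob_spaceI) (simp add: space_point_measure emeasure_point_measure_finite total sum_ennreal)
  have meas: "\<theta> n \<in> measurable (point_measure (A n) (\<lambda>r. ennreal (q n r))) borel" for n by simp
  have rd: "real_distribution (\<mu> n)" for n
    unfolding \<mu>_def real_distribution_def real_distribution_axioms_def
    using prob_space.prob_space_distr[OF ps meas] by simp
  have int: "(\<integral>x. f x \<partial>\<mu> n) = (\<Sum>r\<in>A n. q n r *\<^sub>R f (\<theta> n r))"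
    if "f \<in> borel_measurable borel" for n and f :: "real \<Rightarrow> complex"
    unfolding \<mu>_def integral_distr[OF meas that]
    using q0 fin by (simp add: lebesgue_integral_point_measure_finite)
  have \<theta>: "\<theta> n r \<in> {-1<..7}" if "r \<in> A n" for n r
  proof -
    have "\<theta> n r \<le> 2 * pi" using that pi_gt_zero unfolding \<theta>_def A_def
      by (auto simp: divide_le_eq simp del: of_nat_Suc of_nat_mult)
    moreover have "2 * pi \<le> 7" using pi_less_4 pi_approx by simp
    moreover have "0 \<le> \<theta> n r" unfolding \<theta>_def by simp
    ultimately show ?thesis by simp
  qed
  have "tight \<mu>"
    unfolding tight_def
  proof (intro conjI allI impI rd)
    fix e :: real assume e: "0 < e"
    have "measure (\<mu> n) {-1<..7} = 1" for n
    proof -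
      have "measure (\<mu> n) {-1<..7} = measure (point_measure (A n) (\<lambda>r. ennreal (q n r))) (A n)"
        unfolding \<mu>_def using \<theta>
        by (subst measure_distr[OF meas]) (auto simp: space_point_measure intro!: arg_cong2[where f = measure])
      then show ?thesis using prob_space.prob_space[OF ps] by (simp add: space_point_measure)
    qed
    then show "\<exists>a b::real. a < b \<and> (\<forall>n. 1 - e < measure (\<mu> n) {a<..b})"
      using e by (intro exI[of _ "-1"] exI[of _ 7]) auto
  qed
  from tight_imp_convergent_subsubsequence[OF this, of id]
  obtain s M where s: "strict_mono (s :: nat \<Rightarrow> nat)" and M: "real_distribution M"
    and conv: "weak_conv_m (\<mu> \<circ> id \<circ> s) M" by (auto simp: strict_mono_def)
  interpret M: real_distribution M by (rule M)
  define \<nu> where "\<nu> = distr M (restrict_space borel circle) cis"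
  have cis_meas: "cis \<in> measurable M (restrict_space borel circle)"
  proof (rule measurable_restrict_space2)
    show "cis \<in> measurable M borel"
      by (subst measurable_cong_sets[OF M.events_eq_borel refl])
        (auto intro!: borel_measurable_continuous_onI continuous_intros)
  qed simp
  have \<nu>: "\<nu> \<in> circle_prob"
    unfolding circle_prob_def \<nu>_def using M.prob_space_distr[OF cis_meas] by simp
  have "(\<integral>z. z powi k \<partial>\<nu>) = c k" for k
  proof -
    have cont: "continuous_on UNIV (\<lambda>x. cis x powi k)" by (auto intro!: continuous_intros)
    have bm: "(\<lambda>z::complex. z powi k) \<in> borel_measurable (restrict_space borel circle)"
      by (intro borel_measurable_continuous_on_restrict continuous_intros)
    have "(\<integral>z. z powi k \<partial>\<nu>) = (\<integral>x. cis x powi k \<partial>M)"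
      unfolding \<nu>_def by (rule integral_distr[OF cis_meas bm])
    moreover have "(\<lambda>n. \<integral>x. cis x powi k \<partial>((\<mu> \<circ> id \<circ> s) n)) \<longlonglongrightarrow> (\<integral>x. cis x powi k \<partial>M)"
    proof (rule weak_conv_imp_integral_bdd_continuous_conv[OF _ M conv])
      show "isCont (\<lambda>x. cis x powi k) x" for x
        using cont continuous_on_eq_continuous_at open_UNIV by blast
      show "cmod (cis x powi k) \<le> 1" for x by (simp add: norm_power_int)
    qed (simp add: rd)
    moreover have "(\<lambda>n. \<integral>x. cis x powi k \<partial>((\<mu> \<circ> id \<circ> s) n)) \<longlonglongrightarrow> c k"
    proof -
      have eq: "(\<integral>x. cis x powi k \<partial>\<mu> n) = of_real (real (Suc n - nat \<bar>k\<bar>) / real (Suc n)) * c k"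
        if "nat \<bar>k\<bar> \<le> n" for n
        using that moment[of k n] int[of "\<lambda>x. cis x powi k" n] borel_measurable_continuous_onI[OF cont] by simp
      have "(\<lambda>n. of_real (real (Suc n - nat \<bar>k\<bar>) / real (Suc n)) * c k) \<longlonglongrightarrow> of_real 1 * c k"
        by (intro tendsto_intros fejer_weight_limit)
      then have "(\<lambda>n. of_real (real (Suc n - nat \<bar>k\<bar>) / real (Suc n)) * c k) \<longlonglongrightarrow> c k" by simp
      then have "(\<lambda>n. \<integral>x. cis x powi k \<partial>\<mu> n) \<longlonglongrightarrow> c k"
        by (rule Lim_transform_eventually)
          (use eventually_ge_at_top[of "nat \<bar>k\<bar>"] in \<open>eventually_elim, simp add: eq\<close>)
      from LIMSEQ_subseq_LIMSEQ[OF this s] show ?thesis by (simp add: o_def)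
    qed
    ultimately show ?thesis by (simp only: LIMSEQ_unique)
  qed
  with \<nu> show ?thesis by (rule that)
qed

text \<open>Two linear expressions in a trigonometric polynomial agree once they agree on the powers of \<open>z\<close>.\<close>

lemma trig_represented:
  assumes \<nu>: "\<nu> \<in> circle_prob" and m: "\<And>k. (\<integral>z. z powi k \<partial>\<nu>) = L (U_pow k)"
    and add: "\<And>x y. x \<in> toep_span \<Longrightarrow> y \<in> toep_span \<Longrightarrow> L (x + y) = L x + L y"
    and cmult: "\<And>c x. x \<in> toep_span \<Longrightarrow> L (cmult c o\<^sub>L x) = c * L x"
    and pP: "trig p P"
  shows "(\<integral>z. p z \<partial>\<nu>) = L P"
  using pP
proof (induction rule: trig.induct)
  case (add p P q Q)
  have "integrable \<nu> p" "integrable \<nu> q"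
    using circle_integrable[OF \<nu> trig_continuous] add.hyps by blast+
  moreover have "L (P + Q) = L P + L Q" using trig_toep_span add.hyps by (intro assms(3)) 
  ultimately show ?case using add.IH by simp
next
  case (cong p P q)
  have "(\<integral>z. q z \<partial>\<nu>) = (\<integral>z. p z \<partial>\<nu>)"
    using cong(2) circle_prob_space[OF \<nu>] by (intro Bochner_Integration.integral_cong) auto
  with cong show ?case by simp
qed (simp_all add: m cmult trig_toep_span)

section \<open>The functional calculus of the unitary\<close>

text \<open>The spectral measure of \<open>U\<close> at a unit vector: the sequence \<open>cinner (U\<^sup>k \<xi>) \<xi>\<close> is positive-definite because the Fejer sums are squared norms of \<open>\<Sum>\<^sub>i w\<^bsup>-i\<^esup> U\<^sup>i \<xi>\<close>.\<close>

lemma spectral_measure_exists: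
  fixes \<xi> :: "affine_monoid ell2"
  assumes "norm \<xi> = 1"
  obtains \<nu> where "\<nu> \<in> circle_prob" "\<And>p P. trig p P \<Longrightarrow> (\<integral>z. p z \<partial>\<nu>) = cinner (blinfun_apply P \<xi>) \<xi>"
proof -
  define c where "c k = cinner (blinfun_apply (U_pow k) \<xi>) \<xi>" for k
  have cU: "cinner (blinfun_apply (U_pow i) \<xi>) (blinfun_apply (U_pow j) \<xi>) = c (i - j)" for i j
  proof -
    have "cinner (blinfun_apply (U_pow i) \<xi>) (blinfun_apply (U_pow j) \<xi>) =
        cinner (blinfun_apply (adj (U_pow j)) (blinfun_apply (U_pow i) \<xi>)) \<xi>"
      using cinner_adj[OF adj_adjointable[OF U_pow_adjointable]] by (simp add: adj_adj U_pow_adjointable)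
    also have "\<dots> = c (i - j)"
      unfolding adj_U_pow c_def blinfun_apply_blinfun_compose[symmetric] U_pow_comp by simp
    finally show ?thesis .
  qed
  have "c 0 = 1" using assms by (simp add: c_def U_pow_0 cinner_self_norm)
  moreover have "(\<Sum>i<N. \<Sum>j<N. c (int i - int j) * w powi (int j - int i)) \<in> \<real>\<^sub>\<ge>\<^sub>0" if w: "w \<in> circle" for N w
  proof -
    define v where "v = (\<Sum>i<N. cscale (w powi - int i) (blinfun_apply (U_pow (int i)) \<xi>))"
    have "(\<Sum>i<N. \<Sum>j<N. c (int i - int j) * w powi (int j - int i)) = cinner v v"
      unfolding v_def cinner_sum_left
      unfolding cinner_sum_right cinner_cscale_left cinner_cscale_right cU cnj_powi_circle[OF w]
      using circle_nonzero[OF w] by (intro sum.cong refl) (simp add: power_int_diff power_int_minus field_simps)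
    then show ?thesis by (simp add: cinner_self_norm)
  qed
  ultimately obtain \<nu> where \<nu>: "\<nu> \<in> circle_prob" "\<And>k. (\<integral>z. z powi k \<partial>\<nu>) = c k"
    using herglotz[of c] by blast
  have "(\<integral>z. p z \<partial>\<nu>) = cinner (blinfun_apply P \<xi>) \<xi>" if "trig p P" for p P
    by (rule trig_represented[OF \<nu>(1) _ _ _ that])
      (simp_all add: \<nu>(2) c_def blinfun.add_left cinner_add_left cmult.rep_eq cinner_cscale_left)
  with \<nu> that show ?thesis by blast
qed

text \<open>Integrating \<open>\<bar>p\<bar>\<^sup>2\<close> against the spectral measure at \<open>\<xi>\<close> gives \<open>norm (p(U) \<xi>)\<^sup>2\<close>.\<close>

lemma norm_trig_le:
  assumes pP: "trig p P" and B: "\<And>z. z \<in> circle \<Longrightarrow> cmod (p z) \<le> B"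
  shows "norm P \<le> B"
proof -
  have "0 \<le> B" by (rule order_trans[OF norm_ge_zero B[of 1]]) simp
  have unit: "norm (blinfun_apply P \<xi>) \<le> B" if \<xi>: "norm \<xi> = 1" for \<xi>
  proof -
    obtain \<nu> where \<nu>: "\<nu> \<in> circle_prob" "\<And>p P. trig p P \<Longrightarrow> (\<integral>z. p z \<partial>\<nu>) = cinner (blinfun_apply P \<xi>) \<xi>"
      using spectral_measure_exists[OF \<xi>] by blast
    have t: "trig (\<lambda>z. cnj (p z) * p z) (adj P o\<^sub>L P)" using trig_mult trig_cnj pP by blast
    have "complex_of_real ((norm (blinfun_apply P \<xi>))\<^sup>2) = (\<integral>z. cnj (p z) * p z \<partial>\<nu>)"
      using \<nu>(2)[OF t] norm_adj_apply[OF trig_adjointable[OF pP]] by simp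
    then have "(norm (blinfun_apply P \<xi>))\<^sup>2 = cmod (\<integral>z. cnj (p z) * p z \<partial>\<nu>)"
      by (metis norm_of_real abs_of_nonneg zero_le_power2)
    also have "\<dots> \<le> B\<^sup>2"
    proof (rule circle_integral_bound[OF \<nu>(1) trig_continuous[OF t]])
      fix z assume "z \<in> circle"
      from B[OF this] show "cmod (cnj (p z) * p z) \<le> B\<^sup>2"
        by (simp add: norm_mult power2_eq_square mult_mono')
    qed
    finally show ?thesis using \<open>0 \<le> B\<close> by (rule power2_le_imp_le)
  qed
  show ?thesis
  proof (rule norm_blinfun_bound[OF \<open>0 \<le> B\<close>])
    fix \<xi> show "norm (blinfun_apply P \<xi>) \<le> B * norm \<xi>"
    proof (cases "\<xi> = 0")
      case False
      then have "norm (blinfun_apply P (inverse (norm \<xi>) *\<^sub>R \<xi>)) \<le> B" by (intro unit) simp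
      with False show ?thesis by (simp add: blinfun.scaleR_right field_simps)
    qed (simp add: blinfun.zero_right)
  qed
qed

lemma trig_diff:
  assumes "trig p P" "trig q Q" shows "trig (\<lambda>z. p z - q z) (P - Q)"
  using trig.add[OF assms(1) trig.cmult[OF assms(2), of "-1"]] by (simp add: cmult_minus_one)

text \<open>The functional calculus as a relation: \<open>x = f(U)\<close> if \<open>f\<close> and \<open>x\<close> are approximated simultaneously by a trigonometric polynomial and its value at \<open>U\<close>. By the norm bound this determines \<open>x\<close>.\<close>

definition U_calc_rel :: "(complex \<Rightarrow> complex) \<Rightarrow> operator \<Rightarrow> bool" where
  "U_calc_rel f x \<longleftrightarrow> (\<forall>e>0. \<exists>p P. trig p P \<and> (\<forall>z\<in>circle. cmod (f z - p z) \<le> e) \<and> norm (x - P) \<le> e)"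

lemma U_calc_relE:
  assumes "U_calc_rel f x" "0 < e"
  obtains p P where "trig p P" "\<And>z. z \<in> circle \<Longrightarrow> cmod (f z - p z) \<le> e" "norm (x - P) \<le> e"
  using assms unfolding U_calc_rel_def by blast

lemma U_calc_rel_trig: "trig p P \<Longrightarrow> U_calc_rel p P"
  unfolding U_calc_rel_def by (metis cancel_comm_monoid_add_class.diff_cancel norm_zero less_imp_le)

lemma U_calc_rel_unique:
  assumes "U_calc_rel f x" "U_calc_rel f y" shows "x = y"
proof -
  have "norm (x - y) \<le> 0 + e" if "0 < e" for e
  proof -
    have e: "0 < e / 4" using that by simp
    obtain p P where p: "trig p P" "\<And>z. z \<in> circle \<Longrightarrow> cmod (f z - p z) \<le> e / 4" "norm (x - P) \<le> e / 4"
      using U_calc_relE[OF assms(1) e] by blast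
    obtain q Q where q: "trig q Q" "\<And>z. z \<in> circle \<Longrightarrow> cmod (f z - q z) \<le> e / 4" "norm (y - Q) \<le> e / 4"
      using U_calc_relE[OF assms(2) e] by blast
    have "norm (P - Q) \<le> e / 4 + e / 4"
    proof (rule norm_trig_le[OF trig_diff[OF p(1) q(1)]])
      fix z :: complex assume z: "z \<in> circle"
      have "p z - q z = (f z - q z) - (f z - p z)" by simp
      then show "cmod (p z - q z) \<le> e / 4 + e / 4"
        using norm_triangle_ineq4[of "f z - q z" "f z - p z"] p(2)[OF z] q(2)[OF z] by simp
    qed
    moreover have "x - y = (x - P) + (P - Q) - (y - Q)" by simp
    ultimately show ?thesis
      using norm_triangle_ineq4[of "(x - P) + (P - Q)" "y - Q"] norm_triangle_ineq[of "x - P" "P - Q"] p(3) q(3)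
      by simp
  qed
  then have "norm (x - y) \<le> 0" by (rule field_le_epsilon)
  then show ?thesis by simp
qed

lemma U_calc_rel_exists:
  assumes f: "continuous_on circle f" obtains x where "U_calc_rel f x"
proof -
  have "\<exists>p P. trig p P \<and> (\<forall>z\<in>circle. cmod (f z - p z) < inverse (real (Suc n)))" for n
    using trig_dense[OF f, of "inverse (real (Suc n))"] by (metis inverse_positive_iff_positive of_nat_0_less_iff zero_less_Suc)
  then obtain p P where pP: "\<And>n. trig (p n) (P n)"
      and f: "\<And>n z. z \<in> circle \<Longrightarrow> cmod (f z - p n z) < inverse (real (Suc n))"
    by metis
  have near: "norm (P m - P n) \<le> 2 * inverse (real (Suc N))" if "N \<le> m" "N \<le> n" for m n N
  proof (rule norm_trig_le[OF trig_diff[OF pP pP]])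
    fix z :: complex assume z: "z \<in> circle"
    have m: "inverse (real (Suc m)) \<le> inverse (real (Suc N))" "inverse (real (Suc n)) \<le> inverse (real (Suc N))"
      using that by (simp_all add: field_simps)
    have eq: "p m z - p n z = (f z - p n z) - (f z - p m z)" by simp
    show "cmod (p m z - p n z) \<le> 2 * inverse (real (Suc N))"
      using order_trans[OF eq_refl[OF arg_cong[OF eq, of cmod]] norm_triangle_ineq4]
        f[OF z, of m] f[OF z, of n] m by linarith
  qed
  have small: "\<exists>N. 2 * inverse (real (Suc N)) < e" if "0 < e" for e :: real
    using reals_Archimedean[of "e / 2"] that by (auto simp: field_simps)
  have "Cauchy P"
  proof (rule CauchyI)
    fix e :: real assume "0 < e"
    then obtain N where "2 * inverse (real (Suc N)) < e" using small by blast
    then show "\<exists>M. \<forall>m\<ge>M. \<forall>n\<ge>M. norm (P m - P n) < e"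
      by (intro exI[of _ N] allI impI le_less_trans[OF near])
  qed
  then obtain x where x: "P \<longlonglongrightarrow> x" using Cauchy_convergent_iff convergent_def by blast
  have "U_calc_rel f x"
    unfolding U_calc_rel_def
  proof (intro allI impI)
    fix e :: real assume "0 < e"
    then obtain N where N: "2 * inverse (real (Suc N)) < e" using small by blast
    have "norm (x - P N) \<le> 2 * inverse (real (Suc N))"
    proof (rule LIMSEQ_le_const2)
      show "(\<lambda>n. norm (P n - P N)) \<longlonglongrightarrow> norm (x - P N)" by (intro tendsto_intros x)
      show "\<exists>M. \<forall>n\<ge>M. norm (P n - P N) \<le> 2 * inverse (real (Suc N))" using near by blast
    qed
    then have "norm (x - P N) \<le> e" using N by linarith
    moreover have "cmod (f z - p N z) \<le> e" if "z \<in> circle" for z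
    proof -
      have "inverse (real (Suc N)) < e"
        by (rule le_less_trans[OF _ N]) (simp add: field_simps)
      with f[OF that, of N] show ?thesis by linarith
    qed
    ultimately show "\<exists>p P. trig p P \<and> (\<forall>z\<in>circle. cmod (f z - p z) \<le> e) \<and> norm (x - P) \<le> e"
      using pP[of N] by blast
  qed
  with that show ?thesis by blast
qed

lemma U_calc_rel_add:
  assumes "U_calc_rel f x" "U_calc_rel g y" shows "U_calc_rel (\<lambda>z. f z + g z) (x + y)"
  unfolding U_calc_rel_def
proof (intro allI impI)
  fix e :: real assume "0 < e"
  then have "0 < e / 2" by simp
  obtain p P where p: "trig p P" "\<And>z. z \<in> circle \<Longrightarrow> cmod (f z - p z) \<le> e / 2" "norm (x - P) \<le> e / 2"
    using U_calc_relE[OF assms(1) \<open>0 < e / 2\<close>] by blast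
  obtain q Q where q: "trig q Q" "\<And>z. z \<in> circle \<Longrightarrow> cmod (g z - q z) \<le> e / 2" "norm (y - Q) \<le> e / 2"
    using U_calc_relE[OF assms(2) \<open>0 < e / 2\<close>] by blast
  have "cmod (f z + g z - (p z + q z)) \<le> e" if "z \<in> circle" for z
    using norm_triangle_ineq[of "f z - p z" "g z - q z"] p(2)[OF that] q(2)[OF that] by (simp add: algebra_simps)
  moreover have "norm (x + y - (P + Q)) \<le> e"
    using norm_triangle_ineq[of "x - P" "y - Q"] p(3) q(3) by (simp add: algebra_simps)
  ultimately show "\<exists>p P. trig p P \<and> (\<forall>z\<in>circle. cmod (f z + g z - p z) \<le> e) \<and> norm (x + y - P) \<le> e"
    using trig.add[OF p(1) q(1)] by blast
qed

lemma U_calc_rel_cong: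
  assumes "U_calc_rel f x" "\<And>z. z \<in> circle \<Longrightarrow> f z = g z" shows "U_calc_rel g x"
  using assms unfolding U_calc_rel_def by metis

lemma U_calc_rel_mult:
  assumes f: "continuous_on circle f" and g: "continuous_on circle g"
    and fx: "U_calc_rel f x" and gy: "U_calc_rel g y"
  shows "U_calc_rel (\<lambda>z. f z * g z) (x o\<^sub>L y)"
  unfolding U_calc_rel_def
proof (intro allI impI)
  fix e :: real assume e: "0 < e"
  obtain F where F: "\<And>z. z \<in> circle \<Longrightarrow> cmod (f z) \<le> F" using circle_continuous_bounded[OF f] by blast
  obtain G where G: "\<And>z. z \<in> circle \<Longrightarrow> cmod (g z) \<le> G" using circle_continuous_bounded[OF g] by blast
  have FG: "0 \<le> F" "0 \<le> G"
    by (rule order_trans[OF norm_ge_zero F[of 1]], simp, rule order_trans[OF norm_ge_zero G[of 1]], simp)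
  define K where "K = F + G + norm x + norm y + 1"
  define d where "d = min 1 (e / K)"
  have K: "0 < K" "F + G + 1 \<le> K" "norm x + norm y + 1 \<le> K" using FG by (auto simp: K_def add_nonneg_pos)
  have d: "0 < d" "d \<le> 1" "d * K \<le> e" using e K by (auto simp: d_def min_def field_simps)
  obtain p P where p: "trig p P" "\<And>z. z \<in> circle \<Longrightarrow> cmod (f z - p z) \<le> d" "norm (x - P) \<le> d"
    using U_calc_relE[OF fx d(1)] by blast
  obtain q Q where q: "trig q Q" "\<And>z. z \<in> circle \<Longrightarrow> cmod (g z - q z) \<le> d" "norm (y - Q) \<le> d"
    using U_calc_relE[OF gy d(1)] by blast
  have arith: "a * d + d * (b + d) \<le> e" if "a + b + 1 \<le> K" for a b
  proof -
    have "a * d + d * (b + d) \<le> a * d + d * (b + 1)" using d by (intro add_left_mono mult_left_mono) auto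
    also have "\<dots> = d * (a + b + 1)" by (simp add: algebra_simps)
    also have "\<dots> \<le> d * K" using that d by (intro mult_left_mono) auto
    finally show ?thesis using d by simp
  qed
  have "cmod (f z * g z - p z * q z) \<le> e" if z: "z \<in> circle" for z
  proof -
    have "cmod (q z) \<le> G + d" using norm_triangle_ineq2[of "q z" "g z"] q(2)[OF z] G[OF z] by (simp add: norm_minus_commute)
    then have "cmod (f z) * cmod (g z - q z) + cmod (f z - p z) * cmod (q z) \<le> F * d + d * (G + d)"
      using F[OF z] p(2)[OF z] q(2)[OF z] FG d by (intro add_mono mult_mono) auto
    moreover have "f z * g z - p z * q z = f z * (g z - q z) + (f z - p z) * q z" by (simp add: algebra_simps)
    ultimately show ?thesis
      using norm_triangle_ineq[of "f z * (g z - q z)" "(f z - p z) * q z"] arith[OF K(2)] by (simp add: norm_mult)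
  qed
  moreover have "norm ((x o\<^sub>L y) - (P o\<^sub>L Q)) \<le> e"
  proof -
    have "norm Q \<le> norm y + d" using norm_triangle_ineq2[of Q y] q(3) by (simp add: norm_minus_commute)
    then have "norm x * norm (y - Q) + norm (x - P) * norm Q \<le> norm x * d + d * (norm y + d)"
      using p(3) q(3) d by (intro add_mono mult_mono) auto
    moreover have "(x o\<^sub>L y) - (P o\<^sub>L Q) = (x o\<^sub>L (y - Q)) + ((x - P) o\<^sub>L Q)" by (simp add: compose_linear)
    ultimately show ?thesis
      using norm_triangle_ineq[of "x o\<^sub>L (y - Q)" "(x - P) o\<^sub>L Q"] arith[OF K(3)]
        norm_blinfun_compose[of x "y - Q"] norm_blinfun_compose[of "x - P" Q] by simp
  qed
  ultimately show "\<exists>p P. trig p P \<and> (\<forall>z\<in>circle. cmod (f z * g z - p z) \<le> e) \<and> norm ((x o\<^sub>L y) - P) \<le> e"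
    using trig_mult[OF p(1) q(1)] by blast
qed

lemma U_calc_rel_toeplitz: "U_calc_rel f x \<Longrightarrow> x \<in> toeplitz"
  unfolding toeplitz_eq_closure closure_approachable dist_norm
proof (intro allI impI)
  fix e :: real assume x: "U_calc_rel f x" and "0 < e"
  then have "0 < e / 2" by simp
  obtain p P where "trig p P" "norm (x - P) \<le> e / 2" using U_calc_relE[OF x \<open>0 < e / 2\<close>] by blast
  then show "\<exists>y\<in>toep_span. norm (y - x) < e" using \<open>0 < e\<close> trig_toep_span
    by (intro bexI[of _ P]) (auto simp: norm_minus_commute)
qed

lemma U_calc_rel_adj:
  assumes "U_calc_rel f x" shows "U_calc_rel (\<lambda>z. cnj (f z)) (adj x)"
  unfolding U_calc_rel_def
proof (intro allI impI)
  fix e :: real assume "0 < e"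
  then obtain p P where p: "trig p P" "\<And>z. z \<in> circle \<Longrightarrow> cmod (f z - p z) \<le> e" "norm (x - P) \<le> e"
    using U_calc_relE[OF assms] by blast
  have "norm (adj x - adj P) = norm (x - P)"
    using toeplitz_adjointable[OF U_calc_rel_toeplitz[OF assms]] trig_adjointable[OF p(1)]
    by (simp add: adj_diff[symmetric] norm_adj adjointable_intros)
  moreover have "cmod (cnj (f z) - cnj (p z)) = cmod (f z - p z)" for z
    by (metis complex_cnj_diff complex_mod_cnj)
  ultimately show "\<exists>p P. trig p P \<and> (\<forall>z\<in>circle. cmod (cnj (f z) - p z) \<le> e) \<and> norm (adj x - P) \<le> e"
    using trig_cnj[OF p(1)] p by (intro exI[of _ "\<lambda>z. cnj (p z)"] exI[of _ "adj P"]) auto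
qed

definition U_calc :: "(complex \<Rightarrow> complex) \<Rightarrow> operator" where
  "U_calc f = (THE x. U_calc_rel f x)"

lemma U_calc_eqI: "U_calc_rel f x \<Longrightarrow> U_calc f = x"
  unfolding U_calc_def using U_calc_rel_unique by blast

lemma U_calc_rel_U_calc: "continuous_on circle f \<Longrightarrow> U_calc_rel f (U_calc f)"
  using U_calc_rel_exists U_calc_eqI by metis

lemma circle_star_hom_U_calc: "circle_star_hom U_calc"
  unfolding circle_star_hom_def
proof (intro conjI allI impI; (elim conjE)?)
  fix f g :: "complex \<Rightarrow> complex" assume f: "continuous_on circle f" and g: "continuous_on circle g"
  show "U_calc (\<lambda>z. f z + g z) = U_calc f + U_calc g"
    by (intro U_calc_eqI U_calc_rel_add U_calc_rel_U_calc f g)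
  show "U_calc (\<lambda>z. f z * g z) = U_calc f o\<^sub>L U_calc g"
    by (intro U_calc_eqI U_calc_rel_mult U_calc_rel_U_calc f g)
  assume "\<forall>z\<in>circle. f z = g z"
  then show "U_calc f = U_calc g" using U_calc_rel_cong[OF U_calc_rel_U_calc[OF g], of f] by (auto intro: U_calc_eqI)
next
  fix f :: "complex \<Rightarrow> complex" and c assume f: "continuous_on circle f"
  have "U_calc_rel (\<lambda>z. c * f z) (cmult c o\<^sub>L U_calc f)"
    by (intro U_calc_rel_mult U_calc_rel_U_calc U_calc_rel_trig trig_const f continuous_on_const)
  then show "U_calc (\<lambda>z. c * f z) = cmult c o\<^sub>L U_calc f" by (rule U_calc_eqI)
next
  fix f :: "complex \<Rightarrow> complex" and \<xi> \<eta> assume f: "continuous_on circle f"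
  have "adj (U_calc f) = U_calc (\<lambda>z. cnj (f z))"
    using U_calc_eqI[OF U_calc_rel_adj[OF U_calc_rel_U_calc[OF f]]] by simp
  then show "cinner (blinfun_apply (U_calc f) \<xi>) \<eta> = cinner \<xi> (blinfun_apply (U_calc (\<lambda>z. cnj (f z))) \<eta>)"
    using cinner_adj[OF toeplitz_adjointable[OF U_calc_rel_toeplitz[OF U_calc_rel_U_calc[OF f]]]] by simp
next
  show "U_calc (\<lambda>_. 1) = id_blinfun"
    using U_calc_eqI[OF U_calc_rel_trig[OF trig_const[of 1]]] by (simp add: cmult_one)
qed

lemma U_pow_1: "U_pow 1 = U_op" by (simp add: U_pow_eq U_op_def)

lemma U_calc_trig: "trig p P \<Longrightarrow> U_calc p = P"
  by (intro U_calc_eqI U_calc_rel_trig)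

context
  fixes \<Phi> :: "(complex \<Rightarrow> complex) \<Rightarrow> operator"
  assumes hom: "circle_star_hom \<Phi>" and U: "\<Phi> (\<lambda>z. z) = U_op"
begin

lemma hom_add: "continuous_on circle f \<Longrightarrow> continuous_on circle g \<Longrightarrow> \<Phi> (\<lambda>z. f z + g z) = \<Phi> f + \<Phi> g"
  and hom_mult: "continuous_on circle f \<Longrightarrow> continuous_on circle g \<Longrightarrow> \<Phi> (\<lambda>z. f z * g z) = \<Phi> f o\<^sub>L \<Phi> g"
  and hom_cong: "continuous_on circle f \<Longrightarrow> continuous_on circle g \<Longrightarrow> \<forall>z\<in>circle. f z = g z \<Longrightarrow> \<Phi> f = \<Phi> g"
  and hom_cmult: "continuous_on circle f \<Longrightarrow> \<Phi> (\<lambda>z. c * f z) = cmult c o\<^sub>L \<Phi> f"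
  and hom_cinner: "continuous_on circle f \<Longrightarrow> cinner (blinfun_apply (\<Phi> f) \<xi>) \<eta> = cinner \<xi> (blinfun_apply (\<Phi> (\<lambda>z. cnj (f z))) \<eta>)"
  and hom_one: "\<Phi> (\<lambda>_. 1) = id_blinfun"
  using hom unfolding circle_star_hom_def by metis+

lemma hom_norm_square:
  assumes f: "continuous_on circle f"
  shows "complex_of_real ((norm (blinfun_apply (\<Phi> f) \<xi>))\<^sup>2) = cinner \<xi> (blinfun_apply (\<Phi> (\<lambda>z. cnj (f z) * f z)) \<xi>)"
  using hom_cinner[OF f, of \<xi> "blinfun_apply (\<Phi> f) \<xi>"] hom_mult[OF continuous_on_cnj[OF f] f]
  by (simp add: cinner_self_norm)

text \<open>Any unital *-homomorphism is contractive: if \<open>\<bar>f\<bar> \<le> B\<close> then \<open>B\<^sup>2 - \<bar>f\<bar>\<^sup>2\<close> is a square.\<close>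

lemma hom_contractive:
  assumes f: "continuous_on circle f" and B: "\<And>z. z \<in> circle \<Longrightarrow> cmod (f z) \<le> B"
  shows "norm (\<Phi> f) \<le> B"
proof -
  have "0 \<le> B" by (rule order_trans[OF norm_ge_zero B[of 1]]) simp
  define g where "g z = complex_of_real (sqrt (B\<^sup>2 - (cmod (f z))\<^sup>2))" for z
  have g: "continuous_on circle g" unfolding g_def using f by (intro continuous_intros)
  have eq: "cnj (f z) * f z + cnj (g z) * g z = of_real (B\<^sup>2) * 1" if z: "z \<in> circle" for z
  proof -
    have "(cmod (f z))\<^sup>2 \<le> B\<^sup>2" using B[OF z] by (simp add: power_mono)
    then have "sqrt (B\<^sup>2 - (cmod (f z))\<^sup>2) * sqrt (B\<^sup>2 - (cmod (f z))\<^sup>2) = B\<^sup>2 - (cmod (f z))\<^sup>2"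
      by (simp only: real_sqrt_mult_self abs_of_nonneg diff_ge_0_iff_ge)
    then have "cnj (g z) * g z = of_real (B\<^sup>2 - (cmod (f z))\<^sup>2)"
      unfolding g_def complex_cnj_complex_of_real of_real_mult[symmetric] by (simp only:)
    moreover have "cnj (f z) * f z = of_real ((cmod (f z))\<^sup>2)"
      using complex_norm_square[of "f z"] by (simp add: mult.commute)
    ultimately show ?thesis by simp
  qed
  have cont: "continuous_on circle (\<lambda>z. cnj (f z) * f z)" "continuous_on circle (\<lambda>z. cnj (g z) * g z)"
    by (intro continuous_intros continuous_on_cnj f g)+
  have sum: "\<Phi> (\<lambda>z. cnj (f z) * f z) + \<Phi> (\<lambda>z. cnj (g z) * g z) = cmult (of_real (B\<^sup>2))"
  proof -
    have "\<Phi> (\<lambda>z. cnj (f z) * f z) + \<Phi> (\<lambda>z. cnj (g z) * g z) = \<Phi> (\<lambda>z. of_real (B\<^sup>2) * 1)"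
      unfolding hom_add[OF cont, symmetric] using eq by (intro hom_cong continuous_on_add cont continuous_intros) auto
    also have "\<dots> = cmult (of_real (B\<^sup>2))"
      using hom_cmult[of "\<lambda>_. 1" "of_real (B\<^sup>2)"] by (simp add: hom_one blinfun_compose_id_right)
    finally show ?thesis .
  qed
  show ?thesis
  proof (rule norm_blinfun_bound[OF \<open>0 \<le> B\<close>])
    fix \<xi>
    have "complex_of_real ((norm (blinfun_apply (\<Phi> f) \<xi>))\<^sup>2) + complex_of_real ((norm (blinfun_apply (\<Phi> g) \<xi>))\<^sup>2) =
        cinner \<xi> (blinfun_apply (cmult (of_real (B\<^sup>2))) \<xi>)"
      unfolding hom_norm_square[OF f] hom_norm_square[OF g] sum[symmetric] by (simp add: cinner_add_right blinfun.add_left)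
    also have "\<dots> = complex_of_real (B\<^sup>2 * (norm \<xi>)\<^sup>2)"
      by (simp add: cmult.rep_eq cinner_cscale_right cinner_self_norm)
    finally have "(norm (blinfun_apply (\<Phi> f) \<xi>))\<^sup>2 + (norm (blinfun_apply (\<Phi> g) \<xi>))\<^sup>2 = B\<^sup>2 * (norm \<xi>)\<^sup>2"
      by (simp only: of_real_add[symmetric] of_real_eq_iff)
    then have "(norm (blinfun_apply (\<Phi> f) \<xi>))\<^sup>2 \<le> (B * norm \<xi>)\<^sup>2"
      using zero_le_power2[of "norm (blinfun_apply (\<Phi> g) \<xi>)"] unfolding power_mult_distrib by linarith
    then show "norm (blinfun_apply (\<Phi> f) \<xi>) \<le> B * norm \<xi>"
      by (rule power2_le_imp_le) (simp add: \<open>0 \<le> B\<close>)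
  qed
qed

lemma hom_is_adjoint: "continuous_on circle f \<Longrightarrow> is_adjoint (\<Phi> f) (\<Phi> (\<lambda>z. cnj (f z)))"
  unfolding is_adjoint_def using hom_cinner by blast

lemma hom_powi: "\<Phi> (\<lambda>z. z powi k) = U_pow k"
proof -
  have nat: "\<Phi> (\<lambda>z. z ^ n) = U_pow (int n)" for n
  proof (induction n)
    case 0
    show ?case by (simp add: hom_one U_pow_0)
  next
    case (Suc n)
    have "\<Phi> (\<lambda>z. z ^ Suc n) = U_op o\<^sub>L U_pow (int n)"
      using hom_mult[of "\<lambda>z. z" "\<lambda>z. z ^ n"] Suc U by (simp add: continuous_intros)
    then show ?case using U_pow_comp[of 1 "int n"] by (simp add: U_pow_1)
  qed
  show ?thesis
  proof (cases "0 \<le> k")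
    case True
    with nat[of "nat k"] show ?thesis by (simp add: power_int_def)
  next
    case False
    define n where "n = nat (- k)"
    have k: "k = - int n" using False by (simp add: n_def)
    have cont: "continuous_on circle (\<lambda>z::complex. z ^ n)" by (intro continuous_intros)
    have "\<Phi> (\<lambda>z. z powi k) = \<Phi> (\<lambda>z. cnj (z ^ n))"
    proof (rule hom_cong)
      show "\<forall>z\<in>circle. z powi k = cnj (z ^ n)" using cnj_powi_circle[of _ "int n"] by (simp add: k)
    qed (intro continuous_intros continuous_on_cnj)+
    also have "\<dots> = adj (\<Phi> (\<lambda>z. z ^ n))" using adj_eqI[OF hom_is_adjoint[OF cont]] by simp
    also have "\<dots> = U_pow k" by (simp add: nat adj_U_pow k)
    finally show ?thesis .
  qed
qed

lemma hom_trig: "trig p P \<Longrightarrow> \<Phi> p = P"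
proof (induction rule: trig.induct)
  case (cong p P q)
  then show ?case using hom_cong[of p q] trig_continuous trig.cong by metis
qed (simp_all add: hom_powi hom_add hom_cmult trig_continuous)

lemma hom_eq_U_calc:
  assumes f: "continuous_on circle f" shows "\<Phi> f = U_calc f"
proof -
  have "U_calc_rel f (\<Phi> f)"
    unfolding U_calc_rel_def
  proof (intro allI impI)
    fix e :: real assume "0 < e"
    then obtain p P where p: "trig p P" "\<And>z. z \<in> circle \<Longrightarrow> cmod (f z - p z) < e"
      using trig_dense[OF f] by blast
    have cp: "continuous_on circle p" using trig_continuous[OF p(1)] .
    have "\<Phi> (\<lambda>z. f z + - 1 * p z) = \<Phi> f - P"
      using hom_add[OF f, of "\<lambda>z. - 1 * p z"] hom_cmult[OF cp, of "-1"] cp hom_trig[OF p(1)]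
      by (simp add: cmult_minus_one continuous_on_minus)
    moreover have "norm (\<Phi> (\<lambda>z. f z + - 1 * p z)) \<le> e"
      using p(2) f cp by (intro hom_contractive continuous_intros) (auto intro: less_imp_le)
    ultimately show "\<exists>p P. trig p P \<and> (\<forall>z\<in>circle. cmod (f z - p z) \<le> e) \<and> norm (\<Phi> f - P) \<le> e"
      using p by (intro exI[of _ p] exI[of _ P]) (auto intro: less_imp_le)
  qed
  then show ?thesis using U_calc_eqI by simp
qed

end

text \<open>Existence and uniqueness of the homomorphism sending the coordinate function to \<open>U\<close> make the definite description defining \<open>fun_calc\<close> denote \<open>U_calc f\<close>.\<close>

theorem fun_calc_eq_U_calc:
  assumes "continuous_on circle f" shows "fun_calc U_op f = U_calc f"
proof -
  have "U_calc (\<lambda>z. z) = U_op"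
    using U_calc_trig[OF trig.mono[of 1]] by (simp add: U_pow_1)
  then show ?thesis
    unfolding fun_calc_def using hom_eq_U_calc assms circle_star_hom_U_calc by blast
qed

section \<open>States of the Toeplitz algebra are bounded\<close>

lemma adj_zero: "adj 0 = 0"
  by (intro adj_eqI is_adjoint_zero)

lemma adj_scaleR: "x \<in> adjointable \<Longrightarrow> adj (r *\<^sub>R x) = r *\<^sub>R adj x"
  using adj_cmult[of x "of_real r"] by (simp add: cmult_of_real)

text \<open>A solution of \<open>(1 - y)\<^sup>2 = 1 - t\<close> is a fixed point of \<open>y \<mapsto> (t + y\<^sup>2) / 2\<close>, which contracts the ball
  of radius \<open>norm t\<close>.\<close>

lemma square_root_exists:
  assumes t: "t \<in> toeplitz" "adj t = t" "norm t < 1"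
  shows "\<exists>s\<in>toeplitz. adj s = s \<and> s o\<^sub>L s = id_blinfun - t"
proof -
  define S where "S = {y \<in> toeplitz. adj y = y \<and> norm y \<le> norm t}"
  define f where "f y = (1/2) *\<^sub>R (t + (y o\<^sub>L y))" for y :: operator
  have "closed S"
    unfolding closed_sequential_limits
  proof (intro allI impI, elim conjE)
    fix X and x :: operator
    assume X: "\<forall>n. X n \<in> S" and lim: "X \<longlonglongrightarrow> x"
    have xt: "x \<in> toeplitz"
      using closed_toeplitz X lim unfolding closed_sequential_limits S_def by blast
    have "norm (adj x - X n) = norm (x - X n)" for n
    proof -
      have "X n \<in> adjointable" "x \<in> adjointable" "adj (X n) = X n"
        using X xt toeplitz_adjointable unfolding S_def by auto
      then show ?thesis using norm_adj[of "x - X n"] by (simp add: adj_diff adjointable_intros)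
    qed
    then have "(\<lambda>n. norm (adj x - X n)) \<longlonglongrightarrow> 0"
      using tendsto_norm_zero[OF LIM_zero[OF lim]] by (simp add: norm_minus_commute)
    then have "X \<longlonglongrightarrow> adj x" by (simp add: tendsto_iff dist_norm norm_minus_commute)
    then have "adj x = x" using lim LIMSEQ_unique by blast
    moreover have "norm x \<le> norm t"
      by (rule LIMSEQ_le_const2[OF tendsto_norm[OF lim]]) (use X in \<open>auto simp: S_def\<close>)
    ultimately show "x \<in> S" using xt by (simp add: S_def)
  qed
  note complete = complete_eq_closed[THEN iffD2, OF this]
  have "0 \<in> S" by (simp add: S_def toeplitz_zero adj_zero)
  moreover have "f ` S \<subseteq> S"
  proof safe
    fix y assume y: "y \<in> S"
    have "f y \<in> toeplitz" using y t unfolding f_def S_def by (auto intro!: toeplitz_intros)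
    moreover have "adj (f y) = f y"
      using y t toeplitz_adjointable unfolding f_def S_def
      by (simp add: adj_scaleR adj_add adj_compose adjointable_intros)
    moreover have "norm (f y) \<le> norm t"
    proof -
      have "norm (y o\<^sub>L y) \<le> norm t * 1"
        using y t by (intro order_trans[OF norm_blinfun_compose] mult_mono) (auto simp: S_def)
      then show ?thesis using norm_triangle_ineq[of t "y o\<^sub>L y"] unfolding f_def by simp
    qed
    ultimately show "f y \<in> S" by (simp add: S_def)
  qed
  moreover have "dist (f x) (f y) \<le> norm t * dist x y" if "x \<in> S" "y \<in> S" for x y
  proof -
    have "f x - f y = (1/2) *\<^sub>R ((x o\<^sub>L (x - y)) + ((x - y) o\<^sub>L y))"
      by (simp add: f_def compose_linear scaleR_diff_right scaleR_add_right)
    moreover have "norm ((x o\<^sub>L (x - y)) + ((x - y) o\<^sub>L y)) \<le> norm t * norm (x - y) + norm (x - y) * norm t"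
      using that unfolding S_def
      by (intro order_trans[OF norm_triangle_ineq] add_mono order_trans[OF norm_blinfun_compose] mult_mono) auto
    ultimately show ?thesis by (simp add: dist_norm mult.commute)
  qed
  ultimately obtain y where y: "y \<in> S" "f y = y"
    using Banach_fix[OF complete _ norm_ge_zero t(3), of f] by blast
  have "2 *\<^sub>R y = 2 *\<^sub>R f y" by (simp add: y)
  then have "y + y = t + (y o\<^sub>L y)" unfolding f_def by (simp add: scaleR_2)
  then have "(id_blinfun - y) o\<^sub>L (id_blinfun - y) = id_blinfun - t"
    by (simp add: compose_linear blinfun_compose_id_left blinfun_compose_id_right algebra_simps)
  moreover have "id_blinfun - y \<in> toeplitz" using y by (auto simp: S_def intro: toeplitz_intros)
  moreover have "adj (id_blinfun - y) = id_blinfun - y"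
    using y toeplitz_adjointable by (simp add: S_def adj_diff adj_id adjointable_intros)
  ultimately show ?thesis by blast
qed

context
  fixes \<phi> :: "operator \<Rightarrow> complex"
  assumes \<phi>: "is_state toeplitz \<phi>"
begin

lemma state_add: "x \<in> toeplitz \<Longrightarrow> y \<in> toeplitz \<Longrightarrow> \<phi> (x + y) = \<phi> x + \<phi> y"
  and state_cmult: "x \<in> toeplitz \<Longrightarrow> \<phi> (cmult c o\<^sub>L x) = c * \<phi> x"
  and state_pos: "x \<in> toeplitz \<Longrightarrow> \<phi> (adj x o\<^sub>L x) \<in> \<real>\<^sub>\<ge>\<^sub>0"
  and state_id: "\<phi> id_blinfun = 1"
  and state_outside: "x \<notin> toeplitz \<Longrightarrow> \<phi> x = 0"
  using \<phi> by (simp_all add: is_state_def)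

lemma state_zero: "\<phi> 0 = 0"
  using state_add[OF toeplitz_zero toeplitz_zero] by simp

lemma state_minus: "x \<in> toeplitz \<Longrightarrow> \<phi> (- x) = - \<phi> x"
  using state_cmult[of x "-1"] by (simp add: cmult_minus_one)

lemma state_diff: "x \<in> toeplitz \<Longrightarrow> y \<in> toeplitz \<Longrightarrow> \<phi> (x - y) = \<phi> x - \<phi> y"
  using state_add[of x "- y"] by (simp add: state_minus toeplitz_minus)

lemma state_scaleR: "x \<in> toeplitz \<Longrightarrow> \<phi> (r *\<^sub>R x) = of_real r * \<phi> x"
  using state_cmult[of x "of_real r"] by (simp add: cmult_of_real)

text \<open>Positivity alone bounds a state: for selfadjoint \<open>t\<close> of norm below \<open>1\<close> both \<open>1 - t\<close> and \<open>1 + t\<close> are squares of selfadjoint elements.\<close>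

lemma state_selfadjoint:
  assumes a: "a \<in> toeplitz" "adj a = a" shows "cmod (\<phi> a) \<le> norm a"
proof -
  have less: "1 - \<phi> t \<in> \<real>\<^sub>\<ge>\<^sub>0" if t: "t \<in> toeplitz" "adj t = t" "norm t < 1" for t
  proof -
    obtain s where "s \<in> toeplitz" "adj s = s" "s o\<^sub>L s = id_blinfun - t" using square_root_exists[OF t] by blast
    then show ?thesis using state_pos[of s] t by (simp add: state_diff id_toeplitz state_id)
  qed
  have "cmod (\<phi> a) \<le> norm a + e" if e: "0 < e" for e
  proof -
    define t where "t = inverse (norm a + e) *\<^sub>R a"
    have pos: "0 < norm a + e" using e by (simp add: add_nonneg_pos)
    then have t: "t \<in> toeplitz" "adj t = t" "norm t < 1"
      using a e toeplitz_adjointable by (auto simp: t_def toeplitz_scaleR adj_scaleR field_simps)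
    then have t': "- t \<in> toeplitz" "adj (- t) = - t" "norm (- t) < 1"
      using adj_scaleR[of t "-1"] toeplitz_adjointable by (auto simp: toeplitz_minus)
    have "1 - \<phi> t \<in> \<real>\<^sub>\<ge>\<^sub>0" "1 + \<phi> t \<in> \<real>\<^sub>\<ge>\<^sub>0" using less[OF t] less[OF t'] t(1) by (simp_all add: state_minus)
    then have "cmod (\<phi> t) \<le> 1" by (auto simp: complex_nonneg_Reals_iff cmod_def abs_le_square_iff[symmetric])
    moreover have "\<phi> t = of_real (inverse (norm a + e)) * \<phi> a" unfolding t_def by (rule state_scaleR[OF a(1)])
    then have "cmod (\<phi> t) = inverse (norm a + e) * cmod (\<phi> a)" using pos by (simp only: norm_mult norm_of_real) simp
    ultimately show ?thesis using pos by (simp add: field_simps)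
  qed
  then show ?thesis by (rule field_le_epsilon)
qed

lemma state_bound:
  assumes x: "x \<in> toeplitz" shows "cmod (\<phi> x) \<le> 2 * norm x"
proof -
  define a where "a = (1/2) *\<^sub>R (x + adj x)"
  define b where "b = cmult (- \<i>) o\<^sub>L ((1/2) *\<^sub>R (x - adj x))"
  have adjble: "x \<in> adjointable" "adj x \<in> adjointable" using x toeplitz_adjointable toeplitz_adj by blast+
  have T: "a \<in> toeplitz" "b \<in> toeplitz" unfolding a_def b_def using x by (auto intro!: toeplitz_intros)
  have adj: "adj a = a" "adj b = b"
  proof -
    show "adj a = a" unfolding a_def using adjble by (simp add: adj_scaleR adj_add adj_adj adjointable_intros add.commute)
    have "(1/2) *\<^sub>R (x - adj x) \<in> adjointable" using x by (auto intro!: toeplitz_adjointable toeplitz_intros)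
    then have "adj b = cmult \<i> o\<^sub>L ((1/2) *\<^sub>R (adj x - x))"
      unfolding b_def using adjble by (simp add: adj_cmult adj_scaleR adj_diff adj_adj adjointable_intros)
    also have "\<dots> = cmult \<i> o\<^sub>L (cmult (- 1) o\<^sub>L ((1/2) *\<^sub>R (x - adj x)))"
      by (simp add: cmult_minus_one flip: scaleR_minus_right)
    also have "\<dots> = b" unfolding b_def by (simp add: compose_assoc[symmetric] cmult_mult)
    finally show "adj b = b" .
  qed
  have na: "norm a \<le> norm x"
    unfolding a_def using norm_triangle_ineq[of x "adj x"] by (simp add: norm_adj adjble)
  have nb: "norm b \<le> norm x"
    unfolding b_def using norm_triangle_ineq4[of x "adj x"] norm_cmult_compose_le[of "- \<i>" "(1/2) *\<^sub>R (x - adj x)"]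
    by (simp add: norm_adj adjble)
  have "x = a + (cmult \<i> o\<^sub>L b)"
  proof -
    have "cmult \<i> o\<^sub>L b = (1/2) *\<^sub>R (x - adj x)"
      unfolding b_def by (simp add: compose_assoc[symmetric] cmult_mult cmult_one blinfun_compose_id_left)
    then have "a + (cmult \<i> o\<^sub>L b) = (1/2) *\<^sub>R ((x + adj x) + (x - adj x))"
      unfolding a_def by (simp only: scaleR_add_right)
    also have "\<dots> = x" by (simp flip: scaleR_2)
    finally show ?thesis by simp
  qed
  then have "\<phi> x = \<phi> a + \<i> * \<phi> b" using T by (simp add: state_add state_cmult toeplitz_cmult)
  then have "cmod (\<phi> x) \<le> cmod (\<phi> a) + cmod (\<phi> b)"
    using norm_triangle_ineq[of "\<phi> a" "\<i> * \<phi> b"] by (simp add: norm_mult)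
  then show ?thesis using state_selfadjoint[OF T(1) adj(1)] state_selfadjoint[OF T(2) adj(2)] na nb by simp
qed

lemma state_diff_bound: "x \<in> toeplitz \<Longrightarrow> y \<in> toeplitz \<Longrightarrow> cmod (\<phi> x - \<phi> y) \<le> 2 * norm (x - y)"
  using state_bound[of "x - y"] by (simp add: state_diff toeplitz_diff)

end

text \<open>The density argument: Lipschitz functions on the algebra are determined on the span.\<close>

lemma toeplitz_lipschitz_eqI:
  fixes f g :: "operator \<Rightarrow> complex"
  assumes f: "\<And>x y. x \<in> toeplitz \<Longrightarrow> y \<in> toeplitz \<Longrightarrow> cmod (f x - f y) \<le> C * norm (x - y)"
    and g: "\<And>x y. x \<in> toeplitz \<Longrightarrow> y \<in> toeplitz \<Longrightarrow> cmod (g x - g y) \<le> D * norm (x - y)"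
    and eq: "\<And>x. x \<in> toep_span \<Longrightarrow> f x = g x" and x: "x \<in> toeplitz"
  shows "f x = g x"
proof -
  have "cmod (f x - g x) \<le> 0 + e" if e: "0 < e" for e
  proof -
    let ?K = "\<bar>C\<bar> + \<bar>D\<bar> + 1"
    have K: "0 < ?K" by simp
    obtain y where y: "y \<in> toep_span" "norm (x - y) < e / ?K" using toeplitz_approx[OF x] e K by (metis divide_pos_pos)
    have yt: "y \<in> toeplitz" by (rule toep_span_toeplitz[OF y(1)])
    have "cmod (f x - g x) \<le> cmod (f x - f y) + cmod (g x - g y)"
      using norm_triangle_ineq4[of "f x - f y" "g x - g y"] eq[OF y(1)] by simp
    also have "\<dots> \<le> C * norm (x - y) + D * norm (x - y)" using f[OF x yt] g[OF x yt] by simp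
    also have "\<dots> \<le> ?K * norm (x - y)"
      using mult_right_mono[of "C + D" ?K "norm (x - y)"] by (simp add: distrib_right)
    also have "\<dots> \<le> e" using y(2) K by (simp add: field_simps)
    finally show ?thesis by simp
  qed
  then have "cmod (f x - g x) \<le> 0" by (rule field_le_epsilon)
  then show ?thesis by simp
qed

section \<open>The dynamics\<close>

definition phase :: "real \<Rightarrow> affine_monoid \<Rightarrow> complex" where
  "phase t s = exp (\<i> * of_real (t * ln (real (fst (Rep_affine_monoid s)))))"

lemma phase_aff: "0 < m \<Longrightarrow> phase t (aff m j) = exp (\<i> * of_real (t * ln (real m)))"
  by (simp add: phase_def aff_def Abs_affine_monoid_inverse)

lemma norm_phase: "cmod (phase t s) = 1"
  by (simp add: phase_def)

text \<open>The unitary implementing the dynamics multiplies the fibre over \<open>m\<close> by \<open>m\<^bsup>it\<^esup>\<close>.\<close>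

definition dyn_unitary :: "real \<Rightarrow> operator" where
  "dyn_unitary t = weighted_pull_op (phase t) id"

lemma coord_dyn_unitary:
  "0 < m \<Longrightarrow> coord (blinfun_apply (dyn_unitary t) \<xi>) m j = exp (\<i> * of_real (t * ln (real m))) * coord \<xi> m j"
  by (simp add: dyn_unitary_def Rep_weighted_pull_op norm_phase phase_aff)

lemma adj_dyn_unitary: "adj (dyn_unitary t) = dyn_unitary (- t)"
proof -
  have "(\<lambda>s. cnj (phase t s)) = phase (- t)" by (simp add: fun_eq_iff phase_def exp_cnj)
  then show ?thesis
    unfolding dyn_unitary_def using adj_eqI[OF is_adjoint_diagonal[of "phase t"]] norm_phase by simp
qed

lemma dyn_unitary_adjointable: "dyn_unitary t \<in> adjointable"
  unfolding dyn_unitary_def using is_adjoint_diagonal[of "phase t"] norm_phase adjointableI by simp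

lemma dyn_unitary_inverse: "dyn_unitary t o\<^sub>L dyn_unitary (- t) = id_blinfun"
  by (rule operator_eqI) (simp add: coord_dyn_unitary flip: exp_add)

lemma dyn_unitary_inverse': "dyn_unitary (- t) o\<^sub>L dyn_unitary t = id_blinfun"
  using dyn_unitary_inverse[of "- t"] by simp

lemma norm_dyn_unitary: "norm (dyn_unitary t) \<le> 1"
  by (rule norm_blinfun_bound) (simp_all add: dyn_unitary_def weighted_pull_op.rep_eq norm_weighted_pull)

definition flow :: "real \<Rightarrow> operator \<Rightarrow> operator" where
  "flow t x = dyn_unitary t o\<^sub>L x o\<^sub>L dyn_unitary (- t)"

lemma flow_add: "flow t (x + y) = flow t x + flow t y"
  by (simp add: flow_def compose_linear)

lemma flow_diff: "flow t (x - y) = flow t x - flow t y"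
  by (simp add: flow_def compose_linear)

lemma flow_comp: "flow t (x o\<^sub>L y) = flow t x o\<^sub>L flow t y"
proof -
  have "flow t x o\<^sub>L flow t y = dyn_unitary t o\<^sub>L (x o\<^sub>L ((dyn_unitary (- t) o\<^sub>L dyn_unitary t) o\<^sub>L (y o\<^sub>L dyn_unitary (- t))))"
    by (simp add: flow_def compose_assoc)
  then show ?thesis by (simp add: dyn_unitary_inverse' blinfun_compose_id_left flow_def compose_assoc)
qed

lemma flow_cmult: "flow t (cmult c o\<^sub>L x) = cmult c o\<^sub>L flow t x"
  unfolding flow_def
  by (metis compose_assoc compose_cmult dyn_unitary_adjointable)

lemma flow_adj: "x \<in> adjointable \<Longrightarrow> flow t (adj x) = adj (flow t x)"
  unfolding flow_def
  by (simp add: adj_compose adj_dyn_unitary dyn_unitary_adjointable adjointable_intros compose_assoc)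

lemma flow_inverse: "flow t (flow (- t) x) = x"
proof -
  have "flow t (flow (- t) x) = (dyn_unitary t o\<^sub>L dyn_unitary (- t)) o\<^sub>L x o\<^sub>L (dyn_unitary t o\<^sub>L dyn_unitary (- t))"
    by (simp add: flow_def compose_assoc)
  then show ?thesis by (simp add: dyn_unitary_inverse blinfun_compose_id_left blinfun_compose_id_right)
qed

lemma norm_flow: "norm (flow t x) = norm x"
proof -
  have le: "norm (flow t x) \<le> norm x" for t x
  proof -
    have "norm (flow t x) \<le> norm (dyn_unitary t o\<^sub>L x) * norm (dyn_unitary (- t))"
      unfolding flow_def by (rule norm_blinfun_compose)
    also have "\<dots> \<le> norm (dyn_unitary t o\<^sub>L x) * 1" by (intro mult_left_mono norm_dyn_unitary) simp
    also have "\<dots> \<le> norm (dyn_unitary t) * norm x" using norm_blinfun_compose by simp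
    also have "\<dots> \<le> 1 * norm x" by (intro mult_right_mono norm_dyn_unitary) simp
    finally show ?thesis by simp
  qed
  show ?thesis using le[of t x] le[of "- t" "flow t x"] flow_inverse[of "- t" x] by simp
qed

text \<open>The logarithm of the degree \<open>a / b\<close> of \<open>V\<^sub>a U\<^sup>k V\<^sub>b\<^sup>*\<close>, at which the dynamics acts as a character.\<close>

definition log_deg :: "nat \<Rightarrow> nat \<Rightarrow> real" where
  "log_deg a b = ln (real a) - ln (real b)"

lemma powr_quotient:
  assumes "0 < a" "0 < b"
  shows "(of_nat a / of_nat b) powr z = exp (z * complex_of_real (log_deg a b))"
proof -
  have "of_nat a / of_nat b = complex_of_real (real a / real b)" by simp
  moreover have "Ln (complex_of_real (real a / real b)) = complex_of_real (ln (real a / real b))"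
    using assms by (intro Ln_of_real) simp
  ultimately show ?thesis using assms by (simp add: powr_def log_deg_def ln_div)
qed

lemma flow_mon:
  assumes "0 < a" "0 < b"
  shows "flow t (mon a k b) = cmult (exp (\<i> * of_real (t * log_deg a b))) o\<^sub>L mon a k b"
proof (rule operator_eqI)
  fix \<xi> m j assume m: "0 < (m::nat)"
  show "coord (blinfun_apply (flow t (mon a k b)) \<xi>) m j =
    coord (blinfun_apply (cmult (exp (\<i> * of_real (t * log_deg a b))) o\<^sub>L mon a k b) \<xi>) m j"
  proof (cases "a dvd m")
    case True
    then obtain q where q: "m = a * q" by blast
    then have q0: "0 < q" using m by simp
    have "exp (\<i> * complex_of_real (t * ln (real (a * q)))) * exp (\<i> * complex_of_real (- t * ln (real (b * q)))) =
        exp (\<i> * of_real (t * log_deg a b))"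
      unfolding exp_add[symmetric] using assms q0 by (simp add: log_deg_def ln_mult algebra_simps)
    with True assms m q q0 show ?thesis
      by (simp add: flow_def coord_dyn_unitary coord_mon cmult.rep_eq cscale.rep_eq mult.assoc[symmetric])
  qed (use assms m in \<open>simp add: flow_def coord_dyn_unitary coord_mon cmult.rep_eq cscale.rep_eq\<close>)
qed

lemma flow_toeplitz:
  assumes x: "x \<in> toeplitz" shows "flow t x \<in> toeplitz"
proof -
  have span: "flow t y \<in> toep_span" if "y \<in> toep_span" for y
    using that by (induction rule: toep_span.induct) (simp_all add: flow_mon flow_add flow_cmult toep_span.intros)
  show ?thesis
    unfolding toeplitz_eq_closure closure_approachable
  proof (intro allI impI)
    fix e :: real assume "0 < e"
    then obtain y where "y \<in> toep_span" "norm (x - y) < e" using toeplitz_approx[OF x] by blast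
    then show "\<exists>y\<in>toep_span. dist y (flow t x) < e"
      using span norm_flow[of t "x - y"] by (auto simp: flow_diff dist_norm norm_minus_commute intro!: bexI[of _ "flow t y"])
  qed
qed

lemma star_automorphism_flow: "star_automorphism toeplitz (flow t)"
  unfolding star_automorphism_def
proof (intro conjI ballI allI)
  show "bij_betw (flow t) toeplitz toeplitz"
    using flow_inverse[of t] flow_inverse[of "- t"] flow_toeplitz
    by (intro bij_betw_byWitness[where f' = "flow (- t)"]) auto
qed (rule flow_add flow_comp flow_cmult norm_flow | simp add: flow_adj toeplitz_adjointable)+

text \<open>An isometric automorphism is determined by its values on the monomials, hence the conjugation by \<open>dyn_unitary t\<close> is the automorphism singled out in the definition of \<open>dyn\<close>.\<close>

lemma dyn_eq_flow:
  assumes x: "x \<in> toeplitz" shows "dyn t x = flow t x"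
proof -
  let ?P = "\<lambda>\<alpha>. star_automorphism toeplitz \<alpha> \<and>
     (\<forall>a b k. 0 < a \<longrightarrow> 0 < b \<longrightarrow>
        \<alpha> (V_op a o\<^sub>L U_pow k o\<^sub>L adj (V_op b)) =
          cmult ((of_nat a / of_nat b) powr (\<i> * of_real t)) o\<^sub>L
            (V_op a o\<^sub>L U_pow k o\<^sub>L adj (V_op b)))"
  have "?P (flow t)"
    using star_automorphism_flow
    by (simp add: flow_mon powr_quotient mult.assoc flip: mon_def)
  moreover have "\<alpha> x = flow t x" if \<alpha>: "?P \<alpha>" for \<alpha>
  proof -
    have add: "\<alpha> (u + v) = \<alpha> u + \<alpha> v" if "u \<in> toeplitz" "v \<in> toeplitz" for u v
      using \<alpha> that unfolding star_automorphism_def by blast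
    have cm: "\<alpha> (cmult c o\<^sub>L u) = cmult c o\<^sub>L \<alpha> u" if "u \<in> toeplitz" for u c
      using \<alpha> that unfolding star_automorphism_def by blast
    have nrm: "norm (\<alpha> u) = norm u" if "u \<in> toeplitz" for u
      using \<alpha> that unfolding star_automorphism_def by blast
    have span: "\<alpha> u = flow t u" if "u \<in> toep_span" for u
      using that
    proof (induction rule: toep_span.induct)
      case (mon a b k)
      then show ?case using \<alpha> by (simp add: flow_mon powr_quotient mult.assoc flip: mon_def)
    qed (simp_all add: add cm flow_add flow_cmult toep_span_toeplitz)
    have "norm (\<alpha> x - flow t x) \<le> 0 + e" if "0 < e" for e
    proof -
      obtain y where y: "y \<in> toep_span" "norm (x - y) < e / 2"
        using toeplitz_approx[OF x, of "e / 2"] \<open>0 < e\<close> by auto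
      have yt: "y \<in> toeplitz" by (rule toep_span_toeplitz[OF y(1)])
      have d: "\<alpha> (x - y) = \<alpha> x - \<alpha> y"
        using add[OF x toeplitz_cmult[OF yt, of "-1"]] cm[OF yt, of "-1"] by (simp add: cmult_minus_one)
      have "\<alpha> x - flow t x = \<alpha> (x - y) - flow t (x - y)" by (simp add: d flow_diff span[OF y(1)])
      then have "norm (\<alpha> x - flow t x) \<le> norm (\<alpha> (x - y)) + norm (flow t (x - y))"
        using norm_triangle_ineq4 by metis
      also have "\<dots> \<le> e" using y(2) by (simp add: nrm norm_flow toeplitz_diff x yt)
      finally show ?thesis by simp
    qed
    then have "norm (\<alpha> x - flow t x) \<le> 0" by (rule field_le_epsilon)
    then show ?thesis by simp
  qed
  ultimately have "(THE y. \<exists>\<alpha>. ?P \<alpha> \<and> y = \<alpha> x) = flow t x"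
    by (intro the_equality) (blast, metis)
  then show ?thesis unfolding dyn_def by (simp only: conj_assoc)
qed

section \<open>The KMS condition on the spanning monomials\<close>

text \<open>On the monomial of logarithmic degree \<open>l\<close> the dynamics is multiplication by \<open>exp (i t l)\<close>, which makes sense for complex \<open>t\<close>.\<close>

lemma entire_extension_mon:
  assumes ab: "0 < a" "0 < b"
  shows "entire_extension (mon a k b) (\<lambda>z. cmult (exp (\<i> * z * of_real (log_deg a b))) o\<^sub>L mon a k b)"
  unfolding entire_extension_def
proof (intro conjI allI)
  show "cmult (exp (\<i> * of_real t * of_real (log_deg a b))) o\<^sub>L mon a k b = dyn t (mon a k b)" for t
    using ab by (simp add: dyn_eq_flow mon_toeplitz flow_mon mult.assoc)
  show "cmult (exp (\<i> * z * of_real (log_deg a b))) o\<^sub>L mon a k b \<in> toeplitz" for z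
    using ab by (intro toeplitz_cmult mon_toeplitz)
  fix z :: complex
  let ?L = "complex_of_real (log_deg a b)" and ?x = "mon a k b"
  have lin: "bounded_linear (\<lambda>c. cmult c o\<^sub>L ?x)"
  proof (rule bounded_linear_intro)
    show "norm (cmult c o\<^sub>L ?x) \<le> norm c * norm ?x" for c by (rule norm_cmult_compose_le)
    show "cmult (r *\<^sub>R c) o\<^sub>L ?x = r *\<^sub>R (cmult c o\<^sub>L ?x)" for r c
      by (simp add: scaleR_conv_of_real cmult_mult[symmetric] compose_assoc cmult_of_real
          bounded_bilinear.scaleR_left[OF bounded_bilinear_blinfun_compose])
  qed (simp add: cmult_add compose_linear)
  have "((\<lambda>z. exp (\<i> * z * ?L)) has_field_derivative exp (\<i> * z * ?L) * (\<i> * ?L)) (at z)"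
    by (auto intro!: derivative_eq_intros)
  then have "((\<lambda>z. exp (\<i> * z * ?L)) has_derivative (\<lambda>h. exp (\<i> * z * ?L) * (\<i> * ?L) * h)) (at z)"
    by (simp only: has_field_derivative_def)
  from bounded_linear.has_derivative[OF lin this]
  have "((\<lambda>z. cmult (exp (\<i> * z * ?L)) o\<^sub>L ?x) has_derivative
      (\<lambda>h. cmult (exp (\<i> * z * ?L) * (\<i> * ?L) * h) o\<^sub>L ?x)) (at z)" .
  moreover have "(\<lambda>h. cmult (exp (\<i> * z * ?L) * (\<i> * ?L) * h) o\<^sub>L ?x) =
      (\<lambda>h. cmult h o\<^sub>L (cmult (exp (\<i> * z * ?L) * (\<i> * ?L)) o\<^sub>L ?x))"
    by (simp add: compose_assoc[symmetric] cmult_mult mult_ac)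
  ultimately show "\<exists>D. ((\<lambda>z. cmult (exp (\<i> * z * ?L)) o\<^sub>L ?x) has_derivative (\<lambda>h. cmult h o\<^sub>L D)) (at z)"
    by metis
qed

text \<open>The KMS condition in terms of moments: a KMS state is determined by its restriction to the powers of \<open>U\<close>.\<close>

definition KMS_values :: "real \<Rightarrow> (operator \<Rightarrow> complex) \<Rightarrow> bool" where
  "KMS_values \<beta> \<phi> \<longleftrightarrow> (\<forall>a b k. 0 < a \<longrightarrow> 0 < b \<longrightarrow>
     \<phi> (mon a k b) = (if a = b then of_real (real a powr (- \<beta>)) * \<phi> (U_pow k) else 0))"

lemma log_deg_zero_iff: "0 < a \<Longrightarrow> 0 < b \<Longrightarrow> log_deg a b = 0 \<longleftrightarrow> a = b"
  by (simp add: log_deg_def)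

lemma log_deg_one: "log_deg a 1 = ln (real a)"
  by (simp add: log_deg_def)

text \<open>For \<open>a = b\<close> move \<open>V\<^sub>a\<close> past \<open>U\<^sup>k V\<^sub>a\<^sup>*\<close> and use that \<open>V\<^sub>a\<close> is an isometry. For \<open>a \<noteq> b\<close> compare the monomial with its own multiple by \<open>(a/b)\<^bsup>-\<beta>\<^esup>\<close>; when \<open>\<beta> = 0\<close> this factor is \<open>1\<close>, and invariance at a time at which the character takes the value \<open>-1\<close> replaces it.\<close>

lemma KMS_values_of_KMS_state:
  assumes \<phi>: "\<phi> \<in> KMS_states \<beta>"
  shows "KMS_values \<beta> \<phi>"
  unfolding KMS_values_def
proof (intro allI impI)
  fix a b k assume ab: "0 < (a::nat)" "0 < (b::nat)"
  have st: "is_state toeplitz \<phi>" using \<phi> by (simp add: KMS_states_def)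
  note kms = \<phi>[unfolded KMS_states_def mem_Collect_eq]
  have tw: "\<phi> (mon a k b o\<^sub>L y) = exp (- of_real (\<beta> * log_deg a b)) * \<phi> (y o\<^sub>L mon a k b)"
    if y: "y \<in> toeplitz" and ab: "0 < a" "0 < b" for a b k y
  proof -
    have "\<phi> (mon a k b o\<^sub>L y) =
        \<phi> (y o\<^sub>L (cmult (exp (\<i> * (\<i> * of_real \<beta>) * of_real (log_deg a b))) o\<^sub>L mon a k b))"
      using kms y entire_extension_mon[OF ab, of k] mon_toeplitz[OF ab] by blast
    also have "y o\<^sub>L (cmult c o\<^sub>L mon a k b) = cmult c o\<^sub>L (y o\<^sub>L mon a k b)" for c
      by (metis compose_assoc compose_cmult toeplitz_adjointable[OF y])
    finally show ?thesis
      using y ab by (simp add: state_cmult[OF st] toeplitz_comp mon_toeplitz mult.assoc[symmetric])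
  qed
  show "\<phi> (mon a k b) = (if a = b then of_real (real a powr (- \<beta>)) * \<phi> (U_pow k) else 0)"
  proof (cases "a = b")
    case True
    have c: "mon b 0 1 o\<^sub>L mon 1 k b = mon b k b" "mon 1 k b o\<^sub>L mon b 0 1 = mon 1 k 1"
      using ab by (simp_all add: mon_comp)
    have "exp (- complex_of_real (\<beta> * log_deg b 1)) = of_real (real b powr (- \<beta>))"
      using ab by (simp add: log_deg_one[simplified] powr_def flip: exp_of_real)
    with tw[of "mon 1 k b" b 1 0] ab True show ?thesis by (simp add: c[simplified] mon_toeplitz U_pow_eq_mon)
  next
    case False
    have "\<phi> (mon a k b) = 0"
    proof (cases "\<beta> = 0")
      case True
      \<comment> \<open>At this time the character takes the value \<open>exp (i \<pi>) = -1\<close>.\<close>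
      define t where "t = pi / log_deg a b"
      have "\<phi> (mon a k b) = \<phi> (dyn t (mon a k b))" using kms True mon_toeplitz[OF ab] by simp
      also have "\<dots> = exp (\<i> * of_real (t * log_deg a b)) * \<phi> (mon a k b)"
        using ab by (simp add: dyn_eq_flow mon_toeplitz flow_mon state_cmult[OF st])
      also have "t * log_deg a b = pi" using False ab by (simp add: t_def log_deg_zero_iff)
      finally show ?thesis by (simp add: mult.commute[of \<i>])
    next
      case nz: False
      have "\<phi> (mon a k b) = exp (- of_real (\<beta> * log_deg a b)) * \<phi> (mon a k b)"
        using tw[OF id_toeplitz ab, of k] by (simp add: blinfun_compose_id_left blinfun_compose_id_right)
      moreover have "exp (- complex_of_real (\<beta> * log_deg a b)) \<noteq> 1"
      proof
        assume "exp (- complex_of_real (\<beta> * log_deg a b)) = 1"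
        then have "complex_of_real (exp (- (\<beta> * log_deg a b))) = 1" by (simp flip: exp_of_real)
        then have "\<beta> * log_deg a b = 0" by (simp only: of_real_eq_1_iff exp_eq_one_iff neg_equal_0_iff_equal)
        with nz False ab show False by (simp add: log_deg_zero_iff)
      qed
      ultimately show ?thesis by simp
    qed
    with False show ?thesis by simp
  qed
qed

context
  fixes \<phi> :: "operator \<Rightarrow> complex" and \<beta> :: real
  assumes st: "is_state toeplitz \<phi>" and vals: "KMS_values \<beta> \<phi>"
begin

lemma values_mon: "0 < a \<Longrightarrow> 0 < b \<Longrightarrow>
    \<phi> (mon a k b) = (if a = b then of_real (real a powr (- \<beta>)) * \<phi> (U_pow k) else 0)"
  using vals unfolding KMS_values_def by blast

text \<open>Both products are nonzero for \<open>\<phi>\<close> only if \<open>a c = b d\<close>; then the reduced fractions of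
  \<open>a/d\<close> and \<open>b/c\<close> coincide, and so do the exponents of \<open>U\<close> in the two products.\<close>

lemma twisted_trace_mon:
  assumes a: "0 < a" and b: "0 < b" and c: "0 < c" and d: "0 < d"
  shows "\<phi> (mon c l d o\<^sub>L mon a k b) = exp (- of_real (\<beta> * log_deg c d)) * \<phi> (mon a k b o\<^sub>L mon c l d)"
proof -
  define g where "g = gcd d a"
  define h where "h = gcd b c"
  obtain d' a' where d': "d = d' * g" and a': "a = a' * g" and cop1: "coprime d' a'"
    using gcd_coprime_exists[of d a] d unfolding g_def by auto
  obtain b' c' where b': "b = b' * h" and c': "c = c' * h" and cop2: "coprime b' c'"
    using gcd_coprime_exists[of b c] b unfolding h_def by auto
  have gh: "0 < g" "0 < h" and pos: "0 < a'" "0 < b'" "0 < c'" "0 < d'"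
    using a b c d a' b' c' d' by (auto intro: Nat.gr0I)
  have div: "d div g = d'" "a div g = a'" "b div h = b'" "c div h = c'" using gh a' b' c' d' by simp_all
  have L: "mon c l d o\<^sub>L mon a k b = mon (c * a') (l * int a' + k * int d') (b * d')"
    using mon_comp[OF c d a b] unfolding g_def[symmetric] div .
  have R: "mon a k b o\<^sub>L mon c l d = mon (a * c') (k * int c' + l * int b') (d * b')"
    using mon_comp[OF a b c d] unfolding h_def[symmetric] div .
  have iff1: "c * a' = b * d' \<longleftrightarrow> c' * a' = b' * d'" using gh by (simp add: b' c')
  have iff2: "a * c' = d * b' \<longleftrightarrow> c' * a' = b' * d'" using gh by (simp add: a' d' mult_ac)
  show ?thesis
  proof (cases "c' * a' = b' * d'")
    case True
    have "a' dvd b'" using True cop1 by (metis coprime_commute coprime_dvd_mult_left_iff dvd_triv_right)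
    moreover have "b' dvd a'" using True cop2 by (metis coprime_dvd_mult_right_iff dvd_triv_left)
    ultimately have "a' = b'" by (rule dvd_antisym)
    with True pos have "c' = d'" by simp
    have eq: "real (c * a') = real c / real d * real (a * c')"
      using gh pos by (simp add: a' d' \<open>c' = d'\<close>)
    have "exp (- complex_of_real (\<beta> * log_deg c d)) * complex_of_real (real (a * c') powr - \<beta>) =
        of_real ((real c / real d) powr - \<beta> * real (a * c') powr - \<beta>)"
      using c d by (simp add: powr_def log_deg_def ln_div flip: exp_of_real)
    also have "(real c / real d) powr - \<beta> * real (a * c') powr - \<beta> = real (c * a') powr - \<beta>"
      unfolding eq by (subst powr_mult) simp_all
    finally have fac: "exp (- complex_of_real (\<beta> * log_deg c d)) * complex_of_real (real (a * c') powr - \<beta>) =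
      of_real (real (c * a') powr - \<beta>)" .
    have "\<phi> (mon c l d o\<^sub>L mon a k b) = of_real (real (c * a') powr - \<beta>) * \<phi> (U_pow (l * int a' + k * int d'))"
      unfolding L using True iff1 a b c d pos values_mon[of "c * a'" "b * d'"] by simp
    moreover have "\<phi> (mon a k b o\<^sub>L mon c l d) = of_real (real (a * c') powr - \<beta>) * \<phi> (U_pow (l * int a' + k * int d'))"
      unfolding R using True iff2 a b c d pos values_mon[of "a * c'" "d * b'"]
      by (simp add: \<open>c' = d'\<close> \<open>a' = b'\<close> add.commute)
    ultimately show ?thesis unfolding fac[symmetric] by (simp add: mult.assoc)
  next
    case False
    then have "c * a' \<noteq> b * d'" "a * c' \<noteq> d * b'" using iff1 iff2 by blast+
    then show ?thesis unfolding L R using a b c d pos by (simp add: values_mon)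
  qed
qed

lemma comp_left_lipschitz:
  assumes y: "y \<in> toeplitz" and "x \<in> toeplitz" "x' \<in> toeplitz"
  shows "cmod (\<phi> (y o\<^sub>L x) - \<phi> (y o\<^sub>L x')) \<le> 2 * norm y * norm (x - x')"
proof -
  have "cmod (\<phi> (y o\<^sub>L x) - \<phi> (y o\<^sub>L x')) \<le> 2 * norm ((y o\<^sub>L x) - (y o\<^sub>L x'))"
    using assms by (intro state_diff_bound[OF st] toeplitz_comp)
  also have "\<dots> = 2 * norm (y o\<^sub>L (x - x'))" by (simp add: compose_linear)
  also have "\<dots> \<le> 2 * norm y * norm (x - x')" using norm_blinfun_compose[of y "x - x'"] by simp
  finally show ?thesis .
qed

lemma comp_right_lipschitz:
  assumes y: "y \<in> toeplitz" and "x \<in> toeplitz" "x' \<in> toeplitz"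
  shows "cmod (\<phi> (x o\<^sub>L y) - \<phi> (x' o\<^sub>L y)) \<le> 2 * norm y * norm (x - x')"
proof -
  have "cmod (\<phi> (x o\<^sub>L y) - \<phi> (x' o\<^sub>L y)) \<le> 2 * norm ((x o\<^sub>L y) - (x' o\<^sub>L y))"
    using assms by (intro state_diff_bound[OF st] toeplitz_comp)
  also have "\<dots> = 2 * norm ((x - x') o\<^sub>L y)" by (simp add: compose_linear)
  also have "\<dots> \<le> 2 * norm y * norm (x - x')" using norm_blinfun_compose[of "x - x'" y] by (simp add: mult_ac)
  finally show ?thesis .
qed

lemma twisted_trace:
  assumes x: "x \<in> toeplitz" and cd: "0 < c" "0 < d"
  shows "\<phi> (mon c l d o\<^sub>L x) = exp (- of_real (\<beta> * log_deg c d)) * \<phi> (x o\<^sub>L mon c l d)"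
proof (rule toeplitz_lipschitz_eqI[OF _ _ _ x])
  let ?y = "mon c l d" and ?r = "exp (- complex_of_real (\<beta> * log_deg c d))"
  have y: "?y \<in> toeplitz" by (rule mon_toeplitz[OF cd])
  show "cmod (\<phi> (?y o\<^sub>L u) - \<phi> (?y o\<^sub>L v)) \<le> 2 * norm ?y * norm (u - v)" if "u \<in> toeplitz" "v \<in> toeplitz" for u v
    by (rule comp_left_lipschitz[OF y that])
  show "cmod (?r * \<phi> (u o\<^sub>L ?y) - ?r * \<phi> (v o\<^sub>L ?y)) \<le> (cmod ?r * (2 * norm ?y)) * norm (u - v)"
    if "u \<in> toeplitz" "v \<in> toeplitz" for u v
    using mult_left_mono[OF comp_right_lipschitz[OF y that], of "cmod ?r"]
    by (simp only: right_diff_distrib[symmetric] norm_mult norm_ge_zero mult.assoc)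
  fix u assume "u \<in> toep_span"
  then show "\<phi> (?y o\<^sub>L u) = ?r * \<phi> (u o\<^sub>L ?y)"
  proof (induction rule: toep_span.induct)
    case (mon a b k)
    then show ?case by (rule twisted_trace_mon[OF _ _ cd])
  next
    case (add u v)
    then show ?case using y
      by (simp add: compose_linear state_add[OF st] toeplitz_comp toep_span_toeplitz distrib_left)
  next
    case (cmult u r)
    have "?y o\<^sub>L (cmult r o\<^sub>L u) = cmult r o\<^sub>L (?y o\<^sub>L u)"
      by (metis compose_assoc compose_cmult mon_adjointable)
    with cmult y show ?case
      by (simp add: compose_assoc state_cmult[OF st] toeplitz_comp toep_span_toeplitz)
  qed
qed

lemma flow_invariant:
  assumes x: "x \<in> toeplitz" shows "\<phi> (flow t x) = \<phi> x"
proof (rule toeplitz_lipschitz_eqI[OF _ _ _ x])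
  show "cmod (\<phi> (flow t u) - \<phi> (flow t v)) \<le> 2 * norm (u - v)" if "u \<in> toeplitz" "v \<in> toeplitz" for u v
    using state_diff_bound[OF st flow_toeplitz[OF that(1)] flow_toeplitz[OF that(2)], of t t]
    by (simp add: norm_flow flip: flow_diff)
  show "cmod (\<phi> u - \<phi> v) \<le> 2 * norm (u - v)" if "u \<in> toeplitz" "v \<in> toeplitz" for u v
    by (rule state_diff_bound[OF st that])
  fix u assume "u \<in> toep_span"
  then show "\<phi> (flow t u) = \<phi> u"
  proof (induction rule: toep_span.induct)
    case (mon a b k)
    then show ?case
      by (cases "a = b") (simp_all add: flow_mon state_cmult[OF st] mon_toeplitz values_mon log_deg_def)
  qed (simp_all add: flow_add flow_cmult state_add[OF st] state_cmult[OF st] flow_toeplitz toep_span_toeplitz)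
qed

text \<open>For \<open>y = V\<^sub>c U\<^sup>l V\<^sub>d\<^sup>*\<close> invariance and the twisted trace property determine \<open>\<phi>(y \<sigma>\<^sub>t(x))\<close> for real \<open>t\<close>; the
  identity theorem carries the formula to \<open>t = i\<beta>\<close>.\<close>

lemma KMS_condition_mon:
  assumes x: "x \<in> toeplitz" and F: "entire_extension x F" and cd: "0 < c" "0 < d"
  shows "\<phi> (x o\<^sub>L mon c l d) = \<phi> (mon c l d o\<^sub>L F (\<i> * of_real \<beta>))"
proof -
  let ?y = "mon c l d" and ?L = "complex_of_real (log_deg c d)"
  have y: "?y \<in> toeplitz" by (rule mon_toeplitz[OF cd])
  have FT: "F z \<in> toeplitz" for z using F unfolding entire_extension_def by blast
  define h where "h z = \<phi> (?y o\<^sub>L F z)" for z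
  have hol: "h holomorphic_on UNIV"
    unfolding holomorphic_on_open[OF open_UNIV]
  proof (intro ballI)
    fix z :: complex
    obtain D where D: "(F has_derivative (\<lambda>h. cmult h o\<^sub>L D)) (at z)" using F unfolding entire_extension_def by blast
    then have est: "\<exists>r>0. \<forall>w. norm (w - z) < r \<longrightarrow> norm (F w - F z - (cmult (w - z) o\<^sub>L D)) \<le> e * norm (w - z)"
      if "0 < e" for e using that unfolding has_derivative_at_alt by blast
    have DT: "D \<in> toeplitz"
    proof -
      have "D \<in> closure toeplitz"
        unfolding closure_approachable
      proof (intro allI impI)
        fix e :: real assume "0 < e"
        then obtain r where r: "0 < r"
          "\<And>w. norm (w - z) < r \<Longrightarrow> norm (F w - F z - (cmult (w - z) o\<^sub>L D)) \<le> e / 2 * norm (w - z)"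
          using est[of "e / 2"] by auto
        define s where "s = r / 2"
        have s: "0 < s" "s < r" using r(1) by (simp_all add: s_def)
        have "norm (F (z + of_real s) - F z - s *\<^sub>R D) \<le> e / 2 * s"
          using r(2)[of "z + of_real s"] s by (simp add: cmult_of_real)
        moreover have "inverse s *\<^sub>R (F (z + of_real s) - F z) - D = inverse s *\<^sub>R (F (z + of_real s) - F z - s *\<^sub>R D)"
          using s by (simp add: scaleR_diff_right)
        ultimately have "norm (inverse s *\<^sub>R (F (z + of_real s) - F z) - D) \<le> inverse s * (e / 2 * s)"
          using s by (simp only: norm_scaleR) (simp only: abs_of_pos positive_imp_inverse_positive mult_left_mono less_imp_le)
        moreover have "inverse s * (e / 2 * s) = e / 2" using s by (simp add: field_simps)
        ultimately have "norm (inverse s *\<^sub>R (F (z + of_real s) - F z) - D) \<le> e / 2" by linarith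
        then show "\<exists>y\<in>toeplitz. dist y D < e" using \<open>0 < e\<close> FT
          by (intro bexI[of _ "inverse s *\<^sub>R (F (z + of_real s) - F z)"]) (auto simp: dist_norm intro!: toeplitz_intros)
      qed
      then show ?thesis using closed_toeplitz by simp
    qed
    have "(h has_derivative (\<lambda>w. \<phi> (?y o\<^sub>L D) * w)) (at z)"
      unfolding has_derivative_at_alt
    proof (intro conjI allI impI bounded_linear_mult_right)
      fix e :: real assume "0 < e"
      let ?K = "2 * norm ?y + 1"
      have K: "0 < ?K" by (simp add: add_nonneg_pos)
      then obtain r where r: "0 < r"
        "\<And>w. norm (w - z) < r \<Longrightarrow> norm (F w - F z - (cmult (w - z) o\<^sub>L D)) \<le> e / ?K * norm (w - z)"
        using est[of "e / ?K"] \<open>0 < e\<close> by auto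
      have "cmod (h w - h z - \<phi> (?y o\<^sub>L D) * (w - z)) \<le> e * cmod (w - z)" if w: "norm (w - z) < r" for w
      proof -
        let ?v = "F w - F z - (cmult (w - z) o\<^sub>L D)"
        have "?y o\<^sub>L (cmult (w - z) o\<^sub>L D) = cmult (w - z) o\<^sub>L (?y o\<^sub>L D)"
          by (metis compose_assoc compose_cmult mon_adjointable)
        then have "\<phi> (?y o\<^sub>L ?v) = h w - h z - \<phi> (?y o\<^sub>L D) * (w - z)"
          using FT DT y by (simp add: h_def compose_linear state_diff[OF st] state_cmult[OF st] toeplitz_intros)
        then have "cmod (h w - h z - \<phi> (?y o\<^sub>L D) * (w - z)) \<le> 2 * norm (?y o\<^sub>L ?v)"
          using state_bound[OF st, of "?y o\<^sub>L ?v"] FT DT y by (metis toeplitz_comp toeplitz_diff toeplitz_cmult)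
        also have "\<dots> \<le> 2 * (norm ?y * norm ?v)" using norm_blinfun_compose by simp
        also have "\<dots> \<le> ?K * norm ?v" by (simp add: distrib_right)
        also have "\<dots> \<le> ?K * (e / ?K * norm (w - z))" using r(2)[OF w] K by (intro mult_left_mono) auto
        also have "\<dots> = e * cmod (w - z)" using K by simp
        finally show ?thesis .
      qed
      with r(1) show "\<exists>r>0. \<forall>w. norm (w - z) < r \<longrightarrow> norm (h w - h z - \<phi> (?y o\<^sub>L D) * (w - z)) \<le> e * norm (w - z)"
        by blast
    qed
    then show "\<exists>f'. (h has_field_derivative f') (at z)" by (auto simp: has_field_derivative_def)
  qed
  have real: "h (of_real t) = exp (- (\<i> * of_real t * ?L)) * \<phi> (?y o\<^sub>L x)" for t
  proof -
    have "h (of_real t) = \<phi> (?y o\<^sub>L flow t x)"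
      using F x by (simp add: h_def entire_extension_def dyn_eq_flow)
    also have "\<dots> = \<phi> (flow (- t) (?y o\<^sub>L flow t x))"
      using flow_invariant[of "?y o\<^sub>L flow t x" "- t"] y x by (simp add: toeplitz_comp flow_toeplitz)
    also have "flow (- t) (?y o\<^sub>L flow t x) = cmult (exp (- (\<i> * of_real t * ?L))) o\<^sub>L (?y o\<^sub>L x)"
      using flow_inverse[of "- t" x] by (simp add: flow_comp flow_mon[OF cd] compose_assoc mult_ac)
    finally show ?thesis using x y by (simp add: state_cmult[OF st] toeplitz_comp)
  qed
  have lim: "(0::complex) islimpt range complex_of_real"
    unfolding islimpt_approachable
  proof (intro allI impI)
    fix e :: real assume "0 < e"
    then show "\<exists>x'\<in>range complex_of_real. x' \<noteq> 0 \<and> dist x' 0 < e"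
      by (intro bexI[OF _ rangeI[of complex_of_real "e / 2"]]) auto
  qed
  have "(\<lambda>z. h z - exp (- (\<i> * z * ?L)) * \<phi> (?y o\<^sub>L x)) holomorphic_on UNIV"
    by (intro holomorphic_intros hol)
  then have "h z - exp (- (\<i> * z * ?L)) * \<phi> (?y o\<^sub>L x) = 0" for z
    by (rule analytic_continuation[OF _ open_UNIV connected_UNIV subset_UNIV UNIV_I lim _ UNIV_I])
      (use real in auto)
  from this[of "\<i> * of_real \<beta>"]
  have "h (\<i> * of_real \<beta>) = exp (of_real \<beta> * ?L) * \<phi> (?y o\<^sub>L x)" by (simp add: mult.assoc[symmetric])
  also have "\<dots> = \<phi> (x o\<^sub>L ?y)"
    unfolding twisted_trace[OF x cd] mult.assoc[symmetric] exp_add[symmetric] by simp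
  finally show ?thesis by (simp add: h_def)
qed

lemma KMS_state_of_KMS_values: "\<phi> \<in> KMS_states \<beta>"
  unfolding KMS_states_def
proof (intro CollectI conjI st ballI allI impI)
  fix x F y assume x: "x \<in> toeplitz" and F: "entire_extension x F" and y: "y \<in> toeplitz"
  let ?w = "F (\<i> * of_real \<beta>)"
  have w: "?w \<in> toeplitz" using F unfolding entire_extension_def by blast
  show "\<phi> (x o\<^sub>L y) = \<phi> (y o\<^sub>L ?w)"
  proof (rule toeplitz_lipschitz_eqI[OF comp_left_lipschitz[OF x] comp_right_lipschitz[OF w] _ y])
    fix u assume "u \<in> toep_span"
    then show "\<phi> (x o\<^sub>L u) = \<phi> (u o\<^sub>L ?w)"
    proof (induction rule: toep_span.induct)
      case (mon c d l)
      then show ?case by (rule KMS_condition_mon[OF x F])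
    next
      case (add u v)
      then show ?case using x w by (simp add: compose_linear state_add[OF st] toeplitz_comp toep_span_toeplitz)
    next
      case (cmult u r)
      have "x o\<^sub>L (cmult r o\<^sub>L u) = cmult r o\<^sub>L (x o\<^sub>L u)"
        by (metis compose_assoc compose_cmult toeplitz_adjointable[OF x])
      with cmult x w show ?case
        by (simp add: compose_assoc state_cmult[OF st] toeplitz_comp toep_span_toeplitz)
    qed
  qed
next
  fix t x assume "x \<in> toeplitz"
  then show "\<phi> (dyn t x) = \<phi> x" by (simp add: dyn_eq_flow flow_invariant)
qed

end

theorem KMS_states_iff: "\<phi> \<in> KMS_states \<beta> \<longleftrightarrow> is_state toeplitz \<phi> \<and> KMS_values \<beta> \<phi>"
proof (intro iffI conjI)
  assume "\<phi> \<in> KMS_states \<beta>"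
  then show "is_state toeplitz \<phi>" unfolding KMS_states_def by blast
qed (blast intro: KMS_values_of_KMS_state KMS_state_of_KMS_values)+

section \<open>The diagonal function algebra\<close>

text \<open>Compressing an operator of the algebra to the fibre over \<open>n\<close> gives a multiplication operator on the
  circle, so the diagonal becomes an algebra of functions of \<open>(n, z)\<close>; the compression of
  \<open>V\<^sub>b U\<^sup>k V\<^sub>b\<^sup>*\<close> is \<open>diag_fun b k\<close>.  Functions vanish off \<open>n > 0\<close>, \<open>\<bar>z\<bar> = 1\<close>, so that the sup norm can be
  taken over all pairs.\<close>

type_synonym point = "nat \<times> complex"

definition diag_fun :: "nat \<Rightarrow> int \<Rightarrow> point \<Rightarrow> complex" where
  "diag_fun b k = (\<lambda>(n, z). if 0 < n \<and> z \<in> circle \<and> b dvd n then z powi (k * int (n div b)) else 0)"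

inductive_set diag_span :: "(point \<Rightarrow> complex) set" where
  gen: "0 < b \<Longrightarrow> diag_fun b k \<in> diag_span"
| add: "f \<in> diag_span \<Longrightarrow> g \<in> diag_span \<Longrightarrow> (\<lambda>x. f x + g x) \<in> diag_span"
| cmult: "f \<in> diag_span \<Longrightarrow> (\<lambda>x. c * f x) \<in> diag_span"

definition diag_alg :: "(point \<Rightarrow> complex) set" where
  "diag_alg = {h. \<forall>e>0. \<exists>p\<in>diag_span. \<forall>x. cmod (h x - p x) \<le> e}"

definition diag_real :: "(point \<Rightarrow> real) set" where
  "diag_real = {h. (\<lambda>x. complex_of_real (h x)) \<in> diag_alg}"

definition diag_unit :: "point \<Rightarrow> real" where
  "diag_unit = (\<lambda>(n, z). if 0 < n \<and> z \<in> circle then 1 else 0)"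

lemma diag_unit_eq: "complex_of_real (diag_unit x) = diag_fun 1 0 x"
  by (cases x) (simp add: diag_unit_def diag_fun_def)

lemma diag_span_subset: "p \<in> diag_span \<Longrightarrow> p \<in> diag_alg"
  unfolding diag_alg_def by (auto intro!: bexI[of _ p])

lemma diag_algE:
  assumes "h \<in> diag_alg" "0 < e"
  obtains p where "p \<in> diag_span" "\<And>x. cmod (h x - p x) \<le> e"
  using assms unfolding diag_alg_def by blast

lemma approxI:
  "p \<in> S \<Longrightarrow> (\<And>x. cmod (h x - p x) \<le> e) \<Longrightarrow> \<exists>p\<in>S. \<forall>x. cmod (h x - p x) \<le> e"
  by blast

lemma diag_alg_closed:
  assumes "\<And>e. 0 < e \<Longrightarrow> \<exists>g\<in>diag_alg. \<forall>x. cmod (h x - g x) \<le> e"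
  shows "h \<in> diag_alg"
  unfolding diag_alg_def
proof (intro CollectI allI impI)
  fix e :: real assume "0 < e"
  then have e2: "0 < e / 2" by simp
  obtain g where g: "g \<in> diag_alg" "\<And>x. cmod (h x - g x) \<le> e / 2" using assms[OF e2] by blast
  obtain p where p: "p \<in> diag_span" "\<And>x. cmod (g x - p x) \<le> e / 2" using diag_algE[OF g(1) e2] by blast
  have "cmod (h x - p x) \<le> e" for x
    using norm_triangle_ineq[of "h x - g x" "g x - p x"] g(2)[of x] p(2)[of x] by simp
  with p(1) show "\<exists>p\<in>diag_span. \<forall>x. cmod (h x - p x) \<le> e" by blast
qed

lemma diag_alg_add:
  assumes "f \<in> diag_alg" "g \<in> diag_alg" shows "(\<lambda>x. f x + g x) \<in> diag_alg"
  unfolding diag_alg_def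
proof (intro CollectI allI impI)
  fix e :: real assume "0 < e"
  then have e2: "0 < e / 2" by simp
  obtain p where p: "p \<in> diag_span" "\<And>x. cmod (f x - p x) \<le> e / 2" using diag_algE[OF assms(1) e2] by blast
  obtain q where q: "q \<in> diag_span" "\<And>x. cmod (g x - q x) \<le> e / 2" using diag_algE[OF assms(2) e2] by blast
  have "cmod (f x + g x - (p x + q x)) \<le> e" for x
    using norm_triangle_ineq[of "f x - p x" "g x - q x"] p(2)[of x] q(2)[of x] by (simp add: algebra_simps)
  then show "\<exists>p\<in>diag_span. \<forall>x. cmod (f x + g x - p x) \<le> e"
    by (rule approxI[OF diag_span.add[OF p(1) q(1)]])
qed

lemma diag_alg_cmult:
  assumes "f \<in> diag_alg" shows "(\<lambda>x. c * f x) \<in> diag_alg"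
  unfolding diag_alg_def
proof (intro CollectI allI impI)
  fix e :: real assume "0 < e"
  then have "0 < e / (cmod c + 1)" by (simp add: add_nonneg_pos)
  then obtain p where p: "p \<in> diag_span" "\<And>x. cmod (f x - p x) \<le> e / (cmod c + 1)"
    using diag_algE[OF assms] by blast
  have "cmod (c * f x - c * p x) \<le> e" for x
  proof -
    have "cmod (c * f x - c * p x) \<le> (cmod c + 1) * cmod (f x - p x)"
      by (simp add: right_diff_distrib[symmetric] norm_mult distrib_right)
    also have "\<dots> \<le> (cmod c + 1) * (e / (cmod c + 1))" by (intro mult_left_mono p) simp
    also have "\<dots> = e" by (simp add: add_nonneg_eq_0_iff)
    finally show ?thesis .
  qed
  then show "\<exists>p\<in>diag_span. \<forall>x. cmod (c * f x - p x) \<le> e"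
    by (rule approxI[OF diag_span.cmult[OF p(1)]])
qed

lemma cmod_diag_fun_le: "cmod (diag_fun b k x) \<le> 1"
  by (cases x) (auto simp: diag_fun_def norm_power_int)

lemma diag_span_bounded: "p \<in> diag_span \<Longrightarrow> \<exists>B. \<forall>x. cmod (p x) \<le> B"
proof (induction rule: diag_span.induct)
  case (gen b k)
  then show ?case using cmod_diag_fun_le by blast
next
  case (add f g)
  then obtain A B where "\<forall>x. cmod (f x) \<le> A" "\<forall>x. cmod (g x) \<le> B" by blast
  then show ?case by (intro exI[of _ "A + B"] allI norm_triangle_le add_mono) auto
next
  case (cmult f c)
  then obtain B where "\<forall>x. cmod (f x) \<le> B" by blast
  then show ?case by (intro exI[of _ "cmod c * B"]) (auto simp: norm_mult intro: mult_left_mono)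
qed

lemma diag_alg_bounded:
  assumes "h \<in> diag_alg" obtains B where "\<And>x. cmod (h x) \<le> B" "0 \<le> B"
proof -
  obtain p where p: "p \<in> diag_span" "\<And>x. cmod (h x - p x) \<le> 1" using diag_algE[OF assms, of 1] by auto
  obtain B where B: "\<And>x. cmod (p x) \<le> B" using diag_span_bounded[OF p(1)] by blast
  have "cmod (h x) \<le> 1 + B" for x
    using norm_triangle_ineq[of "h x - p x" "p x"] p(2)[of x] B[of x] by simp
  moreover have "0 \<le> 1 + B" using order_trans[OF norm_ge_zero B[of undefined]] by simp
  ultimately show ?thesis using that by blast
qed

lemma diag_fun_mult:
  assumes "0 < b" "0 < c"
  shows "diag_fun b k x * diag_fun c l x = diag_fun (lcm b c) (k * int (lcm b c div b) + l * int (lcm b c div c)) x"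
proof -
  obtain n z where x: "x = (n, z)" by (cases x)
  show ?thesis
  proof (cases "0 < n \<and> z \<in> circle \<and> b dvd n \<and> c dvd n")
    case True
    define m where "m = lcm b c"
    have "m dvd n" using True by (simp add: m_def)
    then obtain q where q: "n = m * q" by blast
    obtain u v where u: "m = b * u" and v: "m = c * v" unfolding m_def by (meson dvd_lcm1 dvd_lcm2 dvdE)
    have "0 < m" using assms by (simp add: m_def lcm_pos_nat)
    have "n div b = u * q" "n div c = v * q" "n div m = q" "m div b = u" "m div c = v"
      using q u v assms \<open>0 < m\<close> by (simp, metis mult.assoc nonzero_mult_div_cancel_left less_numeral_extra(3), simp_all,
        metis nonzero_mult_div_cancel_left less_numeral_extra(3))
    with True \<open>m dvd n\<close> show ?thesis
      unfolding x diag_fun_def m_def[symmetric]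
      using circle_nonzero[of z] by (auto simp: power_int_add algebra_simps)
  qed (auto simp: x diag_fun_def)
qed

lemma diag_span_mult:
  assumes "f \<in> diag_span" "g \<in> diag_span" shows "(\<lambda>x. f x * g x) \<in> diag_span"
  using assms
proof (induction arbitrary: g rule: diag_span.induct)
  case (gen b k)
  from gen(2) show ?case
  proof (induction rule: diag_span.induct)
    case (gen c l)
    have "0 < lcm b c" using \<open>0 < b\<close> \<open>0 < c\<close> by (simp add: lcm_pos_nat)
    then show ?case using diag_fun_mult[OF \<open>0 < b\<close> \<open>0 < c\<close>] by (simp add: diag_span.gen)
  next
    case (add f g)
    then show ?case using diag_span.add[OF add.IH] by (simp add: distrib_left)
  next
    case (cmult f c)
    then show ?case using diag_span.cmult[OF cmult.IH, of c] by (simp add: mult_ac)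
  qed
next
  case (add f f')
  then show ?case using diag_span.add[OF add.IH(1)[OF add.prems] add.IH(2)[OF add.prems]] by (simp add: distrib_right)
next
  case (cmult f c)
  then show ?case using diag_span.cmult[OF cmult.IH[OF cmult.prems], of c] by (simp add: mult_ac)
qed

lemma diag_alg_mult:
  assumes f: "f \<in> diag_alg" and g: "g \<in> diag_alg" shows "(\<lambda>x. f x * g x) \<in> diag_alg"
  unfolding diag_alg_def
proof (intro CollectI allI impI)
  fix e :: real assume e: "0 < e"
  obtain F where F: "\<And>x. cmod (f x) \<le> F" "0 \<le> F" using diag_alg_bounded[OF f] by blast
  obtain G where G: "\<And>x. cmod (g x) \<le> G" "0 \<le> G" using diag_alg_bounded[OF g] by blast
  define d where "d = min 1 (e / (F + G + 1))"
  have FG: "0 < F + G + 1" using F(2) G(2) by simp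
  have d: "0 < d" "d \<le> 1" using e FG by (simp_all add: d_def)
  have "d \<le> e / (F + G + 1)" by (simp add: d_def)
  then have d3: "d * (F + G + 1) \<le> e" using FG by (simp only: pos_le_divide_eq)
  obtain p where p: "p \<in> diag_span" "\<And>x. cmod (f x - p x) \<le> d" using diag_algE[OF f d(1)] by blast
  obtain q where q: "q \<in> diag_span" "\<And>x. cmod (g x - q x) \<le> d" using diag_algE[OF g d(1)] by blast
  have "cmod (f x * g x - p x * q x) \<le> e" for x
  proof -
    have "cmod (q x) \<le> G + 1"
      using norm_triangle_ineq2[of "q x" "g x"] q(2)[of x] G(1)[of x] d by (simp add: norm_minus_commute)
    then have "cmod (f x) * cmod (g x - q x) + cmod (f x - p x) * cmod (q x) \<le> F * d + d * (G + 1)"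
      using F(1)[of x] p(2)[of x] q(2)[of x] F(2) G(2) d by (intro add_mono mult_mono) auto
    moreover have "f x * g x - p x * q x = f x * (g x - q x) + (f x - p x) * q x" by (simp add: algebra_simps)
    ultimately show ?thesis
      using norm_triangle_ineq[of "f x * (g x - q x)" "(f x - p x) * q x"] d3
      unfolding norm_mult by (simp only: distrib_left distrib_right mult.commute[of _ d] mult_1_right)
  qed
  then show "\<exists>p\<in>diag_span. \<forall>x. cmod (f x * g x - p x) \<le> e"
    by (rule approxI[OF diag_span_mult[OF p(1) q(1)]])
qed

lemma cnj_diag_fun: "cnj (diag_fun b k x) = diag_fun b (- k) x"
  by (cases x) (auto simp: diag_fun_def cnj_powi_circle simp del: complex_cnj_power_int)

lemma diag_span_cnj: "f \<in> diag_span \<Longrightarrow> (\<lambda>x. cnj (f x)) \<in> diag_span"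
proof (induction rule: diag_span.induct)
  case (gen b k)
  then show ?case by (simp add: cnj_diag_fun diag_span.gen)
next
  case (add f g)
  then show ?case using diag_span.add[OF add.IH] by simp
next
  case (cmult f c)
  then show ?case using diag_span.cmult[OF cmult.IH, of "cnj c"] by simp
qed

lemma diag_alg_cnj:
  assumes "f \<in> diag_alg" shows "(\<lambda>x. cnj (f x)) \<in> diag_alg"
  unfolding diag_alg_def
proof (intro CollectI allI impI)
  fix e :: real assume "0 < e"
  then obtain p where p: "p \<in> diag_span" "\<And>x. cmod (f x - p x) \<le> e" using diag_algE[OF assms] by blast
  have "cmod (cnj (f x) - cnj (p x)) \<le> e" for x
    using p(2)[of x] by (metis complex_cnj_diff complex_mod_cnj)
  then show "\<exists>p\<in>diag_span. \<forall>x. cmod (cnj (f x) - p x) \<le> e"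
    by (rule approxI[OF diag_span_cnj[OF p(1)]])
qed

lemma diag_alg_domain: "h \<in> diag_alg \<Longrightarrow> diag_unit x = 0 \<Longrightarrow> h x = 0"
proof -
  assume h: "h \<in> diag_alg" and x: "diag_unit x = 0"
  have span: "p x = 0" if "p \<in> diag_span" for p
    using that
  proof (induction rule: diag_span.induct)
    case (gen b k)
    then show ?case using x by (cases x) (auto simp: diag_fun_def diag_unit_def split: if_splits)
  qed simp_all
  have "cmod (h x) \<le> 0 + e" if "0 < e" for e
  proof -
    obtain p where "p \<in> diag_span" "\<And>x. cmod (h x - p x) \<le> e" using diag_algE[OF h \<open>0 < e\<close>] by blast
    then show ?thesis using span[of p] by (metis add_0 diff_zero)
  qed
  then have "cmod (h x) \<le> 0" by (rule field_le_epsilon)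
  then show "h x = 0" by simp
qed

lemma diag_real_unit: "diag_unit \<in> diag_real"
  unfolding diag_real_def using diag_span_subset[OF diag_span.gen[of 1 0]] by (simp add: diag_unit_eq)

lemma diag_real_add: "f \<in> diag_real \<Longrightarrow> g \<in> diag_real \<Longrightarrow> (\<lambda>x. f x + g x) \<in> diag_real"
  unfolding diag_real_def using diag_alg_add by force

lemma diag_real_scale: "f \<in> diag_real \<Longrightarrow> (\<lambda>x. r * f x) \<in> diag_real"
  unfolding diag_real_def using diag_alg_cmult[of _ "of_real r"] by force

lemma diag_real_mult: "f \<in> diag_real \<Longrightarrow> g \<in> diag_real \<Longrightarrow> (\<lambda>x. f x * g x) \<in> diag_real"
  unfolding diag_real_def using diag_alg_mult by force

lemma diag_real_minus: "f \<in> diag_real \<Longrightarrow> (\<lambda>x. - f x) \<in> diag_real"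
  using diag_real_scale[of f "-1"] by simp

lemma diag_real_diff: "f \<in> diag_real \<Longrightarrow> g \<in> diag_real \<Longrightarrow> (\<lambda>x. f x - g x) \<in> diag_real"
  using diag_real_add[of f "\<lambda>x. - g x"] diag_real_minus[of g] by simp

lemma diag_real_Re: "h \<in> diag_alg \<Longrightarrow> (\<lambda>x. Re (h x)) \<in> diag_real"
proof -
  assume h: "h \<in> diag_alg"
  have "(\<lambda>x. (1/2) * (h x + cnj (h x))) \<in> diag_alg"
    by (intro diag_alg_cmult diag_alg_add diag_alg_cnj h)
  moreover have "(\<lambda>x. (1/2) * (h x + cnj (h x))) = (\<lambda>x. complex_of_real (Re (h x)))"
    by (simp add: complex_add_cnj)
  ultimately show ?thesis by (simp add: diag_real_def)
qed

lemma diag_real_Im: "h \<in> diag_alg \<Longrightarrow> (\<lambda>x. Im (h x)) \<in> diag_real"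
  using diag_real_Re[OF diag_alg_cmult[of h "- \<i>"]] by simp

lemma diag_real_bounded:
  assumes "h \<in> diag_real" obtains B where "\<And>x. \<bar>h x\<bar> \<le> B * diag_unit x" "0 \<le> B"
proof -
  have h: "(\<lambda>x. complex_of_real (h x)) \<in> diag_alg" using assms by (simp add: diag_real_def)
  obtain B where B: "\<And>x. cmod (complex_of_real (h x)) \<le> B" "0 \<le> B" using diag_alg_bounded[OF h] by blast
  have "\<bar>h x\<bar> \<le> B * diag_unit x" for x
    using B(1)[of x] diag_alg_domain[OF h, of x] by (cases x) (auto simp: diag_unit_def split: if_splits)
  with B(2) that show ?thesis by blast
qed

text \<open>The algebra is a vector lattice, as \<open>\<bar>t\<bar>\<close> is a uniform limit of polynomials on bounded intervals.\<close>

lemma diag_real_polynomial: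
  fixes p :: "real \<Rightarrow> real"
  assumes "real_polynomial_function p" and h: "h \<in> diag_real"
  shows "(\<lambda>x. diag_unit x * p (h x)) \<in> diag_real"
  using assms(1)
proof (induction rule: real_polynomial_function.induct)
  case (linear f)
  then obtain c where c: "f = (\<lambda>x. x * c)" using real_bounded_linear by blast
  have "(\<lambda>x. c * (diag_unit x * h x)) \<in> diag_real" by (intro diag_real_scale diag_real_mult diag_real_unit h)
  then show ?case by (simp add: c mult_ac)
next
  case (const c)
  have "(\<lambda>x. c * diag_unit x) \<in> diag_real" by (intro diag_real_scale diag_real_unit)
  then show ?case by (simp add: mult.commute)
next
  case (add p q)
  then show ?case using diag_real_add[OF add.IH] by (simp add: distrib_left)
next
  case (mult p q)
  have "(\<lambda>x. diag_unit x * p (h x) * (diag_unit x * q (h x))) = (\<lambda>x. diag_unit x * (p (h x) * q (h x)))"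
    by (auto simp: diag_unit_def fun_eq_iff)
  then show ?case using diag_real_mult[OF mult.IH] by (simp only:)
qed

lemma diag_real_abs:
  assumes h: "h \<in> diag_real" shows "(\<lambda>x. \<bar>h x\<bar>) \<in> diag_real"
  unfolding diag_real_def
proof (intro CollectI diag_alg_closed)
  fix e :: real assume e: "0 < e"
  obtain B where B: "\<And>x. \<bar>h x\<bar> \<le> B * diag_unit x" "0 \<le> B" using diag_real_bounded[OF h] by blast
  have "continuous_on {-B..B} (\<lambda>t::real. \<bar>t\<bar>)" by (intro continuous_intros)
  then obtain p where p: "real_polynomial_function p" "\<And>t. t \<in> {-B..B} \<Longrightarrow> \<bar>\<bar>t\<bar> - p t\<bar> < e"
    using Stone_Weierstrass_real_polynomial_function[OF compact_Icc _ e] by blast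
  have "\<bar>\<bar>h x\<bar> - diag_unit x * p (h x)\<bar> \<le> e" for x
    using B(1)[of x] p(2)[of "h x"] e by (cases x) (auto simp: diag_unit_def abs_le_iff split: if_splits)
  then have "cmod (complex_of_real \<bar>h x\<bar> - complex_of_real (diag_unit x * p (h x))) \<le> e" for x
    by (metis norm_of_real of_real_diff)
  moreover have q: "(\<lambda>x. complex_of_real (diag_unit x * p (h x))) \<in> diag_alg"
    using diag_real_polynomial[OF p(1) h] by (simp add: diag_real_def)
  ultimately show "\<exists>g\<in>diag_alg. \<forall>x. cmod (complex_of_real \<bar>h x\<bar> - g x) \<le> e"
    by (intro approxI[OF q])
qed

lemma diag_real_pos: "f \<in> diag_real \<Longrightarrow> (\<lambda>x. max 0 (f x)) \<in> diag_real"
proof -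
  assume f: "f \<in> diag_real"
  have "(\<lambda>x. (1/2) * (f x + \<bar>f x\<bar>)) \<in> diag_real" by (intro diag_real_scale diag_real_add diag_real_abs f)
  moreover have "(\<lambda>x. (1/2) * (f x + \<bar>f x\<bar>)) = (\<lambda>x. max 0 (f x))" by (auto simp: fun_eq_iff max_def)
  ultimately show ?thesis by simp
qed

lemma diag_real_min: "f \<in> diag_real \<Longrightarrow> g \<in> diag_real \<Longrightarrow> (\<lambda>x. min (f x) (g x)) \<in> diag_real"
proof -
  assume f: "f \<in> diag_real" and g: "g \<in> diag_real"
  have "(\<lambda>x. f x - max 0 (f x - g x)) \<in> diag_real" by (intro diag_real_diff diag_real_pos f g)
  moreover have "(\<lambda>x. f x - max 0 (f x - g x)) = (\<lambda>x. min (f x) (g x))" by (auto simp: fun_eq_iff max_def min_def)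
  ultimately show ?thesis by simp
qed

text \<open>The endomorphism \<open>x \<mapsto> V\<^sub>b x V\<^sub>b\<^sup>*\<close> and its left inverse \<open>x \<mapsto> V\<^sub>b\<^sup>* x V\<^sub>b\<close>, in terms of functions.\<close>

definition stretch :: "nat \<Rightarrow> (point \<Rightarrow> 'a::zero) \<Rightarrow> point \<Rightarrow> 'a" where
  "stretch b h = (\<lambda>(n, z). if b dvd n then h (n div b, z) else 0)"

definition compress :: "nat \<Rightarrow> (point \<Rightarrow> 'a) \<Rightarrow> point \<Rightarrow> 'a" where
  "compress b h = (\<lambda>(n, z). h (b * n, z))"

lemma compress_stretch: "0 < b \<Longrightarrow> compress b (stretch b h) = h"
  by (auto simp: compress_def stretch_def fun_eq_iff)

lemma stretch_compress: "(\<And>n z. \<not> b dvd n \<Longrightarrow> h (n, z) = 0) \<Longrightarrow> stretch b (compress b h) = h"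
  by (auto simp: compress_def stretch_def fun_eq_iff)

lemma stretch_diag_fun:
  assumes "0 < b" "0 < c" shows "stretch b (diag_fun c k) = diag_fun (b * c) k"
proof (rule ext, clarify)
  fix n z
  show "stretch b (diag_fun c k) (n, z) = diag_fun (b * c) k (n, z)"
  proof (cases "b dvd n")
    case True
    then obtain q where "n = b * q" by blast
    then show ?thesis using assms by (simp add: stretch_def diag_fun_def)
  next
    case False
    then have "\<not> b * c dvd n" using dvd_mult_left by blast
    with False show ?thesis by (simp add: stretch_def diag_fun_def)
  qed
qed

lemma compress_diag_fun:
  assumes "0 < b" "0 < c"
  shows "compress b (diag_fun c k) = diag_fun (c div gcd b c) (k * int (b div gcd b c))"
proof (rule ext, clarify)
  fix n z
  define g where "g = gcd b c"
  obtain b' c' where b': "b = b' * g" and c': "c = c' * g" and cop: "coprime b' c'"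
    using gcd_coprime_exists[of b c] assms unfolding g_def by auto
  have g: "0 < g" "0 < b'" "0 < c'" using assms b' c' by (auto intro: Nat.gr0I)
  have div: "b div g = b'" "c div g = c'" using g b' c' by simp_all
  have dvd: "c dvd b * n \<longleftrightarrow> c' dvd n"
  proof -
    have "c dvd b * n \<longleftrightarrow> g * c' dvd g * (b' * n)" using b' c' by (simp add: mult_ac)
    also have "\<dots> \<longleftrightarrow> c' dvd n" using g cop by (simp add: coprime_dvd_mult_right_iff coprime_commute)
    finally show ?thesis .
  qed
  show "compress b (diag_fun c k) (n, z) = diag_fun (c div gcd b c) (k * int (b div gcd b c)) (n, z)"
    unfolding g_def[symmetric] div
  proof (cases "c' dvd n")
    case True
    then obtain q where q: "n = c' * q" by blast
    have "b * n div c = b' * q"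
    proof -
      have "b * n = c * (b' * q)" using b' c' q by simp
      then show ?thesis using assms by simp
    qed
    moreover have "n div c' = q" using q g by simp
    ultimately show "compress b (diag_fun c k) (n, z) = diag_fun c' (k * int b') (n, z)"
      using True dvd assms by (simp add: compress_def diag_fun_def mult.assoc)
  next
    case False
    then show "compress b (diag_fun c k) (n, z) = diag_fun c' (k * int b') (n, z)"
      using dvd by (simp add: compress_def diag_fun_def)
  qed
qed

lemma stretch_diag_alg:
  assumes b: "0 < b" and h: "h \<in> diag_alg" shows "stretch b h \<in> diag_alg"
proof -
  have span: "stretch b p \<in> diag_span" if "p \<in> diag_span" for p
    using that
  proof (induction rule: diag_span.induct)
    case (gen c k)
    then show ?case using b by (simp add: stretch_diag_fun diag_span.gen)
  next
    case (add f g)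
    have "stretch b (\<lambda>x. f x + g x) = (\<lambda>x. stretch b f x + stretch b g x)" by (auto simp: stretch_def fun_eq_iff)
    then show ?case using diag_span.add[OF add.IH] by simp
  next
    case (cmult f c)
    have "stretch b (\<lambda>x. c * f x) = (\<lambda>x. c * stretch b f x)" by (auto simp: stretch_def fun_eq_iff)
    then show ?case using diag_span.cmult[OF cmult.IH, of c] by simp
  qed
  show ?thesis
    unfolding diag_alg_def
  proof (intro CollectI allI impI)
    fix e :: real assume e: "0 < e"
    then obtain p where p: "p \<in> diag_span" "\<And>x. cmod (h x - p x) \<le> e" using diag_algE[OF h] by blast
    have "cmod (stretch b h x - stretch b p x) \<le> e" for x
      using p(2) e by (cases x) (simp add: stretch_def)
    then show "\<exists>p\<in>diag_span. \<forall>x. cmod (stretch b h x - p x) \<le> e"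
      by (rule approxI[OF span[OF p(1)]])
  qed
qed

lemma compress_diag_alg:
  assumes b: "0 < b" and h: "h \<in> diag_alg" shows "compress b h \<in> diag_alg"
proof -
  have span: "compress b p \<in> diag_span" if "p \<in> diag_span" for p
    using that
  proof (induction rule: diag_span.induct)
    case (gen c k)
    have "0 < c div gcd b c" using gen b by (simp add: div_greater_zero_iff dvd_imp_le)
    then show ?case using b gen by (simp add: compress_diag_fun diag_span.gen)
  next
    case (add f g)
    have "compress b (\<lambda>x. f x + g x) = (\<lambda>x. compress b f x + compress b g x)" by (auto simp: compress_def fun_eq_iff)
    then show ?case using diag_span.add[OF add.IH] by simp
  next
    case (cmult f c)
    have "compress b (\<lambda>x. c * f x) = (\<lambda>x. c * compress b f x)" by (auto simp: compress_def fun_eq_iff)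
    then show ?case using diag_span.cmult[OF cmult.IH, of c] by simp
  qed
  show ?thesis
    unfolding diag_alg_def
  proof (intro CollectI allI impI)
    fix e :: real assume e: "0 < e"
    then obtain p where p: "p \<in> diag_span" "\<And>x. cmod (h x - p x) \<le> e" using diag_algE[OF h] by blast
    have "cmod (compress b h x - compress b p x) \<le> e" for x
      using p(2) by (cases x) (simp add: compress_def)
    then show "\<exists>p\<in>diag_span. \<forall>x. cmod (compress b h x - p x) \<le> e"
      by (rule approxI[OF span[OF p(1)]])
  qed
qed

lemma of_real_stretch: "(\<lambda>x. complex_of_real (stretch b h x)) = stretch b (\<lambda>x. complex_of_real (h x))"
  by (auto simp: stretch_def fun_eq_iff)

lemma stretch_diag_real: "0 < b \<Longrightarrow> h \<in> diag_real \<Longrightarrow> stretch b h \<in> diag_real"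
  unfolding diag_real_def mem_Collect_eq of_real_stretch by (rule stretch_diag_alg)

lemma of_real_compress: "(\<lambda>x. complex_of_real (compress b h x)) = compress b (\<lambda>x. complex_of_real (h x))"
  by (auto simp: compress_def fun_eq_iff)

lemma compress_diag_real: "0 < b \<Longrightarrow> h \<in> diag_real \<Longrightarrow> compress b h \<in> diag_real"
  unfolding diag_real_def mem_Collect_eq of_real_compress by (rule compress_diag_alg)

section \<open>Scaling functionals and their suprema\<close>

definition positive_functional :: "((point \<Rightarrow> real) \<Rightarrow> real) \<Rightarrow> bool" where
  "positive_functional L \<longleftrightarrow>
     (\<forall>f\<in>diag_real. \<forall>g\<in>diag_real. L (\<lambda>x. f x + g x) = L f + L g) \<and>
     (\<forall>f\<in>diag_real. \<forall>r. L (\<lambda>x. r * f x) = r * L f) \<and>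
     (\<forall>f\<in>diag_real. (\<forall>x. 0 \<le> f x) \<longrightarrow> 0 \<le> L f)"

text \<open>The scaling relation is the KMS condition \<open>\<phi>(V\<^sub>b x V\<^sub>b\<^sup>*) = b\<^bsup>-\<beta>\<^esup> \<phi>(x)\<close> on the diagonal.\<close>

definition scaling_functional :: "real \<Rightarrow> ((point \<Rightarrow> real) \<Rightarrow> real) \<Rightarrow> bool" where
  "scaling_functional \<beta> L \<longleftrightarrow> positive_functional L \<and>
     (\<forall>b>0. \<forall>f\<in>diag_real. L (stretch b f) = real b powr (- \<beta>) * L f)"

lemma functional_add: "positive_functional L \<Longrightarrow> f \<in> diag_real \<Longrightarrow> g \<in> diag_real \<Longrightarrow> L (\<lambda>x. f x + g x) = L f + L g"
  and functional_scale: "positive_functional L \<Longrightarrow> f \<in> diag_real \<Longrightarrow> L (\<lambda>x. r * f x) = r * L f"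
  and functional_pos: "positive_functional L \<Longrightarrow> f \<in> diag_real \<Longrightarrow> (\<And>x. 0 \<le> f x) \<Longrightarrow> 0 \<le> L f"
  unfolding positive_functional_def by blast+

lemma functional_diff: "positive_functional L \<Longrightarrow> f \<in> diag_real \<Longrightarrow> g \<in> diag_real \<Longrightarrow> L (\<lambda>x. f x - g x) = L f - L g"
  using functional_add[of L f "\<lambda>x. - 1 * g x"] functional_scale[of L g "-1"] diag_real_minus[of g] by simp

lemma functional_mono:
  assumes L: "positive_functional L" and "f \<in> diag_real" "g \<in> diag_real" "\<And>x. f x \<le> g x"
  shows "L f \<le> L g"
  using functional_pos[OF L diag_real_diff[of g f]] functional_diff[OF L, of g f] assms by simp

text \<open>Elements of the algebra vanish off the support of the unit, so \<open>C \<cdot> diag_unit\<close> dominates any \<open>h\<close> bounded by \<open>C\<close>.\<close>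

lemma functional_bound:
  assumes L: "positive_functional L" and h: "h \<in> diag_real" and C: "\<And>x. \<bar>h x\<bar> \<le> C"
  shows "\<bar>L h\<bar> \<le> C * L diag_unit"
proof -
  have "0 \<le> C" using C[of undefined] by simp
  have u: "(\<lambda>x. C * diag_unit x) \<in> diag_real" by (intro diag_real_scale diag_real_unit)
  have b: "\<bar>h x\<bar> \<le> C * diag_unit x" for x
  proof -
    obtain B where B: "\<bar>h x\<bar> \<le> B * diag_unit x" using diag_real_bounded[OF h] by blast
    have "diag_unit x = 0 \<or> diag_unit x = 1" by (cases x) (simp add: diag_unit_def)
    then show ?thesis using B C[of x] by auto
  qed
  have "L h \<le> C * L diag_unit"
    using functional_mono[OF L h u] b functional_scale[OF L diag_real_unit, of C] by (simp add: abs_le_iff)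
  moreover have "- L h \<le> C * L diag_unit"
    using functional_mono[OF L diag_real_minus[OF h] u] b functional_scale[OF L diag_real_unit, of C]
      functional_scale[OF L h, of "-1"] by (simp add: abs_le_iff)
  ultimately show ?thesis by simp
qed

text \<open>The Riesz decomposition: the positive part of a difference of positive functionals, first on
  the positive cone and then extended by linearity.\<close>

definition cone_part :: "((point \<Rightarrow> real) \<Rightarrow> real) \<Rightarrow> (point \<Rightarrow> real) \<Rightarrow> real" where
  "cone_part D f = (SUP g\<in>{g \<in> diag_real. \<forall>x. 0 \<le> g x \<and> g x \<le> f x}. D g)"

definition pos_part :: "((point \<Rightarrow> real) \<Rightarrow> real) \<Rightarrow> (point \<Rightarrow> real) \<Rightarrow> real" where
  "pos_part D f = cone_part D (\<lambda>x. max 0 (f x)) - cone_part D (\<lambda>x. max 0 (- f x))"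

context
  fixes L1 L2 :: "(point \<Rightarrow> real) \<Rightarrow> real"
  assumes L1: "positive_functional L1" and L2: "positive_functional L2"
begin

private abbreviation (input) D :: "(point \<Rightarrow> real) \<Rightarrow> real" where "D f \<equiv> L1 f - L2 f"

lemma D_add: "f \<in> diag_real \<Longrightarrow> g \<in> diag_real \<Longrightarrow> D (\<lambda>x. f x + g x) = D f + D g"
  by (simp add: functional_add L1 L2)

lemma D_scale: "f \<in> diag_real \<Longrightarrow> D (\<lambda>x. r * f x) = r * D f"
  by (simp add: functional_scale L1 L2 right_diff_distrib)

lemma zero_diag_real: "(\<lambda>_. 0) \<in> diag_real"
  using diag_real_scale[OF diag_real_unit, of 0] by simp

lemma cone_part_upper:
  assumes f: "f \<in> diag_real" and g: "g \<in> diag_real" "\<And>x. 0 \<le> g x" "\<And>x. g x \<le> f x"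
  shows "D g \<le> cone_part D f"
  unfolding cone_part_def
proof (rule cSUP_upper)
  show "g \<in> {g \<in> diag_real. \<forall>x. 0 \<le> g x \<and> g x \<le> f x}" using g by simp
  show "bdd_above (D ` {g \<in> diag_real. \<forall>x. 0 \<le> g x \<and> g x \<le> f x})"
  proof (rule bdd_aboveI2)
    fix g assume "g \<in> {g \<in> diag_real. \<forall>x. 0 \<le> g x \<and> g x \<le> f x}"
    then have g: "g \<in> diag_real" "\<And>x. 0 \<le> g x" "\<And>x. g x \<le> f x" by blast+
    show "D g \<le> L1 f" using functional_mono[OF L1 g(1) f g(3)] functional_pos[OF L2 g(1,2)] by simp
  qed
qed

lemma cone_part_least:
  assumes "\<And>x. 0 \<le> f x" "\<And>g. g \<in> diag_real \<Longrightarrow> (\<And>x. 0 \<le> g x) \<Longrightarrow> (\<And>x. g x \<le> f x) \<Longrightarrow> D g \<le> B"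
  shows "cone_part D f \<le> B"
  unfolding cone_part_def using assms zero_diag_real by (intro cSUP_least) auto

lemma cone_part_nonneg: "f \<in> diag_real \<Longrightarrow> (\<And>x. 0 \<le> f x) \<Longrightarrow> 0 \<le> cone_part D f"
  using cone_part_upper[of f "\<lambda>_. 0"] zero_diag_real D_scale[OF zero_diag_real, of 0] by simp

text \<open>One inequality is the Riesz decomposition property: what lies below \<open>f + g\<close> splits as \<open>min h f\<close> and the rest, which lies below \<open>g\<close>.\<close>

lemma cone_part_add:
  assumes f: "f \<in> diag_real" "\<And>x. 0 \<le> f x" and g: "g \<in> diag_real" "\<And>x. 0 \<le> g x"
  shows "cone_part D (\<lambda>x. f x + g x) = cone_part D f + cone_part D g"
proof (rule antisym)
  show "cone_part D (\<lambda>x. f x + g x) \<le> cone_part D f + cone_part D g"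
  proof (rule cone_part_least)
    fix h assume h: "h \<in> diag_real" "\<And>x. 0 \<le> h x" "\<And>x. h x \<le> f x + g x"
    let ?u = "\<lambda>x. min (h x) (f x)"
    let ?v = "\<lambda>x. h x - ?u x"
    have u: "?u \<in> diag_real" and v: "?v \<in> diag_real" by (intro diag_real_min diag_real_diff h f)+
    have "D h = D ?u + D ?v" using D_add[OF u v] by simp
    also have "\<dots> \<le> cone_part D f + cone_part D g"
    proof (rule add_mono)
      show "D ?u \<le> cone_part D f" using h f by (intro cone_part_upper u) auto
      show "D ?v \<le> cone_part D g"
      proof (rule cone_part_upper[OF g(1) v])
        show "?v x \<le> g x" for x using h(3)[of x] g(2)[of x] by (auto simp: min_def)
      qed simp
    qed
    finally show "D h \<le> cone_part D f + cone_part D g" .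
  qed (use f g in auto)
  have "cone_part D f \<le> cone_part D (\<lambda>x. f x + g x) - cone_part D g"
  proof (rule cone_part_least[OF f(2)])
    fix u assume u: "u \<in> diag_real" "\<And>x. 0 \<le> u x" "\<And>x. u x \<le> f x"
    have "cone_part D g \<le> cone_part D (\<lambda>x. f x + g x) - D u"
    proof (rule cone_part_least[OF g(2)])
      fix v assume v: "v \<in> diag_real" "\<And>x. 0 \<le> v x" "\<And>x. v x \<le> g x"
      have "D (\<lambda>x. u x + v x) \<le> cone_part D (\<lambda>x. f x + g x)"
        using u v by (intro cone_part_upper diag_real_add f g) (auto intro: add_mono)
      then show "D v \<le> cone_part D (\<lambda>x. f x + g x) - D u" using D_add[OF u(1) v(1)] by simp
    qed
    then show "D u \<le> cone_part D (\<lambda>x. f x + g x) - cone_part D g" by simp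
  qed
  then show "cone_part D f + cone_part D g \<le> cone_part D (\<lambda>x. f x + g x)" by simp
qed

lemma cone_part_scale_le:
  assumes f: "f \<in> diag_real" "\<And>x. 0 \<le> f x" and r: "0 < r"
  shows "cone_part D (\<lambda>x. r * f x) \<le> r * cone_part D f"
proof (rule cone_part_least)
  fix g assume g: "g \<in> diag_real" "\<And>x. 0 \<le> g x" "\<And>x. g x \<le> r * f x"
  have "D (\<lambda>x. inverse r * g x) \<le> cone_part D f"
    using g r by (intro cone_part_upper f diag_real_scale) (auto simp: field_simps)
  then have "inverse r * D g \<le> cone_part D f" unfolding D_scale[OF g(1), of "inverse r"] .
  then show "D g \<le> r * cone_part D f" using r by (simp add: field_simps)
qed (use f r in auto)

lemma cone_part_scale:
  assumes f: "f \<in> diag_real" "\<And>x. 0 \<le> f x" and r: "0 \<le> r"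
  shows "cone_part D (\<lambda>x. r * f x) = r * cone_part D f"
proof (cases "r = 0")
  case True
  have "cone_part D (\<lambda>_. 0) = 0"
    using cone_part_add[OF zero_diag_real _ zero_diag_real] by simp
  with True show ?thesis by simp
next
  case False
  with r have r: "0 < r" by simp
  have "cone_part D (\<lambda>x. inverse r * (r * f x)) \<le> inverse r * cone_part D (\<lambda>x. r * f x)"
    using f r by (intro cone_part_scale_le diag_real_scale) auto
  moreover have "(\<lambda>x. inverse r * (r * f x)) = f" using r by (simp add: fun_eq_iff)
  ultimately have "r * cone_part D f \<le> cone_part D (\<lambda>x. r * f x)" using r by (simp add: field_simps)
  with cone_part_scale_le[OF f r] show ?thesis by simp
qed

lemma pos_part_eq:
  assumes u: "u \<in> diag_real" "\<And>x. 0 \<le> u x" and v: "v \<in> diag_real" "\<And>x. 0 \<le> v x"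
    and f: "f = (\<lambda>x. u x - v x)"
  shows "pos_part D f = cone_part D u - cone_part D v"
proof -
  have fr: "f \<in> diag_real" unfolding f by (intro diag_real_diff u v)
  let ?p = "\<lambda>x. max 0 (f x)" and ?m = "\<lambda>x. max 0 (- f x)"
  have p: "?p \<in> diag_real" "?m \<in> diag_real" by (intro diag_real_pos diag_real_minus fr)+
  have "(\<lambda>x. ?p x + v x) = (\<lambda>x. u x + ?m x)" by (auto simp: f fun_eq_iff)
  then have "cone_part D ?p + cone_part D v = cone_part D u + cone_part D ?m"
    using cone_part_add[OF p(1) _ v] cone_part_add[OF u p(2)] by simp
  then show ?thesis unfolding pos_part_def by simp
qed

lemma pos_part_cone: "f \<in> diag_real \<Longrightarrow> (\<And>x. 0 \<le> f x) \<Longrightarrow> pos_part D f = cone_part D f"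
  using pos_part_eq[of f "\<lambda>_. 0" f] zero_diag_real cone_part_scale[OF zero_diag_real, of 0] by simp

lemma positive_functional_pos_part: "positive_functional (pos_part D)"
  unfolding positive_functional_def
proof (intro conjI ballI allI impI)
  fix f g assume f: "f \<in> diag_real" and g: "g \<in> diag_real"
  let ?p = "\<lambda>h x. max 0 (h x)" and ?m = "\<lambda>h x. max 0 (- h x :: real)"
  have pm: "?p f \<in> diag_real" "?m f \<in> diag_real" "?p g \<in> diag_real" "?m g \<in> diag_real"
    by (intro diag_real_pos diag_real_minus f g)+
  have "pos_part D (\<lambda>x. f x + g x) = cone_part D (\<lambda>x. ?p f x + ?p g x) - cone_part D (\<lambda>x. ?m f x + ?m g x)"
    by (intro pos_part_eq diag_real_add pm) (auto simp: fun_eq_iff)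
  then show "pos_part D (\<lambda>x. f x + g x) = pos_part D f + pos_part D g"
    using pm by (simp add: cone_part_add pos_part_def)
next
  fix f and r :: real assume f: "f \<in> diag_real"
  let ?p = "\<lambda>x. max 0 (f x)" and ?m = "\<lambda>x. max 0 (- f x :: real)"
  have pm: "?p \<in> diag_real" "?m \<in> diag_real" by (intro diag_real_pos diag_real_minus f)+
  show "pos_part D (\<lambda>x. r * f x) = r * pos_part D f"
  proof (cases "0 \<le> r")
    case True
    have "pos_part D (\<lambda>x. r * f x) = cone_part D (\<lambda>x. r * ?p x) - cone_part D (\<lambda>x. r * ?m x)"
      using True by (intro pos_part_eq diag_real_scale pm) (auto simp: fun_eq_iff max_def right_diff_distrib[symmetric])
    with True pm show ?thesis by (simp add: cone_part_scale pos_part_def right_diff_distrib)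
  next
    case False
    have "pos_part D (\<lambda>x. r * f x) = cone_part D (\<lambda>x. (- r) * ?m x) - cone_part D (\<lambda>x. (- r) * ?p x)"
      using False by (intro pos_part_eq diag_real_scale pm) (auto simp: fun_eq_iff max_def mult_nonpos_nonpos mult_nonpos_nonneg
          mult_less_0_iff zero_less_mult_iff zero_le_mult_iff mult_le_0_iff)
    with False pm show ?thesis
      using cone_part_scale[of ?m "- r"] cone_part_scale[of ?p "- r"] by (simp add: pos_part_def algebra_simps)
  qed
next
  fix f assume f: "f \<in> diag_real" and "\<forall>x. 0 \<le> f x"
  then have f0: "\<And>x. 0 \<le> f x" by blast
  show "0 \<le> pos_part D f" unfolding pos_part_cone[OF f f0] by (rule cone_part_nonneg[OF f f0])
qed

text \<open>The positive part inherits the scaling relation because everything below \<open>V\<^sub>b f V\<^sub>b\<^sup>*\<close> is of the form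
  \<open>V\<^sub>b g V\<^sub>b\<^sup>*\<close> with \<open>g \<le> f\<close>.\<close>

lemma cone_part_stretch:
  assumes sc: "\<And>h. h \<in> diag_real \<Longrightarrow> D (stretch b h) = c * D h" and c: "0 < c" and b: "0 < b"
    and f: "f \<in> diag_real" "\<And>x. 0 \<le> f x"
  shows "cone_part D (stretch b f) = c * cone_part D f"
proof (rule antisym)
  have st: "0 \<le> stretch b h x" if "\<And>x. 0 \<le> h x" for x and h :: "point \<Rightarrow> real"
    using that by (cases x) (simp add: stretch_def)
  show "cone_part D (stretch b f) \<le> c * cone_part D f"
  proof (rule cone_part_least[OF st[OF f(2)]])
    fix g assume g: "g \<in> diag_real" "\<And>x. 0 \<le> g x" "\<And>x. g x \<le> stretch b f x"
    have "g (n, z) = 0" if "\<not> b dvd n" for n z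
      using g(2,3)[of "(n, z)"] that by (simp add: stretch_def)
    then have eq: "stretch b (compress b g) = g" by (intro stretch_compress) blast
    have cg: "compress b g \<in> diag_real" by (rule compress_diag_real[OF b g(1)])
    have "compress b g x \<le> f x" for x
    proof -
      have "compress b g x \<le> compress b (stretch b f) x" using g(3) by (cases x) (simp add: compress_def)
      then show ?thesis by (simp add: compress_stretch[OF b])
    qed
    moreover have "0 \<le> compress b g x" for x using g(2) by (cases x) (simp add: compress_def)
    ultimately have "D (compress b g) \<le> cone_part D f" by (intro cone_part_upper f cg)
    then show "D g \<le> c * cone_part D f" using sc[OF cg] c by (simp add: eq mult_left_mono)
  qed
  have "cone_part D f \<le> cone_part D (stretch b f) / c"
  proof (rule cone_part_least[OF f(2)])
    fix h assume h: "h \<in> diag_real" "\<And>x. 0 \<le> h x" "\<And>x. h x \<le> f x"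
    have "stretch b h x \<le> stretch b f x" for x using h(3) by (cases x) (simp add: stretch_def)
    then have "D (stretch b h) \<le> cone_part D (stretch b f)"
      by (intro cone_part_upper stretch_diag_real b f h st)
    then show "D h \<le> cone_part D (stretch b f) / c" using sc[OF h(1)] c by (simp add: field_simps)
  qed
  then show "c * cone_part D f \<le> cone_part D (stretch b f)" using c by (simp add: field_simps)
qed

end

lemma positive_functional_add:
  "positive_functional L \<Longrightarrow> positive_functional M \<Longrightarrow> positive_functional (\<lambda>f. L f + M f)"
  by (simp add: positive_functional_def distrib_left)

lemma scaling_functional_add:
  "scaling_functional \<beta> L \<Longrightarrow> scaling_functional \<beta> M \<Longrightarrow> scaling_functional \<beta> (\<lambda>f. L f + M f)"
  by (simp add: scaling_functional_def positive_functional_add distrib_left)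

text \<open>The supremum is \<open>L2 + (L1 - L2)\<^sup>+\<close>, as for all positive functionals on a vector lattice, and the positive part scales. It is also the supremum in the order of the cone of scaling functionals, since differences of scaling functionals obey the scaling relation, so that only their positivity matters.\<close>

theorem scaling_functional_sup:
  assumes L1: "scaling_functional \<beta> L1" and L2: "scaling_functional \<beta> L2"
  shows "\<exists>S. scaling_functional \<beta> S \<and> scaling_functional \<beta> (\<lambda>f. S f - L1 f) \<and> scaling_functional \<beta> (\<lambda>f. S f - L2 f) \<and>
    (\<forall>M. scaling_functional \<beta> M \<longrightarrow> scaling_functional \<beta> (\<lambda>f. M f - L1 f) \<longrightarrow> scaling_functional \<beta> (\<lambda>f. M f - L2 f) \<longrightarrow>
      scaling_functional \<beta> (\<lambda>f. M f - S f))"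
proof -
  let ?D = "\<lambda>f. L1 f - L2 f"
  let ?P = "pos_part ?D"
  have p1: "positive_functional L1" and p2: "positive_functional L2"
    using L1 L2 by (simp_all add: scaling_functional_def)
  have sc: "?D (stretch b h) = real b powr (- \<beta>) * ?D h" if "0 < b" "h \<in> diag_real" for b h
    using L1 L2 that by (simp add: scaling_functional_def right_diff_distrib)
  have P: "positive_functional ?P" by (rule positive_functional_pos_part[OF p1 p2])
  have Psc: "?P (stretch b f) = real b powr (- \<beta>) * ?P f" if b: "0 < b" and f: "f \<in> diag_real" for b f
  proof -
    have pm: "(\<lambda>x. max 0 (f x)) \<in> diag_real" "(\<lambda>x. max 0 (- f x)) \<in> diag_real"
      by (intro diag_real_pos diag_real_minus f)+
    have eq: "(\<lambda>x. max 0 (stretch b f x)) = stretch b (\<lambda>x. max 0 (f x))"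
      "(\<lambda>x. max 0 (- stretch b f x)) = stretch b (\<lambda>x. max 0 (- f x))"
      by (auto simp: stretch_def fun_eq_iff)
    show ?thesis
      unfolding pos_part_def eq
      using cone_part_stretch[OF p1 p2 sc[OF b] _ b pm(1)] cone_part_stretch[OF p1 p2 sc[OF b] _ b pm(2)] b
      by (simp add: right_diff_distrib)
  qed
  have Ps: "scaling_functional \<beta> ?P" using P Psc by (simp add: scaling_functional_def)
  have ge: "positive_functional (\<lambda>f. ?P f - ?D f)"
    unfolding positive_functional_def
  proof (intro conjI ballI allI impI)
    fix f assume f: "f \<in> diag_real" "\<forall>x. 0 \<le> f x"
    then have f0: "\<And>x. 0 \<le> f x" by blast
    show "0 \<le> ?P f - ?D f"
      using cone_part_upper[OF p1 p2 f(1) f(1) f0 order_refl] pos_part_cone[OF p1 p2 f(1) f0] by linarith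
  qed (simp_all add: functional_add functional_scale P p1 p2 algebra_simps)
  have s1: "scaling_functional \<beta> (\<lambda>f. ?P f - ?D f)"
    using ge Psc sc by (simp add: scaling_functional_def right_diff_distrib)
  let ?S = "\<lambda>f. ?P f + L2 f"
  have least: "scaling_functional \<beta> (\<lambda>f. M f - ?S f)"
    if M: "scaling_functional \<beta> M" and M1: "scaling_functional \<beta> (\<lambda>f. M f - L1 f)"
      and M2: "scaling_functional \<beta> (\<lambda>f. M f - L2 f)" for M
  proof -
    have pM: "positive_functional M" "positive_functional (\<lambda>f. M f - L1 f)" "positive_functional (\<lambda>f. M f - L2 f)"
      using M M1 M2 by (simp_all add: scaling_functional_def)
    have "positive_functional (\<lambda>f. M f - ?S f)"
      unfolding positive_functional_def
    proof (intro conjI ballI allI impI)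
      fix f assume f: "f \<in> diag_real" "\<forall>x. 0 \<le> f x"
      have "cone_part ?D f \<le> M f - L2 f"
      proof (rule cone_part_least[OF p1 p2])
        fix g assume g: "g \<in> diag_real" "\<And>x. 0 \<le> g x" "\<And>x. g x \<le> f x"
        have "?D g \<le> M g - L2 g" using functional_pos[OF pM(2) g(1,2)] by simp
        also have "\<dots> \<le> M f - L2 f" using functional_mono[OF pM(3) g(1) f(1) g(3)] .
        finally show "?D g \<le> M f - L2 f" .
      qed (use f in auto)
      then show "0 \<le> M f - ?S f" using pos_part_cone[OF p1 p2 f(1)] f(2) by fastforce
    qed (simp_all add: functional_add functional_scale P pM p2 algebra_simps)
    then show ?thesis
      using M Psc L2 by (simp add: scaling_functional_def algebra_simps)
  qed
  have "(\<lambda>f. ?S f - L1 f) = (\<lambda>f. ?P f - ?D f)" "(\<lambda>f. ?S f - L2 f) = ?P" by (auto simp: fun_eq_iff)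
  then have "scaling_functional \<beta> (\<lambda>f. ?S f - L1 f)" "scaling_functional \<beta> (\<lambda>f. ?S f - L2 f)" using s1 Ps by simp_all
  then show ?thesis using least scaling_functional_add[OF Ps L2] by blast
qed

section \<open>Compression to the fibres\<close>

lemma convergent_approx:
  fixes X :: "nat \<Rightarrow> 'a::banach"
  assumes "\<And>e. 0 < e \<Longrightarrow> \<exists>Y. convergent Y \<and> (\<forall>n. norm (X n - Y n) \<le> e)"
  shows "convergent X"
proof -
  have "Cauchy X"
  proof (rule CauchyI)
    fix e :: real assume e: "0 < e"
    then obtain Y where Y: "convergent Y" "\<And>n. norm (X n - Y n) \<le> e / 4" using assms[of "e / 4"] by auto
    then obtain M where M: "\<And>m n. M \<le> m \<Longrightarrow> M \<le> n \<Longrightarrow> norm (Y m - Y n) < e / 4"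
      using CauchyD[of Y "e / 4"] e by (auto simp: Cauchy_convergent_iff)
    have "norm (X m - X n) < e" if "M \<le> m" "M \<le> n" for m n
    proof -
      have "X m - X n = (X m - Y m) + (Y m - Y n) - (X n - Y n)" by simp
      then have "norm (X m - X n) \<le> norm (X m - Y m) + norm (Y m - Y n) + norm (X n - Y n)"
        using norm_triangle_ineq4[of "(X m - Y m) + (Y m - Y n)" "X n - Y n"]
          norm_triangle_ineq[of "X m - Y m" "Y m - Y n"] by simp
      with Y(2)[of m] Y(2)[of n] M[OF that] e show ?thesis by linarith
    qed
    then show "\<exists>M. \<forall>m\<ge>M. \<forall>n\<ge>M. norm (X m - X n) < e" by blast
  qed
  then show ?thesis by (simp add: Cauchy_convergent_iff)
qed

lemma coord_basis_vec: "0 < n \<Longrightarrow> 0 < m \<Longrightarrow> coord (basis_vec (aff n j)) m i = (if m = n \<and> i = j then 1 else 0)"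
  by (simp add: basis_vec.rep_eq aff_eq_iff)

lemma mon_basis_vec:
  assumes a: "0 < a" and b: "0 < b" and n: "0 < n"
  shows "blinfun_apply (mon a k b) (basis_vec (aff n j)) =
    (if b dvd n then basis_vec (aff (a * (n div b)) (j + k * int (n div b))) else 0)"
proof (rule coord_eqI)
  fix m i assume m: "0 < (m::nat)"
  show "coord (blinfun_apply (mon a k b) (basis_vec (aff n j))) m i =
    coord (if b dvd n then basis_vec (aff (a * (n div b)) (j + k * int (n div b))) else 0) m i"
  proof (cases "b dvd n")
    case True
    then obtain q where q: "n = b * q" by blast
    then have q0: "0 < q" using n by simp
    show ?thesis
    proof (cases "a dvd m")
      case True
      then obtain r where r: "m = a * r" by blast
      then have "0 < r" using m by simp
      with a b q q0 r show ?thesis by (auto simp: coord_mon coord_basis_vec)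
    next
      case False
      then have "m \<noteq> a * q" by auto
      with False a b q q0 m show ?thesis by (simp add: coord_mon coord_basis_vec)
    qed
  next
    case False
    then have "b * (m div a) \<noteq> n" by auto
    moreover have "a dvd m \<Longrightarrow> 0 < m div a" using a m by (auto elim: dvdE)
    ultimately show ?thesis using False a b m n
      by (cases "a dvd m") (simp_all add: coord_mon coord_basis_vec zero_ell2.rep_eq)
  qed
qed

text \<open>Approximate eigenvectors of \<open>U\<close> in the fibre over \<open>n\<close>, for the eigenvalue \<open>z\<^sup>n\<close>.\<close>

definition wave :: "nat \<Rightarrow> nat \<Rightarrow> complex \<Rightarrow> affine_monoid ell2" where
  "wave K n z = cscale (of_real (1 / sqrt (real (Suc K))))
     (\<Sum>j<Suc K. cscale (z powi (- int j)) (basis_vec (aff n (int j))))"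

definition wave_form :: "nat \<Rightarrow> operator \<Rightarrow> point \<Rightarrow> complex" where
  "wave_form K x = (\<lambda>(n, z). cinner (blinfun_apply x (wave K n z)) (wave K n z))"

lemma wave_form_expand:
  assumes x: "x \<in> adjointable" and z: "z \<in> circle"
  shows "wave_form K x (n, z) = (\<Sum>i<Suc K. \<Sum>j<Suc K. z powi (int j - int i) *
      cinner (blinfun_apply x (basis_vec (aff n (int i)))) (basis_vec (aff n (int j)))) / of_nat (Suc K)"
proof -
  define c where "c = complex_of_real (1 / sqrt (real (Suc K)))"
  define v where "v = (\<Sum>j<Suc K. cscale (z powi (- int j)) (basis_vec (aff n (int j))))"
  have c: "c * cnj c = 1 / of_nat (Suc K)"
  proof -
    have "c * cnj c = complex_of_real ((1 / sqrt (real (Suc K))) * (1 / sqrt (real (Suc K))))"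
      unfolding c_def complex_cnj_complex_of_real of_real_mult ..
    also have "(1 / sqrt (real (Suc K))) * (1 / sqrt (real (Suc K))) = 1 / real (Suc K)" by (simp del: of_nat_Suc)
    finally show ?thesis by simp
  qed
  have "wave_form K x (n, z) = c * cnj c * cinner (blinfun_apply x v) v"
  proof -
    have "wave K n z = cscale c v" unfolding wave_def c_def v_def ..
    then show ?thesis
      by (simp add: wave_form_def adjointable_cscale[OF x] cinner_cscale_left cinner_cscale_right)
  qed
  also have "cinner (blinfun_apply x v) v = (\<Sum>i<Suc K. \<Sum>j<Suc K. z powi (int j - int i) *
      cinner (blinfun_apply x (basis_vec (aff n (int i)))) (basis_vec (aff n (int j))))"
    unfolding v_def blinfun.sum_right cinner_sum_left adjointable_cscale[OF x]
    unfolding cinner_sum_right cinner_cscale_left cinner_cscale_right cnj_powi_circle[OF z]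
    using circle_nonzero[OF z] by (intro sum.cong refl) (simp add: power_int_diff power_int_minus field_simps)
  finally show ?thesis by (simp add: c)
qed

text \<open>Only the diagonal monomials keep the fibre, and these act on the wave as multiplication by \<open>z\<^bsup>kn/b\<^esup>\<close> up to a boundary effect of relative size \<open>\<bar>kn/b\<bar> / (K + 1)\<close>.\<close>

lemma wave_form_mon:
  assumes a: "0 < a" and b: "0 < b" and n: "0 < n" and z: "z \<in> circle"
    and K: "\<bar>k * int (n div b)\<bar> \<le> int (Suc K)"
  shows "wave_form K (mon a k b) (n, z) =
    (if a = b then diag_fun b k (n, z) * of_real (real (Suc K - nat \<bar>k * int (n div b)\<bar>) / real (Suc K)) else 0)"
proof (cases "b dvd n")
  case True
  define m where "m = k * int (n div b)"
  have q0: "0 < n div b" using True b n by (auto elim: dvdE)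
  have an: "a * (n div b) = n \<longleftrightarrow> a = b" using True b n by (auto elim!: dvdE)
  have "z powi (int j - int i) * cinner (blinfun_apply (mon a k b) (basis_vec (aff n (int i)))) (basis_vec (aff n (int j)))
      = (if a = b then z powi m * (if int i - int j = - m then 1 else 0) else 0)" for i j
  proof -
    have "cinner (blinfun_apply (mon a k b) (basis_vec (aff n (int i)))) (basis_vec (aff n (int j))) =
        (if a = b \<and> int j = int i + m then 1 else 0)"
      using True a b n q0 an by (simp add: mon_basis_vec cinner_basis_vec coord_basis_vec m_def) auto
    moreover have "int i - int j = - m \<longleftrightarrow> int j = int i + m" by auto
    moreover have "int j = int i + m \<Longrightarrow> int j - int i = m" by simp
    ultimately show ?thesis by (cases "int j = int i + m") simp_all
  qed
  then have "wave_form K (mon a k b) (n, z) =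
      (if a = b then z powi m * (\<Sum>i<Suc K. \<Sum>j<Suc K. if int i - int j = - m then 1 else 0) / of_nat (Suc K) else 0)"
    unfolding wave_form_expand[OF mon_adjointable z] by (simp only: sum_distrib_left sum.neutral_const if_cancel div_0 split: if_split) simp
  also have "(\<Sum>i<Suc K. \<Sum>j<Suc K. if int i - int j = - m then 1 else 0) = complex_of_nat (Suc K - nat \<bar>m\<bar>)"
    using card_diagonal[of "- m" "Suc K"] K by (simp only: m_def abs_minus_cancel)
  finally show ?thesis using True n z by (simp add: diag_fun_def m_def del: of_nat_Suc)
next
  case False
  then have "wave_form K (mon a k b) (n, z) = 0"
    using a b n by (simp add: wave_form_expand[OF mon_adjointable z] mon_basis_vec)
  with False show ?thesis by (simp add: diag_fun_def)
qed

lemma norm_wave: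
  assumes "0 < n" "z \<in> circle" shows "norm (wave K n z) = 1"
proof -
  have "wave_form K (mon 1 0 1) (n, z) = 1"
    using assms by (subst wave_form_mon) (simp_all add: diag_fun_def)
  then have "complex_of_real ((norm (wave K n z))\<^sup>2) = 1"
    unfolding mon_one wave_form_def by (simp add: cinner_self_norm)
  then have "(norm (wave K n z))\<^sup>2 = 1" by (simp only: of_real_eq_1_iff)
  then have "norm (wave K n z) = 1 \<or> norm (wave K n z) = - 1" by (simp only: power2_eq_1_iff)
  then show ?thesis using norm_ge_zero[of "wave K n z"] by linarith
qed

lemma wave_form_bound:
  assumes "0 < n" "z \<in> circle" shows "cmod (wave_form K x (n, z)) \<le> norm x"
  using cmod_cinner_le[of "blinfun_apply x (wave K n z)" "wave K n z"] norm_blinfun[of x "wave K n z"]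
  by (simp add: wave_form_def norm_wave[OF assms])

lemma wave_form_add: "wave_form K (x + y) p = wave_form K x p + wave_form K y p"
  by (cases p) (simp add: wave_form_def blinfun.add_left cinner_add_left)

lemma wave_form_diff: "wave_form K (x - y) p = wave_form K x p - wave_form K y p"
  by (cases p) (simp add: wave_form_def blinfun.diff_left cinner_diff_left)

lemma wave_form_cmult: "wave_form K (cmult c o\<^sub>L x) p = c * wave_form K x p"
  by (cases p) (simp add: wave_form_def cmult.rep_eq cinner_cscale_left)

text \<open>The symbol at \<open>z\<close> of the compression of an operator to the fibre over \<open>n\<close>.\<close>

definition fibre :: "operator \<Rightarrow> point \<Rightarrow> complex" where
  "fibre x p = (if diag_unit p = 0 then 0 else lim (\<lambda>K. wave_form K x p))"

lemma wave_form_mon_tendsto: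
  assumes a: "0 < a" and b: "0 < b" and n: "0 < n" and z: "z \<in> circle"
  shows "(\<lambda>K. wave_form K (mon a k b) (n, z)) \<longlonglongrightarrow> (if a = b then diag_fun b k (n, z) else 0)"
proof (rule Lim_transform_eventually)
  let ?m = "k * int (n div b)"
  have "(\<lambda>K. diag_fun b k (n, z) * of_real (real (Suc K - nat \<bar>?m\<bar>) / real (Suc K))) \<longlonglongrightarrow> diag_fun b k (n, z) * of_real 1"
    by (intro tendsto_intros fejer_weight_limit)
  then show "(\<lambda>K. if a = b then diag_fun b k (n, z) * of_real (real (Suc K - nat \<bar>?m\<bar>) / real (Suc K)) else 0)
      \<longlonglongrightarrow> (if a = b then diag_fun b k (n, z) else 0)" by (cases "a = b") simp_all
  show "\<forall>\<^sub>F K in sequentially.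
      (if a = b then diag_fun b k (n, z) * of_real (real (Suc K - nat \<bar>?m\<bar>) / real (Suc K)) else 0) =
      wave_form K (mon a k b) (n, z)"
    using eventually_ge_at_top[of "nat \<bar>?m\<bar>"]
  proof eventually_elim
    case (elim K)
    then have "\<bar>?m\<bar> \<le> int (Suc K)" by linarith
    from wave_form_mon[OF a b n z this] show ?case by simp
  qed
qed

lemma wave_form_convergent:
  assumes x: "x \<in> toeplitz" and n: "0 < n" and z: "z \<in> circle"
  shows "convergent (\<lambda>K. wave_form K x (n, z))"
proof -
  have span: "convergent (\<lambda>K. wave_form K y (n, z))" if "y \<in> toep_span" for y
    using that
  proof (induction rule: toep_span.induct)
    case (mon a b k)
    then show ?case using wave_form_mon_tendsto[OF _ _ n z] convergentI by blast
  next
    case (add x y)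
    then show ?case by (simp add: wave_form_add convergent_add)
  next
    case (cmult x c)
    then show ?case unfolding wave_form_cmult using convergent_mult[OF convergent_const] by blast
  qed
  show ?thesis
  proof (rule convergent_approx)
    fix e :: real assume "0 < e"
    then obtain y where y: "y \<in> toep_span" "norm (x - y) < e" using toeplitz_approx[OF x] by blast
    have "norm (wave_form K x (n, z) - wave_form K y (n, z)) \<le> e" for K
      using wave_form_bound[OF n z, of K "x - y"] y(2) by (simp add: wave_form_diff)
    with span[OF y(1)] show "\<exists>Y. convergent Y \<and> (\<forall>K. norm (wave_form K x (n, z) - Y K) \<le> e)"
      by (intro exI[of _ "\<lambda>K. wave_form K y (n, z)"]) simp
  qed
qed

lemma wave_form_tendsto:
  "x \<in> toeplitz \<Longrightarrow> diag_unit p \<noteq> 0 \<Longrightarrow> (\<lambda>K. wave_form K x p) \<longlonglongrightarrow> fibre x p"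
  using wave_form_convergent[of x "fst p" "snd p"]
  by (cases p) (auto simp: fibre_def diag_unit_def convergent_LIMSEQ_iff split: if_splits)

lemma fibre_eqI: "diag_unit p \<noteq> 0 \<Longrightarrow> (\<lambda>K. wave_form K x p) \<longlonglongrightarrow> l \<Longrightarrow> fibre x p = l"
  by (simp add: fibre_def limI)

lemma fibre_mon:
  assumes "0 < a" "0 < b" shows "fibre (mon a k b) = (if a = b then diag_fun b k else (\<lambda>_. 0))"
proof
  fix p :: point
  obtain n z where p: "p = (n, z)" by (cases p)
  show "fibre (mon a k b) p = (if a = b then diag_fun b k else (\<lambda>_. 0)) p"
  proof (cases "0 < n \<and> z \<in> circle")
    case True
    then have "fibre (mon a k b) p = (if a = b then diag_fun b k (n, z) else 0)"
      using wave_form_mon_tendsto[OF assms, of n z k] by (intro fibre_eqI) (auto simp: p diag_unit_def)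
    then show ?thesis by (simp add: p)
  next
    case False
    then have "diag_unit p = 0" by (auto simp: p diag_unit_def)
    then show ?thesis using False by (auto simp: fibre_def p diag_fun_def)
  qed
qed

lemma fibre_add:
  assumes "x \<in> toeplitz" "y \<in> toeplitz" shows "fibre (x + y) = (\<lambda>p. fibre x p + fibre y p)"
proof
  fix p show "fibre (x + y) p = fibre x p + fibre y p"
  proof (cases "diag_unit p = 0")
    case False
    then show ?thesis using assms by (intro fibre_eqI) (simp_all add: wave_form_add tendsto_add wave_form_tendsto)
  qed (simp add: fibre_def)
qed

lemma fibre_cmult:
  assumes "x \<in> toeplitz" shows "fibre (cmult c o\<^sub>L x) = (\<lambda>p. c * fibre x p)"
proof
  fix p show "fibre (cmult c o\<^sub>L x) p = c * fibre x p"
  proof (cases "diag_unit p = 0")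
    case False
    then show ?thesis using assms
      by (intro fibre_eqI) (simp_all add: wave_form_cmult tendsto_mult_left wave_form_tendsto)
  qed (simp add: fibre_def)
qed

lemma fibre_diff:
  assumes "x \<in> toeplitz" "y \<in> toeplitz" shows "fibre (x - y) p = fibre x p - fibre y p"
proof -
  have eq: "x - y = x + (cmult (- 1) o\<^sub>L y)" by (simp add: cmult_minus_one)
  show ?thesis
    unfolding eq fibre_add[OF assms(1) toeplitz_cmult[OF assms(2)]] fibre_cmult[OF assms(2)] by simp
qed

lemma fibre_bound:
  assumes x: "x \<in> toeplitz" shows "cmod (fibre x p) \<le> norm x"
proof (cases "diag_unit p = 0")
  case False
  obtain n z where p: "p = (n, z)" by (cases p)
  show ?thesis
  proof (rule LIMSEQ_le_const2[OF tendsto_norm[OF wave_form_tendsto[OF x False]]])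
    show "\<exists>N. \<forall>K\<ge>N. cmod (wave_form K x p) \<le> norm x"
      using False wave_form_bound[of n z] by (auto simp: p diag_unit_def split: if_splits)
  qed
qed (simp add: fibre_def)

text \<open>Each \<open>wave_form K\<close> is a vector state, so positivity is inherited by the limit.\<close>

lemma fibre_positive:
  assumes x: "x \<in> toeplitz" shows "fibre (adj x o\<^sub>L x) p \<in> \<real>\<^sub>\<ge>\<^sub>0"
proof (cases "diag_unit p = 0")
  case False
  have T: "adj x o\<^sub>L x \<in> toeplitz" using x by (intro toeplitz_intros)
  have "wave_form K (adj x o\<^sub>L x) p \<in> \<real>\<^sub>\<ge>\<^sub>0" for K
    using norm_adj_apply[OF toeplitz_adjointable[OF x]] by (cases p) (simp add: wave_form_def del: blinfun_apply_blinfun_compose)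
  then show ?thesis
    using closed_sequentially[OF closed_nonneg_Reals_complex _ wave_form_tendsto[OF T False]] by blast
qed (simp add: fibre_def)

lemma fibre_diag_alg:
  assumes x: "x \<in> toeplitz" shows "fibre x \<in> diag_alg"
proof -
  have span: "fibre y \<in> diag_span" if "y \<in> toep_span" for y
    using that
  proof (induction rule: toep_span.induct)
    case (mon a b k)
    have "(\<lambda>x. 0 * diag_fun 1 0 x) \<in> diag_span" by (intro diag_span.intros) simp
    then show ?case using mon by (simp add: fibre_mon diag_span.gen)
  qed (simp_all add: fibre_add fibre_cmult toep_span_toeplitz diag_span.intros)
  show ?thesis
    unfolding diag_alg_def
  proof (intro CollectI allI impI)
    fix e :: real assume "0 < e"
    then obtain y where y: "y \<in> toep_span" "norm (x - y) < e" using toeplitz_approx[OF x] by blast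
    have yt: "y \<in> toeplitz" by (rule toep_span_toeplitz[OF y(1)])
    have "cmod (fibre x p - fibre y p) \<le> e" for p
      using fibre_bound[OF toeplitz_diff[OF x yt], of p] y(2) by (simp add: fibre_diff x yt)
    then show "\<exists>q\<in>diag_span. \<forall>p. cmod (fibre x p - q p) \<le> e" by (rule approxI[OF span[OF y(1)]])
  qed
qed

section \<open>From scaling functionals to KMS states\<close>

definition complexify :: "((point \<Rightarrow> real) \<Rightarrow> real) \<Rightarrow> (point \<Rightarrow> complex) \<Rightarrow> complex" where
  "complexify L h = of_real (L (\<lambda>p. Re (h p))) + \<i> * of_real (L (\<lambda>p. Im (h p)))"

definition state_of :: "((point \<Rightarrow> real) \<Rightarrow> real) \<Rightarrow> operator \<Rightarrow> complex" where
  "state_of L x = (if x \<in> toeplitz then complexify L (fibre x) else 0)"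

lemma complexify_add:
  assumes L: "positive_functional L" and f: "f \<in> diag_alg" and g: "g \<in> diag_alg"
  shows "complexify L (\<lambda>p. f p + g p) = complexify L f + complexify L g"
  using functional_add[OF L diag_real_Re[OF f] diag_real_Re[OF g]] functional_add[OF L diag_real_Im[OF f] diag_real_Im[OF g]]
  by (simp add: complexify_def distrib_left)

lemma complexify_cmult:
  assumes L: "positive_functional L" and f: "f \<in> diag_alg"
  shows "complexify L (\<lambda>p. c * f p) = c * complexify L f"
proof -
  have R: "(\<lambda>p. r * Re (f p)) \<in> diag_real" "(\<lambda>p. r * Im (f p)) \<in> diag_real" for r
    by (intro diag_real_scale diag_real_Re diag_real_Im f)+
  have "L (\<lambda>p. Re c * Re (f p) - Im c * Im (f p)) = Re c * L (\<lambda>p. Re (f p)) - Im c * L (\<lambda>p. Im (f p))"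
    using functional_diff[OF L R(1,2)] by (simp add: functional_scale[OF L] diag_real_Re diag_real_Im f)
  moreover have "L (\<lambda>p. Re c * Im (f p) + Im c * Re (f p)) = Re c * L (\<lambda>p. Im (f p)) + Im c * L (\<lambda>p. Re (f p))"
    using functional_add[OF L R(2,1)] by (simp add: functional_scale[OF L] diag_real_Re diag_real_Im f)
  ultimately show ?thesis unfolding complexify_def by (simp add: complex_eq_iff)
qed

lemma complexify_diag_fun:
  assumes L: "scaling_functional \<beta> L" and b: "0 < b"
  shows "complexify L (diag_fun b k) = of_real (real b powr (- \<beta>)) * complexify L (diag_fun 1 k)"
proof -
  have h: "diag_fun 1 k \<in> diag_alg" by (intro diag_span_subset diag_span.gen) simp
  have eq: "diag_fun b k = stretch b (diag_fun 1 k)" using stretch_diag_fun[OF b, of 1 k] by simp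
  have st: "(\<lambda>p. Re (stretch b g p)) = stretch b (\<lambda>p. Re (g p))" "(\<lambda>p. Im (stretch b g p)) = stretch b (\<lambda>p. Im (g p))"
    for g :: "point \<Rightarrow> complex" by (auto simp: stretch_def fun_eq_iff)
  have "L (stretch b f) = real b powr (- \<beta>) * L f" if "f \<in> diag_real" for f
    using L b that by (simp add: scaling_functional_def)
  then show ?thesis
    unfolding complexify_def eq st using diag_real_Re[OF h] diag_real_Im[OF h] by (simp add: algebra_simps)
qed

lemma complexify_unit: "positive_functional L \<Longrightarrow> complexify L (diag_fun 1 0) = of_real (L diag_unit)"
proof -
  assume L: "positive_functional L"
  have "(\<lambda>p. Re (diag_fun 1 0 p)) = diag_unit" "(\<lambda>p. Im (diag_fun 1 0 p)) = (\<lambda>p. 0 * diag_unit p)"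
    by (simp_all only: diag_unit_eq[symmetric] Re_complex_of_real Im_complex_of_real mult_zero_left)
  then show ?thesis
    unfolding complexify_def using functional_scale[OF L diag_real_unit, of 0] by simp
qed

lemma state_of_mon:
  assumes L: "positive_functional L" and "0 < a" "0 < b"
  shows "state_of L (mon a k b) = (if a = b then complexify L (diag_fun b k) else 0)"
proof -
  have "complexify L (\<lambda>_. 0) = 0"
    using complexify_cmult[OF L diag_span_subset[OF diag_span.gen[of 1 0]], of 0] by simp
  then show ?thesis using assms by (simp add: state_of_def mon_toeplitz fibre_mon)
qed

text \<open>The state is the functional composed with the compression to the diagonal, a positive map that annihilates the off-diagonal monomials and sends \<open>V\<^sub>b U\<^sup>k V\<^sub>b\<^sup>*\<close> to the stretched function \<open>diag_fun b k\<close>.\<close>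

theorem state_of_KMS:
  assumes L: "scaling_functional \<beta> L" and unit: "L diag_unit = 1"
  shows "state_of L \<in> KMS_states \<beta>"
proof -
  have pL: "positive_functional L" using L by (simp add: scaling_functional_def)
  have "is_state toeplitz (state_of L)"
    unfolding is_state_def
  proof (intro conjI ballI allI impI)
    show "state_of L id_blinfun = 1"
      unfolding mon_one[symmetric] using state_of_mon[OF pL, of 1 1 0] complexify_unit[OF pL] unit by simp
    fix x assume x: "x \<in> toeplitz"
    have f: "fibre (adj x o\<^sub>L x) \<in> diag_alg" using x by (intro fibre_diag_alg toeplitz_intros)
    have p: "0 \<le> Re (fibre (adj x o\<^sub>L x) p)" "Im (fibre (adj x o\<^sub>L x) p) = 0 * diag_unit p" for p
      using fibre_positive[OF x, of p] by (simp_all add: complex_nonneg_Reals_iff)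
    have "L (\<lambda>p. Im (fibre (adj x o\<^sub>L x) p)) = 0" unfolding p using functional_scale[OF pL diag_real_unit, of 0] by simp
    moreover have "0 \<le> L (\<lambda>p. Re (fibre (adj x o\<^sub>L x) p))" by (rule functional_pos[OF pL diag_real_Re[OF f] p(1)])
    ultimately show "state_of L (adj x o\<^sub>L x) \<in> \<real>\<^sub>\<ge>\<^sub>0"
      using x by (simp add: state_of_def complexify_def toeplitz_intros)
    show "state_of L (cmult c o\<^sub>L x) = c * state_of L x" for c
      using x by (simp add: state_of_def toeplitz_intros fibre_cmult complexify_cmult[OF pL] fibre_diag_alg)
    show "state_of L (x + y) = state_of L x + state_of L y" if "y \<in> toeplitz" for y
      using x that by (simp add: state_of_def toeplitz_intros fibre_add complexify_add[OF pL] fibre_diag_alg)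
  qed (simp add: state_of_def)
  moreover have "KMS_values \<beta> (state_of L)"
    unfolding KMS_values_def U_pow_eq_mon
  proof (intro allI impI)
    fix a b k assume "0 < (a::nat)" "0 < (b::nat)"
    then show "state_of L (mon a k b) = (if a = b then of_real (real a powr - \<beta>) * state_of L (mon 1 k 1) else 0)"
      using complexify_diag_fun[OF L, of b k] by (simp only: state_of_mon[OF pL] zero_less_one) simp
  qed
  ultimately show ?thesis by (simp add: KMS_states_iff)
qed

text \<open>Positive functionals are bounded by their value at the unit, so they are determined on the dense span of the generators.\<close>

lemma complexify_ext:
  assumes L: "positive_functional L" and M: "positive_functional M"
    and eq: "\<And>b k. 0 < b \<Longrightarrow> complexify L (diag_fun b k) = complexify M (diag_fun b k)"
    and f: "f \<in> diag_real"
  shows "L f = M f"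
proof -
  have span: "complexify L p = complexify M p" if "p \<in> diag_span" for p
    using that
    by (induction rule: diag_span.induct)
      (simp_all add: eq complexify_add[OF L] complexify_add[OF M] complexify_cmult[OF L] complexify_cmult[OF M] diag_span_subset)
  let ?C = "\<bar>L diag_unit\<bar> + \<bar>M diag_unit\<bar> + 1"
  have "\<bar>L f - M f\<bar> \<le> 0 + e" if e: "0 < e" for e
  proof -
    have C: "0 < ?C" by simp
    with e have d: "0 < e / ?C" by (rule divide_pos_pos)
    have fa: "(\<lambda>p. complex_of_real (f p)) \<in> diag_alg" using f by (simp add: diag_real_def)
    obtain p where p: "p \<in> diag_span" "\<And>x. cmod (complex_of_real (f x) - p x) \<le> e / ?C" using diag_algE[OF fa d] by blast
    let ?g = "\<lambda>x. Re (p x)"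
    have g: "?g \<in> diag_real" by (intro diag_real_Re diag_span_subset p)
    have near: "\<bar>f x - ?g x\<bar> \<le> e / ?C" for x using abs_Re_le_cmod[of "complex_of_real (f x) - p x"] p(2)[of x] by simp
    have "L ?g = M ?g" using arg_cong[OF span[OF p(1)], of Re] by (simp add: complexify_def)
    moreover have "\<bar>L f - L ?g\<bar> \<le> e / ?C * L diag_unit"
      using functional_bound[OF L diag_real_diff[OF f g] near] by (simp add: functional_diff[OF L f g])
    moreover have "\<bar>M f - M ?g\<bar> \<le> e / ?C * M diag_unit"
      using functional_bound[OF M diag_real_diff[OF f g] near] by (simp add: functional_diff[OF M f g])
    ultimately have "\<bar>L f - M f\<bar> \<le> e / ?C * (L diag_unit + M diag_unit)" unfolding distrib_left by linarith
    also have "\<dots> \<le> e / ?C * ?C" using d by (intro mult_left_mono) auto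
    also have "\<dots> = e" using C by simp
    finally show ?thesis by simp
  qed
  then have "\<bar>L f - M f\<bar> \<le> 0" by (rule field_le_epsilon)
  then show ?thesis by simp
qed

section \<open>Moebius inversion\<close>

lemma moebius_mu_prime_mult:
  assumes p: "prime p" and d: "0 < d" "\<not> p dvd d"
  shows "moebius_mu (p * d) = - moebius_mu d"
proof -
  have cop: "coprime p d" using p d by (simp add: prime_imp_coprime)
  have sq: "squarefree (p * d) \<longleftrightarrow> squarefree d"
    using squarefree_mult_coprime[OF cop squarefree_prime[OF p]] squarefree_multD(2)[of p d] by blast
  have "prime_factors (p * d) = insert p (prime_factors d)"
    using p d prime_gt_0_nat[OF p] by (simp add: prime_factors_product prime_prime_factors)
  moreover have "p \<notin> prime_factors d" using d by (simp add: in_prime_factors_iff)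
  ultimately have "card (prime_factors (p * d)) = Suc (card (prime_factors d))" by simp
  with sq show ?thesis by (simp add: moebius_mu_def)
qed

text \<open>For a prime \<open>p\<close> dividing \<open>q\<close>, the squarefree divisors prime to \<open>p\<close> cancel against their multiples by \<open>p\<close>.\<close>

lemma sum_moebius_mu:
  assumes q: "0 < q" shows "(\<Sum>d | d dvd q. moebius_mu d) = (if q = 1 then 1 else 0)"
proof (cases "q = 1")
  case True
  then show ?thesis by (simp add: moebius_mu_def)
next
  case False
  then obtain p where p: "prime p" "p dvd q" using prime_factor_nat by blast
  define S where "S = {d. d dvd q \<and> squarefree d}"
  define S0 where "S0 = {d \<in> S. \<not> p dvd d}"
  have fin: "finite {d. d dvd q}" using q by simp
  have finS: "finite S" using finite_subset[OF _ fin, of S] by (auto simp: S_def)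
  have pos: "0 < d" if "d \<in> S" for d using that q by (auto simp: S_def intro: Nat.gr0I)
  have img: "{d \<in> S. p dvd d} = (*) p ` S0"
  proof (intro equalityI subsetI)
    fix e assume e: "e \<in> {d \<in> S. p dvd d}"
    then obtain d where d: "e = p * d" by auto
    have "\<not> p dvd d"
    proof
      assume "p dvd d"
      then have "p\<^sup>2 dvd e" unfolding d power2_eq_square by (intro mult_dvd_mono) auto
      then have "p dvd 1" using e squarefreeD[of e p] by (auto simp: S_def)
      with p show False by simp
    qed
    moreover have "d \<in> S" using e squarefree_multD(2)[of p d] dvd_mult_right[of p d q] by (auto simp: S_def d)
    ultimately show "e \<in> (*) p ` S0" using d by (auto simp: S0_def)
  next
    fix e assume "e \<in> (*) p ` S0"
    then obtain d where d: "d \<in> S" "\<not> p dvd d" "e = p * d" by (auto simp: S0_def)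
    have cop: "coprime p d" using p d by (simp add: prime_imp_coprime)
    have "e dvd q" using divides_mult[OF p(2) _ cop] d by (auto simp: S_def)
    moreover have "squarefree e"
      using squarefree_mult_coprime[OF cop squarefree_prime[OF p(1)]] d by (auto simp: S_def)
    ultimately show "e \<in> {d \<in> S. p dvd d}" using d by (auto simp: S_def)
  qed
  have "(\<Sum>d | d dvd q. moebius_mu d) = (\<Sum>d\<in>S. moebius_mu d)"
    using fin by (intro sum.mono_neutral_right) (auto simp: S_def moebius_mu_def)
  also have "\<dots> = (\<Sum>d\<in>S0. moebius_mu d) + (\<Sum>d\<in>{d \<in> S. p dvd d}. moebius_mu d)"
    using finS by (subst sum.union_disjoint[symmetric]) (auto simp: S0_def intro!: sum.cong)
  also have "(\<Sum>d\<in>{d \<in> S. p dvd d}. moebius_mu d) = (\<Sum>d\<in>S0. moebius_mu (p * d))"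
    unfolding img using prime_gt_0_nat[OF p(1)] by (subst sum.reindex) (auto simp: inj_on_def)
  also have "\<dots> = (\<Sum>d\<in>S0. - moebius_mu d)"
    using pos by (intro sum.cong refl moebius_mu_prime_mult p) (auto simp: S0_def)
  finally show ?thesis using False by (simp add: sum_negf)
qed

section \<open>From subconformal measures to scaling functionals\<close>

lemma power_circle: "z \<in> circle \<Longrightarrow> z ^ d \<in> circle"
  by (simp add: norm_power)

lemma continuous_on_circle_power:
  assumes "continuous_on circle f" shows "continuous_on circle (\<lambda>z. f (z ^ d))"
  using assms power_circle by (intro continuous_on_compose2[OF assms] continuous_intros) auto

lemma diag_fun_circle: "z \<in> circle \<Longrightarrow> diag_fun b k (n, z) = (if 0 < n \<and> b dvd n then z powi (k * int (n div b)) else 0)"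
  by (simp add: diag_fun_def)

lemma diag_alg_continuous:
  assumes h: "h \<in> diag_alg" shows "continuous_on circle (\<lambda>z. h (n, z))"
proof -
  have span: "continuous_on circle (\<lambda>z. p (n, z))" if "p \<in> diag_span" for p
    using that
  proof (induction rule: diag_span.induct)
    case (gen b k)
    have "continuous_on circle (\<lambda>z. if 0 < n \<and> b dvd n then z powi (k * int (n div b)) else (0::complex))"
      by (cases "0 < n \<and> b dvd n") (auto intro!: continuous_on_powi_circle)
    then show ?case by (subst continuous_on_cong[OF refl diag_fun_circle])
  qed (auto intro!: continuous_intros)
  have "\<exists>p\<in>diag_span. \<forall>x. cmod (h x - p x) \<le> inverse (real (Suc N))" for N
    using diag_algE[OF h, of "inverse (real (Suc N))"] by (metis inverse_positive_iff_positive of_nat_0_less_iff zero_less_Suc)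
  then obtain p where p: "\<And>N. p N \<in> diag_span" "\<And>N x. cmod (h x - p N x) \<le> inverse (real (Suc N))" by metis
  show ?thesis
  proof (rule uniform_limit_theorem[where f = "\<lambda>N z. p N (n, z)" and F = sequentially])
    show "\<forall>\<^sub>F N in sequentially. continuous_on circle (\<lambda>z. p N (n, z))" using span[OF p(1)] by simp
    show "uniform_limit circle (\<lambda>N z. p N (n, z)) (\<lambda>z. h (n, z)) sequentially"
      unfolding uniform_limit_iff
    proof (intro allI impI)
      fix e :: real assume "0 < e"
      then obtain M where M: "inverse (real (Suc M)) < e" using reals_Archimedean by blast
      show "\<forall>\<^sub>F N in sequentially. \<forall>z\<in>circle. dist (p N (n, z)) (h (n, z)) < e"
        using eventually_ge_at_top[of M]
      proof eventually_elim
        case (elim N)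
        then have "inverse (real (Suc N)) \<le> inverse (real (Suc M))" by (simp add: field_simps)
        show ?case
        proof
          fix z
          show "dist (p N (n, z)) (h (n, z)) < e"
            using p(2)[of "(n, z)" N] M \<open>inverse (real (Suc N)) \<le> inverse (real (Suc M))\<close>
            unfolding dist_norm norm_minus_commute[of "p N (n, z)"] by linarith
        qed
      qed
    qed
  qed simp
qed

lemma diag_real_continuous:
  assumes "h \<in> diag_real" shows "continuous_on circle (\<lambda>z. h (n, z))"
proof -
  have "continuous_on circle (\<lambda>z. Re (complex_of_real (h (n, z))))"
    using assms by (intro continuous_intros diag_alg_continuous[of "\<lambda>x. complex_of_real (h x)"]) (simp add: diag_real_def)
  then show ?thesis by simp
qed

text \<open>The weights turn \<open>\<nu>\<close> into a measure on the fibres over the divisors of \<open>M\<close>: subconformality at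
  \<open>M / n\<close> says that the part over \<open>n\<close> is positive.\<close>

definition fibre_sum :: "real \<Rightarrow> nat \<Rightarrow> complex measure \<Rightarrow> (point \<Rightarrow> 'a::{banach, second_countable_topology}) \<Rightarrow> 'a" where
  "fibre_sum \<beta> M \<nu> h = (\<Sum>n | n dvd M. (real n powr (- \<beta>)) *\<^sub>R
     (\<Sum>d | d dvd M div n. (moebius_mu d * real d powr (- \<beta>)) *\<^sub>R (\<integral>z. h (n, z ^ d) \<partial>\<nu>)))"

lemma fibre_sum_add:
  assumes \<nu>: "\<nu> \<in> circle_prob" and f: "\<And>n. continuous_on circle (\<lambda>z. f (n, z))" and g: "\<And>n. continuous_on circle (\<lambda>z. g (n, z))"
  shows "fibre_sum \<beta> M \<nu> (\<lambda>p. f p + g p) = fibre_sum \<beta> M \<nu> f + fibre_sum \<beta> M \<nu> g"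
proof -
  have "integrable \<nu> (\<lambda>z. f (n, z ^ d))" "integrable \<nu> (\<lambda>z. g (n, z ^ d))" for n d
    by (intro circle_integrable[OF \<nu>] continuous_on_circle_power[OF f] continuous_on_circle_power[OF g])+
  then show ?thesis unfolding fibre_sum_def by (simp add: scaleR_add_right sum.distrib)
qed

lemma fibre_sum_scale: "fibre_sum \<beta> M \<nu> (\<lambda>p. c * h p) = c * fibre_sum \<beta> M \<nu> (h :: point \<Rightarrow> 'a::{real_normed_field, banach, second_countable_topology})"
  unfolding fibre_sum_def by (simp add: sum_distrib_left)

lemma fibre_sum_of_real: "complex_of_real (fibre_sum \<beta> M \<nu> h) = fibre_sum \<beta> M \<nu> (\<lambda>p. complex_of_real (h p))"
  unfolding fibre_sum_def by (simp add: scaleR_conv_of_real)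

lemma fibre_sum_Re:
  assumes \<nu>: "\<nu> \<in> circle_prob" and h: "\<And>n. continuous_on circle (\<lambda>z. h (n, z))"
  shows "fibre_sum \<beta> M \<nu> (\<lambda>p. Re (h p)) = Re (fibre_sum \<beta> M \<nu> h)"
proof -
  have "integrable \<nu> (\<lambda>z. h (n, z ^ d))" for n d
    by (intro circle_integrable[OF \<nu>] continuous_on_circle_power[OF h])
  then show ?thesis unfolding fibre_sum_def by simp
qed

lemma fibre_sum_nonneg:
  fixes h :: "point \<Rightarrow> real"
  assumes \<nu>: "subconformal \<beta> \<nu>" and M: "0 < M" and h: "\<And>n. continuous_on circle (\<lambda>z. h (n, z))" "\<And>p. 0 \<le> h p"
  shows "0 \<le> fibre_sum \<beta> M \<nu> h"
  unfolding fibre_sum_def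
proof (rule sum_nonneg)
  fix n assume n: "n \<in> {n. n dvd M}"
  then have "0 < M div n" using M by (auto elim!: dvdE)
  then have "0 \<le> (\<Sum>d | d dvd M div n. moebius_mu d * real d powr (- \<beta>) * (\<integral>z. h (n, z ^ d) \<partial>\<nu>))"
    using \<nu> h unfolding subconformal_def by blast
  then show "0 \<le> (real n powr (- \<beta>)) *\<^sub>R (\<Sum>d | d dvd M div n. (moebius_mu d * real d powr (- \<beta>)) *\<^sub>R (\<integral>z. h (n, z ^ d) \<partial>\<nu>))"
    by simp
qed

text \<open>With \<open>m = n d\<close> the double sum becomes a sum over \<open>b dvd m dvd M\<close> of \<open>m\<^bsup>-\<beta>\<^esup> \<integral> z\<^bsup>km/b\<^esup>\<close> times the sum of the Moebius function over the divisors of \<open>m / b\<close>, so that only \<open>m = b\<close> contributes.\<close>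

lemma fibre_sum_diag_fun:
  assumes \<nu>: "\<nu> \<in> circle_prob" and M: "0 < M" and bM: "b dvd M"
  shows "fibre_sum \<beta> M \<nu> (diag_fun b k) = (real b powr (- \<beta>)) *\<^sub>R (\<integral>z. z powi k \<partial>\<nu>)"
proof -
  define I where "I m = (\<integral>z. z powi (k * int m) \<partial>\<nu>)" for m :: nat
  have b: "0 < b" using M bM by (auto intro: Nat.gr0I)
  have fin: "finite {n. n dvd M}" using M by simp
  have int: "(\<integral>z. diag_fun b k (n, z ^ d) \<partial>\<nu>) = (if b dvd n then I (n div b * d) else 0)" if "n dvd M" for n d
  proof -
    have n: "0 < n" using that M by (auto intro: Nat.gr0I)
    have "(\<integral>z. diag_fun b k (n, z ^ d) \<partial>\<nu>) = (\<integral>z. (if b dvd n then z powi (k * int (n div b * d)) else 0) \<partial>\<nu>)"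
    proof (rule Bochner_Integration.integral_cong[OF refl])
      fix z assume "z \<in> space \<nu>"
      then have z: "z \<in> circle" using circle_prob_space[OF \<nu>] by simp
      have "(z ^ d) powi m = z powi (m * int d)" for m
        by (metis mult.commute power_int_mult power_int_of_nat)
      then show "diag_fun b k (n, z ^ d) = (if b dvd n then z powi (k * int (n div b * d)) else 0)"
        using n diag_fun_circle[OF power_circle[OF z], of b k n d] by (simp add: mult.assoc)
    qed
    then show ?thesis by (simp add: I_def)
  qed
  have "fibre_sum \<beta> M \<nu> (diag_fun b k) = (\<Sum>n | n dvd M. \<Sum>d | d dvd M div n.
      (real n powr (- \<beta>) * (moebius_mu d * real d powr (- \<beta>))) *\<^sub>R (if b dvd n then I (n div b * d) else 0))"
    unfolding fibre_sum_def scaleR_sum_right scaleR_scaleR by (intro sum.cong refl) (simp add: int)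
  also have "\<dots> = (\<Sum>n | n dvd M \<and> b dvd n. \<Sum>d | d dvd M div n.
      (real n powr (- \<beta>) * (moebius_mu d * real d powr (- \<beta>))) *\<^sub>R I (n div b * d))"
    by (rule sum.mono_neutral_cong_right[OF fin]) auto
  also have "\<dots> = (\<Sum>(n, d)\<in>Sigma {n. n dvd M \<and> b dvd n} (\<lambda>n. {d. d dvd M div n}).
      (real n powr (- \<beta>) * (moebius_mu d * real d powr (- \<beta>))) *\<^sub>R I (n div b * d))"
  proof (rule sum.Sigma)
    show "finite {n. n dvd M \<and> b dvd n}" using fin by (rule rev_finite_subset) auto
    show "\<forall>n\<in>{n. n dvd M \<and> b dvd n}. finite {d. d dvd M div n}"
    proof
      fix n assume "n \<in> {n. n dvd M \<and> b dvd n}"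
      then have "0 < M div n" using M by (auto simp: div_greater_zero_iff dvd_imp_le intro: Nat.gr0I)
      then show "finite {d. d dvd M div n}" by simp
    qed
  qed
  also have "\<dots> = (\<Sum>(m, d)\<in>Sigma {m. m dvd M \<and> b dvd m} (\<lambda>m. {d. d dvd m div b}).
      (real m powr (- \<beta>) * moebius_mu d) *\<^sub>R I (m div b))"
  proof (rule sum.reindex_bij_witness[where i = "\<lambda>(m, d). (m div d, d)" and j = "\<lambda>(n, d). (n * d, d)"])
    fix p assume p: "p \<in> Sigma {n. n dvd M \<and> b dvd n} (\<lambda>n. {d. d dvd M div n})"
    then obtain n d where nd: "p = (n, d)" "n dvd M" "b dvd n" "d dvd M div n" by auto
    then have pos: "0 < n" "0 < d" using M by (auto intro!: Nat.gr0I elim!: dvdE)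
    have e: "n * d div b = n div b * d" using nd(3) b by (auto elim!: dvdE)
    have "n * d dvd M" using nd(2,4) pos by (auto elim!: dvdE)
    then show "(case p of (n, d) \<Rightarrow> (n * d, d)) \<in> Sigma {m. m dvd M \<and> b dvd m} (\<lambda>m. {d. d dvd m div b})"
      using nd e by auto
    show "(case case p of (n, d) \<Rightarrow> (n * d, d) of (m, d) \<Rightarrow> (m div d, d)) = p" using nd pos by simp
    show "(case case p of (n, d) \<Rightarrow> (n * d, d) of (m, d) \<Rightarrow> (real m powr (- \<beta>) * moebius_mu d) *\<^sub>R I (m div b)) =
        (case p of (n, d) \<Rightarrow> (real n powr (- \<beta>) * (moebius_mu d * real d powr (- \<beta>))) *\<^sub>R I (n div b * d))"
      unfolding nd(1) prod.case e using pos by (simp add: powr_mult mult_ac)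
  next
    fix p assume p: "p \<in> Sigma {m. m dvd M \<and> b dvd m} (\<lambda>m. {d. d dvd m div b})"
    then obtain m d where md: "p = (m, d)" "m dvd M" "b dvd m" "d dvd m div b" by auto
    then have pos: "0 < m" "0 < d" using M b by (auto intro!: Nat.gr0I elim!: dvdE)
    obtain q where "m div b = d * q" using md(4) by blast
    then have q: "m = b * (d * q)" using md(3) by (metis dvd_mult_div_cancel)
    have dm: "m div d = b * q" "d * (m div d) = m" using pos by (simp_all add: q mult.left_commute[of b])
    have "m div d dvd M" using md(2) dm(2) dvd_mult_right[of d "m div d" M] by simp
    moreover have "d dvd M div (m div d)"
    proof -
      obtain r where "M = m * r" using md(2) by blast
      then have "M = (m div d) * (d * r)" using dm(2) by (simp add: mult_ac)
      moreover have "0 < m div d" using pos dm(2) by (metis mult_0_right neq0_conv)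
      ultimately show ?thesis by simp
    qed
    ultimately show "(case p of (m, d) \<Rightarrow> (m div d, d)) \<in> Sigma {n. n dvd M \<and> b dvd n} (\<lambda>n. {d. d dvd M div n})"
      using md dm by simp
    show "(case case p of (m, d) \<Rightarrow> (m div d, d) of (n, d) \<Rightarrow> (n * d, d)) = p" using md dm by (simp add: mult.commute)
  qed
  also have "\<dots> = (\<Sum>m | m dvd M \<and> b dvd m. \<Sum>d | d dvd m div b. (real m powr (- \<beta>) * moebius_mu d) *\<^sub>R I (m div b))"
  proof (rule sum.Sigma[symmetric])
    show "finite {m. m dvd M \<and> b dvd m}" using fin by (rule rev_finite_subset) auto
    show "\<forall>m\<in>{m. m dvd M \<and> b dvd m}. finite {d. d dvd m div b}"
    proof
      fix m assume "m \<in> {m. m dvd M \<and> b dvd m}"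
      then have "0 < m div b" using M b by (auto simp: div_greater_zero_iff intro!: dvd_imp_le Nat.gr0I)
      then show "finite {d. d dvd m div b}" by simp
    qed
  qed
  also have "\<dots> = (\<Sum>m | m dvd M \<and> b dvd m. if m = b then (real b powr (- \<beta>)) *\<^sub>R I 1 else 0)"
  proof (rule sum.cong[OF refl])
    fix m assume "m \<in> {m. m dvd M \<and> b dvd m}"
    then have m: "0 < m div b" "m div b = 1 \<longleftrightarrow> m = b" using M b by (auto elim!: dvdE)
    have "(\<Sum>d | d dvd m div b. (real m powr (- \<beta>) * moebius_mu d) *\<^sub>R I (m div b)) =
        (real m powr (- \<beta>) * (\<Sum>d | d dvd m div b. moebius_mu d)) *\<^sub>R I (m div b)"
      by (simp add: scaleR_sum_left[symmetric] sum_distrib_left)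
    then show "(\<Sum>d | d dvd m div b. (real m powr (- \<beta>) * moebius_mu d) *\<^sub>R I (m div b)) =
        (if m = b then (real b powr (- \<beta>)) *\<^sub>R I 1 else 0)"
      unfolding sum_moebius_mu[OF m(1)] m(2) using b by simp
  qed
  also have "\<dots> = (real b powr (- \<beta>)) *\<^sub>R I 1"
    using bM fin by (subst sum.delta) (auto intro: rev_finite_subset)
  finally show ?thesis by (simp add: I_def)
qed

context
  fixes \<beta> :: real and \<nu> :: "complex measure"
  assumes sub: "\<nu> \<in> subconformal_probs \<beta>"
begin

private lemma measure_props: "\<nu> \<in> circle_prob" "subconformal \<beta> \<nu>"
  using sub by (simp_all add: subconformal_probs_def)

private lemma positive_fibre_sum:
  assumes M: "0 < M" shows "positive_functional (fibre_sum \<beta> M \<nu>)"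
  unfolding positive_functional_def
proof (intro conjI ballI allI impI)
  fix f g assume "f \<in> diag_real" "g \<in> diag_real"
  then show "fibre_sum \<beta> M \<nu> (\<lambda>x. f x + g x) = fibre_sum \<beta> M \<nu> f + fibre_sum \<beta> M \<nu> g"
    by (intro fibre_sum_add measure_props diag_real_continuous)
next
  fix f and r :: real assume "f \<in> diag_real"
  show "fibre_sum \<beta> M \<nu> (\<lambda>x. r * f x) = r * fibre_sum \<beta> M \<nu> f" by (rule fibre_sum_scale)
next
  fix f :: "point \<Rightarrow> real" assume f: "f \<in> diag_real" and "\<forall>x. 0 \<le> f x"
  then have f0: "\<And>x. 0 \<le> f x" by blast
  show "0 \<le> fibre_sum \<beta> M \<nu> f" by (rule fibre_sum_nonneg[OF measure_props(2) M diag_real_continuous[OF f] f0])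
qed

private lemma fibre_sum_unit: "0 < M \<Longrightarrow> fibre_sum \<beta> M \<nu> diag_unit = 1"
proof -
  assume M: "0 < M"
  interpret prob_space \<nu> using measure_props by (simp add: circle_prob_def)
  have "complex_of_real (fibre_sum \<beta> M \<nu> diag_unit) = fibre_sum \<beta> M \<nu> (diag_fun 1 0)"
    unfolding fibre_sum_of_real diag_unit_eq ..
  also have "\<dots> = 1" using fibre_sum_diag_fun[OF measure_props(1) M, of 1 \<beta> 0] by (simp add: prob_space)
  finally show ?thesis by (simp only: of_real_eq_1_iff)
qed

private lemma fibre_sum_diag_fun_tendsto:
  assumes b: "0 < b"
  shows "(\<lambda>N. fibre_sum \<beta> (fact N) \<nu> (diag_fun b k)) \<longlonglongrightarrow> (real b powr (- \<beta>)) *\<^sub>R (\<integral>z. z powi k \<partial>\<nu>)"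
proof (rule tendsto_eventually)
  show "\<forall>\<^sub>F N in sequentially. fibre_sum \<beta> (fact N) \<nu> (diag_fun b k) = (real b powr (- \<beta>)) *\<^sub>R (\<integral>z. z powi k \<partial>\<nu>)"
    using eventually_ge_at_top[of b]
  proof eventually_elim
    case (elim N)
    then have "b dvd fact N" using b by (intro dvd_fact) auto
    then show ?case by (intro fibre_sum_diag_fun measure_props) simp_all
  qed
qed

private lemma fibre_sum_convergent:
  assumes h: "h \<in> diag_real" shows "convergent (\<lambda>N. fibre_sum \<beta> (fact N) \<nu> h)"
proof -
  have span: "convergent (\<lambda>N. fibre_sum \<beta> (fact N) \<nu> p)" if "p \<in> diag_span" for p
    using that
  proof (induction rule: diag_span.induct)
    case (gen b k)
    then show ?case using fibre_sum_diag_fun_tendsto convergentI by blast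
  next
    case (add f g)
    note c = diag_alg_continuous[OF diag_span_subset[OF add.hyps(1)]] diag_alg_continuous[OF diag_span_subset[OF add.hyps(2)]]
    show ?case unfolding fibre_sum_add[OF measure_props(1) c] by (rule convergent_add[OF add.IH])
  next
    case (cmult f c)
    then show ?case unfolding fibre_sum_scale using convergent_mult[OF convergent_const] by blast
  qed
  show ?thesis
  proof (rule convergent_approx)
    fix e :: real assume e: "0 < e"
    have ha: "(\<lambda>p. complex_of_real (h p)) \<in> diag_alg" using h by (simp add: diag_real_def)
    obtain p where p: "p \<in> diag_span" "\<And>x. cmod (complex_of_real (h x) - p x) \<le> e" using diag_algE[OF ha e] by blast
    have pr: "(\<lambda>x. Re (p x)) \<in> diag_real" by (intro diag_real_Re diag_span_subset p)
    have near: "\<bar>h x - Re (p x)\<bar> \<le> e" for x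
      using abs_Re_le_cmod[of "complex_of_real (h x) - p x"] p(2)[of x] by simp
    have "norm (fibre_sum \<beta> (fact N) \<nu> h - fibre_sum \<beta> (fact N) \<nu> (\<lambda>x. Re (p x))) \<le> e" for N
    proof -
      have L: "positive_functional (fibre_sum \<beta> (fact N) \<nu>)" by (rule positive_fibre_sum) simp
      show ?thesis
        using functional_bound[OF L diag_real_diff[OF h pr] near] functional_diff[OF L h pr]
        by (simp add: fibre_sum_unit)
    qed
    moreover have "convergent (\<lambda>N. fibre_sum \<beta> (fact N) \<nu> (\<lambda>x. Re (p x)))"
    proof -
      obtain l where "(\<lambda>N. fibre_sum \<beta> (fact N) \<nu> p) \<longlonglongrightarrow> l" using span[OF p(1)] convergent_def by blast
      from tendsto_Re[OF this] show ?thesis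
        using fibre_sum_Re[OF measure_props(1) diag_alg_continuous[OF diag_span_subset[OF p(1)]]] by (auto simp: convergent_def)
    qed
    ultimately show "\<exists>Y. convergent Y \<and> (\<forall>N. norm (fibre_sum \<beta> (fact N) \<nu> h - Y N) \<le> e)" by blast
  qed
qed

text \<open>The sums over the divisors of \<open>N!\<close> are positive functionals of mass one. On each generator they are eventually constant, so they converge on the whole algebra, and the scaling relation holds because it holds on the generators.\<close>

theorem scaling_functional_of_measure:
  "\<exists>L. scaling_functional \<beta> L \<and> L diag_unit = 1 \<and>
     (\<forall>b k. 0 < b \<longrightarrow> complexify L (diag_fun b k) = of_real (real b powr (- \<beta>)) * (\<integral>z. z powi k \<partial>\<nu>))"
proof -
  define L where "L h = lim (\<lambda>N. fibre_sum \<beta> (fact N) \<nu> h)" for h :: "point \<Rightarrow> real"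
  have lim: "(\<lambda>N. fibre_sum \<beta> (fact N) \<nu> h) \<longlonglongrightarrow> L h" if "h \<in> diag_real" for h
    using fibre_sum_convergent[OF that] by (simp add: L_def convergent_LIMSEQ_iff)
  have pos: "positive_functional (fibre_sum \<beta> (fact N) \<nu>)" for N by (rule positive_fibre_sum) simp
  have L: "positive_functional L"
    unfolding positive_functional_def
  proof (intro conjI ballI allI impI)
    fix f g assume fg: "f \<in> diag_real" "g \<in> diag_real"
    show "L (\<lambda>x. f x + g x) = L f + L g"
      using LIMSEQ_unique[OF lim[OF diag_real_add[OF fg]]] tendsto_add[OF lim[OF fg(1)] lim[OF fg(2)]]
      by (simp add: functional_add[OF pos fg])
  next
    fix f and r :: real assume f: "f \<in> diag_real"
    show "L (\<lambda>x. r * f x) = r * L f"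
      using LIMSEQ_unique[OF lim[OF diag_real_scale[OF f]]] tendsto_mult_left[OF lim[OF f]]
      by (simp add: functional_scale[OF pos f])
  next
    fix f :: "point \<Rightarrow> real" assume f: "f \<in> diag_real" "\<forall>x. 0 \<le> f x"
    show "0 \<le> L f"
      by (rule LIMSEQ_le_const[OF lim[OF f(1)]]) (use functional_pos[OF pos f(1)] f(2) in blast)
  qed
  have val: "complexify L (diag_fun b k) = of_real (real b powr (- \<beta>)) * (\<integral>z. z powi k \<partial>\<nu>)" if b: "0 < b" for b k
  proof -
    let ?l = "(real b powr (- \<beta>)) *\<^sub>R (\<integral>z. z powi k \<partial>\<nu>)"
    have h: "diag_fun b k \<in> diag_alg" "(\<lambda>p. - \<i> * diag_fun b k p) \<in> diag_alg"
      using diag_span_subset[OF diag_span.gen[OF b]] diag_span_subset[OF diag_span.cmult[OF diag_span.gen[OF b]]] by blast+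
    have c: "continuous_on circle (\<lambda>z. diag_fun b k (n, z))" for n by (rule diag_alg_continuous[OF h(1)])
    have "L (\<lambda>p. Re (diag_fun b k p)) = Re ?l"
      using LIMSEQ_unique[OF lim[OF diag_real_Re[OF h(1)]]] tendsto_Re[OF fibre_sum_diag_fun_tendsto[OF b, of k]]
      unfolding fibre_sum_Re[OF measure_props(1) c] by blast
    moreover have "L (\<lambda>p. Im (diag_fun b k p)) = Im ?l"
    proof -
      have "fibre_sum \<beta> M \<nu> (\<lambda>p. Im (diag_fun b k p)) = Im (fibre_sum \<beta> M \<nu> (diag_fun b k))" for M
        using fibre_sum_Re[OF measure_props(1) diag_alg_continuous[OF h(2)], of \<beta> M] fibre_sum_scale[of \<beta> M \<nu> "- \<i>" "diag_fun b k"] by simp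
      then show ?thesis
        using LIMSEQ_unique[OF lim[OF diag_real_Im[OF h(1)]]] tendsto_Im[OF fibre_sum_diag_fun_tendsto[OF b, of k]] by simp
    qed
    ultimately show ?thesis unfolding complexify_def by (simp add: scaleR_conv_of_real complex_eq_iff)
  qed
  have "L (stretch c f) = real c powr (- \<beta>) * L f" if c: "0 < c" and f: "f \<in> diag_real" for c f
  proof (rule complexify_ext[OF _ _ _ f])
    have st: "stretch c (\<lambda>x. f x + g x) = (\<lambda>x. stretch c f x + stretch c g x)"
      "stretch c (\<lambda>x. r * f x) = (\<lambda>x. r * stretch c f x)" for f g :: "point \<Rightarrow> real" and r
      by (auto simp: stretch_def fun_eq_iff)
    show "positive_functional (\<lambda>f. L (stretch c f))"
      unfolding positive_functional_def
    proof (intro conjI ballI allI impI)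
      fix f :: "point \<Rightarrow> real" assume f: "f \<in> diag_real" "\<forall>x. 0 \<le> f x"
      then have "0 \<le> stretch c f x" for x by (cases x) (simp add: stretch_def)
      then show "0 \<le> L (stretch c f)" by (intro functional_pos[OF L] stretch_diag_real c f)
    qed (simp_all add: st functional_add[OF L] functional_scale[OF L] stretch_diag_real c)
    show "positive_functional (\<lambda>f. real c powr (- \<beta>) * L f)"
      unfolding positive_functional_def
      using functional_pos[OF L] by (auto simp: functional_add[OF L] functional_scale[OF L] distrib_left)
    fix b k assume b: "0 < (b::nat)"
    have "complexify (\<lambda>f. L (stretch c f)) (diag_fun b k) = complexify L (diag_fun (c * b) k)"
    proof -
      have "(\<lambda>p. Re (stretch c h p)) = stretch c (\<lambda>p. Re (h p))" "(\<lambda>p. Im (stretch c h p)) = stretch c (\<lambda>p. Im (h p))"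
        for h :: "point \<Rightarrow> complex" by (auto simp: stretch_def fun_eq_iff)
      then show ?thesis unfolding complexify_def stretch_diag_fun[OF c b, symmetric] by simp
    qed
    also have "\<dots> = of_real (real c powr (- \<beta>)) * complexify L (diag_fun b k)"
      using b c by (simp add: val powr_mult)
    also have "\<dots> = complexify (\<lambda>f. real c powr (- \<beta>) * L f) (diag_fun b k)"
      by (simp add: complexify_def algebra_simps)
    finally show "complexify (\<lambda>f. L (stretch c f)) (diag_fun b k) = complexify (\<lambda>f. real c powr (- \<beta>) * L f) (diag_fun b k)" .
  qed
  then have "scaling_functional \<beta> L" using L by (simp add: scaling_functional_def)
  moreover have "L diag_unit = 1"
    using LIMSEQ_unique[OF lim[OF diag_real_unit]] by (simp add: fibre_sum_unit)
  ultimately show ?thesis using val by blast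
qed

end

section \<open>The measure of a state\<close>

lemma state_sum:
  assumes "is_state toeplitz \<phi>" "\<And>i. i \<in> I \<Longrightarrow> x i \<in> toeplitz"
  shows "(\<Sum>i\<in>I. x i) \<in> toeplitz \<and> \<phi> (\<Sum>i\<in>I. x i) = (\<Sum>i\<in>I. \<phi> (x i))"
  using assms(2)
  by (induction I rule: infinite_finite_induct)
    (auto simp: toeplitz_zero state_zero[OF assms(1)] toeplitz_add state_add[OF assms(1)])

lemma adj_sum:
  assumes "\<And>i. i \<in> I \<Longrightarrow> x i \<in> adjointable"
  shows "(\<Sum>i\<in>I. x i) \<in> adjointable \<and> adj (\<Sum>i\<in>I. x i) = (\<Sum>i\<in>I. adj (x i))"
  using assms
  by (induction I rule: infinite_finite_induct) (auto simp: adjointable_intros adj_zero adj_add)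

lemma compose_sum_left: "(\<Sum>i\<in>I. x i) o\<^sub>L y = (\<Sum>i\<in>I. x i o\<^sub>L y)"
  by (rule bounded_bilinear.sum_left[OF bounded_bilinear_blinfun_compose])

lemma compose_sum_right: "y o\<^sub>L (\<Sum>i\<in>I. x i) = (\<Sum>i\<in>I. y o\<^sub>L x i)"
  by (rule bounded_bilinear.sum_right[OF bounded_bilinear_blinfun_compose])

lemma U_pow_toeplitz: "U_pow k \<in> toeplitz"
  by (simp add: U_pow_eq_mon mon_toeplitz)

text \<open>The moments \<open>\<phi>(U\<^sup>k)\<close> are positive-definite since the Fejer sums are the values of \<open>\<phi>\<close> at \<open>x\<^sup>* x\<close> for \<open>x = \<Sum>\<^sub>j w\<^bsup>-j\<^esup> U\<^sup>j\<close>.\<close>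

lemma state_moments:
  assumes \<phi>: "is_state toeplitz \<phi>"
  obtains \<nu> where "\<nu> \<in> circle_prob" "\<And>k. (\<integral>z. z powi k \<partial>\<nu>) = \<phi> (U_pow k)"
proof (rule herglotz[of "\<lambda>k. \<phi> (U_pow k)"])
  show "\<phi> (U_pow 0) = 1" by (simp add: U_pow_0 state_id[OF \<phi>])
  fix N :: nat and w :: complex assume w: "w \<in> circle"
  define x where "x = (\<Sum>j<N. cmult (w powi - int j) o\<^sub>L U_pow (int j))"
  have xt: "x \<in> toeplitz" unfolding x_def
    using state_sum[OF \<phi>, of "{..<N}" "\<lambda>j. cmult (w powi - int j) o\<^sub>L U_pow (int j)"]
    by (simp add: toeplitz_cmult U_pow_toeplitz)
  have ax: "adj x = (\<Sum>i<N. cmult (w powi int i) o\<^sub>L U_pow (- int i))"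
  proof -
    have "adj x = (\<Sum>i<N. adj (cmult (w powi - int i) o\<^sub>L U_pow (int i)))"
      unfolding x_def using adj_sum[of "{..<N}" "\<lambda>j. cmult (w powi - int j) o\<^sub>L U_pow (int j)"]
      by (simp add: adjointable_intros U_pow_adjointable)
    then show ?thesis by (simp only: adj_cmult[OF U_pow_adjointable] adj_U_pow cnj_powi_circle[OF w] minus_minus)
  qed
  have "adj x o\<^sub>L x = (\<Sum>i<N. \<Sum>j<N. cmult (w powi (int i - int j)) o\<^sub>L U_pow (int j - int i))"
  proof -
    have "(cmult (w powi int i) o\<^sub>L U_pow (- int i)) o\<^sub>L (cmult (w powi - int j) o\<^sub>L U_pow (int j)) =
        cmult (w powi (int i - int j)) o\<^sub>L U_pow (int j - int i)" for i j
    proof -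
      have "(cmult (w powi int i) o\<^sub>L U_pow (- int i)) o\<^sub>L (cmult (w powi - int j) o\<^sub>L U_pow (int j)) =
          cmult (w powi int i) o\<^sub>L ((U_pow (- int i) o\<^sub>L cmult (w powi - int j)) o\<^sub>L U_pow (int j))"
        by (simp add: compose_assoc)
      also have "\<dots> = (cmult (w powi int i) o\<^sub>L cmult (w powi - int j)) o\<^sub>L (U_pow (- int i) o\<^sub>L U_pow (int j))"
        unfolding compose_cmult[OF U_pow_adjointable] by (simp add: compose_assoc)
      finally show ?thesis
        unfolding cmult_mult U_pow_comp using circle_nonzero[OF w] by (simp add: power_int_diff power_int_minus divide_inverse)
    qed
    then show ?thesis unfolding ax unfolding x_def compose_sum_left unfolding compose_sum_right by simp
  qed
  then have "\<phi> (adj x o\<^sub>L x) = (\<Sum>i<N. \<Sum>j<N. w powi (int i - int j) * \<phi> (U_pow (int j - int i)))"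
    by (simp add: state_sum[OF \<phi>] toeplitz_cmult U_pow_toeplitz state_cmult[OF \<phi>])
  then have "(\<Sum>i<N. \<Sum>j<N. \<phi> (U_pow (int i - int j)) * w powi (int j - int i)) = \<phi> (adj x o\<^sub>L x)"
    by (subst sum.swap) (simp add: mult.commute)
  then show "(\<Sum>i<N. \<Sum>j<N. \<phi> (U_pow (int i - int j)) * w powi (int j - int i)) \<in> \<real>\<^sub>\<ge>\<^sub>0"
    using state_pos[OF \<phi> xt] by simp
qed (rule that)

text \<open>Identities between Lipschitz expressions in \<open>f(U)\<close> and in \<open>f\<close> need only be checked on
  trigonometric polynomials.\<close>

lemma U_calc_extend:
  fixes A :: "operator \<Rightarrow> complex" and J :: "(complex \<Rightarrow> complex) \<Rightarrow> complex"
  assumes A: "\<And>x y. x \<in> toeplitz \<Longrightarrow> y \<in> toeplitz \<Longrightarrow> cmod (A x - A y) \<le> C * norm (x - y)"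
    and J: "\<And>f g e. continuous_on circle f \<Longrightarrow> continuous_on circle g \<Longrightarrow>
      (\<And>z. z \<in> circle \<Longrightarrow> cmod (f z - g z) \<le> e) \<Longrightarrow> cmod (J f - J g) \<le> D * e"
    and trig: "\<And>p P. trig p P \<Longrightarrow> A P = J p" and f: "continuous_on circle f"
  shows "A (U_calc f) = J f"
proof -
  let ?K = "\<bar>C\<bar> + \<bar>D\<bar> + 1"
  have K: "0 < ?K" by simp
  have rel: "U_calc_rel f (U_calc f)" by (rule U_calc_rel_U_calc[OF f])
  have "cmod (A (U_calc f) - J f) \<le> 0 + e" if e: "0 < e" for e
  proof -
    have d: "0 < e / ?K" using e K by (rule divide_pos_pos)
    obtain p P where p: "trig p P" "\<And>z. z \<in> circle \<Longrightarrow> cmod (f z - p z) \<le> e / ?K" "norm (U_calc f - P) \<le> e / ?K"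
      using U_calc_relE[OF rel d] by blast
    have "cmod (A (U_calc f) - A P) \<le> \<bar>C\<bar> * (e / ?K)"
    proof -
      have "cmod (A (U_calc f) - A P) \<le> C * norm (U_calc f - P)"
        by (rule A[OF U_calc_rel_toeplitz[OF rel] toep_span_toeplitz[OF trig_toep_span[OF p(1)]]])
      also have "\<dots> \<le> \<bar>C\<bar> * (e / ?K)" using p(3) by (intro mult_mono) auto
      finally show ?thesis .
    qed
    moreover have "cmod (J f - J p) \<le> \<bar>D\<bar> * (e / ?K)"
    proof -
      have "cmod (J f - J p) \<le> D * (e / ?K)" by (rule J[OF f trig_continuous[OF p(1)] p(2)])
      also have "\<dots> \<le> \<bar>D\<bar> * (e / ?K)" using d by (intro mult_right_mono) auto
      finally show ?thesis .
    qed
    moreover have "cmod (A (U_calc f) - J f) \<le> cmod (A (U_calc f) - A P) + cmod (J f - J p)"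
      using norm_triangle_ineq4[of "A (U_calc f) - A P" "J f - J p"] trig[OF p(1)] by simp
    ultimately have "cmod (A (U_calc f) - J f) \<le> (\<bar>C\<bar> + \<bar>D\<bar>) * (e / ?K)" unfolding distrib_right by linarith
    also have "\<dots> \<le> ?K * (e / ?K)" using d by (intro mult_right_mono) auto
    also have "\<dots> = e" using K by simp
    finally show ?thesis by simp
  qed
  then have "cmod (A (U_calc f) - J f) \<le> 0" by (rule field_le_epsilon)
  then show ?thesis by simp
qed

lemma U_calc_linear:
  fixes A :: "operator \<Rightarrow> complex"
  assumes \<nu>: "\<nu> \<in> circle_prob"
    and lip: "\<And>x y. x \<in> toeplitz \<Longrightarrow> y \<in> toeplitz \<Longrightarrow> cmod (A x - A y) \<le> C * norm (x - y)"
    and add: "\<And>x y. x \<in> toeplitz \<Longrightarrow> y \<in> toeplitz \<Longrightarrow> A (x + y) = A x + A y"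
    and cmult: "\<And>c x. x \<in> toeplitz \<Longrightarrow> A (cmult c o\<^sub>L x) = c * A x"
    and pow: "\<And>k. A (U_pow k) = w * (\<integral>z. (z ^ d) powi k \<partial>\<nu>)"
    and f: "continuous_on circle f"
  shows "A (U_calc f) = w * (\<integral>z. f (z ^ d) \<partial>\<nu>)"
proof -
  let ?J = "\<lambda>f. w * (\<integral>z. f (z ^ d) \<partial>\<nu>)"
  show ?thesis
  proof (rule U_calc_extend[OF lip _ _ f])
    show "cmod (?J f - ?J g) \<le> cmod w * e"
      if fg: "continuous_on circle f" "continuous_on circle g" "\<And>z. z \<in> circle \<Longrightarrow> cmod (f z - g z) \<le> e"
      for f g :: "complex \<Rightarrow> complex" and e
    proof -
      have "cmod ((\<integral>z. f (z ^ d) \<partial>\<nu>) - (\<integral>z. g (z ^ d) \<partial>\<nu>)) \<le> e"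
        by (rule circle_integral_diff_bound[OF \<nu> continuous_on_circle_power[OF fg(1)] continuous_on_circle_power[OF fg(2)]])
          (rule fg(3)[OF power_circle])
      then show ?thesis by (auto simp: norm_mult right_diff_distrib[symmetric] intro!: mult_left_mono)
    qed
    show "A P = ?J p" if "trig p P" for p P
      using that
    proof (induction rule: trig.induct)
      case (mono k)
      show ?case by (rule pow)
    next
      case (add p P q Q)
      have "integrable \<nu> (\<lambda>z. p (z ^ d))" "integrable \<nu> (\<lambda>z. q (z ^ d))"
        using circle_integrable[OF \<nu> continuous_on_circle_power[OF trig_continuous]] add.hyps by blast+
      then show ?case
        using add.IH assms(3)[OF toep_span_toeplitz[OF trig_toep_span[OF add.hyps(1)]]
            toep_span_toeplitz[OF trig_toep_span[OF add.hyps(2)]]]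
        by (simp add: distrib_left)
    next
      case (cmult p P r)
      then show ?case using assms(4)[OF toep_span_toeplitz[OF trig_toep_span[OF cmult.hyps]]] by simp
    next
      case (cong p P q)
      have "(\<integral>z. q (z ^ d) \<partial>\<nu>) = (\<integral>z. p (z ^ d) \<partial>\<nu>)"
        using cong(2) power_circle circle_prob_space[OF \<nu>] by (intro Bochner_Integration.integral_cong) auto
      with cong show ?case by simp
    qed
  qed
qed

lemma state_represented:
  assumes \<phi>: "is_state toeplitz \<phi>" and \<nu>: "\<nu> \<in> circle_prob" and m: "\<And>k. (\<integral>z. z powi k \<partial>\<nu>) = \<phi> (U_pow k)"
    and f: "continuous_on circle f"
  shows "(\<integral>z. f z \<partial>\<nu>) = \<phi> (fun_calc U_op f)"
  using U_calc_linear[OF \<nu> state_diff_bound[OF \<phi>] state_add[OF \<phi>] state_cmult[OF \<phi>] _ f, of 1 1]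
  by (simp add: m fun_calc_eq_U_calc[OF f])

lemma state_measure_eqI:
  assumes \<phi>: "is_state toeplitz \<phi>" and \<nu>: "\<nu> \<in> circle_prob" and m: "\<And>k. (\<integral>z. z powi k \<partial>\<nu>) = \<phi> (U_pow k)"
  shows "state_measure \<phi> = \<nu>"
  unfolding state_measure_def
proof (rule the_equality)
  show "\<nu> \<in> circle_prob \<and> (\<forall>f. continuous_on circle f \<longrightarrow> (\<integral>z. f z \<partial>\<nu>) = \<phi> (fun_calc U_op f))"
    using \<nu> state_represented[OF \<phi> \<nu> m] by blast
  fix \<nu>' assume "\<nu>' \<in> circle_prob \<and> (\<forall>f. continuous_on circle f \<longrightarrow> (\<integral>z. f z \<partial>\<nu>') = \<phi> (fun_calc U_op f))"
  then show "\<nu>' = \<nu>" using state_represented[OF \<phi> \<nu> m] by (intro circle_measure_eqI \<nu>) auto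
qed

lemma state_measure_props:
  assumes \<phi>: "is_state toeplitz \<phi>"
  shows state_measure_circle_prob: "state_measure \<phi> \<in> circle_prob"
    and state_measure_moment: "(\<integral>z. z powi k \<partial>(state_measure \<phi>)) = \<phi> (U_pow k)"
    and state_measure_integral: "continuous_on circle f \<Longrightarrow> (\<integral>z. f z \<partial>(state_measure \<phi>)) = \<phi> (fun_calc U_op f)"
proof -
  obtain \<nu> where \<nu>: "\<nu> \<in> circle_prob" "\<And>k. (\<integral>z. z powi k \<partial>\<nu>) = \<phi> (U_pow k)" using state_moments[OF \<phi>] by blast
  have "state_measure \<phi> = \<nu>" by (rule state_measure_eqI[OF \<phi> \<nu>])
  then show "state_measure \<phi> \<in> circle_prob" "(\<integral>z. z powi k \<partial>(state_measure \<phi>)) = \<phi> (U_pow k)"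
    "continuous_on circle f \<Longrightarrow> (\<integral>z. f z \<partial>(state_measure \<phi>)) = \<phi> (fun_calc U_op f)"
    using \<nu> state_represented[OF \<phi> \<nu>] by simp_all
qed

section \<open>The measure of a KMS state is subconformal\<close>

context
  fixes \<phi> :: "operator \<Rightarrow> complex" and \<beta> :: real
  assumes kms: "\<phi> \<in> KMS_states \<beta>"
begin

private abbreviation (input) "\<nu> \<equiv> state_measure \<phi>"

private lemma st: "is_state toeplitz \<phi>"
  using kms by (simp add: KMS_states_iff)

private lemma circle_prob: "\<nu> \<in> circle_prob"
  by (rule state_measure_circle_prob[OF st])

private lemma mon_val: "0 < a \<Longrightarrow> 0 < b \<Longrightarrow>
    \<phi> (mon a k b) = (if a = b then of_real (real a powr (- \<beta>)) * (\<integral>z. z powi k \<partial>\<nu>) else 0)"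
  using kms by (simp add: KMS_states_iff KMS_values_def state_measure_moment[OF st])

private lemma sandwich_lipschitz:
  assumes "v \<in> toeplitz" "w \<in> toeplitz" "x \<in> toeplitz" "y \<in> toeplitz"
  shows "cmod (\<phi> (v o\<^sub>L x o\<^sub>L w) - \<phi> (v o\<^sub>L y o\<^sub>L w)) \<le> (2 * norm v * norm w) * norm (x - y)"
proof -
  have "cmod (\<phi> (v o\<^sub>L x o\<^sub>L w) - \<phi> (v o\<^sub>L y o\<^sub>L w)) \<le> 2 * norm ((v o\<^sub>L x o\<^sub>L w) - (v o\<^sub>L y o\<^sub>L w))"
    using assms by (intro state_diff_bound[OF st] toeplitz_comp)
  also have "(v o\<^sub>L x o\<^sub>L w) - (v o\<^sub>L y o\<^sub>L w) = v o\<^sub>L (x - y) o\<^sub>L w" by (simp add: compose_linear)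
  also have "norm \<dots> \<le> norm (v o\<^sub>L (x - y)) * norm w" by (rule norm_blinfun_compose)
  also have "\<dots> \<le> norm v * norm (x - y) * norm w" by (intro mult_right_mono norm_blinfun_compose) simp
  finally show ?thesis by (simp add: mult_ac)
qed

lemma KMS_V_calc_V:
  assumes bc: "0 < b" "0 < c" and f: "continuous_on circle f"
  shows "\<phi> (V_op b o\<^sub>L fun_calc U_op f o\<^sub>L adj (V_op c)) =
    (if b = c then of_real (real b powr (- \<beta>)) * (\<integral>z. f z \<partial>\<nu>) else 0)"
proof -
  let ?A = "\<lambda>x. \<phi> (V_op b o\<^sub>L x o\<^sub>L adj (V_op c))"
  let ?w = "if b = c then complex_of_real (real b powr (- \<beta>)) else 0"
  have VT: "V_op b \<in> toeplitz" "adj (V_op c) \<in> toeplitz"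
    using bc by (auto simp: V_op_eq_mon intro!: toeplitz_adj mon_toeplitz)
  have "?A (U_calc f) = ?w * (\<integral>z. f (z ^ 1) \<partial>\<nu>)"
  proof (rule U_calc_linear[OF circle_prob sandwich_lipschitz[OF VT] _ _ _ f])
    show "?A (x + y) = ?A x + ?A y" if "x \<in> toeplitz" "y \<in> toeplitz" for x y
      using VT that by (simp add: compose_linear state_add[OF st] toeplitz_comp)
    show "?A (cmult r o\<^sub>L x) = r * ?A x" if "x \<in> toeplitz" for r x
    proof -
      have "V_op b o\<^sub>L (cmult r o\<^sub>L x) o\<^sub>L adj (V_op c) = cmult r o\<^sub>L (V_op b o\<^sub>L x o\<^sub>L adj (V_op c))"
        by (metis compose_assoc compose_cmult toeplitz_adjointable[OF VT(1)])
      then show ?thesis using VT that by (simp add: state_cmult[OF st] toeplitz_comp)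
    qed
    show "?A (U_pow k) = ?w * (\<integral>z. (z ^ 1) powi k \<partial>\<nu>)" for k
      using mon_val[OF bc, of k] by (simp add: mon_def)
  qed
  then show ?thesis by (simp add: fun_calc_eq_U_calc[OF f])
qed

text \<open>This is the instance of the KMS values for \<open>V\<^sub>d V\<^sub>d\<^sup>* f(U) = V\<^sub>d f(U\<^sup>d) V\<^sub>d\<^sup>*\<close>.\<close>

lemma KMS_range_projection_calc:
  assumes d: "0 < d" and f: "continuous_on circle f"
  shows "\<phi> (mon d 0 d o\<^sub>L U_calc f) = of_real (real d powr (- \<beta>)) * (\<integral>z. f (z ^ d) \<partial>\<nu>)"
proof -
  let ?A = "\<lambda>x. \<phi> (mon d 0 d o\<^sub>L x)"
  have VT: "mon d 0 d \<in> toeplitz" using d by (intro mon_toeplitz)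
  show "?A (U_calc f) = of_real (real d powr (- \<beta>)) * (\<integral>z. f (z ^ d) \<partial>\<nu>)"
  proof (rule U_calc_linear[OF circle_prob _ _ _ _ f])
    show "cmod (?A x - ?A y) \<le> (2 * norm (mon d 0 d) * norm (id_blinfun :: operator)) * norm (x - y)"
      if "x \<in> toeplitz" "y \<in> toeplitz" for x y
      using sandwich_lipschitz[OF VT id_toeplitz that] by (simp add: blinfun_compose_id_right)
    show "?A (x + y) = ?A x + ?A y" if "x \<in> toeplitz" "y \<in> toeplitz" for x y
      using VT that by (simp add: compose_linear state_add[OF st] toeplitz_comp)
    show "?A (cmult r o\<^sub>L x) = r * ?A x" if "x \<in> toeplitz" for r x
    proof -
      have "mon d 0 d o\<^sub>L (cmult r o\<^sub>L x) = cmult r o\<^sub>L (mon d 0 d o\<^sub>L x)"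
        by (metis compose_assoc compose_cmult mon_adjointable)
      then show ?thesis using VT that by (simp add: state_cmult[OF st] toeplitz_comp)
    qed
    fix k
    have "mon d 0 d o\<^sub>L U_pow k = mon d (k * int d) d" using d by (simp add: U_pow_eq_mon mon_comp)
    moreover have "(\<integral>z. (z ^ d) powi k \<partial>\<nu>) = (\<integral>z. z powi (k * int d) \<partial>\<nu>)"
      by (intro Bochner_Integration.integral_cong refl) (metis mult.commute power_int_mult power_int_of_nat)
    ultimately show "?A (U_pow k) = of_real (real d powr (- \<beta>)) * (\<integral>z. (z ^ d) powi k \<partial>\<nu>)"
      using mon_val[OF d d] by simp
  qed
qed

end

text \<open>The product of the commuting projections \<open>1 - V\<^sub>p V\<^sub>p\<^sup>*\<close> over the primes \<open>p\<close> dividing \<open>n\<close>: it selects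
  the fibres whose level is coprime to \<open>n\<close>.\<close>

definition coprime_projection :: "nat \<Rightarrow> operator" where
  "coprime_projection n = (\<Sum>d | d dvd n. cmult (of_real (moebius_mu d)) o\<^sub>L mon d 0 d)"

lemma Rep_ell2_sum: "Rep_ell2 (\<Sum>i\<in>I. x i) t = (\<Sum>i\<in>I. Rep_ell2 (x i) t)"
  by (induction I rule: infinite_finite_induct) (simp_all add: ell2_rep)

lemma coord_coprime_projection:
  assumes n: "0 < n" and m: "0 < m"
  shows "coord (blinfun_apply (coprime_projection n) \<xi>) m j = (if coprime n m then coord \<xi> m j else 0)"
proof -
  have fin: "finite {d. d dvd n}" using n by simp
  have "coord (blinfun_apply (coprime_projection n) \<xi>) m j =
      (\<Sum>d | d dvd n. of_real (moebius_mu d) * (if d dvd m then coord \<xi> m j else 0))"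
    unfolding coprime_projection_def blinfun.sum_left Rep_ell2_sum
  proof (rule sum.cong[OF refl])
    fix d assume "d \<in> {d. d dvd n}"
    then have "0 < d" using n by (auto intro: Nat.gr0I)
    then show "coord (blinfun_apply (cmult (complex_of_real (moebius_mu d)) o\<^sub>L mon d 0 d) \<xi>) m j =
        of_real (moebius_mu d) * (if d dvd m then coord \<xi> m j else 0)"
      using m by (simp add: cmult.rep_eq cscale.rep_eq coord_mon)
  qed
  also have "\<dots> = (\<Sum>d | d dvd gcd n m. of_real (moebius_mu d) * coord \<xi> m j)"
    using fin by (intro sum.mono_neutral_cong_right) auto
  also have "\<dots> = of_real (\<Sum>d | d dvd gcd n m. moebius_mu d) * coord \<xi> m j"
    by (simp add: sum_distrib_right)
  also have "(\<Sum>d | d dvd gcd n m. moebius_mu d) = (if coprime n m then 1 else 0)"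
    using sum_moebius_mu[of "gcd n m"] n by (simp add: coprime_iff_gcd_eq_1)
  finally show ?thesis by simp
qed

lemma coprime_projection_toeplitz:
  assumes n: "0 < n" shows "coprime_projection n \<in> toeplitz"
proof -
  have "cmult (of_real (moebius_mu d)) o\<^sub>L mon d 0 d \<in> toeplitz" if "d dvd n" for d
    using that n by (intro toeplitz_cmult mon_toeplitz) (auto intro: Nat.gr0I)
  then have "(\<Sum>d\<in>D. cmult (of_real (moebius_mu d)) o\<^sub>L mon d 0 d) \<in> toeplitz" if "D \<subseteq> {d. d dvd n}" for D
    using that by (induction D rule: infinite_finite_induct) (auto simp: toeplitz_zero toeplitz_add)
  then show ?thesis unfolding coprime_projection_def by simp
qed

lemma coprime_projection_idem: "0 < n \<Longrightarrow> coprime_projection n o\<^sub>L coprime_projection n = coprime_projection n"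
  by (rule operator_eqI) (simp add: coord_coprime_projection)

lemma adj_coprime_projection:
  assumes n: "0 < n" shows "adj (coprime_projection n) = coprime_projection n"
proof -
  have eq: "adj (cmult (of_real (moebius_mu d)) o\<^sub>L mon d 0 d) = cmult (of_real (moebius_mu d)) o\<^sub>L mon d 0 d"
    if "d \<in> {d. d dvd n}" for d
  proof -
    have "0 < d" using that n by (auto intro: Nat.gr0I)
    then show ?thesis by (simp add: adj_cmult mon_adjointable adj_mon)
  qed
  have "adj (coprime_projection n) = (\<Sum>d | d dvd n. adj (cmult (of_real (moebius_mu d)) o\<^sub>L mon d 0 d))"
    unfolding coprime_projection_def
    using adj_sum[of "{d. d dvd n}" "\<lambda>d. cmult (of_real (moebius_mu d)) o\<^sub>L mon d 0 d"]
    by (simp add: adjointable_intros mon_adjointable)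
  also have "\<dots> = coprime_projection n" unfolding coprime_projection_def by (rule sum.cong[OF refl eq])
  finally show ?thesis .
qed

lemma coprime_projection_calc:
  assumes n: "0 < n" and fx: "U_calc_rel f x"
  shows "coprime_projection n o\<^sub>L x = x o\<^sub>L coprime_projection n"
proof -
  let ?E = "coprime_projection n"
  have trig: "?E o\<^sub>L P = P o\<^sub>L ?E" if "trig p P" for p P
    using that
  proof (induction rule: trig.induct)
    case (mono k)
    show ?case
      by (rule operator_eqI) (simp add: n coord_coprime_projection U_pow_eq coord_T_op[where a = 1, simplified])
  next
    case (cmult p P c)
    have "?E o\<^sub>L (cmult c o\<^sub>L P) = cmult c o\<^sub>L (?E o\<^sub>L P)"
      by (metis compose_assoc compose_cmult toeplitz_adjointable[OF coprime_projection_toeplitz[OF n]])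
    with cmult show ?case by (simp add: compose_assoc)
  qed (simp_all add: compose_linear)
  let ?K = "2 * norm ?E + 1"
  have K: "0 < ?K" by (simp add: add_nonneg_pos)
  have "norm ((?E o\<^sub>L x) - (x o\<^sub>L ?E)) \<le> 0 + e" if e: "0 < e" for e
  proof -
    have d: "0 < e / ?K" using e K by (rule divide_pos_pos)
    obtain p P where p: "trig p P" "norm (x - P) \<le> e / ?K" using U_calc_relE[OF fx d] by blast
    have "(?E o\<^sub>L x) - (x o\<^sub>L ?E) = (?E o\<^sub>L (x - P)) - ((x - P) o\<^sub>L ?E)" using trig[OF p(1)] by (simp add: compose_linear)
    then have "norm ((?E o\<^sub>L x) - (x o\<^sub>L ?E)) \<le> norm (?E o\<^sub>L (x - P)) + norm ((x - P) o\<^sub>L ?E)"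
      by (simp only: norm_triangle_ineq4)
    also have "\<dots> \<le> norm ?E * norm (x - P) + norm (x - P) * norm ?E" by (intro add_mono norm_blinfun_compose)
    also have "\<dots> \<le> ?K * norm (x - P)" by (simp add: algebra_simps)
    also have "\<dots> \<le> ?K * (e / ?K)" using p(2) K by (intro mult_left_mono) auto
    also have "\<dots> = e" using K by simp
    finally show ?thesis by simp
  qed
  then have "norm ((?E o\<^sub>L x) - (x o\<^sub>L ?E)) \<le> 0" by (rule field_le_epsilon)
  then show ?thesis by simp
qed

text \<open>The projection onto the fibres of level coprime to \<open>n\<close> commutes with \<open>f(U)\<close>, so the state is nonnegative at their product when \<open>f \<ge> 0\<close>; expanding the projection as \<open>\<Sum>\<^bsub>d dvd n\<^esub> \<mu>(d) V\<^sub>d V\<^sub>d\<^sup>*\<close> gives the subconformality sum.\<close>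

theorem state_measure_subconformal:
  assumes kms: "\<phi> \<in> KMS_states \<beta>" shows "state_measure \<phi> \<in> subconformal_probs \<beta>"
  unfolding subconformal_probs_def subconformal_def
proof (intro CollectI conjI allI impI, goal_cases)
  case 1
  show ?case using kms by (simp add: KMS_states_iff state_measure_circle_prob)
next
  case (2 f n)
  then have f: "continuous_on circle f" and f0: "\<And>z. z \<in> circle \<Longrightarrow> 0 \<le> f z" and n: "0 < n" by auto
  have st: "is_state toeplitz \<phi>" using kms by (simp add: KMS_states_iff)
  let ?E = "coprime_projection n"
  let ?F = "U_calc (\<lambda>z. complex_of_real (f z))"
  define g where "g z = complex_of_real (sqrt (f z))" for z
  define G where "G = U_calc g"
  have g: "continuous_on circle g" unfolding g_def using f by (intro continuous_intros)
  have relG: "U_calc_rel g G" unfolding G_def by (rule U_calc_rel_U_calc[OF g])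
  have GT: "G \<in> toeplitz" by (rule U_calc_rel_toeplitz[OF relG])
  have ET: "?E \<in> toeplitz" by (rule coprime_projection_toeplitz[OF n])
  have aG: "adj G = G"
    using U_calc_rel_unique[OF U_calc_rel_cong[OF U_calc_rel_adj[OF relG]] relG] by (simp add: g_def)
  have "g z * g z = complex_of_real (f z)" if "z \<in> circle" for z
    using f0[OF that] by (simp add: g_def flip: of_real_mult)
  then have "U_calc_rel (\<lambda>z. complex_of_real (f z)) (G o\<^sub>L G)"
    by (rule U_calc_rel_cong[OF U_calc_rel_mult[OF g g relG relG]])
  then have GG: "?F = G o\<^sub>L G" by (rule U_calc_eqI)
  have comm: "?E o\<^sub>L G = G o\<^sub>L ?E" by (rule coprime_projection_calc[OF n relG])
  have "adj (G o\<^sub>L ?E) o\<^sub>L (G o\<^sub>L ?E) = ?E o\<^sub>L ?F"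
  proof -
    have "adj (G o\<^sub>L ?E) = ?E o\<^sub>L G"
      using GT ET toeplitz_adjointable by (simp add: adj_compose aG adj_coprime_projection[OF n])
    then have "adj (G o\<^sub>L ?E) o\<^sub>L (G o\<^sub>L ?E) = ?E o\<^sub>L (G o\<^sub>L (?E o\<^sub>L G))"
      by (simp only: comm[symmetric] compose_assoc)
    also have "\<dots> = (?E o\<^sub>L (?E o\<^sub>L G)) o\<^sub>L G" by (simp only: comm compose_assoc)
    also have "\<dots> = ?E o\<^sub>L ?F"
      using coprime_projection_idem[OF n] by (simp add: GG compose_assoc[symmetric])
    finally show ?thesis .
  qed
  then have "\<phi> (?E o\<^sub>L ?F) \<in> \<real>\<^sub>\<ge>\<^sub>0" using state_pos[OF st toeplitz_comp[OF GT ET]] by simp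
  moreover have "\<phi> (?E o\<^sub>L ?F) =
      of_real (\<Sum>d | d dvd n. moebius_mu d * real d powr (- \<beta>) * (\<integral>z. f (z ^ d) \<partial>(state_measure \<phi>)))"
  proof -
    have fc: "continuous_on circle (\<lambda>z. complex_of_real (f z))" using f by (intro continuous_intros)
    have FT: "?F \<in> toeplitz" unfolding GG by (rule toeplitz_comp[OF GT GT])
    have "?E o\<^sub>L ?F = (\<Sum>d | d dvd n. cmult (of_real (moebius_mu d)) o\<^sub>L (mon d 0 d o\<^sub>L ?F))"
      unfolding coprime_projection_def compose_sum_left compose_assoc ..
    moreover have mT: "mon d 0 d o\<^sub>L ?F \<in> toeplitz" if "d \<in> {d. d dvd n}" for d
      using that n FT by (intro toeplitz_comp mon_toeplitz) (auto intro: Nat.gr0I)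
    ultimately have "\<phi> (?E o\<^sub>L ?F) = (\<Sum>d | d dvd n. \<phi> (cmult (of_real (moebius_mu d)) o\<^sub>L (mon d 0 d o\<^sub>L ?F)))"
      using state_sum[OF st, of "{d. d dvd n}" "\<lambda>d. cmult (of_real (moebius_mu d)) o\<^sub>L (mon d 0 d o\<^sub>L ?F)"]
      by (simp add: toeplitz_cmult)
    also have "\<dots> = (\<Sum>d | d dvd n. of_real (moebius_mu d) * (of_real (real d powr (- \<beta>)) * (\<integral>z. complex_of_real (f (z ^ d)) \<partial>(state_measure \<phi>))))"
    proof (rule sum.cong[OF refl])
      fix d assume d: "d \<in> {d. d dvd n}"
      then have "0 < d" using n by (auto intro: Nat.gr0I)
      then show "\<phi> (cmult (of_real (moebius_mu d)) o\<^sub>L (mon d 0 d o\<^sub>L ?F)) =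
          of_real (moebius_mu d) * (of_real (real d powr (- \<beta>)) * (\<integral>z. complex_of_real (f (z ^ d)) \<partial>(state_measure \<phi>)))"
        using KMS_range_projection_calc[OF kms _ fc] by (simp add: state_cmult[OF st mT[OF d]])
    qed
    finally show ?thesis by (simp add: mult.assoc)
  qed
  ultimately show ?case by (simp add: complex_nonneg_Reals_iff)
qed

section \<open>The bijection between KMS states and subconformal measures\<close>

lemma KMS_state_eqI:
  assumes \<phi>: "\<phi> \<in> KMS_states \<beta>" and \<psi>: "\<psi> \<in> KMS_states \<beta>" and eq: "\<And>k. \<phi> (U_pow k) = \<psi> (U_pow k)"
  shows "\<phi> = \<psi>"
proof
  fix x
  have st: "is_state toeplitz \<phi>" "is_state toeplitz \<psi>" using \<phi> \<psi> by (simp_all add: KMS_states_iff)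
  show "\<phi> x = \<psi> x"
  proof (cases "x \<in> toeplitz")
    case True
    show ?thesis
    proof (rule toeplitz_lipschitz_eqI[OF state_diff_bound[OF st(1)] state_diff_bound[OF st(2)] _ True])
      fix u assume "u \<in> toep_span"
      then show "\<phi> u = \<psi> u"
      proof (induction rule: toep_span.induct)
        case (mon a b k)
        then show ?case using \<phi> \<psi> eq by (simp add: KMS_states_iff KMS_values_def)
      qed (simp_all add: state_add[OF st(1)] state_add[OF st(2)] state_cmult[OF st(1)] state_cmult[OF st(2)] toep_span_toeplitz)
    qed
  next
    case False
    then show ?thesis by (simp add: state_outside[OF st(1)] state_outside[OF st(2)])
  qed
qed

lemma inj_on_state_measure: "inj_on state_measure (KMS_states \<beta>)"
proof (rule inj_onI)
  fix \<phi> \<psi> assume h: "\<phi> \<in> KMS_states \<beta>" "\<psi> \<in> KMS_states \<beta>" "state_measure \<phi> = state_measure \<psi>"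
  then have "is_state toeplitz \<phi>" "is_state toeplitz \<psi>" by (simp_all add: KMS_states_iff)
  then have "\<phi> (U_pow k) = \<psi> (U_pow k)" for k using state_measure_moment h(3) by metis
  then show "\<phi> = \<psi>" by (rule KMS_state_eqI[OF h(1,2)])
qed

lemma KMS_state_of_measure:
  assumes \<nu>: "\<nu> \<in> subconformal_probs \<beta>"
  obtains L where "scaling_functional \<beta> L" "L diag_unit = 1" "state_of L \<in> KMS_states \<beta>" "state_measure (state_of L) = \<nu>"
proof -
  obtain L where L: "scaling_functional \<beta> L" "L diag_unit = 1"
    "\<And>b k. 0 < b \<Longrightarrow> complexify L (diag_fun b k) = of_real (real b powr (- \<beta>)) * (\<integral>z. z powi k \<partial>\<nu>)"
    using scaling_functional_of_measure[OF \<nu>] by blast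
  have kms: "state_of L \<in> KMS_states \<beta>" by (rule state_of_KMS[OF L(1,2)])
  have pL: "positive_functional L" using L(1) by (simp add: scaling_functional_def)
  have "(\<integral>z. z powi k \<partial>\<nu>) = state_of L (U_pow k)" for k
    unfolding U_pow_eq_mon using state_of_mon[OF pL, of 1 1 k] L(3)[of 1 k] by simp
  then have "state_measure (state_of L) = \<nu>"
    using kms \<nu> by (intro state_measure_eqI) (simp_all add: KMS_states_iff subconformal_probs_def)
  with L(1,2) kms that show ?thesis by blast
qed

lemma bij_betw_state_measure: "bij_betw state_measure (KMS_states \<beta>) (subconformal_probs \<beta>)"
  unfolding bij_betw_def
proof (intro conjI inj_on_state_measure equalityI subsetI)
  fix \<nu> assume "\<nu> \<in> subconformal_probs \<beta>"
  then obtain L where "state_of L \<in> KMS_states \<beta>" "state_measure (state_of L) = \<nu>" using KMS_state_of_measure by blast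
  then show "\<nu> \<in> state_measure ` KMS_states \<beta>" by blast
qed (auto intro: state_measure_subconformal)

lemma KMS_state_of_functional:
  assumes \<phi>: "\<phi> \<in> KMS_states \<beta>"
  obtains L where "scaling_functional \<beta> L" "L diag_unit = 1" "\<phi> = state_of L"
proof -
  obtain L where L: "scaling_functional \<beta> L" "L diag_unit = 1" "state_of L \<in> KMS_states \<beta>"
    "state_measure (state_of L) = state_measure \<phi>"
    using KMS_state_of_measure[OF state_measure_subconformal[OF \<phi>]] by blast
  then have "\<phi> = state_of L" using inj_on_state_measure \<phi> by (metis inj_onD)
  with L that show ?thesis by blast
qed

section \<open>Weak topologies\<close>

lemma topspace_weak_topology: "topspace (weak_topology X I e) = X"
  by (auto simp: weak_topology_def topspace_pullback_topology topspace_product_topology)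

lemma continuous_map_weak_eval:
  assumes "i \<in> I" shows "continuous_map (weak_topology X I e) euclidean (\<lambda>x. e x i)"
proof -
  have "continuous_map (weak_topology X I e) euclidean ((\<lambda>u. u i) \<circ> (\<lambda>x. restrict (e x) I))"
    unfolding weak_topology_def by (intro continuous_map_pullback continuous_map_product_projection assms)
  moreover have "(\<lambda>u. u i) \<circ> (\<lambda>x. restrict (e x) I) = (\<lambda>x. e x i)" using assms by (simp add: fun_eq_iff)
  ultimately show ?thesis by simp
qed

lemma continuous_map_into_weak:
  assumes "\<And>x. x \<in> topspace T \<Longrightarrow> g x \<in> X" and "\<And>i. i \<in> I \<Longrightarrow> continuous_map T euclidean (\<lambda>x. e (g x) i)"
  shows "continuous_map T (weak_topology X I e) g"
  unfolding weak_topology_def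
proof (rule continuous_map_pullback')
  show "topspace T \<subseteq> g -` X" using assms(1) by auto
  show "continuous_map T (product_topology (\<lambda>_. euclidean) I) ((\<lambda>x. restrict (e x) I) \<circ> g)"
    unfolding continuous_map_componentwise
  proof (intro conjI ballI)
    fix i assume i: "i \<in> I"
    have "(\<lambda>x. ((\<lambda>x. restrict (e x) I) \<circ> g) x i) = (\<lambda>x. e (g x) i)" using i by (simp add: fun_eq_iff)
    with assms(2)[OF i] show "continuous_map T euclidean (\<lambda>x. ((\<lambda>x. restrict (e x) I) \<circ> g) x i)" by simp
  qed auto
qed

lemma continuous_map_cmult:
  fixes f :: "'a \<Rightarrow> complex"
  shows "continuous_map T euclidean f \<Longrightarrow> continuous_map T euclidean (\<lambda>x. c * f x)"
  by (simp add: continuous_map_atin tendsto_mult_left)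

lemma continuous_map_uniform_approx:
  fixes f :: "'a \<Rightarrow> complex"
  assumes "\<And>e. 0 < e \<Longrightarrow> \<exists>g. continuous_map T euclidean g \<and> (\<forall>x\<in>topspace T. cmod (f x - g x) \<le> e)"
  shows "continuous_map T euclidean f"
  unfolding continuous_map_atin
proof (intro ballI)
  fix a assume a: "a \<in> topspace T"
  have "(f \<longlongrightarrow> f a) (atin T a)"
  proof (rule tendstoI)
    fix e :: real assume e: "0 < e"
    obtain g where g: "continuous_map T euclidean g" "\<And>x. x \<in> topspace T \<Longrightarrow> cmod (f x - g x) \<le> e / 4"
      using assms[of "e / 4"] e by auto
    have "(g \<longlongrightarrow> g a) (atin T a)" using g(1) a by (simp add: continuous_map_atin)
    then have "\<forall>\<^sub>F x in atin T a. dist (g x) (g a) < e / 4" using e by (intro tendstoD) auto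
    moreover have "\<forall>\<^sub>F x in atin T a. x \<in> topspace T" using a by (auto simp: eventually_atin)
    ultimately show "\<forall>\<^sub>F x in atin T a. dist (f x) (f a) < e"
    proof eventually_elim
      case (elim x)
      have "f x - f a = (f x - g x) + (g x - g a) - (f a - g a)" by simp
      then have "cmod (f x - f a) \<le> cmod (f x - g x) + cmod (g x - g a) + cmod (f a - g a)"
        using norm_triangle_ineq4[of "(f x - g x) + (g x - g a)" "f a - g a"]
          norm_triangle_ineq[of "f x - g x" "g x - g a"] by simp
      then show ?case using elim g(2)[of x] g(2)[OF a] e unfolding dist_norm by linarith
    qed
  qed
  then show "limitin euclidean f (f a) (atin T a)" by simp
qed

section \<open>The homeomorphism\<close>

lemma continuous_map_state_measure:
  "continuous_map (state_topology (KMS_states \<beta>)) (measure_topology (subconformal_probs \<beta>)) state_measure"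
  unfolding measure_topology_def
proof (rule continuous_map_into_weak)
  fix \<phi> assume "\<phi> \<in> topspace (state_topology (KMS_states \<beta>))"
  then show "state_measure \<phi> \<in> subconformal_probs \<beta>"
    by (simp add: state_topology_def topspace_weak_topology state_measure_subconformal)
next
  fix f :: "complex \<Rightarrow> complex" assume "f \<in> {f. continuous_on circle f}"
  then have f: "continuous_on circle f" by simp
  have "fun_calc U_op f \<in> toeplitz"
    unfolding fun_calc_eq_U_calc[OF f] by (rule U_calc_rel_toeplitz[OF U_calc_rel_U_calc[OF f]])
  then have "continuous_map (state_topology (KMS_states \<beta>)) euclidean (\<lambda>\<phi>. \<phi> (fun_calc U_op f))"
    unfolding state_topology_def by (rule continuous_map_weak_eval)
  then show "continuous_map (state_topology (KMS_states \<beta>)) euclidean (\<lambda>\<phi>. \<integral>z. f z \<partial>(state_measure \<phi>))"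
    by (rule continuous_map_eq)
      (simp add: state_topology_def topspace_weak_topology KMS_states_iff state_measure_integral[OF _ f])
qed

definition KMS_of_measure :: "real \<Rightarrow> complex measure \<Rightarrow> operator \<Rightarrow> complex" where
  "KMS_of_measure \<beta> = inv_into (KMS_states \<beta>) state_measure"

lemma KMS_of_measure:
  assumes "\<nu> \<in> subconformal_probs \<beta>"
  shows "KMS_of_measure \<beta> \<nu> \<in> KMS_states \<beta>" "state_measure (KMS_of_measure \<beta> \<nu>) = \<nu>"
  using assms bij_betw_state_measure[of \<beta>] unfolding KMS_of_measure_def bij_betw_def
  by (metis inv_into_into, metis f_inv_into_f)

text \<open>On the span the value of the state is a finite combination of moments of the measure; the
  uniform bound on states carries continuity over to the closure.\<close>

lemma continuous_map_KMS_of_measure: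
  "continuous_map (measure_topology (subconformal_probs \<beta>)) (state_topology (KMS_states \<beta>)) (KMS_of_measure \<beta>)"
  unfolding state_topology_def
proof (rule continuous_map_into_weak)
  let ?T = "measure_topology (subconformal_probs \<beta>)"
  have top: "topspace ?T = subconformal_probs \<beta>" by (simp add: measure_topology_def topspace_weak_topology)
  have st: "is_state toeplitz (KMS_of_measure \<beta> \<nu>)" if "\<nu> \<in> topspace ?T" for \<nu>
    using KMS_of_measure(1)[of \<nu> \<beta>] that by (simp add: top KMS_states_iff)
  show "KMS_of_measure \<beta> \<nu> \<in> KMS_states \<beta>" if "\<nu> \<in> topspace ?T" for \<nu>
    using KMS_of_measure(1) that by (simp add: top)
  have span: "continuous_map ?T euclidean (\<lambda>\<nu>. KMS_of_measure \<beta> \<nu> y)" if "y \<in> toep_span" for y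
    using that
  proof (induction rule: toep_span.induct)
    case (mon a b k)
    have "continuous_map ?T euclidean (\<lambda>\<nu>. \<integral>z. z powi k \<partial>\<nu>)"
      unfolding measure_topology_def
      using continuous_map_weak_eval[of "\<lambda>z::complex. z powi k" "{f. continuous_on circle f}" "subconformal_probs \<beta>" "\<lambda>\<nu> f. \<integral>z. f z \<partial>\<nu>"]
        continuous_on_powi_circle by simp
    then have "continuous_map ?T euclidean (\<lambda>\<nu>. (if a = b then of_real (real a powr (- \<beta>)) else 0) * (\<integral>z. z powi k \<partial>\<nu>))"
      by (rule continuous_map_cmult)
    then show ?case
    proof (rule continuous_map_eq)
      fix \<nu> assume \<nu>: "\<nu> \<in> topspace ?T"
      have "KMS_of_measure \<beta> \<nu> (U_pow k) = (\<integral>z. z powi k \<partial>\<nu>)"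
        using state_measure_moment[OF st[OF \<nu>], of k] KMS_of_measure(2)[of \<nu> \<beta>] \<nu> top by simp
      moreover have "KMS_values \<beta> (KMS_of_measure \<beta> \<nu>)"
        using KMS_of_measure(1)[of \<nu> \<beta>] \<nu> by (simp add: top KMS_states_iff)
      ultimately show "(if a = b then of_real (real a powr (- \<beta>)) else 0) * (\<integral>z. z powi k \<partial>\<nu>) = KMS_of_measure \<beta> \<nu> (mon a k b)"
        using mon by (simp add: KMS_values_def)
    qed
  next
    case (add x y)
    show ?case
      by (rule continuous_map_eq[OF continuous_map_add[OF add.IH]])
        (use add.hyps st in \<open>simp add: state_add toep_span_toeplitz\<close>)
  next
    case (cmult x c)
    show ?case
      by (rule continuous_map_eq[OF continuous_map_cmult[OF cmult.IH, of c]])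
        (use cmult.hyps st in \<open>simp add: state_cmult toep_span_toeplitz\<close>)
  qed
  fix x assume x: "x \<in> toeplitz"
  show "continuous_map ?T euclidean (\<lambda>\<nu>. KMS_of_measure \<beta> \<nu> x)"
  proof (rule continuous_map_uniform_approx)
    fix e :: real assume "0 < e"
    then have "0 < e / 2" by simp
    then obtain y where y: "y \<in> toep_span" "norm (x - y) < e / 2" using toeplitz_approx[OF x] by blast
    have "cmod (KMS_of_measure \<beta> \<nu> x - KMS_of_measure \<beta> \<nu> y) \<le> e" if "\<nu> \<in> topspace ?T" for \<nu>
      using state_diff_bound[OF st[OF that] x toep_span_toeplitz[OF y(1)]] y(2) by simp
    with span[OF y(1)] show "\<exists>g. continuous_map ?T euclidean g \<and>
        (\<forall>\<nu>\<in>topspace ?T. cmod (KMS_of_measure \<beta> \<nu> x - g \<nu>) \<le> e)" by blast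
  qed
qed

theorem homeomorphic_maps_state_measure:
  "homeomorphic_maps (state_topology (KMS_states \<beta>)) (measure_topology (subconformal_probs \<beta>))
     state_measure (KMS_of_measure \<beta>)"
  unfolding homeomorphic_maps_def
proof (intro conjI ballI continuous_map_state_measure continuous_map_KMS_of_measure)
  fix \<phi> assume "\<phi> \<in> topspace (state_topology (KMS_states \<beta>))"
  then have "\<phi> \<in> KMS_states \<beta>" by (simp add: state_topology_def topspace_weak_topology)
  then show "KMS_of_measure \<beta> (state_measure \<phi>) = \<phi>"
    unfolding KMS_of_measure_def by (rule inv_into_f_f[OF inj_on_state_measure])
next
  fix \<nu> assume "\<nu> \<in> topspace (measure_topology (subconformal_probs \<beta>))"
  then show "state_measure (KMS_of_measure \<beta> \<nu>) = \<nu>"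
    by (simp add: measure_topology_def topspace_weak_topology KMS_of_measure)
qed

section \<open>The simplex of KMS states\<close>

lemma KMS_states_convex:
  assumes \<phi>: "\<phi> \<in> KMS_states \<beta>" and \<psi>: "\<psi> \<in> KMS_states \<beta>" and t: "t \<in> {0..1}"
  shows "(\<lambda>x. complex_of_real (1 - t) * \<phi> x + complex_of_real t * \<psi> x) \<in> KMS_states \<beta>"
proof -
  have s: "is_state toeplitz \<phi>" "is_state toeplitz \<psi>" and v: "KMS_values \<beta> \<phi>" "KMS_values \<beta> \<psi>"
    using \<phi> \<psi> by (simp_all add: KMS_states_iff)
  have "is_state toeplitz (\<lambda>x. complex_of_real (1 - t) * \<phi> x + complex_of_real t * \<psi> x)"
    unfolding is_state_def
  proof (intro conjI ballI allI impI)
    fix x assume x: "x \<in> toeplitz"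
    have "complex_of_real (1 - t) \<in> \<real>\<^sub>\<ge>\<^sub>0" "complex_of_real t \<in> \<real>\<^sub>\<ge>\<^sub>0"
      using t by (simp_all only: nonneg_Reals_of_real_iff atLeastAtMost_iff diff_ge_0_iff_ge)
    then show "complex_of_real (1 - t) * \<phi> (adj x o\<^sub>L x) + complex_of_real t * \<psi> (adj x o\<^sub>L x) \<in> \<real>\<^sub>\<ge>\<^sub>0"
      by (intro nonneg_Reals_add_I nonneg_Reals_mult_I state_pos[OF s(1) x] state_pos[OF s(2) x])
  qed (simp_all add: state_outside[OF s(1)] state_outside[OF s(2)] state_add[OF s(1)] state_add[OF s(2)]
      state_cmult[OF s(1)] state_cmult[OF s(2)] state_id[OF s(1)] state_id[OF s(2)] algebra_simps)
  moreover have "KMS_values \<beta> (\<lambda>x. complex_of_real (1 - t) * \<phi> x + complex_of_real t * \<psi> x)"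
    using v unfolding KMS_values_def by (simp add: algebra_simps)
  ultimately show ?thesis by (simp add: KMS_states_iff)
qed

text \<open>Banach-Alaoglu for this set: it is a closed subset of a product of discs.\<close>

lemma compact_space_KMS_states: "compact_space (state_topology (KMS_states \<beta>))"
proof -
  define P where "P = product_topology (\<lambda>_::operator. euclidean :: complex topology) toeplitz"
  \<comment> \<open>The state axioms and the KMS values, as closed conditions on finitely many evaluations.\<close>
  define Q :: "(((operator \<Rightarrow> complex) \<Rightarrow> complex) \<times> complex set) set" where
    "Q = {(\<lambda>u. u (x + y) - u x - u y, {0}) | x y. x \<in> toeplitz \<and> y \<in> toeplitz} \<union>
       {(\<lambda>u. u (cmult c o\<^sub>L x) - c * u x, {0}) | c x. x \<in> toeplitz} \<union>
       {(\<lambda>u. u (adj x o\<^sub>L x), \<real>\<^sub>\<ge>\<^sub>0) | x. x \<in> toeplitz} \<union>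
       {(\<lambda>u. u id_blinfun, {1})} \<union>
       {(\<lambda>u. u (mon a k b) - (if a = b then of_real (real a powr (- \<beta>)) else 0) * u (U_pow k), {0}) | a b k. 0 < a \<and> 0 < b}"
  define D where "D = PiE toeplitz (\<lambda>x. cball (0::complex) (2 * norm x))"
  define K where "K = D \<inter> {u \<in> topspace P. \<forall>(h, C)\<in>Q. h u \<in> C}"
  define ext where "ext u x = (if x \<in> toeplitz then u x else 0)" for u :: "operator \<Rightarrow> complex" and x
  have "compactin P D" unfolding P_def D_def by (simp add: compactin_PiE)
  moreover have "closedin P {u \<in> topspace P. \<forall>(h, C)\<in>Q. h u \<in> C}"
  proof -
    have ev: "continuous_map P euclidean (\<lambda>u. u x)" if "x \<in> toeplitz" for x
      unfolding P_def using continuous_map_product_projection[OF that, of "\<lambda>_. euclidean"] .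
    have each: "closedin P {u \<in> topspace P. fst q u \<in> snd q}" if "q \<in> Q" for q
    proof (rule closedin_continuous_map_preimage)
      show "closedin euclidean (snd q)" using that unfolding Q_def by auto
      show "continuous_map P euclidean (fst q)"
        using that unfolding Q_def
        by (auto intro!: continuous_map_diff continuous_map_cmult ev toeplitz_intros U_pow_toeplitz)
    qed
    have "(\<lambda>u. u id_blinfun, {1}) \<in> Q" unfolding Q_def by simp
    then have "Q \<noteq> {}" by (simp only: ex_in_conv[symmetric]) (rule exI)
    then have "closedin P (\<Inter>q\<in>Q. {u \<in> topspace P. fst q u \<in> snd q})" using each by (intro closedin_INT) auto
    moreover have "(\<Inter>q\<in>Q. {u \<in> topspace P. fst q u \<in> snd q}) = {u \<in> topspace P. \<forall>(h, C)\<in>Q. h u \<in> C}"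
      using \<open>Q \<noteq> {}\<close> by fastforce
    ultimately show ?thesis by simp
  qed
  ultimately have K: "compactin P K" unfolding K_def by (rule compact_Int_closedin)
  have states: "ext u \<in> KMS_states \<beta>" if u: "u \<in> K" for u
  proof -
    have all: "\<forall>(h, C)\<in>Q. h u \<in> C" using u unfolding K_def Int_iff mem_Collect_eq by (elim conjE)
    have q: "h u \<in> C" if "(h, C) \<in> Q" for h C using bspec[OF all that] by simp
    have "is_state toeplitz (ext u)"
      unfolding is_state_def
    proof (intro conjI ballI allI impI)
      show "ext u id_blinfun = 1" using q[of "\<lambda>u. u id_blinfun" "{1}"] by (simp add: Q_def ext_def id_toeplitz)
      fix x assume x: "x \<in> toeplitz"
      show "ext u (adj x o\<^sub>L x) \<in> \<real>\<^sub>\<ge>\<^sub>0"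
        using q[of "\<lambda>u. u (adj x o\<^sub>L x)" "\<real>\<^sub>\<ge>\<^sub>0"] x by (auto simp: Q_def ext_def toeplitz_intros)
      show "ext u (cmult c o\<^sub>L x) = c * ext u x" for c
      proof -
        have "(\<lambda>u. u (cmult c o\<^sub>L x) - c * u x, {0}) \<in> Q" unfolding Q_def using x by blast
        from q[OF this] show ?thesis using x by (simp add: ext_def toeplitz_intros)
      qed
      show "ext u (x + y) = ext u x + ext u y" if y: "y \<in> toeplitz" for y
      proof -
        have "(\<lambda>u. u (x + y) - u x - u y, {0}) \<in> Q" unfolding Q_def using x y by blast
        from q[OF this] show ?thesis using x y by (simp add: ext_def toeplitz_intros algebra_simps)
      qed
    qed (simp add: ext_def)
    moreover have "KMS_values \<beta> (ext u)"
      unfolding KMS_values_def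
    proof (intro allI impI)
      fix a b k assume ab: "0 < (a::nat)" "0 < (b::nat)"
      have "(\<lambda>u. u (mon a k b) - (if a = b then of_real (real a powr (- \<beta>)) else 0) * u (U_pow k), {0}) \<in> Q"
        unfolding Q_def using ab by blast
      from q[OF this] show "ext u (mon a k b) = (if a = b then of_real (real a powr (- \<beta>)) * ext u (U_pow k) else 0)"
        using ab by (auto simp: ext_def mon_toeplitz U_pow_toeplitz split: if_splits)
    qed
    ultimately show ?thesis by (simp add: KMS_states_iff)
  qed
  have "ext ` K = KMS_states \<beta>"
  proof (intro equalityI subsetI)
    fix \<phi> assume \<phi>: "\<phi> \<in> KMS_states \<beta>"
    then have s: "is_state toeplitz \<phi>" and v: "KMS_values \<beta> \<phi>" by (simp_all add: KMS_states_iff)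
    let ?u = "restrict \<phi> toeplitz"
    have "?u \<in> D" unfolding D_def using state_bound[OF s] by (auto simp: dist_norm)
    moreover have "?u \<in> topspace P" by (simp add: P_def topspace_product_topology)
    moreover have "h ?u \<in> C" if "(h, C) \<in> Q" for h C
      using that unfolding Q_def
      by (auto simp: toeplitz_intros U_pow_toeplitz state_add[OF s] state_cmult[OF s] state_pos[OF s] state_id[OF s]
          v[unfolded KMS_values_def, rule_format])
    then have "\<forall>(h, C)\<in>Q. h ?u \<in> C" by (rule_tac ballI) (rename_tac q, case_tac q, simp)
    ultimately have "?u \<in> K" unfolding K_def Int_iff mem_Collect_eq by (intro conjI)
    moreover have "ext ?u = \<phi>" by (auto simp: ext_def fun_eq_iff state_outside[OF s])
    ultimately show "\<phi> \<in> ext ` K" by (metis imageI)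
  qed (use states in blast)
  moreover have "compactin (state_topology (KMS_states \<beta>)) (ext ` K)"
  proof (rule image_compactin)
    show "compactin (subtopology P K) K" using K by (simp add: compactin_subtopology)
    show "continuous_map (subtopology P K) (state_topology (KMS_states \<beta>)) ext"
      unfolding state_topology_def
    proof (rule continuous_map_into_weak)
      show "ext u \<in> KMS_states \<beta>" if "u \<in> topspace (subtopology P K)" for u using that states by simp
      fix x assume x: "x \<in> toeplitz"
      have "continuous_map (subtopology P K) euclidean (\<lambda>u. u x)"
        unfolding P_def using continuous_map_from_subtopology[OF continuous_map_product_projection[OF x, of "\<lambda>_. euclidean"]] .
      then show "continuous_map (subtopology P K) euclidean (\<lambda>u. ext u x)" using x by (simp add: ext_def)
    qed
  qed
  ultimately show ?thesis
    by (simp add: compact_space_def state_topology_def topspace_weak_topology)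
qed

text \<open>In an ordered cone suprema suffice: the infimum of \<open>x\<close> and \<open>y\<close> is \<open>x + y\<close> minus their supremum.\<close>

lemma cone_latticeI:
  fixes C :: "('i \<Rightarrow> complex) set"
  assumes zero: "(\<lambda>_. 0) \<in> C" and add: "\<And>f g. f \<in> C \<Longrightarrow> g \<in> C \<Longrightarrow> (\<lambda>i. f i + g i) \<in> C"
    and pointed: "\<And>f. f \<in> C \<Longrightarrow> (\<lambda>i. - f i) \<in> C \<Longrightarrow> f = (\<lambda>_. 0)"
    and sup: "\<And>x y. x \<in> C \<Longrightarrow> y \<in> C \<Longrightarrow> \<exists>s\<in>C. (\<lambda>i. s i - x i) \<in> C \<and> (\<lambda>i. s i - y i) \<in> C \<and>
      (\<forall>u\<in>C. (\<lambda>i. u i - x i) \<in> C \<longrightarrow> (\<lambda>i. u i - y i) \<in> C \<longrightarrow> (\<lambda>i. u i - s i) \<in> C)"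
  shows "Lattice.lattice \<lparr>carrier = C, eq = (=), le = (\<lambda>\<phi> \<psi>. (\<lambda>i. \<psi> i - \<phi> i) \<in> C)\<rparr>"
proof -
  let ?L = "\<lparr>carrier = C, eq = (=), le = (\<lambda>\<phi> \<psi>. (\<lambda>i. \<psi> i - \<phi> i) \<in> C)\<rparr>"
  have trans: "(\<lambda>i. z i - x i) \<in> C" if "(\<lambda>i. y i - x i) \<in> C" "(\<lambda>i. z i - y i) \<in> C" for x y z
    using add[OF that] by (simp add: algebra_simps)
  have antisym: "x = y" if "(\<lambda>i. y i - x i) \<in> C" "(\<lambda>i. x i - y i) \<in> C" for x y
    using pointed[OF that(1)] that(2) by (simp add: fun_eq_iff)
  have po: "partial_order ?L"
    by unfold_locales (auto simp: zero intro: trans antisym)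
  have up: "\<exists>s. least ?L s (Upper ?L {x, y})" and lo: "\<exists>s. greatest ?L s (Lower ?L {x, y})"
    if x: "x \<in> C" and y: "y \<in> C" for x y
  proof -
    obtain s where s: "s \<in> C" "(\<lambda>i. s i - x i) \<in> C" "(\<lambda>i. s i - y i) \<in> C"
      "\<And>u. u \<in> C \<Longrightarrow> (\<lambda>i. u i - x i) \<in> C \<Longrightarrow> (\<lambda>i. u i - y i) \<in> C \<Longrightarrow> (\<lambda>i. u i - s i) \<in> C"
      using sup[OF x y] by blast
    have U: "Upper ?L {x, y} = {u \<in> C. (\<lambda>i. u i - x i) \<in> C \<and> (\<lambda>i. u i - y i) \<in> C}"
      using x y by (auto simp: Upper_def)
    have "least ?L s (Upper ?L {x, y})" unfolding least_def U using s by auto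
    then show "\<exists>s. least ?L s (Upper ?L {x, y})" by blast
    let ?w = "\<lambda>i. x i + y i - s i"
    have "?w \<in> C" using s(4)[OF add[OF x y]] x y by simp
    moreover have "(\<lambda>i. x i - ?w i) \<in> C" "(\<lambda>i. y i - ?w i) \<in> C" using s(2,3) by (simp_all add: algebra_simps)
    moreover have "(\<lambda>i. ?w i - w i) \<in> C"
      if w: "w \<in> C" "(\<lambda>i. x i - w i) \<in> C" "(\<lambda>i. y i - w i) \<in> C" for w
    proof -
      have "(\<lambda>i. x i + (y i - w i)) \<in> C" using add[OF x w(3)] by simp
      from s(4)[OF this] show ?thesis using w by (simp add: algebra_simps)
    qed
    moreover have "Lower ?L {x, y} = {u \<in> C. (\<lambda>i. x i - u i) \<in> C \<and> (\<lambda>i. y i - u i) \<in> C}"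
      using x y by (auto simp: Lower_def)
    ultimately have "greatest ?L ?w (Lower ?L {x, y})" unfolding greatest_def by auto
    then show "\<exists>s. greatest ?L s (Lower ?L {x, y})" by blast
  qed
  show ?thesis
    unfolding Lattice.lattice_def upper_semilattice_def lower_semilattice_def
      upper_semilattice_axioms_def lower_semilattice_axioms_def
    using po up lo by simp
qed

lemma state_of_add: "state_of (\<lambda>f. L f + M f) = (\<lambda>x. state_of L x + state_of M x)"
  by (auto simp: fun_eq_iff state_of_def complexify_def algebra_simps)

lemma state_of_diff: "state_of (\<lambda>f. L f - M f) = (\<lambda>x. state_of L x - state_of M x)"
  by (auto simp: fun_eq_iff state_of_def complexify_def algebra_simps)

lemma state_of_scale: "state_of (\<lambda>f. r * L f) = (\<lambda>x. complex_of_real r * state_of L x)"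
  by (auto simp: fun_eq_iff state_of_def complexify_def algebra_simps)

lemma scaling_functional_scale:
  "scaling_functional \<beta> L \<Longrightarrow> 0 \<le> r \<Longrightarrow> scaling_functional \<beta> (\<lambda>f. r * L f)"
  by (simp add: scaling_functional_def positive_functional_def algebra_simps)

lemma state_of_id: "positive_functional L \<Longrightarrow> state_of L id_blinfun = of_real (L diag_unit)"
  unfolding mon_one[symmetric] using state_of_mon[of L 1 1 0] complexify_unit[of L] by simp

lemma state_of_eq_zero:
  assumes L: "positive_functional L" and "L diag_unit = 0" shows "state_of L = (\<lambda>_. 0)"
proof
  fix x
  have z: "L f = 0" if f: "f \<in> diag_real" for f
  proof -
    obtain B where B: "\<And>x. \<bar>f x\<bar> \<le> B * diag_unit x" "0 \<le> B" using diag_real_bounded[OF f] by blast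
    have "\<bar>f x\<bar> \<le> B" for x using B(1)[of x] B(2) by (cases x) (auto simp: diag_unit_def split: if_splits)
    from functional_bound[OF L f this] show ?thesis using assms(2) by simp
  qed
  then show "state_of L x = 0"
    using fibre_diag_alg[of x] by (simp add: state_of_def complexify_def diag_real_Re diag_real_Im)
qed

text \<open>A scaling functional is recovered from its state through the values at \<open>V\<^sub>b U\<^sup>k V\<^sub>b\<^sup>*\<close>.\<close>

lemma state_of_inject:
  assumes L: "positive_functional L" and M: "positive_functional M" and eq: "state_of L = state_of M"
    and f: "f \<in> diag_real"
  shows "L f = M f"
proof (rule complexify_ext[OF L M _ f])
  fix b k assume "0 < (b::nat)"
  then show "complexify L (diag_fun b k) = complexify M (diag_fun b k)"
    using fun_cong[OF eq, of "mon b k b"] state_of_mon[OF L, of b b k] state_of_mon[OF M, of b b k] by simp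
qed

lemma scaling_functional_cong:
  assumes L: "scaling_functional \<beta> L" and eq: "\<And>f. f \<in> diag_real \<Longrightarrow> M f = L f"
  shows "scaling_functional \<beta> M"
  using L unfolding scaling_functional_def positive_functional_def
  by (simp add: eq diag_real_add diag_real_scale stretch_diag_real)

text \<open>The cone over the KMS states is order isomorphic to the cone of scaling functionals.\<close>

lemma cone_over_KMS_states:
  assumes ne: "KMS_states \<beta> \<noteq> {}"
  shows "cone_over (KMS_states \<beta>) = state_of ` {L. scaling_functional \<beta> L}"
proof (intro equalityI subsetI)
  fix f assume "f \<in> cone_over (KMS_states \<beta>)"
  then obtain t \<phi> where f: "f = (\<lambda>x. complex_of_real t * \<phi> x)" "0 \<le> t" "\<phi> \<in> KMS_states \<beta>"
    unfolding cone_over_def by blast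
  obtain L where "scaling_functional \<beta> L" "\<phi> = state_of L" using KMS_state_of_functional[OF f(3)] by blast
  then show "f \<in> state_of ` {L. scaling_functional \<beta> L}"
    using scaling_functional_scale[OF _ f(2)] state_of_scale[of t L] f(1) by (intro image_eqI[of _ _ "\<lambda>g. t * L g"]) auto
next
  fix f assume "f \<in> state_of ` {L. scaling_functional \<beta> L}"
  then obtain L where L: "scaling_functional \<beta> L" "f = state_of L" by blast
  have pL: "positive_functional L" using L(1) by (simp add: scaling_functional_def)
  define t where "t = L diag_unit"
  have t: "0 \<le> t" unfolding t_def by (rule functional_pos[OF pL diag_real_unit]) (simp add: diag_unit_def split_def)
  show "f \<in> cone_over (KMS_states \<beta>)"
  proof (cases "t = 0")
    case True
    obtain \<phi> where "\<phi> \<in> KMS_states \<beta>" using ne by blast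
    moreover have "f = (\<lambda>x. complex_of_real 0 * \<phi> x)" using state_of_eq_zero[OF pL] True by (simp add: L(2) t_def)
    ultimately show ?thesis unfolding cone_over_def by blast
  next
    case False
    with t have t: "0 < t" by simp
    have "scaling_functional \<beta> (\<lambda>g. inverse t * L g)" using t by (intro scaling_functional_scale L) simp
    then have "state_of (\<lambda>g. inverse t * L g) \<in> KMS_states \<beta>" using t by (intro state_of_KMS) (simp_all add: t_def)
    moreover have "f = (\<lambda>x. complex_of_real t * state_of (\<lambda>g. inverse t * L g) x)"
      unfolding state_of_scale using t by (simp add: L(2) fun_eq_iff)
    ultimately show ?thesis unfolding cone_over_def using t less_imp_le by blast
  qed
qed

text \<open>Compactness and convexity hold because the state and KMS conditions are closed and affine. The lattice property is that of the cone of scaling functionals, transported along the order isomorphism.\<close>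

theorem choquet_simplex_KMS_states: "choquet_simplex (state_topology (KMS_states \<beta>))"
proof -
  have top: "topspace (state_topology (KMS_states \<beta>)) = KMS_states \<beta>"
    by (simp add: state_topology_def topspace_weak_topology)
  let ?C = "cone_over (KMS_states \<beta>)"
  have "Lattice.lattice \<lparr>carrier = ?C, eq = (=), le = (\<lambda>\<phi> \<psi>. (\<lambda>i. \<psi> i - \<phi> i) \<in> ?C)\<rparr>"
  proof (cases "KMS_states \<beta> = {}")
    case True
    then have "?C = {}" by (simp add: cone_over_def)
    then show ?thesis by simp (unfold_locales; simp)
  next
    case False
    note C = cone_over_KMS_states[OF False]
    have pos: "positive_functional L" if "scaling_functional \<beta> L" for L
      using that by (simp add: scaling_functional_def)
    have le: "scaling_functional \<beta> (\<lambda>f. M f - L f)"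
      if L: "scaling_functional \<beta> L" and M: "scaling_functional \<beta> M" and d: "(\<lambda>i. state_of M i - state_of L i) \<in> ?C" for L M
    proof -
      obtain N where N: "scaling_functional \<beta> N" "(\<lambda>i. state_of M i - state_of L i) = state_of N" using d unfolding C by blast
      have "state_of M = state_of (\<lambda>f. L f + N f)"
        unfolding state_of_add using fun_cong[OF N(2)] by (simp add: fun_eq_iff algebra_simps)
      then have "M f = L f + N f" if "f \<in> diag_real" for f
        using state_of_inject[OF pos[OF M] pos[OF scaling_functional_add[OF L N(1)]]] that by blast
      then show ?thesis by (intro scaling_functional_cong[OF N(1)]) simp
    qed
    have ge: "(\<lambda>i. state_of M i - state_of L i) \<in> ?C" if "scaling_functional \<beta> (\<lambda>f. M f - L f)" for L M
      unfolding C state_of_diff[symmetric] using that by blast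
    show ?thesis
    proof (rule cone_latticeI)
      show "(\<lambda>_. 0) \<in> ?C" using False unfolding cone_over_def by force
    next
      fix f g assume "f \<in> ?C" "g \<in> ?C"
      then obtain L M where "scaling_functional \<beta> L" "f = state_of L" "scaling_functional \<beta> M" "g = state_of M"
        unfolding C by blast
      then show "(\<lambda>i. f i + g i) \<in> ?C"
        unfolding C using state_of_add[of L M] scaling_functional_add[of \<beta> L M] by (intro image_eqI[of _ _ "\<lambda>h. L h + M h"]) auto
    next
      fix f assume "f \<in> ?C" "(\<lambda>i. - f i) \<in> ?C"
      then obtain L M where L: "scaling_functional \<beta> L" "f = state_of L"
        and M: "scaling_functional \<beta> M" "(\<lambda>i. - f i) = state_of M"
        unfolding C by blast
      have u: "0 \<le> diag_unit p" for p by (cases p) (simp add: diag_unit_def)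
      have "0 \<le> L diag_unit" "0 \<le> M diag_unit"
        by (rule functional_pos[OF pos[OF L(1)] diag_real_unit u], rule functional_pos[OF pos[OF M(1)] diag_real_unit u])
      moreover have "complex_of_real (M diag_unit) = - complex_of_real (L diag_unit)"
        using fun_cong[OF M(2), of id_blinfun] state_of_id[OF pos[OF L(1)]] state_of_id[OF pos[OF M(1)]] L(2) by simp
      then have "M diag_unit = - L diag_unit" by (simp only: of_real_minus[symmetric] of_real_eq_iff)
      ultimately have "L diag_unit = 0" by simp
      then show "f = (\<lambda>_. 0)" using state_of_eq_zero[OF pos[OF L(1)]] L(2) by simp
    next
      fix x y assume "x \<in> ?C" "y \<in> ?C"
      then obtain L1 L2 where L: "scaling_functional \<beta> L1" "x = state_of L1" "scaling_functional \<beta> L2" "y = state_of L2"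
        unfolding C by blast
      obtain S where S: "scaling_functional \<beta> S" "scaling_functional \<beta> (\<lambda>f. S f - L1 f)" "scaling_functional \<beta> (\<lambda>f. S f - L2 f)"
        "\<And>M. scaling_functional \<beta> M \<Longrightarrow> scaling_functional \<beta> (\<lambda>f. M f - L1 f) \<Longrightarrow> scaling_functional \<beta> (\<lambda>f. M f - L2 f) \<Longrightarrow>
          scaling_functional \<beta> (\<lambda>f. M f - S f)"
        using scaling_functional_sup[OF L(1,3)] by blast
      show "\<exists>s\<in>?C. (\<lambda>i. s i - x i) \<in> ?C \<and> (\<lambda>i. s i - y i) \<in> ?C \<and>
          (\<forall>u\<in>?C. (\<lambda>i. u i - x i) \<in> ?C \<longrightarrow> (\<lambda>i. u i - y i) \<in> ?C \<longrightarrow> (\<lambda>i. u i - s i) \<in> ?C)"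
      proof (intro bexI[of _ "state_of S"] conjI ballI impI)
        show "state_of S \<in> ?C" unfolding C using S(1) by blast
        show "(\<lambda>i. state_of S i - x i) \<in> ?C" "(\<lambda>i. state_of S i - y i) \<in> ?C" unfolding L by (intro ge S)+
        fix u assume u: "u \<in> ?C" "(\<lambda>i. u i - x i) \<in> ?C" "(\<lambda>i. u i - y i) \<in> ?C"
        then obtain M where M: "scaling_functional \<beta> M" "u = state_of M" unfolding C by blast
        show "(\<lambda>i. u i - state_of S i) \<in> ?C"
          unfolding M(2)
        proof (rule ge, rule S(4)[OF M(1)])
          show "scaling_functional \<beta> (\<lambda>f. M f - L1 f)" using le[OF L(1) M(1)] u(2) by (simp add: M(2) L(2))
          show "scaling_functional \<beta> (\<lambda>f. M f - L2 f)" using le[OF L(3) M(1)] u(3) by (simp add: M(2) L(4))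
        qed
      qed
    qed
  qed
  then show ?thesis
    unfolding choquet_simplex_def top
    using compact_space_KMS_states KMS_states_convex by blast
qed

text \<open>Integrals against the measure of a convex combination are convex combinations of integrals, as both are values of the states.\<close>

lemma measure_state_measure_affine:
  assumes \<phi>: "\<phi> \<in> KMS_states \<beta>" and \<psi>: "\<psi> \<in> KMS_states \<beta>" and t: "t \<in> {0..1}"
    and E: "E \<in> sets (restrict_space borel circle)"
  shows "measure (state_measure (\<lambda>x. complex_of_real (1 - t) * \<phi> x + complex_of_real t * \<psi> x)) E =
    (1 - t) * measure (state_measure \<phi>) E + t * measure (state_measure \<psi>) E"
proof -
  let ?\<chi> = "\<lambda>x. complex_of_real (1 - t) * \<phi> x + complex_of_real t * \<psi> x"
  have s: "is_state toeplitz \<phi>" "is_state toeplitz \<psi>" "is_state toeplitz ?\<chi>"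
    using \<phi> \<psi> KMS_states_convex[OF \<phi> \<psi> t] by (simp_all only: KMS_states_iff)
  show ?thesis
  proof (rule circle_measure_combination[OF state_measure_circle_prob[OF s(3)] state_measure_circle_prob[OF s(1)]
        state_measure_circle_prob[OF s(2)] _ E])
    fix f :: "complex \<Rightarrow> complex" assume f: "continuous_on circle f"
    show "(\<integral>z. f z \<partial>(state_measure ?\<chi>)) =
        complex_of_real (1 - t) * (\<integral>z. f z \<partial>(state_measure \<phi>)) + complex_of_real t * (\<integral>z. f z \<partial>(state_measure \<psi>))"
      unfolding state_measure_integral[OF s(1) f] state_measure_integral[OF s(2) f] state_measure_integral[OF s(3) f] ..
  qed
qed

theorem theorem4p17:
  fixes \<beta> :: real
  assumes "0 \<le> \<beta>"
  shows "choquet_simplex (state_topology (KMS_states \<beta>)) \<and>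
    (\<forall>\<psi>\<in>KMS_states \<beta>. state_measure \<psi> \<in> circle_prob \<and>
       (\<forall>f. continuous_on circle f \<longrightarrow> (\<integral>z. f z \<partial>(state_measure \<psi>)) = \<psi> (fun_calc U_op f))) \<and>
    (\<forall>\<phi>\<in>KMS_states \<beta>. \<forall>\<psi>\<in>KMS_states \<beta>. \<forall>t\<in>{0..1}. \<forall>E\<in>sets (restrict_space borel circle).
       measure (state_measure (\<lambda>x. complex_of_real (1 - t) * \<phi> x + complex_of_real t * \<psi> x)) E =
         (1 - t) * measure (state_measure \<phi>) E + t * measure (state_measure \<psi>) E) \<and>
    (\<exists>\<Psi>. homeomorphic_maps (state_topology (KMS_states \<beta>))
            (measure_topology (subconformal_probs \<beta>)) state_measure \<Psi> \<and>
       (\<forall>\<nu>\<in>subconformal_probs \<beta>. \<forall>b c f. 0 < b \<longrightarrow> 0 < c \<longrightarrow> continuous_on circle f \<longrightarrow>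
          \<Psi> \<nu> (V_op b o\<^sub>L fun_calc U_op f o\<^sub>L adj (V_op c)) =
            (if b = c then complex_of_real (real b powr (- \<beta>)) * (\<integral>z. f z \<partial>\<nu>) else 0)))"
proof (intro conjI ballI allI impI)
  show "choquet_simplex (state_topology (KMS_states \<beta>))" by (rule choquet_simplex_KMS_states)
next
  fix \<psi> assume "\<psi> \<in> KMS_states \<beta>"
  then have st: "is_state toeplitz \<psi>" by (simp add: KMS_states_iff)
  show "state_measure \<psi> \<in> circle_prob" by (rule state_measure_circle_prob[OF st])
  show "(\<integral>z. f z \<partial>(state_measure \<psi>)) = \<psi> (fun_calc U_op f)" if "continuous_on circle f" for f
    by (rule state_measure_integral[OF st that])
next
  fix \<phi> \<psi> t E
  assume "\<phi> \<in> KMS_states \<beta>" "\<psi> \<in> KMS_states \<beta>" "t \<in> {0..1::real}" "E \<in> sets (restrict_space borel circle)"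
  then show "measure (state_measure (\<lambda>x. complex_of_real (1 - t) * \<phi> x + complex_of_real t * \<psi> x)) E =
      (1 - t) * measure (state_measure \<phi>) E + t * measure (state_measure \<psi>) E"
    by (rule measure_state_measure_affine)
next
  have "KMS_of_measure \<beta> \<nu> (V_op b o\<^sub>L fun_calc U_op f o\<^sub>L adj (V_op c)) =
      (if b = c then complex_of_real (real b powr (- \<beta>)) * (\<integral>z. f z \<partial>\<nu>) else 0)"
    if "\<nu> \<in> subconformal_probs \<beta>" "0 < b" "0 < c" "continuous_on circle f" for \<nu> b c f
    using KMS_V_calc_V[OF KMS_of_measure(1)[OF that(1)] that(2-4)] KMS_of_measure(2)[OF that(1)] by simp
  then show "\<exists>\<Psi>. homeomorphic_maps (state_topology (KMS_states \<beta>))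
            (measure_topology (subconformal_probs \<beta>)) state_measure \<Psi> \<and>
       (\<forall>\<nu>\<in>subconformal_probs \<beta>. \<forall>b c f. 0 < b \<longrightarrow> 0 < c \<longrightarrow> continuous_on circle f \<longrightarrow>
          \<Psi> \<nu> (V_op b o\<^sub>L fun_calc U_op f o\<^sub>L adj (V_op c)) =
            (if b = c then complex_of_real (real b powr (- \<beta>)) * (\<integral>z. f z \<partial>\<nu>) else 0))"
    using homeomorphic_maps_state_measure by blast
qed

end
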